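(* Consider a Markov potential game with parametrized policies and potential value function $u:\mathbb{R}^M\to\mathbb{R}$, and let $\{\theta_t\}_{t\ge 0}$ be the sequence of joint parameters updated by networked policy gradient play (both as defined in the context). Suppose the following assumptions hold. (A1) The network $(\mathcal{N},\mathcal{E}_\infty)$ is connected, where $\mathcal{E}_\infty=\{(i,j): (i,j)\in\mathcal{E}_t \text{ for infinitely many } t\in\mathbb{N}\}$, and there exists a time step $T_{\mathcal{G}}>0$ such that for any edge $(i,j)\in\mathcal{E}_\infty$ and any $t\ge1$, $(i,j)\in\bigcup_{\tau=0}^{T_{\mathcal{G}}-1}\mathcal{E}_{t+\tau}$. (A2) There exists $h\in(0,1)$ such that for all $i,j\in\mathcal{N}$ and all $t\in\mathbb{N}^+$: (i) for $i\neq j$, if $l\in\mathcal{N}_{i,t}\cup\{i\}$ then $w^i_{jl,t}\ge h$, else $w^i_{jl,t}=0$; (ii) $w^j_{jj,t}=1$; (iii) $\sum_{l\in\mathcal{N}_{i,t}\cup\{i\}}w^i_{jl,t}=1$. (A3) There is $\kappa\ge0$ such that $\mathbb{E}[|\hat\theta^i_{j,0}(m)-\theta_{j,0}(m)|]\le\kappa$ for any pair of agents $i\neq j$ and any coordinate $m$ of agent $j$'s parameter. (A4) The step sizes $\alpha_t>0$ are non-summable, $\sum_t\alpha_t=\infty$, and have the decaying form $\alpha_t=\mathcal{O}(1/t^\beta)$, where $\beta\in[1/2,1)$. (A5) There is $R>0$ with $|r_i(s,a)|\le R$ for every agent $i$ and every $(s,a)\in\mathcal{S}\times\mathcal{A}^N$.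 (A6) The first and second moments of the policy score functions exist and are bounded: there are $B,V\ge0$ such that $\mathbb{E}[\|\nabla_i\log\pi_{n,\theta}(a_n|s)\|\mid\theta]\le B$ and $\mathbb{E}[\|\nabla_i\log\pi_{n,\theta}(a_n|s)\|^2\mid\theta]\le V^2$ for all $i,n\in\mathcal{N}$, $\theta\in\mathbb{R}^M$, $s\in\mathcal{S}$ (with $a_n\sim\pi_{n,\theta}(\cdot|s)$). Furthermore the score functions are Lipschitz: there is $\mathcal{L}\ge0$ with $\|\nabla_i\log\pi_{n,\theta^1}(a_n|s)-\nabla_i\log\pi_{n,\theta^2}(a_n|s)\|\le\mathcal{L}\|\theta^1-\theta^2\|$ for all $i,n\in\mathcal{N}$, $\theta^1,\theta^2\in\mathbb{R}^M$, and all $s$, $a_n$. Define the number of iterations required for $\{\theta_t\}_{t\ge0}$ to reach an $\epsilon$-stationary point of the potential in expectation as $$T_\epsilon:=\min\Big\{t\in\mathbb{N}:\ \inf_{0\le\tau\le t}\mathbb{E}\big[\|\nabla u(\theta_\tau)\|^2\big]\le\epsilon\Big\}.$$ Then $T_\epsilon=\mathcal{O}(\epsilon^{-1/\tilde\beta})$, where $\tilde\beta:=\min\{1-\beta,\beta\}$. In particular, if $\beta=\tfrac12$, the optimal rate is achieved, i.e. $T_\epsilon=\mathcal{O}(\epsilon^{-2})$.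
   Context: **Game.** There are agents $\mathcal{N}=\{1,\dots,N\}$, a common action set $\mathcal{A}\subseteq\mathbb{R}^K$ and a state space $\mathcal{S}$ (neither necessarily finite), a transition law $\mathbb{P}(s'|s,a)$ for joint actions $a=(a_1,\dots,a_N)\in\mathcal{A}^N$, an initial state distribution $\rho$ on $\mathcal{S}$, individual rewards $r_i:\mathcal{S}\times\mathcal{A}^N\to\mathbb{R}$ and a discount rate $\gamma\in(0,1)$. The joint parameter is $\theta=(\theta_i,\theta_{-i})\in\mathbb{R}^M$, where $\theta_i\in\mathbb{R}^{M_i}$ is the parameter of agent $i$, $\theta_{-i}$ collects those of the other agents, and $\sum_iM_i=M$. Each agent $n$ uses a smooth and differentiable policy $\pi_{n,\theta}(a_n|s)$, which may depend on the whole vector $\theta$; the joint policy is the product $\Pi_\theta(a|s)=\prod_{n\in\mathcal{N}}\pi_{n,\theta}(a_n|s)$. $\nabla_i$ denotes the partial derivative with respect to $\theta_i$. The utility of agent $i$ is $u_i(\theta_i,\theta_{-i})=\mathbb{E}[\sum_{t=0}^\infty\gamma^tr_i(s_t,a_t)\mid s_0=s]$, where $a_t\sim\Pi_\theta(\cdot|s_t)$ and $s_{t+1}\sim\mathbb{P}(\cdot|s_t,a_t)$ (the dependence on the initial state $s$ is suppressed). The game is a *Markov potential game* if there is a potential value function $u:\mathbb{R}^M\to\mathbb{R}$ with $\nabla_iu_i(\theta_i,\theta_{-i})=\nabla_iu(\theta)$ for all agents $i$ and all $\theta\in\mathbb{R}^M$. **Stochastic gradient $\hat\nabla_iu_i(\theta_i,\theta_{-i})$.**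 $\mathrm{Geom}(p)$ is the law on $\{0,1,\dots\}$ with $\mathbb{P}(x)=(1-p)^xp$. Draw $\mathcal{T}_1\sim\mathrm{Geom}(1-\gamma)$, reset the initial state $s_0$, play the joint policy $\Pi_\theta$ for $\mathcal{T}_1$ steps, and record $(s_{\mathcal{T}_1},a_{\mathcal{T}_1})$. Then draw $\mathcal{T}_2\sim\mathrm{Geom}(1-\gamma^{1/2})$, continue playing, and set $$\hat\nabla_iu_i(\theta_i,\theta_{-i})=\hat R_i\sum_{n\in\mathcal{N}}\nabla_i\log\pi_{n,\theta}(a_{n,\mathcal{T}_1}|s_{\mathcal{T}_1}),$$ where $\hat R_i$ is one of the following estimators: (Q-function) $\hat Q_i(s_{\mathcal{T}_1},a_{\mathcal{T}_1})=\sum_{t=\mathcal{T}_1}^{\mathcal{T}_1+\mathcal{T}_2}\gamma^{(t-\mathcal{T}_1)/2}r_i(s_t,a_t)$; (advantage) $\hat Q_i(s_{\mathcal{T}_1},a_{\mathcal{T}_1})-\hat V_i(s_{\mathcal{T}_1})$; (temporal difference) $r_i(s_{\mathcal{T}_1},a_{\mathcal{T}_1})+\gamma\hat V_i(s_{\mathcal{T}_1+1})-\hat V_i(s_{\mathcal{T}_1})$. Here $\hat V_i(s)$ is the analogous sum of rewards weighted by $\gamma^{k/2}$, $k=0,1,\dots$, over a horizon with law $\mathrm{Geom}(1-\gamma^{1/2})$, along a trajectory under $\Pi_\theta$ started at state $s$; it is obtained in an additional round of estimation, independent of that of $\hat Q_i$ given the starting state $s_{\mathcal{T}_1}$. **Networked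 policy gradient play.** $\mathcal{G}_t=(\mathcal{N},\mathcal{E}_t)$ is a sequence of time-varying communication networks, $\mathcal{N}_{i,t}=\{j:(i,j)\in\mathcal{E}_t\}$ is the set of neighbors of $i$, and $w^i_{jl,t}\ge0$ is the weight that agent $i$ puts on agent $l$'s estimate of agent $j$'s parameters. Agent $i$ keeps a local belief $\hat\theta^i_{j,t}\in\mathbb{R}^{M_j}$ about $\theta_{j,t}$ for every $j\neq i$, and $\hat\theta^i_{-i,t}$ collects these; each agent knows its own parameters, so $\hat\theta^j_{j,t}=\theta_{j,t}$ for all $j$ and all $t\ge0$. $x(m)$ denotes the $m$-th coordinate of $x$. Given initial parameters $\theta_0$ and beliefs $\hat\theta^i_{-i,0}$, at each $t=1,2,\dots$: (1) every agent $i$ computes the stochastic gradient above using its local beliefs in place of the other agents' parameters; (2) it updates $\theta_{i,t}=\theta_{i,t-1}+\alpha_t\hat\nabla_iu_i(\theta_{i,t-1},\hat\theta^i_{-i,t-1})$; (3) agents exchange beliefs with their current neighbors and update their beliefs about the other agents by the consensus rule $\hat\theta^i_{j,t+1}(m)=\sum_{l\in\mathcal{N}_{i,t}\cup\{i\}}w^i_{jl,t}\,\hat\theta^l_{j,t}(m)$ (rule stated with its own time index).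
   Formalization: In (A4), step sizes are assumed to be of exact order 1/t^β (bounded above and below by constant multiples of it for large t), not only O(1/t^β); with the upper bound alone the claim fails, e.g. for α_t = 1/t with a one-agent sigmoid policy and small rewards. *)

theory Defs
  imports "HOL-Probability.Probability" "HOL-Library.Landau_Symbols"
begin

section \<open>Joint parameters and partial gradients\<close>

text \<open>
  The joint parameter space is \<^typ>\<open>real ^ 'm\<close>, and a map \<^term>\<open>own :: 'm \<Rightarrow> 'n\<close> assigns every
  coordinate to the agent it belongs to. The block of agent \<open>i\<close> is therefore
  $\{m.\ \mathit{own}\,m = i\}$, whose cardinality is the dimension of the parameter of agent \<open>i\<close>;
  the dimensions of the agents may differ and add up to \<open>CARD('m)\<close>.
\<close>

definition combine :: "('m::finite \<Rightarrow> 'n) \<Rightarrow> 'n \<Rightarrow> real ^ 'm \<Rightarrow> real ^ 'm \<Rightarrow> real ^ 'm" where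
  "combine own i y x = (\<chi> m. if own m = i then y $ m else x $ m)"

text \<open>
  The partial gradient at \<open>x\<close> with respect to block \<open>i\<close> is the gradient of
  $y_i \mapsto f(y_i, x_{-i})$. It is kept as a vector of the full space, its coordinates outside
  block \<open>i\<close> being zero, so its norm is the norm within the block.
\<close>

definition has_pgrad ::
  "('m::finite \<Rightarrow> 'n) \<Rightarrow> 'n \<Rightarrow> (real ^ 'm \<Rightarrow> real) \<Rightarrow> real ^ 'm \<Rightarrow> real ^ 'm \<Rightarrow> bool" where
  "has_pgrad own i f x D \<longleftrightarrow> GDERIV (\<lambda>y. f (combine own i y x)) x :> D"

definition pgrad ::
  "('m::finite \<Rightarrow> 'n) \<Rightarrow> 'n \<Rightarrow> (real ^ 'm \<Rightarrow> real) \<Rightarrow> real ^ 'm \<Rightarrow> real ^ 'm" where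
  "pgrad own i f x = (THE D. has_pgrad own i f x D)"

definition grad :: "(real ^ 'm::finite \<Rightarrow> real) \<Rightarrow> real ^ 'm \<Rightarrow> real ^ 'm" where
  "grad f x = (THE D. GDERIV f x :> D)"


section \<open>Markov games with parametrized policies\<close>

text \<open>
  The action set is the space of the measure \<open>act_ref\<close>, a sigma-finite reference measure on a
  subset of \<open>real ^ 'k\<close> (counting measure for discrete actions, Lebesgue measure for continuous
  ones); \<open>pol G n \<theta> s a\<close> is the density $\pi_{n,\theta}(a|s)$ with respect to it.
\<close>

record ('s, 'k, 'n, 'm) game =
  states :: "'s measure"
  act_ref :: "(real ^ ('k::finite)) measure"
  transition :: "'s \<times> ('n::finite \<Rightarrow> real ^ 'k) \<Rightarrow> 's measure"
  init :: "'s measure"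
  reward :: "'n \<Rightarrow> 's \<times> ('n \<Rightarrow> real ^ 'k) \<Rightarrow> real"
  discount :: real
  owner :: "('m::finite) \<Rightarrow> 'n"
  pol :: "'n \<Rightarrow> real ^ 'm \<Rightarrow> 's \<Rightarrow> real ^ 'k \<Rightarrow> real"

definition joint_actions :: "('s, 'k::finite, 'n::finite, 'm::finite) game \<Rightarrow> ('n \<Rightarrow> real ^ 'k) measure" where
  "joint_actions G = PiM UNIV (\<lambda>_. act_ref G)"

definition state_actions ::
  "('s, 'k::finite, 'n::finite, 'm::finite) game \<Rightarrow> ('s \<times> ('n \<Rightarrow> real ^ 'k)) measure" where
  "state_actions G = states G \<Otimes>\<^sub>M joint_actions G"

definition policy ::
  "('s, 'k::finite, 'n::finite, 'm::finite) game \<Rightarrow> 'n \<Rightarrow> real ^ 'm \<Rightarrow> 's \<Rightarrow> (real ^ 'k) measure" where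
  "policy G n \<theta> s = density (act_ref G) (\<lambda>a. ennreal (pol G n \<theta> s a))"

definition joint_policy ::
  "('s, 'k::finite, 'n::finite, 'm::finite) game \<Rightarrow> real ^ 'm \<Rightarrow> 's \<Rightarrow> ('n \<Rightarrow> real ^ 'k) measure" where
  "joint_policy G \<theta> s = density (joint_actions G) (\<lambda>a. ennreal (\<Prod>n\<in>UNIV. pol G n \<theta> s (a n)))"

definition markov_game :: "('s, 'k::finite, 'n::finite, 'm::finite) game \<Rightarrow> bool" where
  "markov_game G \<longleftrightarrow>
     sigma_finite_measure (act_ref G) \<and>
     sets (act_ref G) = sets (restrict_space borel (space (act_ref G))) \<and>
     transition G \<in> measurable (state_actions G) (prob_algebra (states G)) \<and>
     init G \<in> space (prob_algebra (states G)) \<and>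
     (\<forall>i. reward G i \<in> borel_measurable (state_actions G)) \<and>
     0 < discount G \<and> discount G < 1 \<and>
     (\<forall>n \<theta>. (\<lambda>(s, a). pol G n \<theta> s a) \<in> borel_measurable (states G \<Otimes>\<^sub>M act_ref G)) \<and>
     (\<forall>n \<theta>. \<forall>s\<in>space (states G). \<forall>a\<in>space (act_ref G). 0 \<le> pol G n \<theta> s a) \<and>
     (\<forall>n \<theta>. \<forall>s\<in>space (states G). prob_space (policy G n \<theta> s)) \<and>
     (\<forall>n. \<forall>s\<in>space (states G). \<forall>a\<in>space (act_ref G). \<forall>\<theta>.
        (\<lambda>\<theta>'. pol G n \<theta>' s a) differentiable (at \<theta>))"

text \<open>
  The score function $\nabla_i \log \pi_{n,\theta}(a|s)$. Positivity of the densities is not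
  required: if the scores are Lipschitz in the parameter, then for given \<open>s\<close> and \<open>a\<close> the density
  is either positive for all parameters or zero for all of them, and in the latter case the score
  is zero because \<open>ln 0 = 0\<close>, and the action is almost surely never played.
\<close>

definition score ::
  "('s, 'k::finite, 'n::finite, 'm::finite) game \<Rightarrow> 'n \<Rightarrow> 'n \<Rightarrow> real ^ 'm \<Rightarrow> 's \<Rightarrow> real ^ 'k \<Rightarrow> real ^ 'm" where
  "score G i n \<theta> s a = pgrad (owner G) i (\<lambda>\<theta>'. ln (pol G n \<theta>' s a)) \<theta>"

text \<open>
  Law of the infinite trajectory of state-action pairs under the joint policy, started from the
  state distribution \<open>\<mu>\<close>: the Ionescu-Tulcea measure whose first pair has law
  $\mu(ds)\,\Pi_\theta(da|s)$ and whose pair at time $k+1$ has, given the past, the law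
  $P(ds|s_k,a_k)\,\Pi_\theta(da|s)$.
\<close>

definition act_step ::
  "('s, 'k::finite, 'n::finite, 'm::finite) game \<Rightarrow> real ^ 'm \<Rightarrow> 's \<Rightarrow> ('s \<times> ('n \<Rightarrow> real ^ 'k)) measure" where
  "act_step G \<theta> s = distr (joint_policy G \<theta> s) (state_actions G) (Pair s)"

definition step_kernel ::
  "('s, 'k::finite, 'n::finite, 'm::finite) game \<Rightarrow> real ^ 'm \<Rightarrow> 's measure \<Rightarrow>
     nat \<Rightarrow> (nat \<Rightarrow> 's \<times> ('n \<Rightarrow> real ^ 'k)) \<Rightarrow> ('s \<times> ('n \<Rightarrow> real ^ 'k)) measure" where
  "step_kernel G \<theta> \<mu> t x =
     Giry_Monad.bind (case t of 0 \<Rightarrow> \<mu> | Suc k \<Rightarrow> transition G (x k)) (act_step G \<theta>)"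

definition trajectory ::
  "('s, 'k::finite, 'n::finite, 'm::finite) game \<Rightarrow> real ^ 'm \<Rightarrow> 's measure \<Rightarrow>
     (nat \<Rightarrow> 's \<times> ('n \<Rightarrow> real ^ 'k)) measure" where
  "trajectory G \<theta> \<mu> =
     projective_family.lim UNIV
       (Ionescu_Tulcea.CI (step_kernel G \<theta> \<mu>) (\<lambda>_. state_actions G)) (\<lambda>_. state_actions G)"

text \<open>
  The utility is the expected discounted reward when the initial state has law \<open>init G\<close>, the same
  law from which the sampling rounds below are reset. A fixed initial state \<open>s\<close> is the case
  \<open>init G = return (states G) s\<close>.
\<close>

definition utility ::
  "('s, 'k::finite, 'n::finite, 'm::finite) game \<Rightarrow> 'n \<Rightarrow> real ^ 'm \<Rightarrow> real" where
  "utility G i \<theta> = (\<integral>x. (\<Sum>t. discount G ^ t * reward G i (x t)) \<partial>trajectory G \<theta> (init G))"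

definition is_potential ::
  "('s, 'k::finite, 'n::finite, 'm::finite) game \<Rightarrow> (real ^ 'm \<Rightarrow> real) \<Rightarrow> bool" where
  "is_potential G u \<longleftrightarrow>
     (\<forall>i \<theta>. \<exists>D. has_pgrad (owner G) i (utility G i) \<theta> D \<and> has_pgrad (owner G) i u \<theta> D)"


section \<open>Stochastic gradients\<close>

datatype estimator = Q_Function | Advantage | Temporal_Difference

definition score_sum ::
  "('s, 'k::finite, 'n::finite, 'm::finite) game \<Rightarrow> 'n \<Rightarrow> real ^ 'm \<Rightarrow> 's \<times> ('n \<Rightarrow> real ^ 'k) \<Rightarrow> real ^ 'm" where
  "score_sum G i \<theta> = (\<lambda>(s, a). \<Sum>n\<in>UNIV. score G i n \<theta> s (a n))"

definition reward_sum ::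
  "('s, 'k::finite, 'n::finite, 'm::finite) game \<Rightarrow> 'n \<Rightarrow> nat \<Rightarrow> nat \<Rightarrow>
     (nat \<Rightarrow> 's \<times> ('n \<Rightarrow> real ^ 'k)) \<Rightarrow> real" where
  "reward_sum G i T T' x =
     (\<Sum>t=T..T + T'. discount G powr (real (t - T) / 2) * reward G i (x t))"

text \<open>
  One sampling round: the two horizons and the trajectory played from a reset initial state. As
  the horizons are drawn independently of the play, the trajectory can be taken to be infinite.
\<close>

definition play ::
  "('s, 'k::finite, 'n::finite, 'm::finite) game \<Rightarrow> real ^ 'm \<Rightarrow>
     (nat \<times> nat \<times> (nat \<Rightarrow> 's \<times> ('n \<Rightarrow> real ^ 'k))) measure" where
  "play G \<theta> =
     measure_pmf (geometric_pmf (1 - discount G)) \<Otimes>\<^sub>M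
     (measure_pmf (geometric_pmf (1 - discount G powr (1 / 2))) \<Otimes>\<^sub>M trajectory G \<theta> (init G))"

definition value_law ::
  "('s, 'k::finite, 'n::finite, 'm::finite) game \<Rightarrow> 'n \<Rightarrow> real ^ 'm \<Rightarrow> 's \<Rightarrow> real measure" where
  "value_law G i \<theta> s =
     distr (measure_pmf (geometric_pmf (1 - discount G powr (1 / 2))) \<Otimes>\<^sub>M
            trajectory G \<theta> (return (states G) s))
       borel (\<lambda>(T, x). reward_sum G i 0 T x)"

text \<open>
  Law of the stochastic gradient of agent \<open>i\<close> at the parameter \<open>\<theta>\<close>. The value estimates come from
  fresh rounds, which depend on the main round only through the states they start from; for the
  temporal difference the two value estimates are conditionally independent.
\<close>

fun gradient_law ::
  "('s, 'k::finite, 'n::finite, 'm::finite) game \<Rightarrow> estimator \<Rightarrow> 'n \<Rightarrow> real ^ 'm \<Rightarrow> (real ^ 'm) measure" where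
  "gradient_law G Q_Function i \<theta> =
     distr (play G \<theta>) borel (\<lambda>(T1, T2, x). reward_sum G i T1 T2 x *\<^sub>R score_sum G i \<theta> (x T1))"
| "gradient_law G Advantage i \<theta> =
     Giry_Monad.bind (play G \<theta>) (\<lambda>(T1, T2, x).
       distr (value_law G i \<theta> (fst (x T1))) borel
         (\<lambda>v. (reward_sum G i T1 T2 x - v) *\<^sub>R score_sum G i \<theta> (x T1)))"
| "gradient_law G Temporal_Difference i \<theta> =
     Giry_Monad.bind (play G \<theta>) (\<lambda>(T1, T2, x).
       distr (value_law G i \<theta> (fst (x T1)) \<Otimes>\<^sub>M value_law G i \<theta> (fst (x (T1 + 1)))) borel
         (\<lambda>(v, v'). (reward G i (x T1) + discount G * v' - v) *\<^sub>R score_sum G i \<theta> (x T1)))"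

definition has_cond_law ::
  "'w measure \<Rightarrow> 'w measure \<Rightarrow> ('w \<Rightarrow> 'b::topological_space) \<Rightarrow> ('w \<Rightarrow> 'b measure) \<Rightarrow> bool" where
  "has_cond_law M F X \<kappa> \<longleftrightarrow>
     X \<in> borel_measurable M \<and>
     (\<forall>B\<in>sets borel. AE \<omega> in M.
        real_cond_exp M F (indicator (X -` B \<inter> space M)) \<omega> = measure (\<kappa> \<omega>) B)"


section \<open>Networked policy gradient play\<close>

definition nbrs :: "(nat \<Rightarrow> ('n \<times> 'n) set) \<Rightarrow> 'n \<Rightarrow> nat \<Rightarrow> 'n set" where
  "nbrs E i t = {j. (i, j) \<in> E t}"

definition limit_edges :: "(nat \<Rightarrow> ('n \<times> 'n) set) \<Rightarrow> ('n \<times> 'n) set" where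
  "limit_edges E = {e. \<exists>\<^sub>\<infinity>t. e \<in> E t}"

text \<open>
  \<open>bel t i \<omega>\<close> is the joint parameter vector as seen by agent \<open>i\<close>: its own block holds the true
  parameter of \<open>i\<close>, the other blocks hold the beliefs of \<open>i\<close>. The weight that \<open>i\<close> puts at time
  \<open>t\<close> on the estimate of \<open>l\<close> about the parameter of \<open>j\<close> is \<open>w t i j l\<close>. The random vector
  \<open>g t i\<close> is the stochastic gradient used by \<open>i\<close> in iteration \<open>t\<close>, and \<open>F t\<close> is the information
  available after iteration \<open>t\<close>. The gradients of different agents may have any joint law.
  The initial parameters may be random with finite mean; fixed ones are a special case.
\<close>

definition networked_play ::
  "('s, 'k::finite, 'n::finite, 'm::finite) game \<Rightarrow> ('n \<Rightarrow> estimator) \<Rightarrow>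
   (nat \<Rightarrow> ('n \<times> 'n) set) \<Rightarrow> (nat \<Rightarrow> 'n \<Rightarrow> 'n \<Rightarrow> 'n \<Rightarrow> real) \<Rightarrow> (nat \<Rightarrow> real) \<Rightarrow>
   'w measure \<Rightarrow> (nat \<Rightarrow> 'w measure) \<Rightarrow>
   (nat \<Rightarrow> 'w \<Rightarrow> real ^ 'm) \<Rightarrow> (nat \<Rightarrow> 'n \<Rightarrow> 'w \<Rightarrow> real ^ 'm) \<Rightarrow> (nat \<Rightarrow> 'n \<Rightarrow> 'w \<Rightarrow> real ^ 'm) \<Rightarrow> bool" where
  "networked_play G est E w \<alpha> M F theta bel g \<longleftrightarrow>
     prob_space M \<and>
     filtration (space M) F \<and> (\<forall>t. subalgebra M (F t)) \<and>
     (\<forall>t. theta t \<in> borel_measurable (F t)) \<and>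
     (\<forall>t i. bel t i \<in> borel_measurable (F t)) \<and>
     integrable M (theta 0) \<and>
     (\<forall>t i j l. 0 \<le> w t i j l) \<and>
     (\<forall>t i. \<forall>\<omega>\<in>space M. \<forall>m. owner G m = i \<longrightarrow> bel t i \<omega> $ m = theta t \<omega> $ m) \<and>
     (\<forall>t\<ge>1. \<forall>i. has_cond_law M (F (t - 1)) (g t i)
        (\<lambda>\<omega>. gradient_law G (est i) i (bel (t - 1) i \<omega>))) \<and>
     (\<forall>t\<ge>1. \<forall>i. \<forall>\<omega>\<in>space M. \<forall>m. owner G m = i \<longrightarrow>
        theta t \<omega> $ m = theta (t - 1) \<omega> $ m + \<alpha> t * g t i \<omega> $ m) \<and>
     (\<forall>t i j. \<forall>\<omega>\<in>space M. \<forall>m. owner G m = j \<and> i \<noteq> j \<longrightarrow>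
        bel (t + 1) i \<omega> $ m = (\<Sum>l\<in>nbrs E i t \<union> {i}. w t i j l * bel t l \<omega> $ m))"

text \<open>
  For \<open>d \<tau>\<close> the expected squared gradient norm of the potential at time \<open>\<tau>\<close>, this is the number
  of iterations needed to reach an \<open>\<epsilon>\<close>-stationary point in expectation. If no iteration qualifies
  the value of \<open>LEAST\<close> is arbitrary, so statements about it should come with existence.
\<close>

definition hitting_time :: "(nat \<Rightarrow> real) \<Rightarrow> real \<Rightarrow> nat" where
  "hitting_time d \<epsilon> = (LEAST t. (INF \<tau>\<in>{0..t}. d \<tau>) \<le> \<epsilon>)"

end

theory Submission
  imports Defs
begin

text \<open>
  With Lipschitz scores, each policy density admits a quadratic expansion in the parameter whose
  linear term is the density times its full score. Inserting this into the Bellman equation and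
  solving the linearised equation by the discounted resolvent gives quadratic expansions of the
  utilities with uniform constants, so their gradients and that of the potential are Lipschitz.
  The sampled gradients are unbiased up to the factor \<open>1 - \<gamma>\<close> (the scores of all agents
  enter the sum, and the horizon \<open>T1\<close> samples the discounted occupation measure), and their second
  moments are bounded. The consensus steps contract the belief errors, which are therefore
  $O(t^{-\beta})$ in mean. Summing the resulting ascent inequality for the potential over a window
  $[T, 2T)$ leaves a bounded quantity, because the potential, unlike a general smooth function,
  has bounded oscillation: if the blocks of the parameter are changed one agent at a time, each change
  alters the potential by the change of a bounded utility. Hence some iterate of the window has
  squared gradient norm $O(T^{\beta - 1})$; windows rather than sums from $0$ avoid a logarithm at
  $\beta = 1/2$.
\<close>

text \<open>Two obstacles shape the proof. Scores are unbounded, and only their second moments are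
  controlled. Differences of densities are therefore bounded by combinations of the old and the new
  density, each weighted by its own score; bounding the ratio of the densities would call for
  exponential moments. Functions containing scores pass through the Markov chain by conditional
  first moments, and only bounded functions enter the resolvent. Moreover, the potential is known
  only through partial gradients, which belong to a different utility for every agent. Its total
  differentiability has to be derived, and this is done by the same agent-by-agent path that bounds
  its oscillation. The exponent is a balance over a window of length \<open>T\<close>. The step
  sizes in it add up to order \<open>T powr (1 - \<beta>)\<close>, while the error terms, step size
  times belief error and squared step size, are of order \<open>1 / T powr (2 * \<beta>)\<close>
  each. As \<open>2 * \<beta> \<ge> 1\<close>, their sum over the window stays bounded, so the
  smallest expected squared gradient norm is at most a constant divided by the total step
  size.\<close>

section \<open>Blocks of the joint parameter and partial gradients\<close>

definition block :: "('m::finite \<Rightarrow> 'n) \<Rightarrow> 'n \<Rightarrow> real ^ 'm \<Rightarrow> real ^ 'm" where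
  "block own i x = (\<chi> m. if own m = i then x $ m else 0)"

lemma block_nth [simp]: "block own i x $ m = (if own m = i then x $ m else 0)"
  by (simp add: block_def)

lemma linear_block: "linear (block own i)"
  by (rule linearI) (auto simp: vec_eq_iff)

lemma norm_block_le: "norm (block own i x) \<le> norm x"
  unfolding norm_vec_def by (rule L2_set_mono) auto

lemma bounded_linear_block: "bounded_linear (block own i)"
  by (simp add: linear_block flip: linear_conv_bounded_linear)

lemma inner_block: "block own i x \<bullet> y = x \<bullet> block own i y"
  unfolding inner_vec_def by (rule sum.cong) auto

lemma sum_block:
  fixes own :: "'m::finite \<Rightarrow> 'n::finite"
  shows "(\<Sum>i\<in>UNIV. block own i x) = x"
  by (simp add: vec_eq_iff)

text \<open>Exhibits the map whose derivative defines a partial gradient as a translate of the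
  linear map \<open>block own i\<close>, so that the chain rule applies.\<close>

lemma combine_eq: "combine own i y x = x + block own i (y - x)"
  by (simp add: vec_eq_iff combine_def)

lemma GDERIV_unique:
  fixes f :: "'a::real_inner \<Rightarrow> real"
  assumes "GDERIV f x :> D" "GDERIV f x :> D'"
  shows "D = D'"
proof -
  have "(\<lambda>h. h \<bullet> D) = (\<lambda>h. h \<bullet> D')"
    using assms has_derivative_unique unfolding gderiv_def by blast
  then have "h \<bullet> D = h \<bullet> D'" for h by metis
  then show ?thesis by (metis vector_eq_ldot)
qed

text \<open>The remainder divided by \<open>norm h\<close> is at most \<open>C * norm h\<close>. The
  gradients of the utilities and of the potential are obtained in this way, from uniform expansions
  that also make the gradients of the utilities Lipschitz.\<close>

lemma GDERIV_quadratic: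
  fixes f :: "'a::real_inner \<Rightarrow> real"
  assumes "\<And>y. \<bar>f y - f x - (y - x) \<bullet> D\<bar> \<le> C * (norm (y - x))\<^sup>2"
  shows "GDERIV f x :> D"
  unfolding gderiv_def has_derivative_at
proof
  show "bounded_linear (\<lambda>h. h \<bullet> D)" by (rule bounded_linear_inner_left)
  show "(\<lambda>h. norm (f (x + h) - f x - h \<bullet> D) / norm h) \<midarrow>0\<rightarrow> 0"
  proof (rule Lim_null_comparison)
    show "((\<lambda>h::'a. C * norm h) \<longlongrightarrow> 0) (at 0)"
      by (intro tendsto_eq_intros refl) auto
    have "norm (norm (f (x + h) - f x - h \<bullet> D) / norm h) \<le> C * norm h" for h
      using assms[of "x + h"] by (cases "h = 0") (auto simp: divide_simps power2_eq_square mult_ac)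
    then show "\<forall>\<^sub>F h in at 0. norm (norm (f (x + h) - f x - h \<bullet> D) / norm h) \<le> C * norm h"
      by simp
  qed
qed

text \<open>The chain rule yields the functional
  \<open>\<lambda>h. block own i h \<bullet> D\<close>; as \<open>block own i\<close> is
  self-adjoint, the projection moves onto \<open>D\<close>.\<close>

lemma has_pgrad_block:
  assumes "GDERIV f x :> D"
  shows "has_pgrad own i f x (block own i D)"
proof -
  have "((\<lambda>y. x + block own i (y - x)) has_derivative (block own i)) (at x)"
  proof -
    have "((\<lambda>y. y - x) has_derivative (\<lambda>h. h)) (at x)" by (auto intro!: derivative_eq_intros)
    from bounded_linear.has_derivative[OF bounded_linear_block this, of own i]
    have "((\<lambda>y. block own i (y - x)) has_derivative (\<lambda>h. block own i h)) (at x)" .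
    from has_derivative_add[OF has_derivative_const[of x] this] show ?thesis by simp
  qed
  then have "((\<lambda>y. f (x + block own i (y - x))) has_derivative (\<lambda>h. block own i h \<bullet> D)) (at x)"
    using assms unfolding gderiv_def
    by (intro has_derivative_compose[where g=f and f="\<lambda>y. x + block own i (y - x)" and f'="block own i" and g'="\<lambda>h. h \<bullet> D"])
      (simp_all add: linear_0[OF linear_block])
  then show ?thesis
    unfolding has_pgrad_def gderiv_def combine_eq by (simp add: inner_block)
qed

lemma has_pgrad_unique: "has_pgrad own i f x D \<Longrightarrow> has_pgrad own i f x D' \<Longrightarrow> D = D'"
  unfolding has_pgrad_def by (rule GDERIV_unique)

lemma pgrad_eq: "has_pgrad own i f x D \<Longrightarrow> pgrad own i f x = D"
  unfolding pgrad_def by (rule the_equality) (auto intro: has_pgrad_unique)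

lemma grad_eq: "GDERIV f x :> D \<Longrightarrow> grad f x = D"
  unfolding grad_def by (rule the_equality) (auto intro: GDERIV_unique)

text \<open>Riesz representation in coordinates: the values of the derivative on the basis vectors
  are the coordinates of the gradient.\<close>

lemma differentiable_GDERIV:
  fixes f :: "real ^ 'm::finite \<Rightarrow> real"
  assumes "f differentiable (at x)"
  obtains D where "GDERIV f x :> D"
proof -
  obtain f' where f': "(f has_derivative f') (at x)" using assms differentiable_def by blast
  then interpret bounded_linear f' by (rule has_derivative_bounded_linear)
  have "f' h = h \<bullet> (\<Sum>b\<in>Basis. f' b *\<^sub>R b)" for h
  proof -
    have "f' h = f' (\<Sum>b\<in>Basis. (h \<bullet> b) *\<^sub>R b)" by (simp add: euclidean_representation)
    also have "\<dots> = (\<Sum>b\<in>Basis. (h \<bullet> b) * f' b)" by (simp add: sum scaleR)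
    also have "\<dots> = h \<bullet> (\<Sum>b\<in>Basis. f' b *\<^sub>R b)" by (simp add: inner_sum_right mult.commute)
    finally show ?thesis .
  qed
  then have "f' = (\<lambda>h. h \<bullet> (\<Sum>b\<in>Basis. f' b *\<^sub>R b))" by blast
  with f' show ?thesis using that unfolding gderiv_def by metis
qed

section \<open>Log-densities with Lipschitz scores\<close>

text \<open>Assembled from partial gradients because the Lipschitz hypothesis is about these. Where
  \<open>ln f\<close> is differentiable it is the ordinary gradient of \<open>ln f\<close>.\<close>

definition full_score :: "('m::finite \<Rightarrow> 'n::finite) \<Rightarrow> (real ^ 'm \<Rightarrow> real) \<Rightarrow> real ^ 'm \<Rightarrow> real ^ 'm" where
  "full_score own f x = (\<Sum>i\<in>UNIV. pgrad own i (\<lambda>y. ln (f y)) x)"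

lemma full_score_GDERIV:
  fixes f :: "real ^ 'm::finite \<Rightarrow> real" and own :: "'m \<Rightarrow> 'n::finite"
  assumes "GDERIV (\<lambda>y. ln (f y)) x :> D"
  shows "full_score own f x = D" "pgrad own i (\<lambda>y. ln (f y)) x = block own i D"
  by (simp_all add: full_score_def pgrad_eq[OF has_pgrad_block[OF assms]] sum_block)

text \<open>The second part is the likelihood-ratio identity: the derivative of a density is the
  density times its score, so derivatives of expectations become expectations again.\<close>

lemma ln_GDERIV:
  fixes f :: "real ^ 'm::finite \<Rightarrow> real" and own :: "'m \<Rightarrow> 'n::finite"
  assumes "f differentiable (at x)" "f x > 0"
  shows "GDERIV (\<lambda>y. ln (f y)) x :> full_score own f x"
    and "GDERIV f x :> f x *\<^sub>R full_score own f x"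
proof -
  obtain D where D: "GDERIV f x :> D" using differentiable_GDERIV assms by blast
  then have L: "GDERIV (\<lambda>y. ln (f y)) x :> (1 / f x) *\<^sub>R D"
    using \<open>f x > 0\<close> unfolding gderiv_def
    by (auto intro!: derivative_eq_intros simp: field_simps)
  then have e: "full_score own f x = (1 / f x) *\<^sub>R D" by (rule full_score_GDERIV)
  from L e show "GDERIV (\<lambda>y. ln (f y)) x :> full_score own f x" by simp
  from D e \<open>f x > 0\<close> show "GDERIV f x :> f x *\<^sub>R full_score own f x" by simp
qed

text \<open>With \<open>ln 0 = 0\<close> the logarithm of an identically vanishing function is
  constant, so its partial gradients exist and vanish.\<close>

lemma full_score_zero:
  fixes own :: "'m::finite \<Rightarrow> 'n::finite"
  assumes "\<And>y. f y = 0"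
  shows "full_score own f x = 0" "pgrad own i (\<lambda>y. ln (f y)) x = 0"
proof -
  have D: "GDERIV (\<lambda>y. ln (f y)) x :> 0" using assms by (simp add: GDERIV_const)
  show "full_score own f x = 0" by (rule full_score_GDERIV[OF D])
  show "pgrad own i (\<lambda>y. ln (f y)) x = 0"
    using full_score_GDERIV(2)[OF D, of own i] by (simp add: vec_eq_iff)
qed

lemma full_score_lipschitz:
  fixes own :: "'m::finite \<Rightarrow> 'n::finite"
  assumes lip: "\<And>i x y. norm (pgrad own i (\<lambda>y. ln (f y)) x - pgrad own i (\<lambda>y. ln (f y)) y) \<le> L * norm (x - y)"
  shows "norm (full_score own f x - full_score own f y) \<le> (real CARD('n) * L) * norm (x - y)"
proof -
  have "norm (full_score own f x - full_score own f y)
      \<le> (\<Sum>i\<in>(UNIV::'n set). L * norm (x - y))"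
    unfolding full_score_def sum_subtractf[symmetric] by (intro sum_norm_le lip)
  then show ?thesis by simp
qed

section \<open>Quadratic expansion of a single density\<close>

lemma segment_deriv:
  fixes f :: "real ^ 'm::finite \<Rightarrow> real"
  assumes "GDERIV f (x + t *\<^sub>R v) :> D"
  shows "((\<lambda>t. f (x + t *\<^sub>R v)) has_real_derivative v \<bullet> D) (at t)"
proof -
  have "((\<lambda>t. x + t *\<^sub>R v) has_derivative (\<lambda>s. s *\<^sub>R v)) (at t)"
    by (auto intro!: derivative_eq_intros)
  from has_derivative_compose[OF this assms[unfolded gderiv_def]]
  show ?thesis by (simp add: has_field_derivative_def mult.commute[of _ "v \<bullet> D"])
qed

text \<open>Along a segment \<open>g\<close> satisfies $|g'| \le C g$, also at its zeros, which are minima. Hence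
  \<open>exp (C * t) * g t\<close> increases.\<close>

lemma density_pos_everywhere:
  fixes f :: "real ^ 'm::finite \<Rightarrow> real" and own :: "'m \<Rightarrow> 'n::finite"
  assumes diff: "\<And>x. f differentiable (at x)" and nonneg: "\<And>x. 0 \<le> f x"
    and lip: "\<And>x y. norm (full_score own f x - full_score own f y) \<le> K * norm (x - y)"
    and K: "K \<ge> 0" and pos: "f x > 0"
  shows "f y > 0"
proof -
  define v where "v = y - x"
  \<comment> \<open>The bracket bounds the full score on the whole segment: its norm at
    \<open>x\<close> plus the Lipschitz growth over a distance \<open>norm v\<close>. Pairing the
    score with \<open>v\<close> contributes the other factor.\<close>
  define C where "C = norm v * (norm (full_score own f x) + K * norm v)"
  define g where "g t = f (x + t *\<^sub>R v)" for t
  have "\<exists>d. (g has_real_derivative d) (at t) \<and> \<bar>d\<bar> \<le> C * g t" if t: "0 \<le> t" "t \<le> 1" for t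
  proof (cases "g t = 0")
    case True
    obtain D where "GDERIV f (x + t *\<^sub>R v) :> D" using differentiable_GDERIV diff by blast
    from segment_deriv[OF this] have d: "(g has_real_derivative v \<bullet> D) (at t)"
      unfolding g_def .
    have "v \<bullet> D = 0"
      by (rule DERIV_local_min[OF d, of 1]) (use True nonneg in \<open>auto simp: g_def\<close>)
    with d True show ?thesis by auto
  next
    case False
    then have p: "f (x + t *\<^sub>R v) > 0" using nonneg[of "x + t *\<^sub>R v"] by (simp add: g_def)
    let ?S = "full_score own f (x + t *\<^sub>R v)"
    have d: "(g has_real_derivative v \<bullet> (g t *\<^sub>R ?S)) (at t)"
      unfolding g_def by (rule segment_deriv[OF ln_GDERIV(2)[OF diff p]])
    have "norm ?S \<le> norm (full_score own f x) + norm (?S - full_score own f x)"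
      by (metis norm_triangle_sub)
    also have "\<dots> \<le> norm (full_score own f x) + K * norm (t *\<^sub>R v)"
      using lip[of "x + t *\<^sub>R v" x] by simp
    also have "\<dots> \<le> norm (full_score own f x) + K * norm v"
      using t K by (auto intro!: mult_left_mono mult_left_le_one_le)
    finally have "\<bar>v \<bullet> ?S\<bar> \<le> C"
      unfolding C_def by (meson Cauchy_Schwarz_ineq2 mult_left_mono norm_ge_zero order_trans)
    then have "\<bar>v \<bullet> (g t *\<^sub>R ?S)\<bar> \<le> C * g t"
      using p by (simp add: abs_mult g_def mult.commute)
    with d show ?thesis by blast
  qed
  then obtain d where d: "\<And>t. 0 \<le> t \<Longrightarrow> t \<le> 1 \<Longrightarrow> (g has_real_derivative d t) (at t)"
      "\<And>t. 0 \<le> t \<Longrightarrow> t \<le> 1 \<Longrightarrow> \<bar>d t\<bar> \<le> C * g t" by metis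
  have "exp (C * 0) * g 0 \<le> exp (C * 1) * g 1"
  proof (rule DERIV_nonneg_imp_nondecreasing[where f="\<lambda>t. exp (C * t) * g t"])
    fix t :: real assume t: "0 \<le> t" "t \<le> 1"
    have "((\<lambda>t. exp (C * t) * g t) has_real_derivative exp (C * t) * (C * g t + d t)) (at t)"
      using d(1)[OF t] by (auto intro!: derivative_eq_intros simp: algebra_simps)
    moreover have "0 \<le> exp (C * t) * (C * g t + d t)"
      using d(2)[OF t] by (auto intro!: mult_nonneg_nonneg)
    ultimately show "\<exists>y. ((\<lambda>t. exp (C * t) * g t) has_real_derivative y) (at t) \<and> 0 \<le> y" by blast
  qed simp
  moreover have "g 0 > 0" "g 1 = f y" using pos by (auto simp: g_def v_def)
  ultimately show ?thesis by (simp add: zero_less_mult_iff) (smt (verit) exp_gt_zero mult_nonneg_nonpos)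
qed

text \<open>The mean value theorem turns the increment into a score at an intermediate point, which
  the Lipschitz bound compares with the score at \<open>x\<close>.\<close>

lemma ln_density_expansion:
  fixes f :: "real ^ 'm::finite \<Rightarrow> real" and own :: "'m \<Rightarrow> 'n::finite"
  assumes diff: "\<And>x. f differentiable (at x)" and pos: "\<And>x. f x > 0"
    and lip: "\<And>x y. norm (full_score own f x - full_score own f y) \<le> K * norm (x - y)"
    and K: "K \<ge> 0"
  shows "\<bar>ln (f (x + v)) - ln (f x) - v \<bullet> full_score own f x\<bar> \<le> K * (norm v)\<^sup>2"
proof -
  have "\<exists>z>0. z < 1 \<and> ln (f (x + 1 *\<^sub>R v)) - ln (f (x + 0 *\<^sub>R v))
          = (1 - 0) * (v \<bullet> full_score own f (x + z *\<^sub>R v))"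
    by (rule MVT2) (auto intro!: segment_deriv ln_GDERIV diff pos)
  then obtain z where z: "0 < z" "z < 1"
      "ln (f (x + v)) - ln (f x) = v \<bullet> full_score own f (x + z *\<^sub>R v)" by auto
  have "\<bar>v \<bullet> (full_score own f (x + z *\<^sub>R v) - full_score own f x)\<bar>
      \<le> norm v * norm (full_score own f (x + z *\<^sub>R v) - full_score own f x)"
    by (rule Cauchy_Schwarz_ineq2)
  also have "\<dots> \<le> norm v * (K * norm (z *\<^sub>R v))"
    using lip[of "x + z *\<^sub>R v" x] by (intro mult_left_mono) auto
  also have "\<dots> \<le> norm v * (K * norm v)"
    using z K by (auto intro!: mult_left_mono mult_left_le_one_le)
  finally show ?thesis using z by (simp add: inner_diff_right power2_eq_square mult_ac)
qed

text \<open>With \<open>q = p * exp x\<close>, the tangents of the exponential at both ends give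
  \<open>p * x \<le> q - p \<le> q * x\<close>. The bounds contain powers of \<open>x\<close> and
  the two densities only, no exponential of \<open>x\<close>, so they remain integrable when
  \<open>x\<close> is controlled through moments of scores.\<close>

lemma exp_diff_bounds:
  fixes p q :: real
  assumes "p > 0" "q > 0" and x: "x = ln q - ln p"
  shows "\<bar>q - p\<bar> \<le> \<bar>x\<bar> * (p + q)" "\<bar>q - p - p * x\<bar> \<le> x\<^sup>2 * (p + q)"
proof -
  have q: "q = p * exp x" using assms by (simp add: exp_diff)
  have 1: "x \<le> exp x - 1" using exp_ge_add_one_self[of x] by linarith
  have 2: "exp x - 1 \<le> exp x * x"
  proof -
    have "exp x * (1 + - x) \<le> exp x * exp (- x)" by (intro mult_left_mono exp_ge_add_one_self) auto
    then show ?thesis by (simp add: exp_minus algebra_simps)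
  qed
  have l: "p * x \<le> q - p" using mult_left_mono[OF 1, of p] assms(1) by (simp add: q algebra_simps)
  have u: "q - p \<le> q * x" using mult_left_mono[OF 2, of p] assms(1) by (simp add: q algebra_simps)
  have a: "p * \<bar>x\<bar> \<ge> 0" "q * \<bar>x\<bar> \<ge> 0" using assms by auto
  have b: "q * x \<le> q * \<bar>x\<bar>" "- (p * \<bar>x\<bar>) \<le> p * x"
    using mult_left_mono[of x "\<bar>x\<bar>" q] mult_left_mono[of "- \<bar>x\<bar>" x p] assms(1,2) by auto
  show A: "\<bar>q - p\<bar> \<le> \<bar>x\<bar> * (p + q)" using l u a b by (simp add: algebra_simps)
  have "q * x - p * x = (q - p) * x" by (simp add: algebra_simps)
  also have "\<dots> \<le> \<bar>q - p\<bar> * \<bar>x\<bar>" by (metis abs_ge_self abs_mult)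
  also have "\<dots> \<le> (\<bar>x\<bar> * (p + q)) * \<bar>x\<bar>" using A by (intro mult_right_mono) auto
  also have "\<dots> = x\<^sup>2 * (p + q)" by (simp add: power2_eq_square abs_if)
  finally show "\<bar>q - p - p * x\<bar> \<le> x\<^sup>2 * (p + q)" using l u by simp
qed

text \<open>The two bounds on the log-ratio are the expansions at both end points; they allow each
  density to be paired with its own score, whose moments are controlled.\<close>

lemma density_expansion:
  fixes J J' v :: "real ^ 'm::finite"
  assumes pq: "p > 0" "q > 0"
    and e: "\<bar>ln q - ln p - v \<bullet> J\<bar> \<le> c * (norm v)\<^sup>2" "\<bar>ln q - ln p - v \<bullet> J'\<bar> \<le> c * (norm v)\<^sup>2"
    and c: "c \<ge> 0" and v: "norm v \<le> 1"
  shows "\<bar>q - p\<bar> \<le> norm v * (p * (norm J + c) + q * (norm J' + c))"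
    and "\<bar>q - p - p * (v \<bullet> J)\<bar>
      \<le> (norm v)\<^sup>2 * (p * (2 * (norm J)\<^sup>2 + 2 * c\<^sup>2 + c) + q * (2 * (norm J')\<^sup>2 + 2 * c\<^sup>2))"
proof -
  define x where "x = ln q - ln p"
  \<comment> \<open>For increments of norm at most one a quadratic error is also a linear one; hence
    the log-ratio is at most \<open>norm v\<close> times an expression in either of the two
    scores.\<close>
  have v2: "(norm v)\<^sup>2 \<le> norm v" using v by (simp add: power2_eq_square mult_left_le)
  have B: "\<bar>x\<bar> \<le> norm v * (norm I + c)" if "\<bar>x - v \<bullet> I\<bar> \<le> c * (norm v)\<^sup>2" for I
    using that Cauchy_Schwarz_ineq2[of v I] mult_left_mono[OF v2 c]
    by (simp add: algebra_simps)
  have B2: "x\<^sup>2 \<le> (norm v)\<^sup>2 * (2 * (norm I)\<^sup>2 + 2 * c\<^sup>2)" if "\<bar>x - v \<bullet> I\<bar> \<le> c * (norm v)\<^sup>2" for I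
  proof -
    have "x\<^sup>2 \<le> (norm v * (norm I + c))\<^sup>2"
      using B[OF that] by (metis abs_ge_zero power2_abs power_mono)
    also have "\<dots> \<le> (norm v)\<^sup>2 * (2 * (norm I)\<^sup>2 + 2 * c\<^sup>2)"
      unfolding power_mult_distrib
      using sum_squares_bound[of "norm I" c] by (intro mult_left_mono) (auto simp: power2_sum)
    finally show ?thesis .
  qed
  have e': "\<bar>x - v \<bullet> J\<bar> \<le> c * (norm v)\<^sup>2" "\<bar>x - v \<bullet> J'\<bar> \<le> c * (norm v)\<^sup>2"
    using e by (auto simp: x_def)
  note X = exp_diff_bounds[OF pq x_def]
  have "\<bar>x\<bar> * (p + q) = p * \<bar>x\<bar> + q * \<bar>x\<bar>" by (simp add: algebra_simps)
  also have "\<dots> \<le> p * (norm v * (norm J + c)) + q * (norm v * (norm J' + c))"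
    using pq B[OF e'(1)] B[OF e'(2)] by (intro add_mono mult_left_mono) auto
  finally show "\<bar>q - p\<bar> \<le> norm v * (p * (norm J + c) + q * (norm J' + c))"
    using X(1) by (simp add: algebra_simps)
  have "\<bar>q - p - p * (v \<bullet> J)\<bar> \<le> \<bar>q - p - p * x\<bar> + \<bar>p * (x - v \<bullet> J)\<bar>"
    by (simp add: algebra_simps)
  also have "\<dots> \<le> x\<^sup>2 * (p + q) + p * (c * (norm v)\<^sup>2)"
    using add_mono[OF X(2) mult_left_mono[OF e'(1), of p]] pq by (simp add: abs_mult)
  also have "\<dots> = p * x\<^sup>2 + q * x\<^sup>2 + p * (c * (norm v)\<^sup>2)" by (simp add: algebra_simps)
  also have "\<dots> \<le> p * ((norm v)\<^sup>2 * (2 * (norm J)\<^sup>2 + 2 * c\<^sup>2))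
      + q * ((norm v)\<^sup>2 * (2 * (norm J')\<^sup>2 + 2 * c\<^sup>2)) + p * (c * (norm v)\<^sup>2)"
    using pq B2[OF e'(1)] B2[OF e'(2)]
    by (intro add_mono mult_left_mono mult_nonneg_nonneg c order_refl zero_le_power2) auto
  finally show "\<bar>q - p - p * (v \<bullet> J)\<bar>
      \<le> (norm v)\<^sup>2 * (p * (2 * (norm J)\<^sup>2 + 2 * c\<^sup>2 + c) + q * (2 * (norm J')\<^sup>2 + 2 * c\<^sup>2))"
    by (simp add: algebra_simps)
qed

text \<open>Comparing the expansions around \<open>x\<close> and \<open>y\<close> at the third point \<open>y + z\<close>.\<close>

lemma quadratic_expansion_lipschitz:
  fixes f :: "'a::real_inner \<Rightarrow> real"
  assumes q: "\<And>x y. \<bar>f y - f x - (y - x) \<bullet> D x\<bar> \<le> C * (norm (y - x))\<^sup>2"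
  shows "norm (D y - D x) \<le> 6 * C * norm (y - x)"
proof (cases "D y = D x \<or> y = x")
  case True
  have "0 \<le> C * (norm (y - x))\<^sup>2" using q[of y x] by linarith
  with True show ?thesis by (cases "y = x") (auto simp: zero_le_mult_iff)
next
  case False
  \<comment> \<open>The test direction is parallel to the difference of the gradients, where the
    inner product attains the product of the norms. Its length is that of \<open>y - x\<close>,
    which makes the three remainders comparable.\<close>
  define z where "z = (norm (y - x) / norm (D y - D x)) *\<^sub>R (D y - D x)"
  have nz: "norm z = norm (y - x)" using False by (simp add: z_def)
  have C0: "0 \<le> C" using q[of y x] False by (smt (verit) mult_nonneg_nonpos2 zero_le_power2 norm_eq_zero right_minus_eq power2_eq_square mult_eq_0_iff zero_le_mult_iff)
  have 1: "\<bar>f (y + z) - f y - z \<bullet> D y\<bar> \<le> C * (norm (y - x))\<^sup>2"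
    using q[of "y + z" y] nz by simp
  have 2: "\<bar>f (y + z) - f x - (y + z - x) \<bullet> D x\<bar> \<le> C * (4 * (norm (y - x))\<^sup>2)"
  proof -
    have "norm (y + z - x) \<le> norm (y - x) + norm z" by (metis add_diff_eq add.commute norm_triangle_ineq add_diff_cancel_left' diff_add_eq)
    then have "(norm (y + z - x))\<^sup>2 \<le> (2 * norm (y - x))\<^sup>2" using nz by (intro power_mono) auto
    then show ?thesis
      using q[of "y + z" x] mult_left_mono[OF _ C0] by (fastforce simp: power_mult_distrib)
  qed
  \<comment> \<open>The remainders of the steps from \<open>y\<close> to \<open>y + z\<close>, from
    \<open>x\<close> to \<open>y + z\<close> and from \<open>x\<close> to \<open>y\<close>
    contribute \<open>1 + 4 + 1\<close> multiples of \<open>C\<close>; the middle step may be twice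
    as long.\<close>
  have "z \<bullet> (D y - D x) \<le> 6 * C * (norm (y - x))\<^sup>2"
    using 1 2 q[of y x] by (simp add: inner_diff_left inner_diff_right inner_add_left)
  moreover have "z \<bullet> (D y - D x) = norm (y - x) * norm (D y - D x)"
    using False by (simp add: z_def power2_norm_eq_inner[symmetric] power2_eq_square)
  ultimately show ?thesis using False by (simp add: power2_eq_square)
qed

section \<open>Consensus and convergence rates\<close>

text \<open>After \<open>k\<close> steps, an agent reached by the pinned agent \<open>j\<close> has error at most
  \<open>(1 - h ^ k) * A\<close> up to noise; reached agents stay reached by their self-weight, and an edge
  of the limit network transmits the property within one period.\<close>

lemma consensus_contraction:
  fixes a :: "nat \<Rightarrow> 'n::finite \<Rightarrow> real" and w :: "nat \<Rightarrow> 'n \<Rightarrow> 'n \<Rightarrow> real"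
  assumes conn: "\<And>i. (i, j) \<in> (limit_edges E)\<^sup>*"
    and period: "\<And>e t. e \<in> limit_edges E \<Longrightarrow> t \<ge> 1 \<Longrightarrow> e \<in> (\<Union>\<tau>\<in>{0..T - 1}. E (t + \<tau>))"
    and T: "T > 0" and h: "0 < h" "h < 1"
    and w: "\<And>t i l. t \<ge> 1 \<Longrightarrow> i \<noteq> j \<Longrightarrow> l \<in> nbrs E i t \<union> {i} \<Longrightarrow> w t i l \<ge> h"
    and w_sum: "\<And>t i. t \<ge> 1 \<Longrightarrow> (\<Sum>l\<in>nbrs E i t \<union> {i}. w t i l) = 1"
    and pinned: "\<And>t. a t j = 0" and b: "\<And>t. b t \<ge> 0"
    and step: "\<And>t i. t \<ge> 1 \<Longrightarrow> i \<noteq> j \<Longrightarrow>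
      a (t + 1) i \<le> (\<Sum>l\<in>nbrs E i t \<union> {i}. w t i l * a t l) + b t"
  shows "\<exists>K>0. \<exists>\<rho>. 0 \<le> \<rho> \<and> \<rho> < 1 \<and> (\<forall>t\<ge>1. \<forall>A. (\<forall>i. a t i \<le> A) \<longrightarrow>
      (\<forall>i. a (t + K) i \<le> \<rho> * A + (\<Sum>s=t..<t + K. b s)))"
proof -
  define S where "S t k = (\<Sum>s=t..<t + k. b s)" for t k
  have S_Suc: "S t (Suc k) = S t k + b (t + k)" for t k by (simp add: S_def)
  have S0: "S t k \<ge> 0" for t k unfolding S_def by (intro sum_nonneg b)
  \<comment> \<open>In a convex combination of values at most \<open>X\<close>, one value at most
    \<open>Y\<close> with weight at least \<open>h\<close> saves \<open>h * (X - Y)\<close>.\<close>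
  have avg: "a (Suc s) i \<le> X - h * (X - Y) + b s"
    if "s \<ge> 1" "i \<noteq> j" "\<And>l. a s l \<le> X" "m \<in> nbrs E i s \<union> {i}" "a s m \<le> Y" "Y \<le> X"
    for s i m X Y
  proof -
    let ?N = "nbrs E i s \<union> {i}"
    have wn: "w s i l \<ge> 0" if "l \<in> ?N" for l using w[OF \<open>s \<ge> 1\<close> \<open>i \<noteq> j\<close> that] h by simp
    have "(\<Sum>l\<in>?N. w s i l * a s l) = w s i m * a s m + (\<Sum>l\<in>?N - {m}. w s i l * a s l)"
      using that by (intro sum.remove) auto
    also have "\<dots> \<le> w s i m * Y + (\<Sum>l\<in>?N - {m}. w s i l * X)"
      using that wn by (intro add_mono sum_mono mult_left_mono) auto
    also have "(\<Sum>l\<in>?N - {m}. w s i l * X) = (1 - w s i m) * X"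
      using w_sum[OF \<open>s \<ge> 1\<close>, of i] sum.remove[of ?N m "w s i"] that
      by (simp add: sum_distrib_right[symmetric])
    finally have "(\<Sum>l\<in>?N. w s i l * a s l) \<le> X - w s i m * (X - Y)" by (simp add: algebra_simps)
    also have "\<dots> \<le> X - h * (X - Y)"
      using w[OF \<open>s \<ge> 1\<close> \<open>i \<noteq> j\<close> that(4)] that by (simp add: mult_right_mono)
    finally show ?thesis using step[OF \<open>s \<ge> 1\<close> \<open>i \<noteq> j\<close>] by simp
  qed
  have upper: "a (t + k) i \<le> A + S t k" if "t \<ge> 1" "\<And>i. a t i \<le> A" for t A k i
  proof (induction k arbitrary: i)
    case 0 then show ?case using that by (simp add: S_def)
  next
    case (Suc k)
    have A0: "0 \<le> A" using that(2)[of j] pinned by simp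
    show ?case
    proof (cases "i = j")
      case True then show ?thesis using pinned A0 S0 by (simp add: add_nonneg_nonneg)
    next
      case False
      from avg[of "t + k" i "A + S t k" i "A + S t k"] Suc that False
      show ?thesis by (simp add: S_Suc)
    qed
  qed
  define Z where "Z t A k i \<longleftrightarrow> a (t + k) i \<le> (1 - h ^ k) * A + S t k" for t A k i
  have spread: "Z t A (Suc k) i"
    if "t \<ge> 1" "\<And>i. a t i \<le> A" "Z t A k m" "m \<in> nbrs E i (t + k) \<union> {i}" for t A k i m
  proof -
    have A0: "0 \<le> A" using that(2)[of j] pinned by simp
    show ?thesis
    proof (cases "i = j")
      case True
      have "h ^ Suc k \<le> 1" using h by (intro power_le_one) auto
      then show ?thesis unfolding Z_def
        using True pinned A0 S0[of t "Suc k"] by (simp del: power_Suc)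
    next
      case False
      have "a (Suc (t + k)) i \<le> (A + S t k) - h * ((A + S t k) - ((1 - h ^ k) * A + S t k)) + b (t + k)"
        using that False A0 h upper[OF that(1,2)] by (intro avg[where m=m]) (auto simp: Z_def algebra_simps)
      then show ?thesis by (simp add: Z_def S_Suc algebra_simps)
    qed
  qed
  \<comment> \<open>Induction along a path of the limit network from its end \<open>j\<close>
    backwards. An edge \<open>(i, l)\<close> means that \<open>i\<close> listens to
    \<open>l\<close>, so the improvement travels from \<open>l\<close> to \<open>i\<close>.\<close>
  have reach: "\<exists>k0. \<forall>t\<ge>1. \<forall>A. (\<forall>i. a t i \<le> A) \<longrightarrow> (\<forall>k\<ge>k0. Z t A k i)" for i
    using conn[of i]
  proof (induction rule: converse_rtrancl_induct)
    case base
    have "Z t A k j" if "t \<ge> 1" "\<forall>i. a t i \<le> A" for t A k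
    proof (induction k)
      case 0 then show ?case using pinned by (simp add: Z_def S_def)
    next
      case (Suc k) then show ?case using spread[of t A k j j] that by blast
    qed
    then show ?case by blast
  next
    case (step i l)
    then obtain k0 where k0: "\<And>t A k. t \<ge> 1 \<Longrightarrow> \<forall>i. a t i \<le> A \<Longrightarrow> k \<ge> k0 \<Longrightarrow> Z t A k l" by blast
    have "Z t A k i" if t: "t \<ge> 1" and A: "\<forall>i. a t i \<le> A" and k: "k \<ge> k0 + T" for t A k
    proof -
      \<comment> \<open>From time \<open>t + k0\<close> on, \<open>l\<close> has the improved bound
        for good, and within one period the edge becomes active. The resulting delay
        \<open>k0 + T\<close> depends neither on \<open>t\<close> nor on \<open>A\<close>.\<close>
      from period[OF step(1), of "t + k0"] t obtain \<tau> where \<tau>: "\<tau> \<le> T - 1" "(i, l) \<in> E (t + k0 + \<tau>)"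
        by auto
      from \<tau> have "Z t A (Suc (k0 + \<tau>)) i"
        using A by (intro spread[OF t _ k0[OF t A]]) (auto simp: nbrs_def add.assoc)
      have "Suc (k0 + \<tau>) \<le> k" using \<tau> T k by simp
      then show ?thesis
      proof (induction k rule: dec_induct)
        case base show ?case by fact
      next
        case (step n) then show ?case using spread[OF t, of A n i i] A by blast
      qed
    qed
    then show ?case by blast
  qed
  then obtain k0 where k0: "\<And>i t A k. t \<ge> 1 \<Longrightarrow> \<forall>i. a t i \<le> A \<Longrightarrow> k \<ge> k0 i \<Longrightarrow> Z t A k i" by metis
  \<comment> \<open>A delay that serves all agents, made positive by \<open>Suc\<close>; the
    contraction factor becomes \<open>1 - h ^ K\<close>.\<close>
  define K where "K = Suc (Max (range k0))"
  have "k0 i \<le> K" for i unfolding K_def by (simp add: le_SucI)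
  then have "\<forall>t\<ge>1. \<forall>A. (\<forall>i. a t i \<le> A) \<longrightarrow> (\<forall>i. a (t + K) i \<le> (1 - h ^ K) * A + (\<Sum>s=t..<t + K. b s))"
    using k0 unfolding Z_def S_def by blast
  moreover have "0 \<le> 1 - h ^ K" "1 - h ^ K < 1" "K > 0" using h by (auto simp: K_def power_le_one simp del: power_Suc)
  ultimately show ?thesis by blast
qed

section \<open>Decay rates and hitting times\<close>

text \<open>Rescaling by \<open>real t powr \<beta>\<close> makes the noise constant. The weight
  grows over \<open>K\<close> steps by a factor tending to one, so for large \<open>t\<close> the
  rescaled sequence still contracts, with the factor \<open>q\<close> halfway between
  \<open>\<rho>\<close> and 1.\<close>

lemma contraction_decay:
  fixes A :: "nat \<Rightarrow> real"
  assumes rec: "\<And>t. t \<ge> 1 \<Longrightarrow> A (t + K) \<le> \<rho> * A t + c / real t powr \<beta>"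
    and A: "\<And>t. A t \<ge> 0" and c: "c \<ge> 0" and \<rho>: "0 \<le> \<rho>" "\<rho> < 1" and \<beta>: "0 \<le> \<beta>" "\<beta> \<le> 1" and K: "K > 0"
  shows "\<exists>D. \<forall>t\<ge>1. A t \<le> D / real t powr \<beta>"
proof -
  define q where "q = (1 + \<rho>) / 2"
  have q: "q < 1" "0 < q" using \<rho> by (auto simp: q_def)
  \<comment> \<open>From here on \<open>(1 + real K / real t) * \<rho> \<le> q\<close>, because
    \<open>real K / real t\<close> is at most half of \<open>1 - \<rho>\<close>; the added one keeps
    \<open>t\<close> positive.\<close>
  define t0 where "t0 = nat \<lceil>2 * real K / (1 - \<rho>)\<rceil> + 1"
  define B where "B t = A t * real t powr \<beta>" for t
  \<comment> \<open>Dominates the finitely many initial values and also the fixed point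
    \<open>(1 + real K) * c / (1 - q)\<close> of the affine recursion.\<close>
  define D where "D = Max (B ` {..t0 + K}) + (1 + real K) * c / (1 - q)"
  have m: "(1 + real K) * c / (1 - q) \<ge> 0" using q c by (auto intro!: divide_nonneg_pos)
  have B0: "B t \<ge> 0" for t by (simp add: B_def A)
  have stepB: "B (t + K) \<le> q * B t + (1 + real K) * c" if t: "t \<ge> t0" for t
  proof -
    have t1: "t \<ge> 1" using t by (simp add: t0_def)
    have "2 * real K / (1 - \<rho>) \<le> real t" using t by (simp add: t0_def) linarith
    then have "2 * real K \<le> real t * (1 - \<rho>)" using \<rho> by (simp add: field_simps)
    moreover have "real K * \<rho> \<le> real K" using \<rho> by (simp add: mult_left_le)
    ultimately have kt: "(1 + real K / real t) * \<rho> \<le> q"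
      using t1 by (simp add: q_def field_simps)
    have pw: "real (t + K) powr \<beta> \<le> (1 + real K / real t) * real t powr \<beta>"
    proof -
      have "real (t + K) = (1 + real K / real t) * real t" using t1 by (simp add: field_simps)
      then have "real (t + K) powr \<beta> = (1 + real K / real t) powr \<beta> * real t powr \<beta>"
        by (simp add: powr_mult)
      \<comment> \<open>The exponent \<open>\<beta> \<le> 1\<close> on a base at least one is
        replaced by 1, which keeps the growth factor linear in \<open>K\<close>.\<close>
      also have "\<dots> \<le> (1 + real K / real t) powr 1 * real t powr \<beta>"
        using \<beta> by (intro mult_right_mono powr_mono) auto
      finally show ?thesis by simp
    qed
    have "B (t + K) \<le> (\<rho> * A t + c / real t powr \<beta>) * ((1 + real K / real t) * real t powr \<beta>)"
      unfolding B_def using rec[OF t1] pw A \<rho> c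
      by (intro mult_mono) (auto intro!: add_nonneg_nonneg mult_nonneg_nonneg)
    also have "\<dots> = (1 + real K / real t) * \<rho> * B t + (1 + real K / real t) * c"
      using t1 by (simp add: B_def field_simps)
    also have "\<dots> \<le> q * B t + (1 + real K) * c"
    proof -
      have "real K / real t \<le> real K" using t1 by (simp add: divide_le_eq mult_le_cancel_left1)
      then show ?thesis using kt B0[of t] c by (intro add_mono mult_right_mono) auto
    qed
    finally show ?thesis .
  qed
  have "B t \<le> D" for t
  proof (induction t rule: less_induct)
    case (less t)
    show ?case
    proof (cases "t \<le> t0 + K")
      case True
      then have "B t \<le> Max (B ` {..t0 + K})" by (intro Max_ge) auto
      then show ?thesis using m by (simp add: D_def)
    next
      case False
      then have "B t \<le> q * B (t - K) + (1 + real K) * c" using stepB[of "t - K"] by simp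
      also have "\<dots> \<le> q * D + (1 + real K) * c"
        using less[of "t - K"] False K q by (intro add_mono mult_left_mono) auto
      also have "\<dots> \<le> D"
      proof -
        have "Max (B ` {..t0 + K}) \<ge> 0" using B0[of 0] by (intro order_trans[OF B0[of 0]] Max_ge) auto
        then have "(1 + real K) * c / (1 - q) \<le> D" by (simp add: D_def)
        then have "(1 + real K) * c \<le> D * (1 - q)" using q by (simp only: pos_divide_le_eq)
        then show ?thesis by (simp add: algebra_simps)
      qed
      finally show ?thesis .
    qed
  qed
  then have "A t \<le> D / real t powr \<beta>" if "t \<ge> 1" for t
    using that by (simp add: B_def field_simps)
  then show ?thesis by blast
qed

text \<open>If \<open>d\<close> exceeded \<open>C' * real T powr (\<beta> - 1)\<close> on the whole
  window, then each of its \<open>T\<close> terms would be at least a constant multiple of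
  \<open>1 / T\<close>, and the constant is chosen so that the sum would exceed
  \<open>C\<close>.\<close>

lemma rate_of_window_sums:
  fixes d \<alpha> :: "nat \<Rightarrow> real"
  assumes d: "\<And>t. d t \<ge> 0" and \<beta>: "0 < \<beta>" "\<beta> < 1"
    and \<alpha>: "\<And>t. t \<ge> T0 \<Longrightarrow> \<alpha> t \<ge> c / real t powr \<beta>" and c: "c > 0"
    and window: "\<And>T. T \<ge> T0 \<Longrightarrow> (\<Sum>t=T..<2*T. \<alpha> (t + 1) * d t) \<le> C"
  shows "\<exists>C'>0. \<exists>T1\<ge>1. \<forall>T\<ge>T1. \<exists>t\<le>2*T. d t \<le> C' * real T powr (\<beta> - 1)"
proof -
  \<comment> \<open>Chosen so that the lower bound of the window sum equals
    \<open>\<bar>C\<bar> + c / 2 powr \<beta>\<close>, which is strictly above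
    \<open>C\<close>.\<close>
  define C' where "C' = \<bar>C\<bar> * 2 powr \<beta> / c + 1"
  have "\<exists>t\<le>2*T. d t \<le> C' * real T powr (\<beta> - 1)" if T: "T \<ge> max 1 T0" for T
  proof (rule ccontr)
    assume "\<not> ?thesis"
    then have big: "d t > C' * real T powr (\<beta> - 1)" if "t \<le> 2*T" for t using that by (meson not_le)
    have T1: "T \<ge> 1" using T by simp
    have C'0: "C' > 0" using c by (auto simp: C'_def add_nonneg_pos)
    have "(\<Sum>t=T..<2*T. (c / real (2*T) powr \<beta>) * (C' * real T powr (\<beta> - 1)))
        \<le> (\<Sum>t=T..<2*T. \<alpha> (t + 1) * d t)"
    proof (rule sum_mono)
      fix t assume t: "t \<in> {T..<2*T}"
      \<comment> \<open>The step size that multiplies \<open>d t\<close> has index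
        \<open>t + 1\<close>, and \<open>t < 2 * T\<close> still gives
        \<open>t + 1 \<le> 2 * T\<close>.\<close>
      have "c / real (2*T) powr \<beta> \<le> c / real (t + 1) powr \<beta>"
        using t c \<beta> by (intro divide_left_mono powr_mono2) auto
      also have "\<dots> \<le> \<alpha> (t + 1)" using t T by (intro \<alpha>) auto
      finally show "(c / real (2*T) powr \<beta>) * (C' * real T powr (\<beta> - 1)) \<le> \<alpha> (t + 1) * d t"
        using big[of t] t c C'0 T1 d[of t]
        by (intro mult_mono) (auto intro: order_trans[of 0 "c / (2 * real T) powr \<beta>"])
    qed
    also have "\<dots> \<le> C" using T by (intro window) auto
    also have "(\<Sum>t=T..<2*T. (c / real (2*T) powr \<beta>) * (C' * real T powr (\<beta> - 1)))
        = c * C' / 2 powr \<beta> * (real T * real T powr (\<beta> - 1) / real T powr \<beta>)"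
      by (simp add: powr_mult)
    also have "real T * real T powr (\<beta> - 1) = real T powr \<beta>"
      using T1 by (simp add: powr_mult_base)
    also have "c * C' / 2 powr \<beta> * (real T powr \<beta> / real T powr \<beta>) = \<bar>C\<bar> + c / 2 powr \<beta>"
      using T1 c by (simp add: C'_def field_simps)
    finally show False using c by (smt (verit) divide_pos_pos powr_gt_zero)
  qed
  moreover have "C' > 0" using c by (auto simp: C'_def add_nonneg_pos)
  ultimately show ?thesis by (intro exI[of _ C'] conjI exI[of _ "max 1 T0"]) auto
qed

text \<open>Solving \<open>C * real T powr (\<beta> - 1) \<le> \<epsilon>\<close> for
  \<open>T\<close> gives the power \<open>1 / (1 - \<beta>)\<close> of
  \<open>C / \<epsilon>\<close>, and \<open>\<beta> \<ge> 1 / 2\<close> makes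
  \<open>1 - \<beta>\<close> the minimum. The same choice of \<open>T\<close> shows that the level
  is reached at all, so that \<open>LEAST\<close> in \<open>hitting_time\<close> is
  meaningful.\<close>

lemma hitting_time_rate:
  fixes d :: "nat \<Rightarrow> real"
  assumes d: "\<And>t. d t \<ge> 0" and \<beta>: "1 / 2 \<le> \<beta>" "\<beta> < 1" and C: "C > 0" and T1: "T1 \<ge> 1"
    and rate: "\<And>T. T \<ge> T1 \<Longrightarrow> \<exists>t\<le>2*T. d t \<le> C * real T powr (\<beta> - 1)"
  shows "(\<forall>\<epsilon>>0. \<exists>t. (INF \<tau>\<in>{0..t}. d \<tau>) \<le> \<epsilon>) \<and>
    (\<lambda>\<epsilon>. real (hitting_time d \<epsilon>)) \<in> O[at_right 0](\<lambda>\<epsilon>. \<epsilon> powr (- 1 / min (1 - \<beta>) \<beta>)) \<and>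
    (\<beta> = 1 / 2 \<longrightarrow> (\<lambda>\<epsilon>. real (hitting_time d \<epsilon>)) \<in> O[at_right 0](\<lambda>\<epsilon>. \<epsilon> powr (- 2)))"
proof -
  define p where "p = 1 / (1 - \<beta>)"
  have p: "p > 0" using \<beta> by (simp add: p_def)
  \<comment> \<open>Adding \<open>T1\<close> instead of taking a maximum keeps the rate applicable
    and the later estimate linear.\<close>
  define N where "N \<epsilon> = T1 + nat \<lceil>(C / \<epsilon>) powr p\<rceil>" for \<epsilon>
  have reach: "(INF \<tau>\<in>{0..2 * N \<epsilon>}. d \<tau>) \<le> \<epsilon>" if \<epsilon>: "\<epsilon> > 0" for \<epsilon>
  proof -
    obtain t where t: "t \<le> 2 * N \<epsilon>" "d t \<le> C * real (N \<epsilon>) powr (\<beta> - 1)"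
      using rate[of "N \<epsilon>"] by (auto simp: N_def)
    have N0: "real (N \<epsilon>) > 0" using T1 unfolding N_def by linarith
    have "(C / \<epsilon>) powr p \<le> real (N \<epsilon>)" unfolding N_def by linarith
    then have "((C / \<epsilon>) powr p) powr (1 - \<beta>) \<le> real (N \<epsilon>) powr (1 - \<beta>)"
      using \<beta> by (intro powr_mono2) auto
    then have "C / \<epsilon> \<le> real (N \<epsilon>) powr (1 - \<beta>)"
      using \<beta> C \<epsilon> by (simp add: powr_powr p_def)
    then have "C / \<epsilon> * real (N \<epsilon>) powr (\<beta> - 1)
        \<le> real (N \<epsilon>) powr (1 - \<beta>) * real (N \<epsilon>) powr (\<beta> - 1)"
      by (intro mult_right_mono) auto
    also have "\<dots> = 1" using N0 by (simp flip: powr_add)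
    finally have "C * real (N \<epsilon>) powr (\<beta> - 1) \<le> \<epsilon>" using \<epsilon> by (simp add: field_simps)
    with t have "d t \<le> \<epsilon>" by simp
    moreover have "(INF \<tau>\<in>{0..2 * N \<epsilon>}. d \<tau>) \<le> d t"
      using t by (intro cINF_lower) auto
    ultimately show ?thesis by simp
  qed
  have bound: "real (hitting_time d \<epsilon>) \<le> (2 * real T1 + 2 * C powr p + 2) * \<epsilon> powr (- p)"
    if \<epsilon>: "0 < \<epsilon>" "\<epsilon> < 1" for \<epsilon>
  proof -
    have "hitting_time d \<epsilon> \<le> 2 * N \<epsilon>" unfolding hitting_time_def
      by (rule Least_le) (rule reach[OF \<epsilon>(1)])
    then have "real (hitting_time d \<epsilon>) \<le> 2 * real (N \<epsilon>)" by linarith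
    also have "\<dots> \<le> 2 * (real T1 + ((C / \<epsilon>) powr p + 1))"
      unfolding N_def using powr_ge_zero[of "C / \<epsilon>" p] by (simp del: powr_ge_zero) linarith
    also have "(C / \<epsilon>) powr p = C powr p * \<epsilon> powr (- p)"
      using C \<epsilon> by (simp add: powr_divide powr_minus field_simps)
    also have "2 * (real T1 + (C powr p * \<epsilon> powr (- p) + 1))
        \<le> 2 * (real T1 * \<epsilon> powr (- p) + (C powr p * \<epsilon> powr (- p) + \<epsilon> powr (- p)))"
    proof -
      \<comment> \<open>Below \<open>\<epsilon> = 1\<close> the power is at least one, so additive
        constants are absorbed into its coefficient.\<close>
      have "1 powr (- p) \<le> \<epsilon> powr (- p)" using \<epsilon> p by (intro powr_mono2') auto
      then have "1 \<le> \<epsilon> powr (- p)" by simp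
      then show ?thesis by (intro mult_left_mono add_mono order_refl) (auto simp: mult_le_cancel_left1)
    qed
    finally show ?thesis by (simp add: algebra_simps)
  qed
  have big: "(\<lambda>\<epsilon>. real (hitting_time d \<epsilon>)) \<in> O[at_right 0](\<lambda>\<epsilon>. \<epsilon> powr (- p))"
  proof (rule bigoI)
    have "\<forall>\<^sub>F \<epsilon> in at_right 0. (\<epsilon>::real) \<in> {0<..<1}"
      by (rule eventually_at_right_real) simp
    then show "\<forall>\<^sub>F \<epsilon> in at_right 0. norm (real (hitting_time d \<epsilon>))
        \<le> (2 * real T1 + 2 * C powr p + 2) * norm (\<epsilon> powr (- p))"
      by eventually_elim (use bound in auto)
  qed
  have "min (1 - \<beta>) \<beta> = 1 - \<beta>" using \<beta> by simp
  then have e: "- 1 / min (1 - \<beta>) \<beta> = - p" by (simp add: p_def)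
  show ?thesis
  proof (intro conjI allI impI)
    show "\<exists>t. (INF \<tau>\<in>{0..t}. d \<tau>) \<le> \<epsilon>" if "\<epsilon> > 0" for \<epsilon> using reach[OF that] by blast
    show "(\<lambda>\<epsilon>. real (hitting_time d \<epsilon>)) \<in> O[at_right 0](\<lambda>\<epsilon>. \<epsilon> powr (- 1 / min (1 - \<beta>) \<beta>))"
      unfolding e by (rule big)
    assume "\<beta> = 1 / 2"
    then have "1 - \<beta> = 1 / 2" by simp
    then have "p = 2" unfolding p_def by (simp only:) simp
    with big show "(\<lambda>\<epsilon>. real (hitting_time d \<epsilon>)) \<in> O[at_right 0](\<lambda>\<epsilon>. \<epsilon> powr (- 2))" by simp
  qed
qed

section \<open>Integrals over composed kernels\<close>

text \<open>Integration against a composed kernel for unbounded integrands: finiteness of the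
  iterated integral of \<open>\<bar>f y\<bar>\<close> takes the place of boundedness. Everything
  reduces to nonnegative integrals of the positive and the negative part; the inner ones may be
  infinite on a null set.\<close>

lemma
  fixes f :: "'b \<Rightarrow> real"
  assumes f: "f \<in> borel_measurable K" and N: "N \<in> measurable M (subprob_algebra K)"
    and ne: "space M \<noteq> {}"
    and fin: "(\<integral>\<^sup>+x. \<integral>\<^sup>+y. ennreal \<bar>f y\<bar> \<partial>N x \<partial>M) < \<infinity>"
  shows integrable_bind_fin: "integrable (M \<bind> N) f"
    and integrable_integral_kernel: "integrable M (\<lambda>x. \<integral>y. f y \<partial>N x)"
    and integral_bind_fin: "(\<integral>y. f y \<partial>(M \<bind> N)) = (\<integral>x. \<integral>y. f y \<partial>N x \<partial>M)"
proof -
  note [measurable] = f N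
  have mN: "f \<in> borel_measurable (N x)" if "x \<in> space M" for x
    using subprob_measurableD(2)[OF N that] f by (simp cong: measurable_cong_sets)
  have mB: "f \<in> borel_measurable (M \<bind> N)"
  proof -
    have "sets (M \<bind> N) = sets K" using ne by (intro sets_bind subprob_measurableD(2)[OF N])
    then show ?thesis using f by (simp cong: measurable_cong_sets)
  qed
  have nn: "(\<integral>\<^sup>+y. g y \<partial>(M \<bind> N)) = (\<integral>\<^sup>+x. \<integral>\<^sup>+y. g y \<partial>N x \<partial>M)" if "g \<in> borel_measurable K" for g
    by (rule nn_integral_bind[OF that N])
  have mnn: "(\<lambda>x. \<integral>\<^sup>+y. g y \<partial>N x) \<in> borel_measurable M" if "g \<in> borel_measurable K" for g :: "'b \<Rightarrow> ennreal"
    using that N by (intro nn_integral_measurable_subprob_algebra2[where N=K]) auto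
  show I: "integrable (M \<bind> N) f"
    using fin by (intro integrableI_bounded mB) (simp add: nn)
  have fin_le: "(\<integral>\<^sup>+x. \<integral>\<^sup>+y. ennreal (s * f y) \<partial>N x \<partial>M) < \<infinity>" if "\<bar>s\<bar> = 1" for s
    using fin by (rule le_less_trans[rotated]) (intro nn_integral_mono ennreal_leI, use that in \<open>auto simp: abs_if split: if_splits\<close>)
  have AEfin: "AE x in M. (\<integral>\<^sup>+y. ennreal \<bar>f y\<bar> \<partial>N x) \<noteq> \<infinity>"
    using fin by (intro nn_integral_PInf_AE mnn) auto
  have AEint: "AE x in M. integrable (N x) f"
    using AEfin AE_space
  proof eventually_elim
    case (elim x) then show ?case
      by (intro integrableI_bounded mN) (auto simp: top.not_eq_extremum)
  qed
  \<comment> \<open>\<open>ennreal\<close> cuts off negative values, so the signs 1 and -1 select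
    the positive and the negative part. \<open>enn2real\<close> gives a harmless finite value on the
    null set where the inner integral is infinite.\<close>
  define P where "P s x = enn2real (\<integral>\<^sup>+y. ennreal (s * f y) \<partial>N x)" for s x
  have Pm: "P s \<in> borel_measurable M" for s unfolding P_def
    using mnn[of "\<lambda>y. ennreal (s * f y)"] f by measurable
  have Pint: "(\<integral>\<^sup>+x. ennreal (P s x) \<partial>M) = (\<integral>\<^sup>+x. \<integral>\<^sup>+y. ennreal (s * f y) \<partial>N x \<partial>M)" if "\<bar>s\<bar> = 1" for s
  proof (rule nn_integral_cong_AE)
    have "AE x in M. (\<integral>\<^sup>+y. ennreal (s * f y) \<partial>N x) \<noteq> \<infinity>"
      using fin_le[OF that] f by (intro nn_integral_PInf_AE mnn) auto
    then show "AE x in M. ennreal (P s x) = (\<integral>\<^sup>+y. ennreal (s * f y) \<partial>N x)"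
      by eventually_elim (auto simp: P_def top.not_eq_extremum)
  qed
  have P0: "P s x \<ge> 0" for s x by (simp add: P_def)
  have PI: "integrable M (P s)" if "\<bar>s\<bar> = 1" for s
    using Pint[OF that] fin_le[OF that] P0 by (intro integrableI_bounded Pm) simp
  have eq: "AE x in M. (\<integral>y. f y \<partial>N x) = P 1 x - P (-1) x"
    using AEint by eventually_elim (simp add: real_lebesgue_integral_def P_def)
  have m: "(\<lambda>x. \<integral>y. f y \<partial>N x) \<in> borel_measurable M"
    by (rule measurable_compose[OF N integral_measurable_subprob_algebra[OF f]])
  show "integrable M (\<lambda>x. \<integral>y. f y \<partial>N x)"
    using Bochner_Integration.integrable_diff[OF PI[of 1] PI[of "-1"]] eq m
    by (subst integrable_cong_AE[OF _ _ eq]) (auto intro: borel_measurable_diff Pm)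
  have "(\<integral>y. f y \<partial>(M \<bind> N)) = enn2real (\<integral>\<^sup>+x. ennreal (P 1 x) \<partial>M) - enn2real (\<integral>\<^sup>+x. ennreal (P (-1) x) \<partial>M)"
    using f by (subst real_lebesgue_integral_def[OF I]) (simp add: nn Pint)
  also have "\<dots> = (\<integral>x. P 1 x \<partial>M) - (\<integral>x. P (-1) x \<partial>M)"
    by (simp add: integral_eq_nn_integral P0 Pm)
  also have "\<dots> = (\<integral>x. P 1 x - P (-1) x \<partial>M)" by (simp add: PI)
  also have "\<dots> = (\<integral>x. \<integral>y. f y \<partial>N x \<partial>M)"
    by (rule integral_cong_AE[OF _ _ AE_symmetric[OF eq]]) (auto intro!: borel_measurable_diff Pm m)
  finally show "(\<integral>y. f y \<partial>(M \<bind> N)) = (\<integral>x. \<integral>y. f y \<partial>N x \<partial>M)" .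
qed

section \<open>Conditional laws\<close>

text \<open>The map \<open>\<omega> \<mapsto> \<kappa> \<omega>\<close> is not assumed to be measurable, so the integrals over \<open>\<kappa> \<omega>\<close> are
  represented by a version \<open>\<Phi>\<close> that is measurable with respect to \<open>F\<close>.\<close>

lemma cond_law_nn_integral:
  fixes f :: "'b::topological_space \<Rightarrow> ennreal"
  assumes M: "prob_space M" and F: "subalgebra M F" and X: "has_cond_law M F X \<kappa>"
    and \<kappa>: "\<And>\<omega>. \<omega> \<in> space M \<Longrightarrow> prob_space (\<kappa> \<omega>)" "\<And>\<omega>. \<omega> \<in> space M \<Longrightarrow> sets (\<kappa> \<omega>) = sets borel"
    and f: "f \<in> borel_measurable borel"
  shows "\<exists>\<Phi>\<in>borel_measurable F. (AE \<omega> in M. \<Phi> \<omega> = (\<integral>\<^sup>+y. f y \<partial>\<kappa> \<omega>)) \<and>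
    (\<forall>A\<in>sets F. (\<integral>\<^sup>+\<omega>. f (X \<omega>) * indicator A \<omega> \<partial>M) = (\<integral>\<^sup>+\<omega>. \<Phi> \<omega> * indicator A \<omega> \<partial>M))"
  using f
proof (induction f rule: borel_measurable_induct)
  interpret prob_space M by fact
  interpret sigma_finite_subalgebra M F
    by (intro finite_measure_subalgebra_is_sigma_finite finite_measure_subalgebra.intro F
        finite_measure_subalgebra_axioms.intro) unfold_locales
  have Xm[measurable]: "X \<in> borel_measurable M" using X by (simp add: has_cond_law_def)
  have FM: "A \<in> sets F \<Longrightarrow> A \<in> sets M" for A using F by (auto simp: subalgebra_def)
  have \<kappa>m: "u \<in> borel_measurable (\<kappa> \<omega>)" if "\<omega> \<in> space M" "u \<in> borel_measurable borel"
    for u :: "'b \<Rightarrow> ennreal" and \<omega>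
    using that \<kappa>(2) by (simp cong: measurable_cong_sets)
  {
    case (cong u v)
    then have "v = u" by (simp add: fun_eq_iff)
    with cong(4) show ?case by simp
  next
    case (set B)
    define e where "e = real_cond_exp M F (indicator (X -` B \<inter> space M))"
    have eF[measurable]: "e \<in> borel_measurable F" by (simp add: e_def)
    have XB[measurable]: "X -` B \<inter> space M \<in> sets M" using set by measurable
    have ae: "AE \<omega> in M. e \<omega> = measure (\<kappa> \<omega>) B" using X set by (simp add: has_cond_law_def e_def)
    have intB: "integrable M (indicator (X -` B \<inter> space M) :: _ \<Rightarrow> real)" by (simp add: emeasure_eq_measure)
    show ?case
    proof (intro bexI[of _ "\<lambda>\<omega>. ennreal (e \<omega>)"] conjI ballI)
      show "AE \<omega> in M. ennreal (e \<omega>) = (\<integral>\<^sup>+y. indicator B y \<partial>\<kappa> \<omega>)"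
        using ae AE_space
      proof eventually_elim
        case (elim \<omega>)
        interpret k: prob_space "\<kappa> \<omega>" using elim \<kappa> by blast
        show ?case using elim set \<kappa> by (simp add: k.emeasure_eq_measure)
      qed
      fix A assume A: "A \<in> sets F"
      note [measurable] = FM[OF A]
      have e0: "AE \<omega> in M. 0 \<le> e \<omega>" using ae by eventually_elim auto
      have [measurable]: "e \<in> borel_measurable M" by (rule measurable_from_subalg[OF F eF])
      have Ie: "integrable M (\<lambda>\<omega>. e \<omega> * indicator A \<omega>)"
        using real_cond_exp_int(1)[OF intB] by (intro integrable_real_mult_indicator) (auto simp: e_def)
      have "(\<integral>\<^sup>+\<omega>. indicator B (X \<omega>) * indicator A \<omega> \<partial>M)
          = (\<integral>\<^sup>+\<omega>. ennreal (indicator A \<omega> * indicator (X -` B \<inter> space M) \<omega>) \<partial>M)"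
        by (intro nn_integral_cong) (auto split: split_indicator)
      also have "\<dots> = ennreal (\<integral>\<omega>. indicator A \<omega> * indicator (X -` B \<inter> space M) \<omega> \<partial>M)"
        by (intro nn_integral_eq_integral integrable_mult_indicator[of _ _ "indicator (X -` B \<inter> space M) :: _ \<Rightarrow> real", simplified] intB) auto
      also have "(\<integral>\<omega>. indicator A \<omega> * indicator (X -` B \<inter> space M) \<omega> \<partial>M) = (\<integral>\<omega>. e \<omega> * indicator A \<omega> \<partial>M)"
        using real_cond_exp_intA[OF intB A] unfolding e_def set_lebesgue_integral_def by (simp add: mult.commute)
      also have "ennreal \<dots> = (\<integral>\<^sup>+\<omega>. ennreal (e \<omega> * indicator A \<omega>) \<partial>M)"
        using e0 by (intro nn_integral_eq_integral[symmetric] Ie) (auto split: split_indicator)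
      also have "\<dots> = (\<integral>\<^sup>+\<omega>. ennreal (e \<omega>) * indicator A \<omega> \<partial>M)"
        by (intro nn_integral_cong) (auto split: split_indicator)
      finally show "(\<integral>\<^sup>+\<omega>. indicator B (X \<omega>) * indicator A \<omega> \<partial>M) = (\<integral>\<^sup>+\<omega>. ennreal (e \<omega>) * indicator A \<omega> \<partial>M)" .
    qed measurable
  next
    case (mult u c)
    then obtain \<Phi> where \<Phi>[measurable]: "\<Phi> \<in> borel_measurable F" and ae: "AE \<omega> in M. \<Phi> \<omega> = (\<integral>\<^sup>+y. u y \<partial>\<kappa> \<omega>)"
      and A: "\<And>A. A \<in> sets F \<Longrightarrow> (\<integral>\<^sup>+\<omega>. u (X \<omega>) * indicator A \<omega> \<partial>M) = (\<integral>\<^sup>+\<omega>. \<Phi> \<omega> * indicator A \<omega> \<partial>M)" by blast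
    have [measurable]: "\<Phi> \<in> borel_measurable M" by (rule measurable_from_subalg[OF F \<Phi>])
    note [measurable] = mult(2)
    show ?case
    proof (intro bexI[of _ "\<lambda>\<omega>. c * \<Phi> \<omega>"] conjI ballI)
      show "AE \<omega> in M. c * \<Phi> \<omega> = (\<integral>\<^sup>+y. c * u y \<partial>\<kappa> \<omega>)"
        using ae AE_space by eventually_elim (simp add: nn_integral_cmult \<kappa>m mult)
      show "(\<integral>\<^sup>+\<omega>. c * u (X \<omega>) * indicator S \<omega> \<partial>M) = (\<integral>\<^sup>+\<omega>. c * \<Phi> \<omega> * indicator S \<omega> \<partial>M)" if S: "S \<in> sets F" for S
      proof -
        note [measurable] = FM[OF S]
        show ?thesis using A[OF S] by (simp add: mult.assoc nn_integral_cmult)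
      qed
    qed measurable
  next
    case (add u v)
    then obtain \<Phi> where \<Phi>[measurable]: "\<Phi> \<in> borel_measurable F" and ae: "AE \<omega> in M. \<Phi> \<omega> = (\<integral>\<^sup>+y. u y \<partial>\<kappa> \<omega>)"
      and A: "\<And>A. A \<in> sets F \<Longrightarrow> (\<integral>\<^sup>+\<omega>. u (X \<omega>) * indicator A \<omega> \<partial>M) = (\<integral>\<^sup>+\<omega>. \<Phi> \<omega> * indicator A \<omega> \<partial>M)" by blast
    from add obtain \<Psi> where \<Psi>[measurable]: "\<Psi> \<in> borel_measurable F" and ae': "AE \<omega> in M. \<Psi> \<omega> = (\<integral>\<^sup>+y. v y \<partial>\<kappa> \<omega>)"
      and A': "\<And>A. A \<in> sets F \<Longrightarrow> (\<integral>\<^sup>+\<omega>. v (X \<omega>) * indicator A \<omega> \<partial>M) = (\<integral>\<^sup>+\<omega>. \<Psi> \<omega> * indicator A \<omega> \<partial>M)" by blast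
    have [measurable]: "\<Phi> \<in> borel_measurable M" "\<Psi> \<in> borel_measurable M"
      by (rule measurable_from_subalg[OF F \<Phi>] measurable_from_subalg[OF F \<Psi>])+
    have uv[measurable]: "u \<in> borel_measurable borel" "v \<in> borel_measurable borel" using add by auto
    show ?case
    proof (intro bexI[of _ "\<lambda>\<omega>. \<Psi> \<omega> + \<Phi> \<omega>"] conjI ballI)
      show "AE \<omega> in M. \<Psi> \<omega> + \<Phi> \<omega> = (\<integral>\<^sup>+y. v y + u y \<partial>\<kappa> \<omega>)"
        using ae ae' AE_space by eventually_elim (simp add: nn_integral_add \<kappa>m uv)
      show "(\<integral>\<^sup>+\<omega>. (v (X \<omega>) + u (X \<omega>)) * indicator S \<omega> \<partial>M) = (\<integral>\<^sup>+\<omega>. (\<Psi> \<omega> + \<Phi> \<omega>) * indicator S \<omega> \<partial>M)"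
        if S: "S \<in> sets F" for S
      proof -
        note [measurable] = FM[OF S]
        show ?thesis using A[OF S] A'[OF S] by (simp add: distrib_right nn_integral_add)
      qed
    qed measurable
  next
    case (seq U)
    define Q where "Q i \<Phi> \<longleftrightarrow> (AE \<omega> in M. \<Phi> \<omega> = (\<integral>\<^sup>+y. U i y \<partial>\<kappa> \<omega>)) \<and>
      (\<forall>A\<in>sets F. (\<integral>\<^sup>+\<omega>. U i (X \<omega>) * indicator A \<omega> \<partial>M) = (\<integral>\<^sup>+\<omega>. \<Phi> \<omega> * indicator A \<omega> \<partial>M))" for i \<Phi>
    have "\<forall>i. \<exists>\<Phi>\<in>borel_measurable F. Q i \<Phi>" unfolding Q_def using seq.IH by (intro allI)
    then obtain \<Phi> where "\<forall>i. \<Phi> i \<in> borel_measurable F \<and> Q i (\<Phi> i)" unfolding Bex_def by (elim choice[THEN exE])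
    then have \<Phi>[measurable]: "\<And>i. \<Phi> i \<in> borel_measurable F" and QQ: "\<And>i. Q i (\<Phi> i)" by simp_all
    have ae: "\<And>i. AE \<omega> in M. \<Phi> i \<omega> = (\<integral>\<^sup>+y. U i y \<partial>\<kappa> \<omega>)"
      and A: "\<And>i A. A \<in> sets F \<Longrightarrow> (\<integral>\<^sup>+\<omega>. U i (X \<omega>) * indicator A \<omega> \<partial>M) = (\<integral>\<^sup>+\<omega>. \<Phi> i \<omega> * indicator A \<omega> \<partial>M)"
      using QQ unfolding Q_def by simp_all
    have [measurable]: "\<Phi> i \<in> borel_measurable M" for i by (rule measurable_from_subalg[OF F \<Phi>])
    note [measurable] = seq.hyps(1)
    have ae_all: "AE \<omega> in M. \<forall>i. \<Phi> i \<omega> = (\<integral>\<^sup>+y. U i y \<partial>\<kappa> \<omega>)" using ae by (simp add: AE_all_countable)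
    show ?case
    proof (intro bexI[of _ "\<lambda>\<omega>. SUP i. \<Phi> i \<omega>"] conjI ballI)
      show "AE \<omega> in M. (SUP i. \<Phi> i \<omega>) = (\<integral>\<^sup>+y. (SUP i. U i) y \<partial>\<kappa> \<omega>)"
        using ae_all AE_space
      proof eventually_elim
        case (elim \<omega>)
        have "(\<integral>\<^sup>+y. (SUP i. U i y) \<partial>\<kappa> \<omega>) = (SUP i. \<integral>\<^sup>+y. U i y \<partial>\<kappa> \<omega>)"
          by (rule nn_integral_monotone_convergence_SUP[OF seq.hyps(3)]) (rule \<kappa>m[OF elim(2) seq.hyps(1)])
        with elim show ?case by (simp only: SUP_apply)
      qed
      fix S assume S: "S \<in> sets F"
      note [measurable] = FM[OF S]
      have "(\<integral>\<^sup>+\<omega>. (SUP i. U i) (X \<omega>) * indicator S \<omega> \<partial>M) = (\<integral>\<^sup>+\<omega>. (SUP i. U i (X \<omega>) * indicator S \<omega>) \<partial>M)"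
        by (simp only: SUP_apply SUP_mult_right_ennreal)
      also have "\<dots> = (SUP i. \<integral>\<^sup>+\<omega>. U i (X \<omega>) * indicator S \<omega> \<partial>M)"
      proof (rule nn_integral_monotone_convergence_SUP)
        show "incseq (\<lambda>i \<omega>. U i (X \<omega>) * indicator S \<omega>)"
          using seq.hyps(3) unfolding incseq_def le_fun_def by (blast intro: mult_right_mono zero_le)
      qed measurable
      also have "\<dots> = (SUP i. \<integral>\<^sup>+\<omega>. \<Phi> i \<omega> * indicator S \<omega> \<partial>M)" by (simp add: A[OF S])
      also have "\<dots> = (\<integral>\<^sup>+\<omega>. (SUP i. \<Phi> i \<omega> * indicator S \<omega>) \<partial>M)"
      \<comment> \<open>The chosen versions agree with the monotone integrals only outside null
        sets, so they increase only almost surely.\<close>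
      proof (rule nn_integral_monotone_convergence_SUP_AE[symmetric])
        fix i
        show "AE \<omega> in M. \<Phi> i \<omega> * indicator S \<omega> \<le> \<Phi> (Suc i) \<omega> * indicator S \<omega>"
          using ae[of i] ae[of "Suc i"]
        proof eventually_elim
          case (elim \<omega>)
          have "U i y \<le> U (Suc i) y" for y using seq.hyps(3) by (simp add: incseq_Suc_iff le_fun_def)
          then show ?case unfolding elim by (intro mult_right_mono nn_integral_mono) auto
        qed
      qed measurable
      also have "\<dots> = (\<integral>\<^sup>+\<omega>. (SUP i. \<Phi> i \<omega>) * indicator S \<omega> \<partial>M)"
        by (simp only: SUP_mult_right_ennreal)
      finally show "(\<integral>\<^sup>+\<omega>. (SUP i. U i) (X \<omega>) * indicator S \<omega> \<partial>M) = (\<integral>\<^sup>+\<omega>. (SUP i. \<Phi> i \<omega>) * indicator S \<omega> \<partial>M)" .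
    qed measurable
  }
qed

text \<open>Testing the conditional law on the whole space gives an unconditional bound. In this way
  a moment bound valid for every parameter passes to the gradients actually sampled.\<close>

lemma cond_law_nn_integral_le:
  fixes f :: "'b::topological_space \<Rightarrow> ennreal"
  assumes M: "prob_space M" and F: "subalgebra M F" and X: "has_cond_law M F X \<kappa>"
    and \<kappa>: "\<And>\<omega>. \<omega> \<in> space M \<Longrightarrow> prob_space (\<kappa> \<omega>)" "\<And>\<omega>. \<omega> \<in> space M \<Longrightarrow> sets (\<kappa> \<omega>) = sets borel"
    and f: "f \<in> borel_measurable borel" and le: "\<And>\<omega>. \<omega> \<in> space M \<Longrightarrow> (\<integral>\<^sup>+y. f y \<partial>\<kappa> \<omega>) \<le> c"
  shows "(\<integral>\<^sup>+\<omega>. f (X \<omega>) \<partial>M) \<le> c"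
proof -
  interpret prob_space M by fact
  from cond_law_nn_integral[OF M F X \<kappa> f] obtain \<Phi> where
    ae: "AE \<omega> in M. \<Phi> \<omega> = (\<integral>\<^sup>+y. f y \<partial>\<kappa> \<omega>)"
    and A: "\<forall>A\<in>sets F. (\<integral>\<^sup>+\<omega>. f (X \<omega>) * indicator A \<omega> \<partial>M) = (\<integral>\<^sup>+\<omega>. \<Phi> \<omega> * indicator A \<omega> \<partial>M)" by blast
  have sp: "space M \<in> sets F" using F by (metis sets.top subalgebra_def)
  have "(\<integral>\<^sup>+\<omega>. f (X \<omega>) \<partial>M) = (\<integral>\<^sup>+\<omega>. f (X \<omega>) * indicator (space M) \<omega> \<partial>M)"
    by (intro nn_integral_cong) auto
  also have "\<dots> = (\<integral>\<^sup>+\<omega>. \<Phi> \<omega> * indicator (space M) \<omega> \<partial>M)" using A sp by blast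
  also have "\<dots> \<le> (\<integral>\<^sup>+\<omega>. c \<partial>M)"
    using ae AE_space by (intro nn_integral_mono_AE, eventually_elim) (simp add: le)
  finally show ?thesis by (simp add: emeasure_space_1)
qed

text \<open>The tower property with a bounded factor \<open>Y\<close> known at the time of
  conditioning. The conditional expectation of \<open>f (X \<omega>)\<close> is identified with
  \<open>m\<close> by testing on sets of \<open>F\<close>, and \<open>Y\<close> is then pulled
  out.\<close>

lemma cond_law_integral:
  fixes f :: "'b::topological_space \<Rightarrow> real"
  assumes M: "prob_space M" and F: "subalgebra M F" and X: "has_cond_law M F X \<kappa>"
    and \<kappa>: "\<And>\<omega>. \<omega> \<in> space M \<Longrightarrow> prob_space (\<kappa> \<omega>)" "\<And>\<omega>. \<omega> \<in> space M \<Longrightarrow> sets (\<kappa> \<omega>) = sets borel"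
    and f: "f \<in> borel_measurable borel"
    and le: "\<And>\<omega>. \<omega> \<in> space M \<Longrightarrow> (\<integral>\<^sup>+y. ennreal \<bar>f y\<bar> \<partial>\<kappa> \<omega>) \<le> ennreal c"
    and m: "m \<in> borel_measurable F" "\<And>\<omega>. \<omega> \<in> space M \<Longrightarrow> (\<integral>y. f y \<partial>\<kappa> \<omega>) = m \<omega>"
    and Y: "Y \<in> borel_measurable F" "\<And>\<omega>. \<omega> \<in> space M \<Longrightarrow> \<bar>Y \<omega>\<bar> \<le> b"
  shows "integrable M (\<lambda>\<omega>. f (X \<omega>))" "integrable M m" "(\<integral>\<omega>. Y \<omega> * f (X \<omega>) \<partial>M) = (\<integral>\<omega>. Y \<omega> * m \<omega> \<partial>M)"
proof -
  interpret prob_space M by fact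
  interpret sigma_finite_subalgebra M F
    by (intro finite_measure_subalgebra_is_sigma_finite finite_measure_subalgebra.intro F
        finite_measure_subalgebra_axioms.intro) unfold_locales
  have Xm[measurable]: "X \<in> borel_measurable M" using X by (simp add: has_cond_law_def)
  note [measurable] = f
  have [measurable]: "m \<in> borel_measurable M" "Y \<in> borel_measurable M"
    by (rule measurable_from_subalg[OF F m(1)] measurable_from_subalg[OF F Y(1)])+
  have fX[measurable]: "(\<lambda>\<omega>. f (X \<omega>)) \<in> borel_measurable M" by measurable
  have fin: "(\<integral>\<^sup>+\<omega>. ennreal \<bar>f (X \<omega>)\<bar> \<partial>M) \<le> ennreal c"
    by (rule cond_law_nn_integral_le[OF M F X \<kappa>]) (auto intro: le)
  then show I: "integrable M (\<lambda>\<omega>. f (X \<omega>))"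
    by (intro integrableI_bounded) (auto intro: le_less_trans)
  have \<kappa>I: "integrable (\<kappa> \<omega>) f" if "\<omega> \<in> space M" for \<omega>
    using le[OF that] f \<kappa>(2)[OF that]
    by (intro integrableI_bounded) (auto intro: le_less_trans cong: measurable_cong_sets)
  have mb: "AE \<omega> in M. norm (m \<omega>) \<le> max c 0"
  proof (rule AE_I2)
    fix \<omega> assume w: "\<omega> \<in> space M"
    have "ennreal (norm (m \<omega>)) \<le> (\<integral>\<^sup>+y. ennreal (norm (f y)) \<partial>\<kappa> \<omega>)"
      unfolding m(2)[OF w, symmetric] by (rule integral_norm_bound_ennreal[OF \<kappa>I[OF w]])
    also have "\<dots> \<le> ennreal c" using le[OF w] by simp
    finally show "norm (m \<omega>) \<le> max c 0" by (cases "c \<ge> 0") (auto simp: ennreal_neg)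
  qed
  show mI: "integrable M m" by (rule integrable_const_bound[OF mb]) measurable
  have "(\<integral>\<omega>. f (X \<omega>) * indicator A \<omega> \<partial>M) = (\<integral>\<omega>. m \<omega> * indicator A \<omega> \<partial>M)" if A: "A \<in> sets F" for A
  proof -
    have Am[measurable]: "A \<in> sets M" using A F by (auto simp: subalgebra_def)
    \<comment> \<open>The signs 1 and -1 treat the positive and the negative part separately, each
      with its own integrable version; their difference represents \<open>m\<close>.\<close>
    have "\<exists>P. integrable M P \<and> (AE \<omega> in M. P \<omega> = enn2real (\<integral>\<^sup>+y. ennreal (s * f y) \<partial>\<kappa> \<omega>)) \<and>
        enn2real (\<integral>\<^sup>+\<omega>. ennreal (s * f (X \<omega>)) * indicator A \<omega> \<partial>M) = (\<integral>\<omega>. P \<omega> * indicator A \<omega> \<partial>M)"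
      if s: "\<bar>s\<bar> = 1" for s
    proof -
      have fs: "(\<lambda>y. ennreal (s * f y)) \<in> borel_measurable borel" by measurable
      from cond_law_nn_integral[OF M F X \<kappa> fs] obtain \<Phi> where
        \<Phi>: "\<Phi> \<in> borel_measurable F" and ae: "AE \<omega> in M. \<Phi> \<omega> = (\<integral>\<^sup>+y. ennreal (s * f y) \<partial>\<kappa> \<omega>)"
        and AA: "\<forall>A\<in>sets F. (\<integral>\<^sup>+\<omega>. ennreal (s * f (X \<omega>)) * indicator A \<omega> \<partial>M) = (\<integral>\<^sup>+\<omega>. \<Phi> \<omega> * indicator A \<omega> \<partial>M)" by blast
      have [measurable]: "\<Phi> \<in> borel_measurable M" by (rule measurable_from_subalg[OF F \<Phi>])
      have ae2: "AE \<omega> in M. \<Phi> \<omega> \<le> ennreal c" using ae AE_space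
      proof eventually_elim
        case (elim \<omega>)
        have "\<Phi> \<omega> \<le> (\<integral>\<^sup>+y. ennreal \<bar>f y\<bar> \<partial>\<kappa> \<omega>)"
          unfolding elim(1) using s by (intro nn_integral_mono ennreal_leI) (auto simp: abs_if split: if_splits)
        then show ?case using le elim(2) order_trans by blast
      qed
      define P where "P \<omega> = enn2real (\<Phi> \<omega>)" for \<omega>
      have [measurable]: "P \<in> borel_measurable M" unfolding P_def by measurable
      have PI: "integrable M P"
      proof (rule integrable_const_bound)
        show "AE \<omega> in M. norm (P \<omega>) \<le> max c 0" using ae2
          by eventually_elim (auto simp: P_def enn2real_leI ennreal_max_0' intro!: enn2real_leI intro: order_trans ennreal_leI)
      qed measurable
      have eqP: "AE \<omega> in M. ennreal (P \<omega>) = \<Phi> \<omega>" using ae2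
        by eventually_elim (simp add: P_def le_less_trans[OF _ ennreal_less_top])
      have "(\<integral>\<^sup>+\<omega>. \<Phi> \<omega> * indicator A \<omega> \<partial>M) = (\<integral>\<^sup>+\<omega>. ennreal (P \<omega> * indicator A \<omega>) \<partial>M)"
        using eqP by (intro nn_integral_cong_AE, eventually_elim) (auto split: split_indicator)
      also have "enn2real \<dots> = (\<integral>\<omega>. P \<omega> * indicator A \<omega> \<partial>M)"
        by (rule integral_eq_nn_integral[symmetric]) (auto simp: P_def)
      finally have "enn2real (\<integral>\<^sup>+\<omega>. ennreal (s * f (X \<omega>)) * indicator A \<omega> \<partial>M) = (\<integral>\<omega>. P \<omega> * indicator A \<omega> \<partial>M)"
        using AA A by simp
      moreover have "AE \<omega> in M. P \<omega> = enn2real (\<integral>\<^sup>+y. ennreal (s * f y) \<partial>\<kappa> \<omega>)"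
        using ae by eventually_elim (simp add: P_def)
      ultimately show ?thesis using PI by blast
    qed
    from this[of 1] this[of "-1"] obtain P Q where
      P: "integrable M P" "AE \<omega> in M. P \<omega> = enn2real (\<integral>\<^sup>+y. ennreal (f y) \<partial>\<kappa> \<omega>)"
        "enn2real (\<integral>\<^sup>+\<omega>. ennreal (f (X \<omega>)) * indicator A \<omega> \<partial>M) = (\<integral>\<omega>. P \<omega> * indicator A \<omega> \<partial>M)" and
      Q: "integrable M Q" "AE \<omega> in M. Q \<omega> = enn2real (\<integral>\<^sup>+y. ennreal (- f y) \<partial>\<kappa> \<omega>)"
        "enn2real (\<integral>\<^sup>+\<omega>. ennreal (- f (X \<omega>)) * indicator A \<omega> \<partial>M) = (\<integral>\<omega>. Q \<omega> * indicator A \<omega> \<partial>M)" by auto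
    have mPQ: "AE \<omega> in M. m \<omega> = P \<omega> - Q \<omega>" using P(2) Q(2) AE_space
      by eventually_elim (simp add: m(2)[symmetric] real_lebesgue_integral_def \<kappa>I)
    have "(\<integral>\<omega>. f (X \<omega>) * indicator A \<omega> \<partial>M)
        = enn2real (\<integral>\<^sup>+\<omega>. ennreal (f (X \<omega>) * indicator A \<omega>) \<partial>M) - enn2real (\<integral>\<^sup>+\<omega>. ennreal (- (f (X \<omega>) * indicator A \<omega>)) \<partial>M)"
      by (intro real_lebesgue_integral_def integrable_real_mult_indicator I) measurable
    also have "(\<integral>\<^sup>+\<omega>. ennreal (f (X \<omega>) * indicator A \<omega>) \<partial>M) = (\<integral>\<^sup>+\<omega>. ennreal (f (X \<omega>)) * indicator A \<omega> \<partial>M)"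
      by (intro nn_integral_cong) (auto split: split_indicator)
    also have "(\<integral>\<^sup>+\<omega>. ennreal (- (f (X \<omega>) * indicator A \<omega>)) \<partial>M) = (\<integral>\<^sup>+\<omega>. ennreal (- f (X \<omega>)) * indicator A \<omega> \<partial>M)"
      by (intro nn_integral_cong) (auto split: split_indicator)
    also have "enn2real (\<integral>\<^sup>+\<omega>. ennreal (f (X \<omega>)) * indicator A \<omega> \<partial>M) - enn2real (\<integral>\<^sup>+\<omega>. ennreal (- f (X \<omega>)) * indicator A \<omega> \<partial>M)
        = (\<integral>\<omega>. P \<omega> * indicator A \<omega> - Q \<omega> * indicator A \<omega> \<partial>M)"
      unfolding P(3) Q(3) by (intro Bochner_Integration.integral_diff[symmetric] integrable_real_mult_indicator P(1) Q(1)) auto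
    also have "\<dots> = (\<integral>\<omega>. m \<omega> * indicator A \<omega> \<partial>M)"
      using P(1) Q(1) mPQ
      by (intro integral_cong_AE) (auto split: split_indicator)
    finally show ?thesis .
  qed
  then have "AE \<omega> in M. real_cond_exp M F (\<lambda>\<omega>. f (X \<omega>)) \<omega> = m \<omega>"
    by (intro real_cond_exp_charact I mI m(1)) (simp add: set_lebesgue_integral_def mult.commute)
  moreover have "(\<integral>\<omega>. Y \<omega> * f (X \<omega>) \<partial>M) = (\<integral>\<omega>. Y \<omega> * real_cond_exp M F (\<lambda>\<omega>. f (X \<omega>)) \<omega> \<partial>M)"
  proof (rule real_cond_exp_intg(2)[symmetric, OF _ Y(1) fX])
    show "integrable M (\<lambda>\<omega>. Y \<omega> * f (X \<omega>))"
    proof (rule Bochner_Integration.integrable_bound)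
      show "integrable M (\<lambda>\<omega>. b * f (X \<omega>))" using I by simp
      show "AE \<omega> in M. norm (Y \<omega> * f (X \<omega>)) \<le> norm (b * f (X \<omega>))"
        using Y(2) by (intro AE_I2) (force simp: abs_mult intro!: mult_right_mono)
    qed measurable
  qed
  ultimately show "(\<integral>\<omega>. Y \<omega> * f (X \<omega>) \<partial>M) = (\<integral>\<omega>. Y \<omega> * m \<omega> \<partial>M)"
    by (simp add: mult.commute) (intro integral_cong_AE, auto)
qed

section \<open>Resolvents of Markov kernels\<close>

definition kop :: "('s \<Rightarrow> 's measure) \<Rightarrow> ('s \<Rightarrow> real) \<Rightarrow> 's \<Rightarrow> real" where
  "kop K g s = (\<integral>x. g x \<partial>K s)"

text \<open>The Neumann series of the inverse of \<open>1 - \<gamma> K\<close> on bounded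
  functions.\<close>

definition resolvent :: "real \<Rightarrow> ('s \<Rightarrow> 's measure) \<Rightarrow> ('s \<Rightarrow> real) \<Rightarrow> 's \<Rightarrow> real" where
  "resolvent \<gamma> K g s = (\<Sum>t. \<gamma> ^ t * (kop K ^^ t) g s)"

lemma kernel_integrable:
  fixes g :: "'b \<Rightarrow> real"
  assumes "prob_space N" "sets N = sets S" "g \<in> borel_measurable S" "\<And>s. s \<in> space S \<Longrightarrow> \<bar>g s\<bar> \<le> b"
  shows "integrable N g" "\<bar>\<integral>x. g x \<partial>N\<bar> \<le> b"
proof -
  interpret prob_space N by fact
  have sp: "space N = space S" using assms(2) sets_eq_imp_space_eq by blast
  show I: "integrable N g"
    using assms sp by (intro integrable_const_bound[of _ b]) (auto cong: measurable_cong_sets)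
  have "\<bar>\<integral>x. g x \<partial>N\<bar> \<le> (\<integral>x. \<bar>g x\<bar> \<partial>N)" by (rule integral_abs_bound)
  also have "\<dots> \<le> (\<integral>x. b \<partial>N)" using I assms(4) sp by (intro integral_mono) auto
  finally show "\<bar>\<integral>x. g x \<partial>N\<bar> \<le> b" by (simp add: prob_space)
qed

lemma kop_measurable [measurable]:
  fixes g :: "'b \<Rightarrow> real"
  assumes "K \<in> S \<rightarrow>\<^sub>M prob_algebra N" "g \<in> borel_measurable N"
  shows "(\<lambda>s. \<integral>x. g x \<partial>K s) \<in> borel_measurable S"
  by (rule measurable_compose[OF measurable_prob_algebraD[OF assms(1)]
      integral_measurable_subprob_algebra[OF assms(2)]])

lemma prob_kernelD:
  assumes "K \<in> S \<rightarrow>\<^sub>M prob_algebra N" "s \<in> space S"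
  shows "prob_space (K s)" "sets (K s) = sets N" "space (K s) = space N"
proof -
  have "K s \<in> space (prob_algebra N)" using assms by (rule measurable_space)
  then show "prob_space (K s)" "sets (K s) = sets N" by (auto simp: space_prob_algebra)
  then show "space (K s) = space N" using sets_eq_imp_space_eq by blast
qed

lemma kop_iterate:
  assumes K: "K \<in> S \<rightarrow>\<^sub>M prob_algebra S" and g: "g \<in> borel_measurable S"
    and b: "\<And>s. s \<in> space S \<Longrightarrow> \<bar>g s\<bar> \<le> b"
  shows "(kop K ^^ t) g \<in> borel_measurable S \<and> (\<forall>s\<in>space S. \<bar>(kop K ^^ t) g s\<bar> \<le> b)"
proof (induction t)
  case (Suc t)
  have "kop K ((kop K ^^ t) g) = (\<lambda>s. \<integral>x. (kop K ^^ t) g x \<partial>K s)" by (simp add: kop_def fun_eq_iff)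
  moreover have "\<dots> \<in> borel_measurable S" using K Suc by (intro kop_measurable) auto
  moreover have "\<bar>kop K ((kop K ^^ t) g) s\<bar> \<le> b" if "s \<in> space S" for s
    unfolding kop_def[of K "(kop K ^^ t) g"] using Suc prob_kernelD[OF K that] by (intro kernel_integrable(2)[where S=S]) auto
  ultimately show ?case by simp
qed (use g b in auto)

text \<open>A probability kernel preserves uniform bounds, so the series has a geometric majorant.
  The same majorant permits exchanging it with the integral, which yields the fixed-point
  equation.\<close>

lemma resolvent:
  assumes K: "K \<in> S \<rightarrow>\<^sub>M prob_algebra S" and g: "g \<in> borel_measurable S"
    and b: "\<And>s. s \<in> space S \<Longrightarrow> \<bar>g s\<bar> \<le> b" and \<gamma>: "0 < \<gamma>" "\<gamma> < 1"
  shows resolvent_measurable: "resolvent \<gamma> K g \<in> borel_measurable S"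
    and resolvent_bound: "\<And>s. s \<in> space S \<Longrightarrow> \<bar>resolvent \<gamma> K g s\<bar> \<le> b / (1 - \<gamma>)"
    and resolvent_summable: "\<And>s. s \<in> space S \<Longrightarrow> summable (\<lambda>t. \<gamma> ^ t * (kop K ^^ t) g s)"
    and resolvent_fixpoint: "\<And>s. s \<in> space S \<Longrightarrow> resolvent \<gamma> K g s = g s + \<gamma> * kop K (resolvent \<gamma> K g) s"
proof -
  note it = kop_iterate[OF K g b]
  have gs: "summable (\<lambda>t. \<gamma> ^ t * b)" using \<gamma> by (intro summable_mult2 summable_geometric) auto
  have le: "norm (\<gamma> ^ t * (kop K ^^ t) g s) \<le> \<gamma> ^ t * b" if "s \<in> space S" for t s
    using it[of t] that \<gamma> by (auto simp: abs_mult intro!: mult_left_mono)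
  show S: "summable (\<lambda>t. \<gamma> ^ t * (kop K ^^ t) g s)" if "s \<in> space S" for s
    by (rule summable_comparison_test'[OF gs le[OF that]])
  have [measurable]: "(kop K ^^ t) g \<in> borel_measurable S" for t using it by blast
  have e: "resolvent \<gamma> K g = (\<lambda>s. \<Sum>t. \<gamma> ^ t * (kop K ^^ t) g s)" by (simp add: resolvent_def fun_eq_iff)
  show M: "resolvent \<gamma> K g \<in> borel_measurable S" unfolding e by measurable
  show "\<bar>resolvent \<gamma> K g s\<bar> \<le> b / (1 - \<gamma>)" if "s \<in> space S" for s
  proof -
    have "norm (resolvent \<gamma> K g s) \<le> (\<Sum>t. \<gamma> ^ t * b)"
      unfolding resolvent_def using le[OF that] gs by (intro norm_suminf_le) auto
    also have "\<dots> = b / (1 - \<gamma>)" using \<gamma> by (simp add: suminf_mult2[symmetric] suminf_geometric)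
    finally show ?thesis by simp
  qed
  show "resolvent \<gamma> K g s = g s + \<gamma> * kop K (resolvent \<gamma> K g) s" if s: "s \<in> space S" for s
  proof -
    interpret prob_space "K s" by (rule prob_kernelD[OF K s])
    note sp = prob_kernelD[OF K s]
    have I: "integrable (K s) (\<lambda>x. \<gamma> ^ t * (kop K ^^ t) g x)" for t
      using it[of t] sp by (intro integrable_mult_right kernel_integrable(1)[where S=S]) auto
    define f where "f t x = \<gamma> ^ t * (kop K ^^ t) g x" for t x
    have fI: "integrable (K s) (f t)" for t using I[of t] by (simp add: f_def[abs_def])
    have fle: "norm (f t x) \<le> \<gamma> ^ t * b" if "x \<in> space (K s)" for t x
      using le[of x t] that sp(3) by (simp add: f_def)
    have "AE x in K s. summable (\<lambda>t. norm (f t x))"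
    proof (rule AE_I2)
      fix x assume "x \<in> space (K s)"
      then show "summable (\<lambda>t. norm (f t x))"
        using fle[of x] by (intro summable_comparison_test'[OF gs, of 0]) simp
    qed
    moreover have "summable (\<lambda>t. \<integral>x. norm (f t x) \<partial>K s)"
    proof (rule summable_comparison_test'[OF gs, of 0])
      fix t
      have "(\<integral>x. norm (f t x) \<partial>K s) \<le> (\<integral>x. \<gamma> ^ t * b \<partial>K s)"
        using fle by (intro integral_mono) (auto intro: fI)
      then show "norm (\<integral>x. norm (f t x) \<partial>K s) \<le> \<gamma> ^ t * b" by (simp add: prob_space)
    qed
    ultimately have "(\<integral>x. (\<Sum>t. f t x) \<partial>K s) = (\<Sum>t. \<integral>x. f t x \<partial>K s)"
      using integral_suminf[of "K s" f] fI by blast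
    then have kk: "kop K (resolvent \<gamma> K g) s = (\<Sum>t. \<gamma> ^ t * (kop K ^^ Suc t) g s)"
      unfolding kop_def[of K "resolvent \<gamma> K g"] resolvent_def by (simp add: kop_def f_def)
    then have "\<gamma> * kop K (resolvent \<gamma> K g) s = (\<Sum>t. \<gamma> ^ Suc t * (kop K ^^ Suc t) g s)"
    proof -
      have "summable (\<lambda>t. \<gamma> * (\<gamma> ^ t * (kop K ^^ Suc t) g s))"
        using S[OF s] summable_Suc_iff[of "\<lambda>t. \<gamma> ^ t * (kop K ^^ t) g s"] by (simp only: power_Suc mult.assoc)
      then have "summable (\<lambda>t. \<gamma> ^ t * (kop K ^^ Suc t) g s)" using \<gamma> by (simp add: summable_cmult_iff)
      from suminf_mult[OF this, of \<gamma>] show ?thesis using kk by (simp add: mult.assoc)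
    qed
    then show ?thesis
      unfolding resolvent_def[of \<gamma> K g s] using suminf_split_head[OF S[OF s]] by simp
  qed
qed

text \<open>Each application of the step multiplies the excess over
  \<open>c / (1 - \<gamma>)\<close> by \<open>\<gamma>\<close>. The bound \<open>B\<close> starts
  the iteration and disappears in the limit.\<close>

lemma contraction_bound:
  fixes e :: "'s \<Rightarrow> real"
  assumes e: "\<And>s. s \<in> A \<Longrightarrow> \<bar>e s\<bar> \<le> B"
    and step: "\<And>b s. (\<And>s. s \<in> A \<Longrightarrow> \<bar>e s\<bar> \<le> b) \<Longrightarrow> s \<in> A \<Longrightarrow> \<bar>e s\<bar> \<le> c + \<gamma> * b"
    and \<gamma>: "0 < \<gamma>" "\<gamma> < 1" and s: "s \<in> A"
  shows "\<bar>e s\<bar> \<le> c / (1 - \<gamma>)"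
proof -
  have "\<forall>s\<in>A. \<bar>e s\<bar> \<le> c / (1 - \<gamma>) + \<gamma> ^ n * (B + \<bar>c / (1 - \<gamma>)\<bar>)" for n
  proof (induction n)
    case 0
    show ?case
    proof
      fix s assume "s \<in> A"
      then show "\<bar>e s\<bar> \<le> c / (1 - \<gamma>) + \<gamma> ^ 0 * (B + \<bar>c / (1 - \<gamma>)\<bar>)"
        using e[of s] abs_ge_minus_self[of "c / (1 - \<gamma>)"] by simp
    qed
  next
    case (Suc n)
    show ?case
    proof
      fix s assume s: "s \<in> A"
      have "\<bar>e s\<bar> \<le> c + \<gamma> * (c / (1 - \<gamma>) + \<gamma> ^ n * (B + \<bar>c / (1 - \<gamma>)\<bar>))"
        using step[OF _ s] Suc by blast
      also have "\<dots> = c / (1 - \<gamma>) + \<gamma> ^ Suc n * (B + \<bar>c / (1 - \<gamma>)\<bar>)"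
      proof -
        have "c + \<gamma> * (c / (1 - \<gamma>)) = c / (1 - \<gamma>)" using \<gamma> by (simp add: field_simps)
        then show ?thesis by (simp add: distrib_left mult.assoc)
      qed
      finally show "\<bar>e s\<bar> \<le> c / (1 - \<gamma>) + \<gamma> ^ Suc n * (B + \<bar>c / (1 - \<gamma>)\<bar>)" .
    qed
  qed
  then have "\<bar>e s\<bar> \<le> c / (1 - \<gamma>) + \<gamma> ^ n * (B + \<bar>c / (1 - \<gamma>)\<bar>)" for n using s by blast
  moreover have "(\<lambda>n. c / (1 - \<gamma>) + \<gamma> ^ n * (B + \<bar>c / (1 - \<gamma>)\<bar>)) \<longlonglongrightarrow> c / (1 - \<gamma>) + 0 * (B + \<bar>c / (1 - \<gamma>)\<bar>)"
    using \<gamma> by (intro tendsto_intros LIMSEQ_realpow_zero) auto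
  ultimately show ?thesis by (intro LIMSEQ_le_const) auto
qed

section \<open>Trajectories of Markov games\<close>

locale markov =
  fixes G :: "('s, 'k::finite, 'n::finite, 'm::finite) game"
  assumes game: "markov_game G"
begin

abbreviation "S \<equiv> states G"
abbreviation "JA \<equiv> joint_actions G"
abbreviation "SA \<equiv> state_actions G"
abbreviation "\<gamma> \<equiv> discount G"

definition jpol :: "real ^ 'm \<Rightarrow> 's \<Rightarrow> ('n \<Rightarrow> real ^ 'k) \<Rightarrow> real" where
  "jpol \<theta> s a = (\<Prod>n\<in>UNIV. pol G n \<theta> s (a n))"

text \<open>With pairs instead of states the play is a homogeneous Markov chain that retains the
  action, at which the score is evaluated.\<close>

definition next_pair :: "real ^ 'm \<Rightarrow> 's \<times> ('n \<Rightarrow> real ^ 'k) \<Rightarrow> ('s \<times> ('n \<Rightarrow> real ^ 'k)) measure" where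
  "next_pair \<theta> x = transition G x \<bind> act_step G \<theta>"

lemma game_facts:
  shows sigma_finite_act: "sigma_finite_measure (act_ref G)"
    and transition_kernel: "transition G \<in> SA \<rightarrow>\<^sub>M prob_algebra S"
    and init_space: "init G \<in> space (prob_algebra S)"
    and reward_measurable: "reward G i \<in> borel_measurable SA"
    and discount: "0 < \<gamma>" "\<gamma> < 1"
    and pol_measurable: "(\<lambda>(s, a). pol G n \<theta> s a) \<in> borel_measurable (S \<Otimes>\<^sub>M act_ref G)"
    and pol_nonneg: "s \<in> space S \<Longrightarrow> b \<in> space (act_ref G) \<Longrightarrow> 0 \<le> pol G n \<theta> s b"
    and policy_prob: "s \<in> space S \<Longrightarrow> prob_space (policy G n \<theta> s)"
    and pol_differentiable: "s \<in> space S \<Longrightarrow> b \<in> space (act_ref G) \<Longrightarrow>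
        (\<lambda>\<theta>. pol G n \<theta> s b) differentiable (at \<theta>)"
  using game unfolding markov_game_def by auto

lemma product_sigma_finite_act: "product_sigma_finite (\<lambda>_::'n. act_ref G)"
  by (simp add: product_sigma_finite_def sigma_finite_act)

lemma space_JA: "space JA = {a. \<forall>n. a n \<in> space (act_ref G)}"
  by (auto simp: joint_actions_def space_PiM PiE_def Pi_def extensional_def)

lemma space_SA: "space SA = space S \<times> space JA"
  by (simp add: state_actions_def space_pair_measure)

lemma sigma_finite_JA: "sigma_finite_measure JA"
  unfolding joint_actions_def
  by (rule product_sigma_finite.sigma_finite[OF product_sigma_finite_act]) simp

lemma pol_component_measurable:
  "(\<lambda>(s, a). pol G n \<theta> s (a n)) \<in> borel_measurable (S \<Otimes>\<^sub>M JA)"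
proof -
  have "(\<lambda>x. (fst x, snd x n)) \<in> S \<Otimes>\<^sub>M JA \<rightarrow>\<^sub>M S \<Otimes>\<^sub>M act_ref G"
    unfolding joint_actions_def by measurable
  from measurable_compose[OF this pol_measurable] show ?thesis by (simp add: case_prod_beta)
qed

lemma jpol_measurable: "(\<lambda>(s, a). jpol \<theta> s a) \<in> borel_measurable (S \<Otimes>\<^sub>M JA)"
  unfolding jpol_def case_prod_beta
  by (intro borel_measurable_prod) (use pol_component_measurable in \<open>simp add: case_prod_beta\<close>)

lemma jpol_measurable_action: "s \<in> space S \<Longrightarrow> jpol \<theta> s \<in> borel_measurable JA"
  using measurable_compose[OF measurable_Pair1' jpol_measurable] by simp

lemma jpol_nonneg: "s \<in> space S \<Longrightarrow> a \<in> space JA \<Longrightarrow> 0 \<le> jpol \<theta> s a"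
  unfolding jpol_def by (intro prod_nonneg) (auto simp: space_JA pol_nonneg)

lemma joint_policy_eq: "joint_policy G \<theta> s = density JA (\<lambda>a. ennreal (jpol \<theta> s a))"
  by (simp add: joint_policy_def jpol_def)

lemma pol_nn_integral: "s \<in> space S \<Longrightarrow> (\<integral>\<^sup>+b. ennreal (pol G n \<theta> s b) \<partial>act_ref G) = 1"
proof -
  assume s: "s \<in> space S"
  have "(\<lambda>b. pol G n \<theta> s b) \<in> borel_measurable (act_ref G)"
    using measurable_compose[OF measurable_Pair1'[OF s] pol_measurable] by simp
  then show ?thesis
    using prob_space.emeasure_space_1[OF policy_prob[OF s, of n \<theta>]]
    by (simp add: policy_def emeasure_density cong: nn_integral_cong)
qed

lemma pol_measurable_action: "s \<in> space S \<Longrightarrow> pol G n \<theta> s \<in> borel_measurable (act_ref G)"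
  using measurable_compose[OF measurable_Pair1' pol_measurable] by simp

text \<open>The joint density is a product, so the integral factorises, and the densities of the
  other agents integrate to one. This transfers the score moments of a single agent to the joint
  policy.\<close>

lemma joint_policy_component:
  assumes s: "s \<in> space S" and f: "f \<in> borel_measurable (act_ref G)"
  shows "(\<integral>\<^sup>+a. ennreal (jpol \<theta> s a) * f (a n) \<partial>JA) = (\<integral>\<^sup>+b. ennreal (pol G n \<theta> s b) * f b \<partial>act_ref G)"
proof -
  define g where "g l b = ennreal (pol G l \<theta> s b) * (if l = n then f b else 1)" for l b
  have gm: "g l \<in> borel_measurable (act_ref G)" for l
    unfolding g_def using pol_measurable_action[OF s] f by (cases "l = n") auto
  have "(\<integral>\<^sup>+a. ennreal (jpol \<theta> s a) * f (a n) \<partial>JA) = (\<integral>\<^sup>+a. (\<Prod>l\<in>UNIV. g l (a l)) \<partial>JA)"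
  proof (rule nn_integral_cong)
    fix a assume a: "a \<in> space JA"
    have "(\<Prod>l\<in>UNIV. if l = n then f (a l) else 1) = f (a n)" by simp
    moreover have "ennreal (jpol \<theta> s a) = (\<Prod>l\<in>UNIV. ennreal (pol G l \<theta> s (a l)))"
      unfolding jpol_def using a s by (intro prod_ennreal[symmetric]) (auto simp: space_JA pol_nonneg)
    ultimately show "ennreal (jpol \<theta> s a) * f (a n) = (\<Prod>l\<in>UNIV. g l (a l))"
      by (simp add: g_def prod.distrib)
  qed
  also have "\<dots> = (\<Prod>l\<in>UNIV. \<integral>\<^sup>+b. g l b \<partial>act_ref G)"
    unfolding joint_actions_def
    by (rule product_sigma_finite.product_nn_integral_prod[OF product_sigma_finite_act]) (auto simp: gm)
  also have "\<dots> = (\<Prod>l\<in>UNIV. if l = n then (\<integral>\<^sup>+b. ennreal (pol G n \<theta> s b) * f b \<partial>act_ref G) else 1)"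
    by (intro prod.cong refl) (auto simp: g_def pol_nn_integral[OF s])
  finally show ?thesis by simp
qed

lemma joint_policy_prob: "s \<in> space S \<Longrightarrow> prob_space (joint_policy G \<theta> s)"
proof
  assume s: "s \<in> space S"
  have "emeasure (joint_policy G \<theta> s) (space (joint_policy G \<theta> s)) = (\<integral>\<^sup>+a. ennreal (jpol \<theta> s a) * 1 \<partial>JA)"
    using jpol_measurable_action[OF s]
    by (simp add: joint_policy_eq emeasure_density cong: nn_integral_cong)
  also have "\<dots> = 1"
    using joint_policy_component[OF s, of "\<lambda>_. 1"] pol_nn_integral[OF s] by simp
  finally show "emeasure (joint_policy G \<theta> s) (space (joint_policy G \<theta> s)) = 1" .
qed

lemma joint_policy_kernel: "joint_policy G \<theta> \<in> S \<rightarrow>\<^sub>M prob_algebra JA"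
proof (rule measurable_prob_algebraI[OF joint_policy_prob])
  show "joint_policy G \<theta> \<in> S \<rightarrow>\<^sub>M subprob_algebra JA"
  proof (rule measurable_subprob_algebra)
    show "subprob_space (joint_policy G \<theta> s)" if "s \<in> space S" for s
      using joint_policy_prob[OF that] by (rule prob_space_imp_subprob_space)
    show "sets (joint_policy G \<theta> s) = sets JA" for s by (simp add: joint_policy_eq)
    fix A assume A[measurable]: "A \<in> sets JA"
    note [measurable] = jpol_measurable
    have "(\<lambda>s. \<integral>\<^sup>+a. ennreal (jpol \<theta> s a) * indicator A a \<partial>JA) \<in> borel_measurable S"
      by (rule sigma_finite_measure.borel_measurable_nn_integral[OF sigma_finite_JA]) measurable
    then show "(\<lambda>s. emeasure (joint_policy G \<theta> s) A) \<in> borel_measurable S"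
      by (rule measurable_cong[THEN iffD1, rotated])
        (simp add: joint_policy_eq emeasure_density jpol_measurable_action)
  qed
qed

lemma act_step_kernel [measurable]: "act_step G \<theta> \<in> S \<rightarrow>\<^sub>M prob_algebra SA"
  unfolding act_step_def[abs_def] state_actions_def
  by (rule measurable_distr_prob_space2[OF joint_policy_kernel]) simp

lemma next_pair_kernel [measurable]: "next_pair \<theta> \<in> SA \<rightarrow>\<^sub>M prob_algebra SA"
  unfolding next_pair_def[abs_def]
  by (rule measurable_bind_prob_space[OF transition_kernel act_step_kernel])

lemma step_kernel_kernel:
  assumes "\<mu> \<in> space (prob_algebra S)"
  shows "step_kernel G \<theta> \<mu> t \<in> PiM {0..<t} (\<lambda>_. SA) \<rightarrow>\<^sub>M prob_algebra SA"
proof (cases t)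
  case 0
  have "(\<lambda>_. \<mu>) \<in> PiM {0..<t} (\<lambda>_. SA) \<rightarrow>\<^sub>M prob_algebra S" using assms by simp
  from measurable_bind_prob_space[OF this act_step_kernel] show ?thesis
    using 0 by (simp add: step_kernel_def[abs_def])
next
  case (Suc k)
  have "(\<lambda>x. x k) \<in> PiM {0..<t} (\<lambda>_. SA) \<rightarrow>\<^sub>M SA"
    by (rule measurable_component_singleton) (simp add: Suc)
  from measurable_compose[OF this next_pair_kernel] show ?thesis
    using Suc by (simp add: step_kernel_def[abs_def] next_pair_def)
qed

lemma step_kernel_IT:
  assumes "\<mu> \<in> space (prob_algebra S)"
  shows "Ionescu_Tulcea (step_kernel G \<theta> \<mu>) (\<lambda>_. SA)"
  unfolding Ionescu_Tulcea_def
proof (intro conjI allI impI)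
  show "step_kernel G \<theta> \<mu> i \<in> PiM {0..<i} (\<lambda>_. SA) \<rightarrow>\<^sub>M subprob_algebra SA" for i
    by (rule measurable_prob_algebraD[OF step_kernel_kernel[OF assms]])
  show "prob_space (step_kernel G \<theta> \<mu> i x)" if "x \<in> space (PiM {0..<i} (\<lambda>_. SA))" for i x
    by (rule prob_kernelD[OF step_kernel_kernel[OF assms] that])
qed

text \<open>The product over no indices has this function as its only point; it is the empty history
  from which the trajectory is built.\<close>

lemma undefined_history: "(\<lambda>_. undefined) \<in> space (PiM {0..<0::nat} (\<lambda>_. SA))"
  by (simp add: space_PiM PiE_def extensional_def)

section \<open>Finite-dimensional laws of a trajectory\<close>

context
  fixes \<mu> :: "'s measure" and \<theta> :: "real ^ 'm"
  assumes \<mu>: "\<mu> \<in> space (prob_algebra S)"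
begin

interpretation IT: Ionescu_Tulcea "step_kernel G \<theta> \<mu>" "\<lambda>_. SA"
  by (rule step_kernel_IT[OF \<mu>])

lemma sets_trajectory [measurable_cong]: "sets (trajectory G \<theta> \<mu>) = sets (PiM UNIV (\<lambda>_. SA))"
  unfolding trajectory_def by (rule IT.PF.sets_lim)

text \<open>The projective family takes marginals from the smallest initial segment containing the
  index set. Here this is the index set itself, so the composed kernel remains without further
  projection.\<close>

lemma trajectory_restrict:
  "distr (trajectory G \<theta> \<mu>) (PiM {0..<n} (\<lambda>_. SA)) (\<lambda>x. restrict x {0..<n}) = IT.C 0 n (\<lambda>_. undefined)"
proof -
  have u: "IT.up_to {0..<n} = n"
  proof (rule antisym)
    show "IT.up_to {0..<n} \<le> n" by (simp add: IT.up_to_iff_Ico)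
    show "n \<le> IT.up_to {0..<n}" using IT.up_to_less[of "{0..<n}" "n - 1"] by (cases n) auto
  qed
  have sp: "(\<lambda>_. undefined) \<in> space (PiM {0..<0::nat} (\<lambda>_. SA))" by (rule undefined_history)
  have "distr (trajectory G \<theta> \<mu>) (PiM {0..<n} (\<lambda>_. SA)) (\<lambda>x. restrict x {0..<n}) = IT.CI {0..<n}"
    unfolding trajectory_def by (rule IT.distr_lim) simp
  also have "\<dots> = distr (IT.C 0 n (\<lambda>_. undefined)) (PiM {0..<n} (\<lambda>_. SA)) (\<lambda>x. restrict x {0..<n})"
    by (simp add: IT.CI_def u)
  also have "\<dots> = IT.C 0 n (\<lambda>_. undefined)"
    using IT.distr_C[of n n "\<lambda>_. undefined" 0] sp by simp
  finally show ?thesis .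
qed

lemma trajectory_prob: "prob_space (trajectory G \<theta> \<mu>)"
proof (rule prob_space_distrD)
  show "(\<lambda>x. restrict x {0..<0}) \<in> trajectory G \<theta> \<mu> \<rightarrow>\<^sub>M PiM {0..<0} (\<lambda>_. SA)"
    by (simp add: sets_trajectory measurable_restrict cong: measurable_cong_sets)
  show "prob_space (distr (trajectory G \<theta> \<mu>) (PiM {0..<0} (\<lambda>_. SA)) (\<lambda>x. restrict x {0..<0}))"
    unfolding trajectory_restrict by (rule IT.prob_space_C) (rule undefined_history)
qed

text \<open>The law of \<open>n + 1\<close> coordinates is the law of the first \<open>n\<close>
  composed with one more kernel, so the last coordinate can be integrated out given the
  history.\<close>

lemma trajectory_nn_integral_step:
  assumes F: "F \<in> borel_measurable (PiM {0..<Suc n} (\<lambda>_. SA))"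
  shows "(\<integral>\<^sup>+x. F (restrict x {0..<Suc n}) \<partial>trajectory G \<theta> \<mu>)
    = (\<integral>\<^sup>+x. \<integral>\<^sup>+y. F ((restrict x {0..<n})(n := y)) \<partial>step_kernel G \<theta> \<mu> n (restrict x {0..<n}) \<partial>trajectory G \<theta> \<mu>)"
proof -
  let ?P = "\<lambda>n. PiM {0..<n} (\<lambda>_. SA)"
  let ?u = "\<lambda>_::nat. undefined :: 's \<times> ('n \<Rightarrow> real ^ 'k)"
  have sp: "?u \<in> space (?P 0)" by (rule undefined_history)
  have r: "(\<lambda>x. restrict x {0..<n}) \<in> trajectory G \<theta> \<mu> \<rightarrow>\<^sub>M ?P n" for n
    by (simp add: sets_trajectory measurable_restrict cong: measurable_cong_sets)
  have Ce: "IT.eP n \<in> ?P n \<rightarrow>\<^sub>M subprob_algebra (?P (Suc n))" by (rule IT.measurable_eP)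
  have sC: "sets (IT.C 0 n ?u) = sets (?P n)" using IT.sets_C[OF sp, of n] by simp
  have Ce': "IT.eP n \<in> IT.C 0 n ?u \<rightarrow>\<^sub>M subprob_algebra (?P (Suc n))"
    using Ce sC by (simp cong: measurable_cong_sets)
  have m: "(\<lambda>z. \<integral>\<^sup>+y. F (z(n := y)) \<partial>step_kernel G \<theta> \<mu> n z) \<in> borel_measurable (?P n)"
  proof -
    have "(\<lambda>z. \<integral>\<^sup>+x. F x \<partial>IT.eP n z) \<in> borel_measurable (?P n)"
      by (rule measurable_compose[OF Ce nn_integral_measurable_subprob_algebra[OF F]])
    then show ?thesis by (rule measurable_cong[THEN iffD1, rotated]) (simp add: IT.nn_integral_eP F)
  qed
  have "(\<integral>\<^sup>+x. F (restrict x {0..<Suc n}) \<partial>trajectory G \<theta> \<mu>) = (\<integral>\<^sup>+z. F z \<partial>IT.C 0 (Suc n) ?u)"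
    unfolding trajectory_restrict[symmetric] by (subst nn_integral_distr[OF r]) (use F in simp_all)
  also have "\<dots> = (\<integral>\<^sup>+z. \<integral>\<^sup>+x. F x \<partial>IT.eP n z \<partial>IT.C 0 n ?u)"
    using nn_integral_bind[OF F Ce'] by simp
  also have "\<dots> = (\<integral>\<^sup>+z. \<integral>\<^sup>+y. F (z(n := y)) \<partial>step_kernel G \<theta> \<mu> n z \<partial>IT.C 0 n ?u)"
    using sets_eq_imp_space_eq[OF sC] by (intro nn_integral_cong IT.nn_integral_eP F) simp
  also have "\<dots> = (\<integral>\<^sup>+x. \<integral>\<^sup>+y. F ((restrict x {0..<n})(n := y)) \<partial>step_kernel G \<theta> \<mu> n (restrict x {0..<n}) \<partial>trajectory G \<theta> \<mu>)"
    unfolding trajectory_restrict[symmetric] by (subst nn_integral_distr[OF r]) (use m in simp_all)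
  finally show ?thesis .
qed

lemma coordinate_measurable [measurable]: "(\<lambda>x. x t) \<in> trajectory G \<theta> \<mu> \<rightarrow>\<^sub>M SA"
  by (simp add: sets_trajectory cong: measurable_cong_sets)

lemma trajectory_start: "distr (trajectory G \<theta> \<mu>) SA (\<lambda>x. x 0) = \<mu> \<bind> act_step G \<theta>"
proof (rule measure_eqI)
  interpret T: prob_space "trajectory G \<theta> \<mu>" by (rule trajectory_prob)
  have s: "sets (\<mu> \<bind> act_step G \<theta>) = sets SA" by (rule sets_bind'[OF \<mu> act_step_kernel])
  then show "sets (distr (trajectory G \<theta> \<mu>) SA (\<lambda>x. x 0)) = sets (\<mu> \<bind> act_step G \<theta>)" by simp
  fix X assume "X \<in> sets (distr (trajectory G \<theta> \<mu>) SA (\<lambda>x. x 0))"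
  then have X: "X \<in> sets SA" by simp
  have F: "(\<lambda>z. indicator X (z 0) :: ennreal) \<in> borel_measurable (PiM {0..<Suc 0} (\<lambda>_. SA))"
    using X by measurable
  have "emeasure (distr (trajectory G \<theta> \<mu>) SA (\<lambda>x. x 0)) X = (\<integral>\<^sup>+x. indicator X (x 0) \<partial>trajectory G \<theta> \<mu>)"
    using X by (simp add: nn_integral_distr flip: nn_integral_indicator)
  also have "\<dots> = (\<integral>\<^sup>+x. \<integral>\<^sup>+y. indicator X y \<partial>(\<mu> \<bind> act_step G \<theta>) \<partial>trajectory G \<theta> \<mu>)"
    using trajectory_nn_integral_step[OF F] by (simp add: step_kernel_def)
  also have "\<dots> = emeasure (\<mu> \<bind> act_step G \<theta>) X" using X s by (simp add: T.emeasure_space_1)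
  finally show "emeasure (distr (trajectory G \<theta> \<mu>) SA (\<lambda>x. x 0)) X = emeasure (\<mu> \<bind> act_step G \<theta>) X" .
qed

text \<open>The earlier coordinate \<open>x t\<close> is retained because the score at one time will
  be correlated with rewards and values at later times.\<close>

lemma trajectory_step:
  assumes t: "t \<le> n"
  shows "distr (trajectory G \<theta> \<mu>) (SA \<Otimes>\<^sub>M SA) (\<lambda>x. (x t, x (Suc n)))
    = trajectory G \<theta> \<mu> \<bind> (\<lambda>x. distr (next_pair \<theta> (x n)) (SA \<Otimes>\<^sub>M SA) (Pair (x t)))" (is "?L = ?R")
    and "(\<lambda>x. distr (next_pair \<theta> (x n)) (SA \<Otimes>\<^sub>M SA) (Pair (x t)))
      \<in> trajectory G \<theta> \<mu> \<rightarrow>\<^sub>M prob_algebra (SA \<Otimes>\<^sub>M SA)"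
proof -
  interpret T: prob_space "trajectory G \<theta> \<mu>" by (rule trajectory_prob)
  show k: "(\<lambda>x. distr (next_pair \<theta> (x n)) (SA \<Otimes>\<^sub>M SA) (Pair (x t)))
      \<in> trajectory G \<theta> \<mu> \<rightarrow>\<^sub>M prob_algebra (SA \<Otimes>\<^sub>M SA)"
    by (rule measurable_distr_prob_space2[OF measurable_compose[OF coordinate_measurable next_pair_kernel]])
      measurable
  have Tin: "trajectory G \<theta> \<mu> \<in> space (prob_algebra (trajectory G \<theta> \<mu>))"
    by (simp add: space_prob_algebra T.prob_space_axioms)
  show "?L = ?R"
  proof (rule measure_eqI)
    show "sets ?L = sets ?R" using sets_bind'[OF Tin k] by simp
    fix X assume "X \<in> sets ?L"
    then have X[measurable]: "X \<in> sets (SA \<Otimes>\<^sub>M SA)" by simp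
    have F: "(\<lambda>z. indicator X (z t, z (Suc n)) :: ennreal) \<in> borel_measurable (PiM {0..<Suc (Suc n)} (\<lambda>_. SA))"
    proof -
      have "(\<lambda>z. (z t, z (Suc n))) \<in> PiM {0..<Suc (Suc n)} (\<lambda>_. SA) \<rightarrow>\<^sub>M SA \<Otimes>\<^sub>M SA"
        using t by (intro measurable_Pair measurable_component_singleton) auto
      then show ?thesis by measurable
    qed
    have "emeasure ?L X = (\<integral>\<^sup>+x. indicator X (x t, x (Suc n)) \<partial>trajectory G \<theta> \<mu>)"
      using X by (simp add: nn_integral_distr flip: nn_integral_indicator)
    also have "\<dots> = (\<integral>\<^sup>+x. \<integral>\<^sup>+y. indicator X (x t, y) \<partial>next_pair \<theta> (x n) \<partial>trajectory G \<theta> \<mu>)"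
      using trajectory_nn_integral_step[OF F] t by (simp add: step_kernel_def next_pair_def)
    also have "\<dots> = (\<integral>\<^sup>+x. emeasure (distr (next_pair \<theta> (x n)) (SA \<Otimes>\<^sub>M SA) (Pair (x t))) X \<partial>trajectory G \<theta> \<mu>)"
    proof (rule nn_integral_cong)
      fix x assume "x \<in> space (trajectory G \<theta> \<mu>)"
      then have x: "x i \<in> space SA" for i using measurable_space[OF coordinate_measurable] by blast
      have "Pair (x t) \<in> next_pair \<theta> (x n) \<rightarrow>\<^sub>M SA \<Otimes>\<^sub>M SA"
        using prob_kernelD(2)[OF next_pair_kernel x] x by (simp cong: measurable_cong_sets)
      then show "(\<integral>\<^sup>+y. indicator X (x t, y) \<partial>next_pair \<theta> (x n)) = emeasure (distr (next_pair \<theta> (x n)) (SA \<Otimes>\<^sub>M SA) (Pair (x t))) X"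
        using X by (simp add: nn_integral_distr flip: nn_integral_indicator)
    qed
    also have "\<dots> = emeasure ?R X" by (rule emeasure_bind_prob_algebra[symmetric, OF Tin k X])
    finally show "emeasure ?L X = emeasure ?R X" .
  qed
qed

lemma trajectory_cylinder:
  assumes "J \<subseteq> {0..<n}" "X \<in> sets (PiM J (\<lambda>_. SA))"
  shows "emeasure (trajectory G \<theta> \<mu>) (prod_emb UNIV (\<lambda>_. SA) J X)
    = emeasure (IT.C 0 n (\<lambda>_. undefined)) (prod_emb {0..<n} (\<lambda>_. SA) J X)"
  unfolding trajectory_def using assms finite_subset[OF assms(1)]
  by (simp add: IT.lim IT.emeasure_CI)

end

section \<open>Dependence of the trajectory law on the initial state\<close>

lemma return_in_prob: "s \<in> space S \<Longrightarrow> return S s \<in> space (prob_algebra S)"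
  by (simp add: space_prob_algebra prob_space_return)

text \<open>The initial state enters only through the first step, and every step is jointly
  measurable in the initial state and the history; the induction composes these kernels.\<close>

lemma finite_history_kernel:
  "(\<lambda>s. Ionescu_Tulcea.C (step_kernel G \<theta> (return S s)) (\<lambda>_. SA) 0 n (\<lambda>_. undefined))
    \<in> S \<rightarrow>\<^sub>M prob_algebra (PiM {0..<n} (\<lambda>_. SA))"
proof (induction n)
  case 0
  have "(\<lambda>s. return (PiM {0..<0::nat} (\<lambda>_. SA)) (\<lambda>_. undefined)) \<in> S \<rightarrow>\<^sub>M prob_algebra (PiM {0..<0} (\<lambda>_. SA))"
    by (intro measurable_const) (simp only: space_prob_algebra mem_Collect_eq sets_return prob_space_return[OF undefined_history])
  then show ?case
    by (rule measurable_cong[THEN iffD1, rotated])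
      (simp add: Ionescu_Tulcea.C.simps[OF step_kernel_IT[OF return_in_prob]])
next
  case (Suc n)
  let ?e = "\<lambda>s \<omega>. distr (step_kernel G \<theta> (return S s) n \<omega>) (PiM {0..<Suc n} (\<lambda>_. SA)) (fun_upd \<omega> n)"
  have k: "(\<lambda>(s, \<omega>). step_kernel G \<theta> (return S s) n \<omega>) \<in> S \<Otimes>\<^sub>M PiM {0..<n} (\<lambda>_. SA) \<rightarrow>\<^sub>M prob_algebra SA"
  proof (cases n)
    case 0
    have "(\<lambda>x. return S (fst x) \<bind> act_step G \<theta>) \<in> S \<Otimes>\<^sub>M PiM {0..<n} (\<lambda>_. SA) \<rightarrow>\<^sub>M prob_algebra SA"
      by (rule measurable_bind_prob_space[OF _ act_step_kernel]) measurable
    then show ?thesis using 0 by (simp add: step_kernel_def case_prod_beta)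
  next
    case (Suc k)
    have "(\<lambda>x. snd x k) \<in> S \<Otimes>\<^sub>M PiM {0..<n} (\<lambda>_. SA) \<rightarrow>\<^sub>M SA"
      by (rule measurable_compose[OF measurable_snd measurable_component_singleton]) (simp add: Suc)
    from measurable_compose[OF this next_pair_kernel] show ?thesis
      using Suc by (simp add: step_kernel_def next_pair_def case_prod_beta)
  qed
  have "(\<lambda>x. distr (case x of (s, \<omega>) \<Rightarrow> step_kernel G \<theta> (return S s) n \<omega>) (PiM {0..<Suc n} (\<lambda>_. SA)) (fun_upd (snd x) n))
      \<in> S \<Otimes>\<^sub>M PiM {0..<n} (\<lambda>_. SA) \<rightarrow>\<^sub>M prob_algebra (PiM {0..<Suc n} (\<lambda>_. SA))"
  proof (rule measurable_distr_prob_space2[OF k])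
    have "(\<lambda>z. (snd (fst z))(n := snd z)) \<in> (S \<Otimes>\<^sub>M PiM {0..<n} (\<lambda>_. SA)) \<Otimes>\<^sub>M SA \<rightarrow>\<^sub>M PiM {0..<Suc n} (\<lambda>_. SA)"
      by (rule measurable_fun_upd[where J="{0..<n}"]) (auto simp: atLeastLessThanSuc)
    then show "(\<lambda>(x, y). (snd x)(n := y)) \<in> (S \<Otimes>\<^sub>M PiM {0..<n} (\<lambda>_. SA)) \<Otimes>\<^sub>M SA \<rightarrow>\<^sub>M PiM {0..<Suc n} (\<lambda>_. SA)"
      by (simp add: case_prod_beta)
  qed
  then have e: "(\<lambda>(s, \<omega>). ?e s \<omega>) \<in> S \<Otimes>\<^sub>M PiM {0..<n} (\<lambda>_. SA) \<rightarrow>\<^sub>M prob_algebra (PiM {0..<Suc n} (\<lambda>_. SA))"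
    by (simp add: case_prod_beta)
  have eP: "Ionescu_Tulcea.eP (step_kernel G \<theta> (return S s)) (\<lambda>_. SA) n = ?e s" if "s \<in> space S" for s
    by (rule ext) (simp add: Ionescu_Tulcea.eP_def[OF step_kernel_IT[OF return_in_prob[OF that]]])
  from measurable_bind_prob_space2[OF Suc e]
  show ?case
    by (rule measurable_cong[THEN iffD1, rotated])
      (simp add: Ionescu_Tulcea.C.simps[OF step_kernel_IT[OF return_in_prob]] eP)
qed

text \<open>A cylinder is decided by finitely many coordinates, whose law is a kernel already, and
  cylinders generate the product algebra. Value estimates need this because they start from a random
  state.\<close>

lemma trajectory_kernel [measurable]:
  "(\<lambda>s. trajectory G \<theta> (return S s)) \<in> S \<rightarrow>\<^sub>M prob_algebra (PiM UNIV (\<lambda>_. SA))"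
proof (rule measurable_prob_algebra_generated[OF sets_PiM Int_stable_prod_algebra prod_algebra_sets_into_space])
  show "prob_space (trajectory G \<theta> (return S s))" if "s \<in> space S" for s
    by (rule trajectory_prob[OF return_in_prob[OF that]])
  show "sets (trajectory G \<theta> (return S s)) = sets (PiM UNIV (\<lambda>_. SA))" if "s \<in> space S" for s
    by (rule sets_trajectory[OF return_in_prob[OF that]])
  fix A assume "A \<in> prod_algebra UNIV (\<lambda>_::nat. SA)"
  then obtain J E where J: "finite J" and A: "A = prod_emb UNIV (\<lambda>_. SA) J (PiE J E)"
      and E: "\<And>i. i \<in> J \<Longrightarrow> E i \<in> sets SA"
    by (auto elim!: prod_algebraE)
  \<comment> \<open>A strict upper bound for \<open>J\<close>; the inserted 0 covers the empty index
    set.\<close>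
  define n where "n = Suc (Max (insert 0 J))"
  have Jn: "J \<subseteq> {0..<n}" using J by (auto simp: n_def less_Suc_eq_le)
  have X: "PiE J E \<in> sets (PiM J (\<lambda>_. SA))" using J E by (intro sets_PiM_I_finite) auto
  have XX: "prod_emb {0..<n} (\<lambda>_. SA) J (PiE J E) \<in> sets (PiM {0..<n} (\<lambda>_. SA))"
    using J Jn E by (intro sets_PiM_I) auto
  have "(\<lambda>s. emeasure (Ionescu_Tulcea.C (step_kernel G \<theta> (return S s)) (\<lambda>_. SA) 0 n (\<lambda>_. undefined))
      (prod_emb {0..<n} (\<lambda>_. SA) J (PiE J E))) \<in> borel_measurable S"
    by (rule measurable_compose[OF measurable_prob_algebraD[OF finite_history_kernel]
        measurable_emeasure_subprob_algebra[OF XX]])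
  then show "(\<lambda>s. emeasure (trajectory G \<theta> (return S s)) A) \<in> borel_measurable S"
    unfolding A by (rule measurable_cong[THEN iffD1, rotated])
      (simp add: trajectory_cylinder[OF return_in_prob Jn X])
qed

end

section \<open>Discounted sums along trajectories\<close>

context markov
begin

text \<open>One step of the play is split into the draw of the action and the draw of the next
  state. The parameter enters only the former, so differentiation is confined to integrals against
  the joint density.\<close>

definition act_mean :: "real ^ 'm \<Rightarrow> ('s \<times> ('n \<Rightarrow> real ^ 'k) \<Rightarrow> real) \<Rightarrow> 's \<Rightarrow> real" where
  "act_mean \<theta> f s = (\<integral>x. f x \<partial>act_step G \<theta> s)"

definition trans_mean :: "('s \<Rightarrow> real) \<Rightarrow> 's \<times> ('n \<Rightarrow> real ^ 'k) \<Rightarrow> real" where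
  "trans_mean g x = (\<integral>s. g s \<partial>transition G x)"

text \<open>Functions such as scores, which are unbounded but have uniformly bounded conditional
  first moments given the state.\<close>

definition act_bounded :: "real ^ 'm \<Rightarrow> real \<Rightarrow> ('s \<times> ('n \<Rightarrow> real ^ 'k) \<Rightarrow> real) \<Rightarrow> bool" where
  "act_bounded \<theta> c f \<longleftrightarrow> f \<in> borel_measurable SA \<and> 0 \<le> c \<and>
     (\<forall>s\<in>space S. (\<integral>\<^sup>+x. ennreal \<bar>f x\<bar> \<partial>act_step G \<theta> s) \<le> ennreal c)"

lemma act_boundedI:
  assumes f: "f \<in> borel_measurable SA" and b: "\<And>x. x \<in> space SA \<Longrightarrow> \<bar>f x\<bar> \<le> c" and c: "0 \<le> c"
  shows "act_bounded \<theta> c f"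
  unfolding act_bounded_def
proof (intro conjI ballI f c)
  fix s assume s: "s \<in> space S"
  note k = prob_kernelD[OF act_step_kernel[of \<theta>] s]
  have "(\<integral>\<^sup>+x. ennreal \<bar>f x\<bar> \<partial>act_step G \<theta> s) \<le> (\<integral>\<^sup>+x. ennreal c \<partial>act_step G \<theta> s)"
    using b k(3) by (intro nn_integral_mono ennreal_leI) auto
  then show "(\<integral>\<^sup>+x. ennreal \<bar>f x\<bar> \<partial>act_step G \<theta> s) \<le> ennreal c"
    using prob_space.emeasure_space_1[OF k(1)] by simp
qed

lemma act_bounded:
  assumes f: "act_bounded \<theta> c f" and s: "s \<in> space S"
  shows act_bounded_integrable: "integrable (act_step G \<theta> s) f"
    and act_mean_bound: "\<bar>act_mean \<theta> f s\<bar> \<le> c"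
proof -
  note k = prob_kernelD[OF act_step_kernel[of \<theta>] s]
  have m: "f \<in> borel_measurable (act_step G \<theta> s)"
    using f k(2) by (simp add: act_bounded_def cong: measurable_cong_sets)
  have le: "(\<integral>\<^sup>+x. ennreal \<bar>f x\<bar> \<partial>act_step G \<theta> s) \<le> ennreal c" using f s by (simp add: act_bounded_def)
  show I: "integrable (act_step G \<theta> s) f"
    using le by (intro integrableI_bounded m) (auto intro: le_less_trans)
  have "ennreal \<bar>act_mean \<theta> f s\<bar> \<le> ennreal c"
    using integral_norm_bound_ennreal[OF I] le by (simp add: act_mean_def)
  then show "\<bar>act_mean \<theta> f s\<bar> \<le> c" using f by (simp add: act_bounded_def)
qed

lemma act_bounded_measurable: "act_bounded \<theta> c f \<Longrightarrow> f \<in> borel_measurable SA"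
  by (simp add: act_bounded_def)

lemma act_mean_measurable: "f \<in> borel_measurable SA \<Longrightarrow> act_mean \<theta> f \<in> borel_measurable S"
  unfolding act_mean_def[abs_def] by (rule kop_measurable[OF act_step_kernel])

lemma trans_mean_measurable: "g \<in> borel_measurable S \<Longrightarrow> trans_mean g \<in> borel_measurable SA"
  unfolding trans_mean_def[abs_def] by (rule kop_measurable[OF transition_kernel])

lemma trans_mean_bound:
  assumes "g \<in> borel_measurable S" "\<And>s. s \<in> space S \<Longrightarrow> \<bar>g s\<bar> \<le> c" "x \<in> space SA"
  shows "\<bar>trans_mean g x\<bar> \<le> c" "integrable (transition G x) g"
  using kernel_integrable[OF prob_kernelD(1,2)[OF transition_kernel assms(3)] assms(1,2)]
  by (auto simp: trans_mean_def)

lemma bind_act_integral: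
  assumes f: "act_bounded \<theta> c f" and \<mu>: "\<mu> \<in> space (prob_algebra S)"
  shows "integrable (\<mu> \<bind> act_step G \<theta>) f" "(\<integral>x. f x \<partial>(\<mu> \<bind> act_step G \<theta>)) = (\<integral>s. act_mean \<theta> f s \<partial>\<mu>)"
proof -
  interpret M: prob_space \<mu> using \<mu> by (simp add: space_prob_algebra)
  have sets: "sets \<mu> = sets S" using \<mu> by (simp add: space_prob_algebra)
  then have sp: "space \<mu> = space S" by (rule sets_eq_imp_space_eq)
  have k: "act_step G \<theta> \<in> \<mu> \<rightarrow>\<^sub>M subprob_algebra SA"
    using measurable_prob_algebraD[OF act_step_kernel] sets by (simp cong: measurable_cong_sets)
  have "(\<integral>\<^sup>+s. \<integral>\<^sup>+x. ennreal \<bar>f x\<bar> \<partial>act_step G \<theta> s \<partial>\<mu>) \<le> (\<integral>\<^sup>+s. ennreal c \<partial>\<mu>)"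
    using f sp by (intro nn_integral_mono) (simp add: act_bounded_def)
  also have "\<dots> < \<infinity>" by (simp add: M.emeasure_space_1)
  finally have fin: "(\<integral>\<^sup>+s. \<integral>\<^sup>+x. ennreal \<bar>f x\<bar> \<partial>act_step G \<theta> s \<partial>\<mu>) < \<infinity>" .
  note * = act_bounded_measurable[OF f] k M.not_empty fin
  show "integrable (\<mu> \<bind> act_step G \<theta>) f" by (rule integrable_bind_fin[OF *])
  show "(\<integral>x. f x \<partial>(\<mu> \<bind> act_step G \<theta>)) = (\<integral>s. act_mean \<theta> f s \<partial>\<mu>)"
    unfolding act_mean_def by (rule integral_bind_fin[OF *])
qed

lemma next_pair_integral:
  assumes f: "act_bounded \<theta> c f" and x: "x \<in> space SA"
  shows "integrable (next_pair \<theta> x) f" "(\<integral>y. f y \<partial>next_pair \<theta> x) = trans_mean (act_mean \<theta> f) x"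
proof -
  have t: "transition G x \<in> space (prob_algebra S)" by (rule measurable_space[OF transition_kernel x])
  show "integrable (next_pair \<theta> x) f" "(\<integral>y. f y \<partial>next_pair \<theta> x) = trans_mean (act_mean \<theta> f) x"
    unfolding next_pair_def trans_mean_def by (rule bind_act_integral[OF f t])+
qed

lemma kop_next_pair:
  assumes "act_bounded \<theta> c f" "x \<in> space SA"
  shows "kop (next_pair \<theta>) f x = trans_mean (act_mean \<theta> f) x"
  using next_pair_integral[OF assms] by (simp add: kop_def)

section \<open>The Markov property and discounted sums\<close>

context
  fixes \<mu> :: "'s measure" and \<theta> :: "real ^ 'm"
  assumes \<mu>: "\<mu> \<in> space (prob_algebra S)"
begin

abbreviation "Tr \<equiv> trajectory G \<theta> \<mu>"

lemma coordinate_in: "x \<in> space Tr \<Longrightarrow> x t \<in> space SA"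
  by (rule measurable_space[OF coordinate_measurable[OF \<mu>]])

lemma start_integral:
  assumes f: "act_bounded \<theta> c f"
  shows "integrable Tr (\<lambda>x. f (x 0))" "(\<integral>x. f (x 0) \<partial>Tr) = (\<integral>s. act_mean \<theta> f s \<partial>\<mu>)"
proof -
  note fm = act_bounded_measurable[OF f]
  note b = bind_act_integral[OF f \<mu>, folded trajectory_start[OF \<mu>]]
  show "integrable Tr (\<lambda>x. f (x 0))"
    using b(1) by (subst (asm) integrable_distr_eq[OF coordinate_measurable[OF \<mu>] fm])
  show "(\<integral>x. f (x 0) \<partial>Tr) = (\<integral>s. act_mean \<theta> f s \<partial>\<mu>)"
    using b(2) by (subst (asm) integral_distr[OF coordinate_measurable[OF \<mu>] fm])
qed

text \<open>The action at time \<open>n + 1\<close> is drawn from the new state, whatever the past,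
  so the conditional bound \<open>c\<close> holds at every time. Averaging over that action replaces
  a possibly unbounded \<open>f\<close> by a bounded function of the preceding pair.\<close>

lemma step_integral:
  assumes f: "act_bounded \<theta> c f"
  shows "integrable Tr (\<lambda>x. f (x (Suc n)))"
    and "(\<integral>x. f (x (Suc n)) \<partial>Tr) = (\<integral>x. trans_mean (act_mean \<theta> f) (x n) \<partial>Tr)"
    and "(\<integral>\<^sup>+x. ennreal \<bar>f (x (Suc n))\<bar> \<partial>Tr) \<le> ennreal c"
proof -
  interpret T: prob_space Tr by (rule trajectory_prob[OF \<mu>])
  let ?k = "\<lambda>x. distr (next_pair \<theta> (x n)) (SA \<Otimes>\<^sub>M SA) (Pair (x n))"
  let ?g = "\<lambda>p. f (snd p)"
  have k: "?k \<in> Tr \<rightarrow>\<^sub>M subprob_algebra (SA \<Otimes>\<^sub>M SA)"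
    by (rule measurable_prob_algebraD[OF trajectory_step(2)[OF \<mu> order_refl]])
  have g: "?g \<in> borel_measurable (SA \<Otimes>\<^sub>M SA)"
    by (rule measurable_compose[OF measurable_snd act_bounded_measurable[OF f]])
  have P: "Pair (x n) \<in> next_pair \<theta> (x n) \<rightarrow>\<^sub>M SA \<Otimes>\<^sub>M SA" if "x \<in> space Tr" for x
    using prob_kernelD(2)[OF next_pair_kernel coordinate_in[OF that]] coordinate_in[OF that]
    by (simp cong: measurable_cong_sets)
  have abs: "(\<lambda>y. ennreal \<bar>f y\<bar>) \<in> borel_measurable SA" using act_bounded_measurable[OF f] by measurable
  have in1: "(\<integral>\<^sup>+p. ennreal \<bar>?g p\<bar> \<partial>?k x) \<le> ennreal c" if "x \<in> space Tr" for x
  proof -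
    have "(\<integral>\<^sup>+p. ennreal \<bar>?g p\<bar> \<partial>?k x) = (\<integral>\<^sup>+y. ennreal \<bar>f y\<bar> \<partial>next_pair \<theta> (x n))"
      using g by (subst nn_integral_distr[OF P[OF that]]) auto
    also have "\<dots> = (\<integral>\<^sup>+s. \<integral>\<^sup>+y. ennreal \<bar>f y\<bar> \<partial>act_step G \<theta> s \<partial>transition G (x n))"
      unfolding next_pair_def
      using measurable_prob_algebraD[OF act_step_kernel] prob_kernelD(2)[OF transition_kernel coordinate_in[OF that]]
      by (intro nn_integral_bind[OF abs]) (simp cong: measurable_cong_sets)
    also have "\<dots> \<le> (\<integral>\<^sup>+s. ennreal c \<partial>transition G (x n))"
      using f prob_kernelD(3)[OF transition_kernel coordinate_in[OF that]]
      by (intro nn_integral_mono) (simp add: act_bounded_def)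
    also have "\<dots> = ennreal c"
      using prob_space.emeasure_space_1[OF prob_kernelD(1)[OF transition_kernel coordinate_in[OF that]]] by simp
    finally show ?thesis .
  qed
  have "(\<integral>\<^sup>+x. \<integral>\<^sup>+p. ennreal \<bar>?g p\<bar> \<partial>?k x \<partial>Tr) \<le> (\<integral>\<^sup>+x. ennreal c \<partial>Tr)"
    by (rule nn_integral_mono[OF in1])
  then have le: "(\<integral>\<^sup>+x. \<integral>\<^sup>+p. ennreal \<bar>?g p\<bar> \<partial>?k x \<partial>Tr) \<le> ennreal c" by (simp add: T.emeasure_space_1)
  then have fin: "(\<integral>\<^sup>+x. \<integral>\<^sup>+p. ennreal \<bar>?g p\<bar> \<partial>?k x \<partial>Tr) < \<infinity>" by (rule le_less_trans) simp
  note * = g k T.not_empty fin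
  note ts = trajectory_step(1)[OF \<mu> order_refl, where n=n and \<theta>=\<theta>, symmetric]
  have m2: "(\<lambda>x. (x n, x (Suc n))) \<in> Tr \<rightarrow>\<^sub>M SA \<Otimes>\<^sub>M SA"
    by (intro measurable_Pair coordinate_measurable \<mu>)
  show "integrable Tr (\<lambda>x. f (x (Suc n)))"
    using integrable_bind_fin[OF *] unfolding ts by (subst (asm) integrable_distr_eq[OF m2 g]) simp
  have "(\<integral>x. f (x (Suc n)) \<partial>Tr) = (\<integral>x. \<integral>p. ?g p \<partial>?k x \<partial>Tr)"
    using integral_bind_fin[OF *] unfolding ts by (subst (asm) integral_distr[OF m2 g]) simp
  also have "\<dots> = (\<integral>x. trans_mean (act_mean \<theta> f) (x n) \<partial>Tr)"
    using next_pair_integral(2)[OF f coordinate_in] g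
    by (intro Bochner_Integration.integral_cong refl) (simp add: integral_distr[OF P])
  finally show "(\<integral>x. f (x (Suc n)) \<partial>Tr) = (\<integral>x. trans_mean (act_mean \<theta> f) (x n) \<partial>Tr)" .
  have "(\<integral>\<^sup>+x. ennreal \<bar>f (x (Suc n))\<bar> \<partial>Tr) = (\<integral>\<^sup>+p. ennreal \<bar>?g p\<bar> \<partial>distr Tr (SA \<Otimes>\<^sub>M SA) (\<lambda>x. (x n, x (Suc n))))"
    using g by (subst nn_integral_distr[OF m2]) auto
  also have "\<dots> = (\<integral>\<^sup>+x. \<integral>\<^sup>+p. ennreal \<bar>?g p\<bar> \<partial>?k x \<partial>Tr)"
    unfolding ts[symmetric] using g by (intro nn_integral_bind[OF _ k]) measurable
  finally show "(\<integral>\<^sup>+x. ennreal \<bar>f (x (Suc n))\<bar> \<partial>Tr) \<le> ennreal c" using le by simp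
qed

lemma start_nn_integral:
  assumes f: "act_bounded \<theta> c f"
  shows "(\<integral>\<^sup>+x. ennreal \<bar>f (x 0)\<bar> \<partial>Tr) \<le> ennreal c"
proof -
  interpret M: prob_space \<mu> using \<mu> by (simp add: space_prob_algebra)
  have sets: "sets \<mu> = sets S" using \<mu> by (simp add: space_prob_algebra)
  then have sp: "space \<mu> = space S" by (rule sets_eq_imp_space_eq)
  have k: "act_step G \<theta> \<in> \<mu> \<rightarrow>\<^sub>M subprob_algebra SA"
    using measurable_prob_algebraD[OF act_step_kernel] sets by (simp cong: measurable_cong_sets)
  have abs: "(\<lambda>y. ennreal \<bar>f y\<bar>) \<in> borel_measurable SA" using act_bounded_measurable[OF f] by measurable
  have "(\<integral>\<^sup>+x. ennreal \<bar>f (x 0)\<bar> \<partial>Tr) = (\<integral>\<^sup>+y. ennreal \<bar>f y\<bar> \<partial>(\<mu> \<bind> act_step G \<theta>))"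
    unfolding trajectory_start[OF \<mu>, symmetric] using abs
    by (subst nn_integral_distr[OF coordinate_measurable[OF \<mu>]]) auto
  also have "\<dots> = (\<integral>\<^sup>+s. \<integral>\<^sup>+y. ennreal \<bar>f y\<bar> \<partial>act_step G \<theta> s \<partial>\<mu>)" by (rule nn_integral_bind[OF abs k])
  also have "\<dots> \<le> (\<integral>\<^sup>+s. ennreal c \<partial>\<mu>)"
    using f sp by (intro nn_integral_mono) (simp add: act_bounded_def)
  finally show ?thesis by (simp add: M.emeasure_space_1)
qed

lemma coordinate_nn_integral:
  assumes f: "act_bounded \<theta> c f"
  shows "(\<integral>\<^sup>+x. ennreal \<bar>f (x t)\<bar> \<partial>Tr) \<le> ennreal c" "integrable Tr (\<lambda>x. f (x t))"
  using start_nn_integral[OF f] step_integral(1,3)[OF f] start_integral(1)[OF f] by (cases t; simp)+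

text \<open>Conditioning on the past up to time \<open>n\<close> applies the kernel once to the
  later factor. The earlier factor is merely integrable, as it will be a score; the later one is
  bounded, as it will be a reward or a value.\<close>

lemma markov_property:
  assumes \<phi>: "\<phi> \<in> borel_measurable SA" "integrable Tr (\<lambda>x. \<phi> (x t))"
    and \<psi>: "\<psi> \<in> borel_measurable SA" "\<And>x. x \<in> space SA \<Longrightarrow> \<bar>\<psi> x\<bar> \<le> b" and t: "t \<le> n"
  shows "(\<integral>x. \<phi> (x t) * \<psi> (x (Suc n)) \<partial>Tr) = (\<integral>x. \<phi> (x t) * kop (next_pair \<theta>) \<psi> (x n) \<partial>Tr)"
proof -
  interpret T: prob_space Tr by (rule trajectory_prob[OF \<mu>])
  let ?k = "\<lambda>x. distr (next_pair \<theta> (x n)) (SA \<Otimes>\<^sub>M SA) (Pair (x t))"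
  let ?g = "\<lambda>p. \<phi> (fst p) * \<psi> (snd p)"
  have k: "?k \<in> Tr \<rightarrow>\<^sub>M subprob_algebra (SA \<Otimes>\<^sub>M SA)"
    by (rule measurable_prob_algebraD[OF trajectory_step(2)[OF \<mu> t]])
  have g: "?g \<in> borel_measurable (SA \<Otimes>\<^sub>M SA)" using \<phi>(1) \<psi>(1) by measurable
  have P: "Pair (x t) \<in> next_pair \<theta> (x n) \<rightarrow>\<^sub>M SA \<Otimes>\<^sub>M SA" if "x \<in> space Tr" for x
    using prob_kernelD(2)[OF next_pair_kernel coordinate_in[OF that]] coordinate_in[OF that]
    by (simp cong: measurable_cong_sets)
  have b0: "0 \<le> b" using T.not_empty coordinate_in \<psi>(2) by (meson abs_ge_zero ex_in_conv order_trans)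
  have in1: "(\<integral>\<^sup>+p. ennreal \<bar>?g p\<bar> \<partial>?k x) \<le> ennreal (b * \<bar>\<phi> (x t)\<bar>)" if x: "x \<in> space Tr" for x
  proof -
    note np = prob_kernelD[OF next_pair_kernel[of \<theta>] coordinate_in[OF x, of n]]
    have "(\<integral>\<^sup>+p. ennreal \<bar>?g p\<bar> \<partial>?k x) = (\<integral>\<^sup>+y. ennreal \<bar>\<phi> (x t) * \<psi> y\<bar> \<partial>next_pair \<theta> (x n))"
      using g by (subst nn_integral_distr[OF P[OF x]]) auto
    also have "\<dots> \<le> (\<integral>\<^sup>+y. ennreal (b * \<bar>\<phi> (x t)\<bar>) \<partial>next_pair \<theta> (x n))"
      using \<psi>(2) np(3) by (intro nn_integral_mono ennreal_leI) (auto simp: abs_mult mult.commute[of b] intro!: mult_left_mono)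
    finally show ?thesis using prob_space.emeasure_space_1[OF np(1)] by simp
  qed
  have "(\<integral>\<^sup>+x. \<integral>\<^sup>+p. ennreal \<bar>?g p\<bar> \<partial>?k x \<partial>Tr) \<le> (\<integral>\<^sup>+x. ennreal (norm (b * \<phi> (x t))) \<partial>Tr)"
    using in1 b0 by (intro nn_integral_mono) (simp add: abs_mult)
  also have "\<dots> < \<infinity>"
    using integrable_mult_right[OF \<phi>(2), of b] unfolding integrable_iff_bounded by blast
  finally have fin: "(\<integral>\<^sup>+x. \<integral>\<^sup>+p. ennreal \<bar>?g p\<bar> \<partial>?k x \<partial>Tr) < \<infinity>" .
  note * = g k T.not_empty fin
  note ts = trajectory_step(1)[OF \<mu> t, where \<theta>=\<theta>, symmetric]
  have m2: "(\<lambda>x. (x t, x (Suc n))) \<in> Tr \<rightarrow>\<^sub>M SA \<Otimes>\<^sub>M SA"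
    by (intro measurable_Pair coordinate_measurable \<mu>)
  have "(\<integral>x. \<phi> (x t) * \<psi> (x (Suc n)) \<partial>Tr) = (\<integral>x. \<integral>p. ?g p \<partial>?k x \<partial>Tr)"
    using integral_bind_fin[OF *] unfolding ts by (subst (asm) integral_distr[OF m2 g]) simp
  also have "\<dots> = (\<integral>x. \<phi> (x t) * kop (next_pair \<theta>) \<psi> (x n) \<partial>Tr)"
    using g by (intro Bochner_Integration.integral_cong refl) (simp add: integral_distr[OF P] kop_def)
  finally show ?thesis .
qed

lemma markov_property_iterate:
  assumes \<phi>: "\<phi> \<in> borel_measurable SA" "integrable Tr (\<lambda>x. \<phi> (x t))"
    and \<psi>: "\<psi> \<in> borel_measurable SA" "\<And>x. x \<in> space SA \<Longrightarrow> \<bar>\<psi> x\<bar> \<le> b"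
  shows "(\<integral>x. \<phi> (x t) * \<psi> (x (t + k)) \<partial>Tr) = (\<integral>x. \<phi> (x t) * (kop (next_pair \<theta>) ^^ k) \<psi> (x t) \<partial>Tr)"
  using \<psi>
proof (induction k arbitrary: \<psi>)
  case (Suc k)
  have it: "kop (next_pair \<theta>) \<psi> \<in> borel_measurable SA \<and> (\<forall>x\<in>space SA. \<bar>kop (next_pair \<theta>) \<psi> x\<bar> \<le> b)"
    using kop_iterate[OF next_pair_kernel[of \<theta>] Suc.prems, where t=1] by simp
  have "(\<integral>x. \<phi> (x t) * \<psi> (x (t + Suc k)) \<partial>Tr) = (\<integral>x. \<phi> (x t) * kop (next_pair \<theta>) \<psi> (x (t + k)) \<partial>Tr)"
    using markov_property[OF \<phi> Suc.prems, of "t + k"] by simp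
  also have "\<dots> = (\<integral>x. \<phi> (x t) * (kop (next_pair \<theta>) ^^ k) (kop (next_pair \<theta>) \<psi>) (x t) \<partial>Tr)"
    using it by (intro Suc.IH) auto
  finally show ?case by (simp add: funpow_swap1)
qed simp

text \<open>Each term of the series is the iterated kernel integrated against the earlier factor.
  The majorant \<open>\<gamma> ^ k * (b * \<bar>\<phi> (x t)\<bar>)\<close> justifies exchanging
  series and integral, after which the resolvent stands under the integral.\<close>

lemma discounted_sum:
  assumes \<phi>: "\<phi> \<in> borel_measurable SA" "integrable Tr (\<lambda>x. \<phi> (x t))"
    and \<psi>: "\<psi> \<in> borel_measurable SA" "\<And>x. x \<in> space SA \<Longrightarrow> \<bar>\<psi> x\<bar> \<le> b"
  shows "(\<lambda>k. \<gamma> ^ k * (\<integral>x. \<phi> (x t) * \<psi> (x (t + k)) \<partial>Tr))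
      sums (\<integral>x. \<phi> (x t) * resolvent \<gamma> (next_pair \<theta>) \<psi> (x t) \<partial>Tr)"
proof -
  interpret T: prob_space Tr by (rule trajectory_prob[OF \<mu>])
  let ?K = "kop (next_pair \<theta>)"
  note it = kop_iterate[OF next_pair_kernel[of \<theta>] \<psi>]
  have b0: "0 \<le> b" using T.not_empty coordinate_in \<psi>(2) by (meson abs_ge_zero ex_in_conv order_trans)
  define f where "f k x = \<phi> (x t) * (\<gamma> ^ k * (?K ^^ k) \<psi> (x t))" for k x
  have gs: "summable (\<lambda>k. \<gamma> ^ k * (b * z))" for z
    using discount by (intro summable_mult2 summable_geometric) auto
  have le: "norm (f k x) \<le> \<gamma> ^ k * (b * norm (\<phi> (x t)))" if "x \<in> space Tr" for k x
  proof -
    have "\<bar>(?K ^^ k) \<psi> (x t)\<bar> \<le> b" using it coordinate_in[OF that] by blast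
    then have "\<bar>\<phi> (x t)\<bar> * (\<gamma> ^ k * \<bar>(?K ^^ k) \<psi> (x t)\<bar>) \<le> \<bar>\<phi> (x t)\<bar> * (\<gamma> ^ k * b)"
      using discount by (intro mult_left_mono) auto
    then show ?thesis using discount by (simp add: f_def abs_mult mult_ac)
  qed
  have fm: "f k \<in> borel_measurable Tr" for k
  proof -
    have [measurable]: "(?K ^^ k) \<psi> \<in> borel_measurable SA" using it by blast
    note [measurable] = \<phi>(1) coordinate_measurable[OF \<mu>]
    show ?thesis unfolding f_def[abs_def] by measurable
  qed
  have fI: "integrable Tr (f k)" for k
  proof (rule Bochner_Integration.integrable_bound[OF _ fm])
    show "integrable Tr (\<lambda>x. \<gamma> ^ k * b * \<phi> (x t))" by (intro integrable_mult_right \<phi>(2))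
    show "AE x in Tr. norm (f k x) \<le> norm (\<gamma> ^ k * b * \<phi> (x t))"
      using le b0 discount by (intro AE_I2) (simp add: abs_mult mult_ac)
  qed
  have "AE x in Tr. summable (\<lambda>k. norm (f k x))"
  proof (rule AE_I2)
    fix x assume "x \<in> space Tr"
    then show "summable (\<lambda>k. norm (f k x))"
      using le[of x] by (intro summable_comparison_test'[OF gs[of "norm (\<phi> (x t))"], of 0]) simp
  qed
  moreover have "summable (\<lambda>k. \<integral>x. norm (f k x) \<partial>Tr)"
  proof (rule summable_comparison_test'[OF gs[of "\<integral>x. norm (\<phi> (x t)) \<partial>Tr"], of 0])
    fix k
    have "(\<integral>x. norm (f k x) \<partial>Tr) \<le> (\<integral>x. \<gamma> ^ k * (b * norm (\<phi> (x t))) \<partial>Tr)"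
      using le \<phi>(2) by (intro integral_mono) (auto intro: fI)
    then show "norm (\<integral>x. norm (f k x) \<partial>Tr) \<le> \<gamma> ^ k * (b * (\<integral>x. norm (\<phi> (x t)) \<partial>Tr))" by simp
  qed
  ultimately have s: "(\<lambda>k. \<integral>x. f k x \<partial>Tr) sums (\<integral>x. (\<Sum>k. f k x) \<partial>Tr)"
    using sums_integral[of Tr f] fI by blast
  have "(\<integral>x. (\<Sum>k. f k x) \<partial>Tr) = (\<integral>x. \<phi> (x t) * resolvent \<gamma> (next_pair \<theta>) \<psi> (x t) \<partial>Tr)"
  proof (intro Bochner_Integration.integral_cong refl)
    fix x assume "x \<in> space Tr"
    from resolvent_summable[OF next_pair_kernel[of \<theta>] \<psi> discount coordinate_in[OF this, of t]]
    show "(\<Sum>k. f k x) = \<phi> (x t) * resolvent \<gamma> (next_pair \<theta>) \<psi> (x t)"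
      unfolding f_def resolvent_def by (rule suminf_mult)
  qed
  moreover have "(\<integral>x. f k x \<partial>Tr) = \<gamma> ^ k * (\<integral>x. \<phi> (x t) * \<psi> (x (t + k)) \<partial>Tr)" for k
  proof -
    have "f k = (\<lambda>x. \<gamma> ^ k * (\<phi> (x t) * (?K ^^ k) \<psi> (x t)))" by (simp add: f_def fun_eq_iff mult.left_commute)
    then show ?thesis by (simp add: markov_property_iterate[OF \<phi> \<psi>])
  qed
  ultimately show ?thesis using s by simp
qed

end

end

section \<open>Moments and expansions of joint policies\<close>

lemma abs_integral_le:
  fixes f g :: "'z \<Rightarrow> real"
  assumes "integrable M f" "integrable M g" "\<And>x. x \<in> space M \<Longrightarrow> \<bar>f x\<bar> \<le> g x"
  shows "\<bar>\<integral>x. f x \<partial>M\<bar> \<le> (\<integral>x. g x \<partial>M)"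
  by (rule order_trans[OF integral_abs_bound integral_mono]) (use assms in auto)

context markov
begin

lemma act_step_nn_integral:
  assumes s: "s \<in> space S" and f: "f \<in> borel_measurable SA"
  shows "(\<integral>\<^sup>+x. f x \<partial>act_step G \<theta> s) = (\<integral>\<^sup>+a. ennreal (jpol \<theta> s a) * f (s, a) \<partial>JA)"
proof -
  have P: "Pair s \<in> joint_policy G \<theta> s \<rightarrow>\<^sub>M SA"
    using s by (simp add: joint_policy_eq state_actions_def)
  have "(\<lambda>a. f (s, a)) \<in> borel_measurable JA"
    using measurable_compose[OF measurable_Pair1'[OF s] f[unfolded state_actions_def]] by simp
  then show ?thesis
    using jpol_measurable_action[OF s] f unfolding act_step_def
    by (subst nn_integral_distr[OF P]) (simp_all add: joint_policy_eq nn_integral_density)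
qed

lemma act_step_integral:
  fixes f :: "'s \<times> ('n \<Rightarrow> real ^ 'k) \<Rightarrow> real"
  assumes s: "s \<in> space S" and f: "f \<in> borel_measurable SA"
  shows "integrable (act_step G \<theta> s) f \<longleftrightarrow> integrable JA (\<lambda>a. jpol \<theta> s a * f (s, a))"
    and "act_mean \<theta> f s = (\<integral>a. jpol \<theta> s a * f (s, a) \<partial>JA)"
proof -
  have P: "Pair s \<in> joint_policy G \<theta> s \<rightarrow>\<^sub>M SA"
    using s by (simp add: joint_policy_eq state_actions_def)
  have m: "(\<lambda>a. f (s, a)) \<in> borel_measurable JA"
    using measurable_compose[OF measurable_Pair1'[OF s] f[unfolded state_actions_def]] by simp
  have ae: "AE a in JA. 0 \<le> jpol \<theta> s a" using jpol_nonneg[OF s] by simp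
  note jm = jpol_measurable_action[OF s, of \<theta>]
  show "integrable (act_step G \<theta> s) f \<longleftrightarrow> integrable JA (\<lambda>a. jpol \<theta> s a * f (s, a))"
    unfolding act_step_def using f
    by (subst integrable_distr_eq[OF P]) (simp_all add: joint_policy_eq integrable_density[OF m jm ae])
  show "act_mean \<theta> f s = (\<integral>a. jpol \<theta> s a * f (s, a) \<partial>JA)"
    unfolding act_mean_def act_step_def using f
    by (subst integral_distr[OF P]) (simp_all add: joint_policy_eq integral_density[OF m jm ae])
qed

end

section \<open>Bounded rewards and Lipschitz scores\<close>

locale smooth_markov = markov G
  for G :: "('s, 'k::finite, 'n::finite, 'm::finite) game" +
  fixes R V L :: real
  assumes R: "0 < R" and reward_bound: "\<And>i x. x \<in> space SA \<Longrightarrow> \<bar>reward G i x\<bar> \<le> R"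
    and score_moment: "\<And>i n \<theta> s. s \<in> space S \<Longrightarrow>
         integrable (policy G n \<theta> s) (\<lambda>a. (norm (score G i n \<theta> s a))\<^sup>2) \<and>
         (\<integral>a. (norm (score G i n \<theta> s a))\<^sup>2 \<partial>policy G n \<theta> s) \<le> V\<^sup>2"
    and L: "0 \<le> L"
    and score_lipschitz: "\<And>i n \<theta>1 \<theta>2 s a. s \<in> space S \<Longrightarrow> a \<in> space (act_ref G) \<Longrightarrow>
         norm (score G i n \<theta>1 s a - score G i n \<theta>2 s a) \<le> L * norm (\<theta>1 - \<theta>2)"
begin

definition nscore :: "'n \<Rightarrow> real ^ 'm \<Rightarrow> 's \<Rightarrow> real ^ 'k \<Rightarrow> real ^ 'm" where
  "nscore n \<theta> s b = full_score (owner G) (\<lambda>\<theta>. pol G n \<theta> s b) \<theta>"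

text \<open>The gradient, in the whole joint parameter, of the logarithm of the joint density at a
  pair where that density is positive.\<close>

definition jscore :: "real ^ 'm \<Rightarrow> 's \<times> ('n \<Rightarrow> real ^ 'k) \<Rightarrow> real ^ 'm" where
  "jscore \<theta> x = (\<Sum>n\<in>UNIV. nscore n \<theta> (fst x) (snd x n))"

definition K0 :: real where "K0 = real CARD('n) * L"

text \<open>A bound for the conditional second moment of \<open>jscore\<close>. Cauchy-Schwarz over
  the agents and over the blocks gives a squared number of agents, and the double sum of second
  moments gives another.\<close>

definition W :: real where "W = real CARD('n) ^ 4 * V\<^sup>2"

lemma K0_nonneg: "0 \<le> K0" using L by (simp add: K0_def)

lemma W_nonneg: "0 \<le> W" by (simp add: W_def)

lemma nscore_lipschitz:
  assumes "s \<in> space S" "b \<in> space (act_ref G)"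
  shows "norm (nscore n \<theta>1 s b - nscore n \<theta>2 s b) \<le> K0 * norm (\<theta>1 - \<theta>2)"
  unfolding nscore_def K0_def
  by (rule full_score_lipschitz) (use score_lipschitz[OF assms] in \<open>simp add: score_def\<close>)

text \<open>Positivity spreads from one parameter to all others. Thus the support of a policy is
  independent of the parameter, and two densities can be compared through their logarithms.\<close>

lemma pol_pos_or_zero:
  assumes "s \<in> space S" "b \<in> space (act_ref G)"
  shows "(\<forall>\<theta>. 0 < pol G n \<theta> s b) \<or> (\<forall>\<theta>. pol G n \<theta> s b = 0)"
proof (cases "\<exists>\<theta>. 0 < pol G n \<theta> s b")
  case True
  then obtain \<theta>0 where p: "0 < pol G n \<theta>0 s b" by blast
  have "0 < pol G n \<theta> s b" for \<theta>
    by (rule density_pos_everywhere[where f="\<lambda>\<theta>. pol G n \<theta> s b" and own="owner G" and K=K0 and x=\<theta>0])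
      (use assms p nscore_lipschitz[OF assms] K0_nonneg in \<open>auto simp: pol_differentiable pol_nonneg nscore_def\<close>)
  then show ?thesis by blast
next
  case False
  then show ?thesis using pol_nonneg[OF assms] by (meson antisym_conv not_le)
qed

lemma score_eq_block:
  assumes "s \<in> space S" "b \<in> space (act_ref G)"
  shows "score G i n \<theta> s b = block (owner G) i (nscore n \<theta> s b)"
  using pol_pos_or_zero[OF assms, of n]
proof
  assume p: "\<forall>\<theta>. 0 < pol G n \<theta> s b"
  have "GDERIV (\<lambda>\<theta>. ln (pol G n \<theta> s b)) \<theta> :> nscore n \<theta> s b"
    unfolding nscore_def by (rule ln_GDERIV(1)[OF pol_differentiable[OF assms]]) (use p in blast)
  from full_score_GDERIV(2)[OF this] show ?thesis by (simp add: score_def)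
next
  assume z: "\<forall>\<theta>. pol G n \<theta> s b = 0"
  have "pgrad (owner G) i (\<lambda>\<theta>. ln (pol G n \<theta> s b)) \<theta> = 0" "full_score (owner G) (\<lambda>\<theta>. pol G n \<theta> s b) \<theta> = 0"
    by (rule full_score_zero; use z in blast)+
  then show ?thesis unfolding score_def nscore_def by (simp only:) (simp add: vec_eq_iff)
qed

text \<open>Identifies the vector factor of the stochastic gradient with a block of the joint score,
  for which the policy gradient formula will be proved.\<close>

lemma score_sum_eq_block:
  assumes "x \<in> space SA"
  shows "score_sum G i \<theta> x = block (owner G) i (jscore \<theta> x)"
proof -
  interpret b: bounded_linear "block (owner G) i" by (rule bounded_linear_block)
  have "score G i n \<theta> (fst x) (snd x n) = block (owner G) i (nscore n \<theta> (fst x) (snd x n))" for n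
    using assms by (intro score_eq_block) (auto simp: space_SA space_JA)
  then show ?thesis by (simp add: score_sum_def case_prod_beta jscore_def b.sum)
qed

section \<open>Measurability and moments of the scores\<close>

text \<open>A gradient obtained by \<open>THE\<close> carries no measurability; here it is the
  pointwise limit of difference quotients of the log-density with steps
  \<open>1 / real (Suc k)\<close>. Where the density vanishes, all quotients are zero and so is the
  score.\<close>

lemma nscore_component_measurable:
  "(\<lambda>(s, b). nscore n \<theta> s b $ m) \<in> borel_measurable (S \<Otimes>\<^sub>M act_ref G)"
proof (rule borel_measurable_LIMSEQ_real)
  fix k
  show "(\<lambda>(s, b). real (Suc k) * (ln (pol G n (\<theta> + (1 / real (Suc k)) *\<^sub>R axis m 1) s b) - ln (pol G n \<theta> s b)))
      \<in> borel_measurable (S \<Otimes>\<^sub>M act_ref G)"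
    using pol_measurable[of n \<theta>] pol_measurable[of n "\<theta> + (1 / real (Suc k)) *\<^sub>R axis m 1"]
    unfolding case_prod_beta by measurable
next
  fix x assume x: "x \<in> space (S \<Otimes>\<^sub>M act_ref G)"
  obtain s b where sb: "x = (s, b)" "s \<in> space S" "b \<in> space (act_ref G)"
    using x by (auto simp: space_pair_measure)
  show "(\<lambda>k. case x of (s, b) \<Rightarrow> real (Suc k) * (ln (pol G n (\<theta> + (1 / real (Suc k)) *\<^sub>R axis m 1) s b) - ln (pol G n \<theta> s b)))
      \<longlonglongrightarrow> (case x of (s, b) \<Rightarrow> nscore n \<theta> s b $ m)"
    using pol_pos_or_zero[OF sb(2,3), of n]
  proof
    assume p: "\<forall>\<theta>. 0 < pol G n \<theta> s b"
    have "GDERIV (\<lambda>\<theta>. ln (pol G n \<theta> s b)) \<theta> :> nscore n \<theta> s b"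
      unfolding nscore_def by (rule ln_GDERIV(1)[OF pol_differentiable[OF sb(2,3)]]) (use p in blast)
    then have "GDERIV (\<lambda>\<theta>. ln (pol G n \<theta> s b)) (\<theta> + 0 *\<^sub>R axis m 1) :> nscore n \<theta> s b" by simp
    from segment_deriv[OF this]
    have "((\<lambda>t. ln (pol G n (\<theta> + t *\<^sub>R axis m 1) s b)) has_real_derivative nscore n \<theta> s b $ m) (at 0)"
      by (simp add: inner_axis')
    then have l: "((\<lambda>t. (ln (pol G n (\<theta> + t *\<^sub>R axis m 1) s b) - ln (pol G n \<theta> s b)) / t) \<longlongrightarrow> nscore n \<theta> s b $ m) (at 0)"
      by (simp add: has_field_derivative_iff)
    have "filterlim (\<lambda>k. 1 / real (Suc k)) (at 0) sequentially"
      using LIMSEQ_inverse_real_of_nat by (auto simp: filterlim_at inverse_eq_divide)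
    from filterlim_compose[OF l this] show ?thesis by (simp add: sb mult.commute)
  next
    assume "\<forall>\<theta>. pol G n \<theta> s b = 0"
    then show ?thesis by (simp add: sb nscore_def full_score_zero)
  qed
qed

lemma borel_measurable_vecI:
  fixes f :: "'z \<Rightarrow> real ^ 'm"
  assumes "\<And>m. (\<lambda>x. f x $ m) \<in> borel_measurable N"
  shows "f \<in> borel_measurable N"
  unfolding borel_measurable_euclidean_space[of f]
  using assms by (auto simp: Basis_vec_def inner_axis)

lemma nscore_measurable: "(\<lambda>(s, b). nscore n \<theta> s b) \<in> borel_measurable (S \<Otimes>\<^sub>M act_ref G)"
  by (rule borel_measurable_vecI) (use nscore_component_measurable in \<open>simp add: case_prod_beta\<close>)

lemma jscore_measurable [measurable]: "jscore \<theta> \<in> borel_measurable SA"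
  unfolding jscore_def[abs_def] state_actions_def
proof (rule borel_measurable_sum)
  fix n
  have "(\<lambda>x. (fst x, snd x n)) \<in> S \<Otimes>\<^sub>M JA \<rightarrow>\<^sub>M S \<Otimes>\<^sub>M act_ref G"
    unfolding joint_actions_def by measurable
  from measurable_compose[OF this nscore_measurable]
  show "(\<lambda>x. nscore n \<theta> (fst x) (snd x n)) \<in> borel_measurable (S \<Otimes>\<^sub>M JA)" by (simp add: case_prod_beta)
qed

lemma score_sum_measurable [measurable]: "score_sum G i \<theta> \<in> borel_measurable SA"
proof -
  have "(\<lambda>x. block (owner G) i (jscore \<theta> x)) \<in> borel_measurable SA"
    by (rule measurable_compose[OF jscore_measurable
          borel_measurable_continuous_onI[OF linear_continuous_on[OF bounded_linear_block]]])
  then show ?thesis by (rule measurable_cong[THEN iffD1, rotated]) (simp add: score_sum_eq_block)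
qed

lemma nscore_square:
  assumes "s \<in> space S" "b \<in> space (act_ref G)"
  shows "(norm (nscore n \<theta> s b))\<^sup>2 \<le> real CARD('n) * (\<Sum>i\<in>UNIV. (norm (score G i n \<theta> s b))\<^sup>2)"
proof -
  have "norm (nscore n \<theta> s b) \<le> (\<Sum>i\<in>UNIV. norm (score G i n \<theta> s b))"
    unfolding nscore_def full_score_def score_def by (rule norm_sum)
  then have "(norm (nscore n \<theta> s b))\<^sup>2 \<le> (\<Sum>i\<in>UNIV. norm (score G i n \<theta> s b))\<^sup>2" by (intro power_mono) auto
  also have "\<dots> \<le> (\<Sum>i\<in>UNIV. (norm (score G i n \<theta> s b))\<^sup>2) * real CARD('n)"
    by (rule sum_squared_le_sum_of_squares)
  finally show ?thesis by (simp add: mult.commute)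
qed

lemma score_measurable_action:
  assumes s: "s \<in> space S"
  shows "score G i n \<theta> s \<in> borel_measurable (act_ref G)"
proof -
  have "(\<lambda>b. nscore n \<theta> s b) \<in> borel_measurable (act_ref G)"
    using measurable_compose[OF measurable_Pair1'[OF s] nscore_measurable] by simp
  then have "(\<lambda>b. block (owner G) i (nscore n \<theta> s b)) \<in> borel_measurable (act_ref G)"
    by (rule measurable_compose[OF _ borel_measurable_continuous_onI[OF linear_continuous_on[OF bounded_linear_block]]])
  then show ?thesis by (rule measurable_cong[THEN iffD1, rotated]) (simp add: score_eq_block[OF s])
qed

lemma score_moment_nn:
  assumes s: "s \<in> space S"
  shows "(\<integral>\<^sup>+b. ennreal (pol G n \<theta> s b) * ennreal ((norm (score G i n \<theta> s b))\<^sup>2) \<partial>act_ref G) \<le> ennreal (V\<^sup>2)"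
proof -
  note [measurable] = score_measurable_action[OF s] pol_measurable_action[OF s]
  have "(\<integral>\<^sup>+b. ennreal (pol G n \<theta> s b) * ennreal ((norm (score G i n \<theta> s b))\<^sup>2) \<partial>act_ref G)
      = (\<integral>\<^sup>+b. ennreal ((norm (score G i n \<theta> s b))\<^sup>2) \<partial>policy G n \<theta> s)"
    unfolding policy_def by (subst nn_integral_density) measurable
  also have "\<dots> = ennreal (\<integral>b. (norm (score G i n \<theta> s b))\<^sup>2 \<partial>policy G n \<theta> s)"
    using score_moment[OF s] by (intro nn_integral_eq_integral) auto
  also have "\<dots> \<le> ennreal (V\<^sup>2)" using score_moment[OF s] by (intro ennreal_leI) blast
  finally show ?thesis .
qed

lemma jscore_square_pointwise:
  assumes "s \<in> space S" "a \<in> space JA"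
  shows "(norm (jscore \<theta> (s, a)))\<^sup>2
    \<le> (real CARD('n))\<^sup>2 * (\<Sum>n\<in>UNIV. \<Sum>i\<in>UNIV. (norm (score G i n \<theta> s (a n)))\<^sup>2)"
proof -
  have "norm (jscore \<theta> (s, a)) \<le> (\<Sum>n\<in>UNIV. norm (nscore n \<theta> s (a n)))"
    unfolding jscore_def fst_conv snd_conv by (rule norm_sum)
  then have "(norm (jscore \<theta> (s, a)))\<^sup>2 \<le> (\<Sum>n\<in>UNIV. norm (nscore n \<theta> s (a n)))\<^sup>2" by (intro power_mono) auto
  also have "\<dots> \<le> (\<Sum>n\<in>UNIV. (norm (nscore n \<theta> s (a n)))\<^sup>2) * real CARD('n)"
    by (rule sum_squared_le_sum_of_squares)
  also have "\<dots> \<le> (\<Sum>n\<in>UNIV. real CARD('n) * (\<Sum>i\<in>UNIV. (norm (score G i n \<theta> s (a n)))\<^sup>2)) * real CARD('n)"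
    using assms by (intro mult_right_mono sum_mono nscore_square) (auto simp: space_JA)
  finally show ?thesis by (simp add: sum_distrib_left power2_eq_square mult_ac)
qed

text \<open>After the pointwise Cauchy-Schwarz bound every summand depends on the action of a single
  agent, so its joint expectation is one under that agent's own policy.\<close>

lemma jscore_second_moment:
  assumes s: "s \<in> space S"
  shows "(\<integral>\<^sup>+x. ennreal ((norm (jscore \<theta> x))\<^sup>2) \<partial>act_step G \<theta> s) \<le> ennreal W"
proof -
  let ?N = "real CARD('n)"
  have sm: "(\<lambda>a. ennreal ((norm (score G i n \<theta> s (a n)))\<^sup>2)) \<in> borel_measurable JA" for i n
  proof -
    have "(\<lambda>a. a n) \<in> JA \<rightarrow>\<^sub>M act_ref G" unfolding joint_actions_def by measurable
    note [measurable] = measurable_compose[OF this score_measurable_action[OF s]]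
    show ?thesis by measurable
  qed
  note [measurable] = sm jpol_measurable_action[OF s]
  have "(\<integral>\<^sup>+x. ennreal ((norm (jscore \<theta> x))\<^sup>2) \<partial>act_step G \<theta> s)
      = (\<integral>\<^sup>+a. ennreal (jpol \<theta> s a) * ennreal ((norm (jscore \<theta> (s, a)))\<^sup>2) \<partial>JA)"
    by (rule act_step_nn_integral[OF s]) measurable
  also have "\<dots> \<le> (\<integral>\<^sup>+a. (\<Sum>n\<in>UNIV. \<Sum>i\<in>UNIV. ennreal (?N\<^sup>2) * (ennreal (jpol \<theta> s a) * ennreal ((norm (score G i n \<theta> s (a n)))\<^sup>2))) \<partial>JA)"
  proof (rule nn_integral_mono)
    fix a assume a: "a \<in> space JA"
    have "ennreal ((norm (jscore \<theta> (s, a)))\<^sup>2)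
        \<le> ennreal (?N\<^sup>2) * (\<Sum>n\<in>UNIV. \<Sum>i\<in>UNIV. ennreal ((norm (score G i n \<theta> s (a n)))\<^sup>2))"
      using ennreal_leI[OF jscore_square_pointwise[OF s a, of \<theta>]]
      by (simp add: ennreal_mult sum_nonneg)
    from mult_left_mono[OF this, of "ennreal (jpol \<theta> s a)"]
    show "ennreal (jpol \<theta> s a) * ennreal ((norm (jscore \<theta> (s, a)))\<^sup>2)
      \<le> (\<Sum>n\<in>UNIV. \<Sum>i\<in>UNIV. ennreal (?N\<^sup>2) * (ennreal (jpol \<theta> s a) * ennreal ((norm (score G i n \<theta> s (a n)))\<^sup>2)))"
      by (simp add: sum_distrib_left mult_ac del: sum_ennreal)
  qed
  also have "\<dots> = (\<Sum>n\<in>UNIV. \<Sum>i\<in>UNIV. ennreal (?N\<^sup>2) * (\<integral>\<^sup>+a. ennreal (jpol \<theta> s a) * ennreal ((norm (score G i n \<theta> s (a n)))\<^sup>2) \<partial>JA))"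
    by (simp add: nn_integral_sum nn_integral_cmult)
  also have "\<dots> \<le> (\<Sum>n\<in>(UNIV::'n set). \<Sum>i\<in>(UNIV::'n set). ennreal (?N\<^sup>2) * ennreal (V\<^sup>2))"
  proof (intro sum_mono mult_left_mono)
    fix n i
    have "(\<integral>\<^sup>+a. ennreal (jpol \<theta> s a) * ennreal ((norm (score G i n \<theta> s (a n)))\<^sup>2) \<partial>JA)
        = (\<integral>\<^sup>+b. ennreal (pol G n \<theta> s b) * ennreal ((norm (score G i n \<theta> s b))\<^sup>2) \<partial>act_ref G)"
      using score_measurable_action[OF s] by (intro joint_policy_component[OF s]) measurable
    then show "(\<integral>\<^sup>+a. ennreal (jpol \<theta> s a) * ennreal ((norm (score G i n \<theta> s (a n)))\<^sup>2) \<partial>JA) \<le> ennreal (V\<^sup>2)"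
      using score_moment_nn[OF s] by simp
  qed simp
  also have "\<dots> = ennreal W"
    by (simp add: W_def ennreal_mult'[symmetric] ennreal_of_nat_eq_real_of_nat power2_eq_square power4_eq_xxxx mult_ac)
  finally show ?thesis .
qed

lemma act_bounded_jscore:
  assumes f: "f \<in> borel_measurable SA" and b: "\<And>x. x \<in> space SA \<Longrightarrow> \<bar>f x\<bar> \<le> b" "0 \<le> b"
    and g: "g \<in> borel_measurable SA" "\<And>x. x \<in> space SA \<Longrightarrow> \<bar>g x\<bar> \<le> c0 + c2 * (norm (jscore \<theta> x))\<^sup>2"
      "0 \<le> c0" "0 \<le> c2"
  shows "act_bounded \<theta> (b * (c0 + c2 * W)) (\<lambda>x. f x * g x)"
  unfolding act_bounded_def
proof (intro conjI ballI)
  show "(\<lambda>x. f x * g x) \<in> borel_measurable SA" using f g(1) by measurable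
  show "0 \<le> b * (c0 + c2 * W)" using assms W_nonneg by simp
  fix s assume s: "s \<in> space S"
  note k = prob_kernelD[OF act_step_kernel[of \<theta>] s]
  have "(\<integral>\<^sup>+x. ennreal \<bar>f x * g x\<bar> \<partial>act_step G \<theta> s)
      \<le> (\<integral>\<^sup>+x. ennreal b * (ennreal c0 + ennreal c2 * ennreal ((norm (jscore \<theta> x))\<^sup>2)) \<partial>act_step G \<theta> s)"
  proof (rule nn_integral_mono)
    fix x assume "x \<in> space (act_step G \<theta> s)"
    then have x: "x \<in> space SA" using k by simp
    have "\<bar>f x * g x\<bar> \<le> b * (c0 + c2 * (norm (jscore \<theta> x))\<^sup>2)"
      unfolding abs_mult using b(1)[OF x] g(2)[OF x] b(2) by (intro mult_mono) auto
    then show "ennreal \<bar>f x * g x\<bar> \<le> ennreal b * (ennreal c0 + ennreal c2 * ennreal ((norm (jscore \<theta> x))\<^sup>2))"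
      using b g by (simp add: ennreal_mult[symmetric] ennreal_plus[symmetric] del: ennreal_plus)
  qed
  also have "\<dots> = ennreal b * (ennreal c0 + ennreal c2 * (\<integral>\<^sup>+x. ennreal ((norm (jscore \<theta> x))\<^sup>2) \<partial>act_step G \<theta> s))"
  proof -
    have m: "(\<lambda>x. ennreal ((norm (jscore \<theta> x))\<^sup>2)) \<in> borel_measurable (act_step G \<theta> s)"
      using k(2) jscore_measurable by (simp cong: measurable_cong_sets)
    show ?thesis using m prob_space.emeasure_space_1[OF k(1)] by (simp add: nn_integral_cmult nn_integral_add)
  qed
  also have "\<dots> \<le> ennreal b * (ennreal c0 + ennreal c2 * ennreal W)"
    using jscore_second_moment[OF s] by (intro mult_left_mono add_left_mono) auto
  also have "\<dots> = ennreal (b * (c0 + c2 * W))"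
    using b g W_nonneg by (simp add: ennreal_mult ennreal_plus)
  finally show "(\<integral>\<^sup>+x. ennreal \<bar>f x * g x\<bar> \<partial>act_step G \<theta> s) \<le> ennreal (b * (c0 + c2 * W))" .
qed

text \<open>Lets the second moment also control the terms linear in the score, so a single constant
  \<open>W\<close> suffices.\<close>

lemma norm_le_one_plus_square: "norm (y :: 'z::real_normed_vector) \<le> 1 + (norm y)\<^sup>2"
  using zero_le_power2[of "norm y - 1"] norm_ge_zero[of y] unfolding power2_diff power_one by linarith

lemma jscore_component_le: "\<bar>jscore \<theta> x $ m\<bar> \<le> 1 + 1 * (norm (jscore \<theta> x))\<^sup>2"
proof -
  have "\<bar>jscore \<theta> x $ m\<bar> \<le> norm (jscore \<theta> x)" by (rule component_le_norm_cart)
  also have "\<dots> \<le> 1 + (norm (jscore \<theta> x))\<^sup>2"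
    by (rule norm_le_one_plus_square)
  finally show ?thesis by simp
qed

lemma jscore_component_measurable: "(\<lambda>x. jscore \<theta> x $ m) \<in> borel_measurable SA"
  by (rule measurable_compose[OF jscore_measurable
        borel_measurable_continuous_onI[OF linear_continuous_on[OF bounded_linear_vec_nth]]])

lemma act_bounded_score:
  assumes "f \<in> borel_measurable SA" "\<And>x. x \<in> space SA \<Longrightarrow> \<bar>f x\<bar> \<le> b" "0 \<le> b"
  shows "act_bounded \<theta> (b * (1 + W)) (\<lambda>x. f x * jscore \<theta> x $ m)"
  using act_bounded_jscore[OF assms jscore_component_measurable jscore_component_le[of \<theta> _ m]] by simp

section \<open>Expansion of expectations over actions\<close>

definition c0 :: real where "c0 = real CARD('n) * K0"

text \<open>Dominates both integrated bounds: \<open>2 * (1 + c0) + 2 * W\<close> for the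
  first-order estimate and \<open>4 * W + 4 * c0\<^sup>2 + c0\<close> for the second-order
  one.\<close>

definition C1 :: real where "C1 = 4 * W + 4 * c0\<^sup>2 + 2 * c0 + 2"

lemma c0_nonneg: "0 \<le> c0" by (simp add: c0_def K0_nonneg)

lemma C1_nonneg: "0 \<le> C1" using W_nonneg c0_nonneg by (simp add: C1_def)

text \<open>If one factor vanishes for some parameter, it vanishes for all, and there is nothing to
  expand. Otherwise the logarithms of the factors add up, and so do their quadratic remainders,
  which gives \<open>c0\<close>.\<close>

lemma jpol_expansion:
  assumes s: "s \<in> space S" and a: "a \<in> space JA" and h: "norm h \<le> 1"
  shows "\<bar>jpol (\<theta> + h) s a - jpol \<theta> s a\<bar>
      \<le> norm h * (jpol \<theta> s a * (norm (jscore \<theta> (s, a)) + c0) + jpol (\<theta> + h) s a * (norm (jscore (\<theta> + h) (s, a)) + c0))"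
    and "\<bar>jpol (\<theta> + h) s a - jpol \<theta> s a - jpol \<theta> s a * (h \<bullet> jscore \<theta> (s, a))\<bar>
      \<le> (norm h)\<^sup>2 * (jpol \<theta> s a * (2 * (norm (jscore \<theta> (s, a)))\<^sup>2 + 2 * c0\<^sup>2 + c0)
        + jpol (\<theta> + h) s a * (2 * (norm (jscore (\<theta> + h) (s, a)))\<^sup>2 + 2 * c0\<^sup>2))"
proof -
  have an: "a n \<in> space (act_ref G)" for n using a by (simp add: space_JA)
  have "(\<forall>n \<theta>. 0 < pol G n \<theta> s (a n)) \<or> (\<forall>\<theta>. jpol \<theta> s a = 0)"
    unfolding jpol_def using pol_pos_or_zero[OF s an] by (metis UNIV_I finite prod_zero_iff)
  then consider "\<forall>n \<theta>. 0 < pol G n \<theta> s (a n)" | "\<forall>\<theta>. jpol \<theta> s a = 0" by blast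
  then have "\<bar>jpol (\<theta> + h) s a - jpol \<theta> s a\<bar>
      \<le> norm h * (jpol \<theta> s a * (norm (jscore \<theta> (s, a)) + c0) + jpol (\<theta> + h) s a * (norm (jscore (\<theta> + h) (s, a)) + c0))
    \<and> \<bar>jpol (\<theta> + h) s a - jpol \<theta> s a - jpol \<theta> s a * (h \<bullet> jscore \<theta> (s, a))\<bar>
      \<le> (norm h)\<^sup>2 * (jpol \<theta> s a * (2 * (norm (jscore \<theta> (s, a)))\<^sup>2 + 2 * c0\<^sup>2 + c0)
        + jpol (\<theta> + h) s a * (2 * (norm (jscore (\<theta> + h) (s, a)))\<^sup>2 + 2 * c0\<^sup>2))"
  proof cases
    case 1
    have ln: "\<bar>ln (jpol (\<theta> + v) s a) - ln (jpol \<theta> s a) - v \<bullet> jscore \<theta> (s, a)\<bar> \<le> c0 * (norm v)\<^sup>2" for \<theta> v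
    proof -
      have "ln (jpol \<theta> s a) = (\<Sum>n\<in>UNIV. ln (pol G n \<theta> s (a n)))" for \<theta>
        unfolding jpol_def using 1 by (intro ln_prod) (auto simp: less_imp_neq[symmetric])
      then have "ln (jpol (\<theta> + v) s a) - ln (jpol \<theta> s a) - v \<bullet> jscore \<theta> (s, a)
          = (\<Sum>n\<in>UNIV. ln (pol G n (\<theta> + v) s (a n)) - ln (pol G n \<theta> s (a n)) - v \<bullet> nscore n \<theta> s (a n))"
        by (simp add: jscore_def inner_sum_right sum_subtractf)
      also have "\<bar>\<dots>\<bar> \<le> (\<Sum>n\<in>(UNIV::'n set). K0 * (norm v)\<^sup>2)"
      proof (rule order_trans[OF sum_abs sum_mono])
        fix n
        show "\<bar>ln (pol G n (\<theta> + v) s (a n)) - ln (pol G n \<theta> s (a n)) - v \<bullet> nscore n \<theta> s (a n)\<bar> \<le> K0 * (norm v)\<^sup>2"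
          unfolding nscore_def
          by (rule ln_density_expansion[where f="\<lambda>\<theta>. pol G n \<theta> s (a n)"])
            (use 1 nscore_lipschitz[OF s an] K0_nonneg in \<open>auto simp: pol_differentiable[OF s an] nscore_def\<close>)
      qed
      finally show ?thesis by (simp add: c0_def mult_ac)
    qed
    have pos: "0 < jpol \<theta> s a" for \<theta> unfolding jpol_def using 1 by (intro prod_pos) auto
    \<comment> \<open>Expanding at \<open>\<theta> + h\<close> in the direction \<open>- h\<close>
      provides the same log-ratio with the score of the other end point.\<close>
    have ln': "\<bar>ln (jpol (\<theta> + h) s a) - ln (jpol \<theta> s a) - h \<bullet> jscore (\<theta> + h) (s, a)\<bar> \<le> c0 * (norm h)\<^sup>2"
      using ln[of "\<theta> + h" "- h"] by simp
    show ?thesis using density_expansion[OF pos pos ln ln' c0_nonneg h] by blast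
  qed simp
  then show "\<bar>jpol (\<theta> + h) s a - jpol \<theta> s a\<bar>
      \<le> norm h * (jpol \<theta> s a * (norm (jscore \<theta> (s, a)) + c0) + jpol (\<theta> + h) s a * (norm (jscore (\<theta> + h) (s, a)) + c0))"
    "\<bar>jpol (\<theta> + h) s a - jpol \<theta> s a - jpol \<theta> s a * (h \<bullet> jscore \<theta> (s, a))\<bar>
      \<le> (norm h)\<^sup>2 * (jpol \<theta> s a * (2 * (norm (jscore \<theta> (s, a)))\<^sup>2 + 2 * c0\<^sup>2 + c0)
        + jpol (\<theta> + h) s a * (2 * (norm (jscore (\<theta> + h) (s, a)))\<^sup>2 + 2 * c0\<^sup>2))"
    by blast+
qed

text \<open>In the pointwise expansion each density stands next to its own score, so integrating
  over actions produces moments under the policy at \<open>\<theta>\<close> or at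
  \<open>\<theta> + h\<close>, both bounded through \<open>W\<close>.\<close>

lemma act_mean_expansion:
  assumes s: "s \<in> space S" and f: "f \<in> borel_measurable SA" and b: "\<And>x. x \<in> space SA \<Longrightarrow> \<bar>f x\<bar> \<le> b" "0 \<le> b"
    and h: "norm h \<le> 1"
  shows "\<bar>act_mean (\<theta> + h) f s - act_mean \<theta> f s\<bar> \<le> b * C1 * norm h"
    and "\<bar>act_mean (\<theta> + h) f s - act_mean \<theta> f s - h \<bullet> (\<chi> m. act_mean \<theta> (\<lambda>x. f x * jscore \<theta> x $ m) s)\<bar>
      \<le> b * C1 * (norm h)\<^sup>2"
proof -
  let ?p = "jpol \<theta> s" and ?q = "jpol (\<theta> + h) s"
  let ?J = "\<lambda>a. jscore \<theta> (s, a)" and ?J' = "\<lambda>a. jscore (\<theta> + h) (s, a)"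
  have x: "(s, a) \<in> space SA" if "a \<in> space JA" for a using s that by (simp add: space_SA)
  have fb: "act_bounded \<theta> b f" for \<theta> using f b by (rule act_boundedI)
  note fs = act_bounded_score[OF f b]
  have If: "integrable JA (\<lambda>a. jpol \<theta> s a * f (s, a))" for \<theta>
    using act_bounded_integrable[OF fb s] act_step_integral(1)[OF s f] by blast
  have If1: "integrable JA (\<lambda>a. ?p a * (f (s, a) * ?J a $ m))" for m
    using act_bounded_integrable[OF fs s, of \<theta> m] act_step_integral(1)[OF s act_bounded_measurable[OF fs], of \<theta> \<theta> m] by simp
  have G: "integrable JA (\<lambda>a. jpol \<theta> s a * g (s, a))" "\<bar>\<integral>a. jpol \<theta> s a * g (s, a) \<partial>JA\<bar> \<le> e0 + e2 * W"
    if g: "g \<in> borel_measurable SA" "\<And>x. \<bar>g x\<bar> \<le> e0 + e2 * (norm (jscore \<theta> x))\<^sup>2" "0 \<le> e0" "0 \<le> e2" for g \<theta> e0 e2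
  proof -
    have "act_bounded \<theta> (1 * (e0 + e2 * W)) (\<lambda>x. 1 * g x)"
      by (rule act_bounded_jscore) (use g in auto)
    then have A: "act_bounded \<theta> (e0 + e2 * W) g" by simp
    show "integrable JA (\<lambda>a. jpol \<theta> s a * g (s, a))"
      using act_bounded_integrable[OF A s] act_step_integral(1)[OF s g(1)] by blast
    show "\<bar>\<integral>a. jpol \<theta> s a * g (s, a) \<partial>JA\<bar> \<le> e0 + e2 * W"
      using act_mean_bound[OF A s] act_step_integral(2)[OF s g(1)] by simp
  qed
  have nJ: "norm (jscore \<theta> x) \<le> 1 + (norm (jscore \<theta> x))\<^sup>2" for \<theta> x by (rule norm_le_one_plus_square)
  have m1: "(\<lambda>x. norm (jscore \<theta> x) + c0) \<in> borel_measurable SA"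
    and m2: "(\<lambda>x. 2 * (norm (jscore \<theta> x))\<^sup>2 + e) \<in> borel_measurable SA" for \<theta> e by measurable
  have G1: "integrable JA (\<lambda>a. jpol \<theta> s a * (norm (jscore \<theta> (s, a)) + c0))"
      "\<bar>\<integral>a. jpol \<theta> s a * (norm (jscore \<theta> (s, a)) + c0) \<partial>JA\<bar> \<le> (1 + c0) + 1 * W" for \<theta>
  proof -
    have "\<bar>norm (jscore \<theta> x) + c0\<bar> \<le> (1 + c0) + 1 * (norm (jscore \<theta> x))\<^sup>2" for x
      using nJ[of \<theta> x] c0_nonneg by (simp add: abs_of_nonneg)
    from G[OF m1 this] c0_nonneg
    show "integrable JA (\<lambda>a. jpol \<theta> s a * (norm (jscore \<theta> (s, a)) + c0))"
      "\<bar>\<integral>a. jpol \<theta> s a * (norm (jscore \<theta> (s, a)) + c0) \<partial>JA\<bar> \<le> (1 + c0) + 1 * W" by simp_all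
  qed
  have G2: "integrable JA (\<lambda>a. jpol \<theta> s a * (2 * (norm (jscore \<theta> (s, a)))\<^sup>2 + e))"
      "\<bar>\<integral>a. jpol \<theta> s a * (2 * (norm (jscore \<theta> (s, a)))\<^sup>2 + e) \<partial>JA\<bar> \<le> e + 2 * W" if "0 \<le> e" for \<theta> e
  proof -
    have "\<bar>2 * (norm (jscore \<theta> x))\<^sup>2 + e\<bar> \<le> e + 2 * (norm (jscore \<theta> x))\<^sup>2" for x using that by simp
    from G[OF m2 this] that
    show "integrable JA (\<lambda>a. jpol \<theta> s a * (2 * (norm (jscore \<theta> (s, a)))\<^sup>2 + e))"
      "\<bar>\<integral>a. jpol \<theta> s a * (2 * (norm (jscore \<theta> (s, a)))\<^sup>2 + e) \<partial>JA\<bar> \<le> e + 2 * W" by simp_all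
  qed
  have e: "act_mean \<theta> f s = (\<integral>a. jpol \<theta> s a * f (s, a) \<partial>JA)" for \<theta> by (rule act_step_integral(2)[OF s f])
  have eq1: "act_mean (\<theta> + h) f s - act_mean \<theta> f s = (\<integral>a. (?q a - ?p a) * f (s, a) \<partial>JA)"
    unfolding e by (simp add: If left_diff_distrib)
  have "\<bar>\<integral>a. (?q a - ?p a) * f (s, a) \<partial>JA\<bar> \<le> (\<integral>a. b * norm h * (?p a * (norm (?J a) + c0) + ?q a * (norm (?J' a) + c0)) \<partial>JA)"
  proof (rule abs_integral_le)
    show "integrable JA (\<lambda>a. (?q a - ?p a) * f (s, a))" using If by (simp add: left_diff_distrib)
    show "integrable JA (\<lambda>a. b * norm h * (?p a * (norm (?J a) + c0) + ?q a * (norm (?J' a) + c0)))"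
      by (intro integrable_mult_right Bochner_Integration.integrable_add G1)
    fix a assume a: "a \<in> space JA"
    have "\<bar>(?q a - ?p a) * f (s, a)\<bar>
        \<le> (norm h * (?p a * (norm (?J a) + c0) + ?q a * (norm (?J' a) + c0))) * b"
      unfolding abs_mult by (intro mult_mono jpol_expansion(1)[OF s a h] b(1)[OF x[OF a]]
          order_trans[OF abs_ge_zero jpol_expansion(1)[OF s a h]] abs_ge_zero)
    then show "\<bar>(?q a - ?p a) * f (s, a)\<bar> \<le> b * norm h * (?p a * (norm (?J a) + c0) + ?q a * (norm (?J' a) + c0))"
      by (simp add: mult_ac)
  qed
  also have "\<dots> = b * norm h * ((\<integral>a. ?p a * (norm (?J a) + c0) \<partial>JA) + (\<integral>a. ?q a * (norm (?J' a) + c0) \<partial>JA))"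
    using G1 by simp
  also have "\<dots> \<le> b * norm h * C1"
  proof (rule mult_left_mono)
    show "(\<integral>a. ?p a * (norm (?J a) + c0) \<partial>JA) + (\<integral>a. ?q a * (norm (?J' a) + c0) \<partial>JA) \<le> C1"
      using abs_le_D1[OF G1(2)[of \<theta>]] abs_le_D1[OF G1(2)[of "\<theta> + h"]] W_nonneg c0_nonneg zero_le_power2[of c0]
      unfolding C1_def by linarith
  qed (use b(2) in simp)
  finally show "\<bar>act_mean (\<theta> + h) f s - act_mean \<theta> f s\<bar> \<le> b * C1 * norm h" unfolding eq1 by (simp only: mult.commute mult.left_commute)

  have "h \<bullet> (\<chi> m. act_mean \<theta> (\<lambda>x. f x * jscore \<theta> x $ m) s) = (\<Sum>m\<in>UNIV. h $ m * (\<integral>a. ?p a * (f (s, a) * ?J a $ m) \<partial>JA))"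
    using act_step_integral(2)[OF s act_bounded_measurable[OF fs]] by (simp add: inner_vec_def)
  also have "\<dots> = (\<integral>a. (\<Sum>m\<in>UNIV. h $ m * (?p a * (f (s, a) * ?J a $ m))) \<partial>JA)"
    using If1 by (subst Bochner_Integration.integral_sum) auto
  also have "\<dots> = (\<integral>a. ?p a * (h \<bullet> ?J a) * f (s, a) \<partial>JA)"
    by (intro Bochner_Integration.integral_cong refl) (simp add: inner_vec_def sum_distrib_left sum_distrib_right mult_ac)
  finally have hJ: "h \<bullet> (\<chi> m. act_mean \<theta> (\<lambda>x. f x * jscore \<theta> x $ m) s) = (\<integral>a. ?p a * (h \<bullet> ?J a) * f (s, a) \<partial>JA)" .
  have "integrable JA (\<lambda>a. (\<Sum>m\<in>UNIV. h $ m * (?p a * (f (s, a) * ?J a $ m))))"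
    using If1 by (intro Bochner_Integration.integrable_sum integrable_mult_right)
  then have IhJ: "integrable JA (\<lambda>a. ?p a * (h \<bullet> ?J a) * f (s, a))"
    by (rule Bochner_Integration.integrable_cong[THEN iffD1, rotated 2])
      (simp_all add: inner_vec_def sum_distrib_left sum_distrib_right mult_ac)
  have eq2: "act_mean (\<theta> + h) f s - act_mean \<theta> f s - h \<bullet> (\<chi> m. act_mean \<theta> (\<lambda>x. f x * jscore \<theta> x $ m) s)
      = (\<integral>a. (?q a - ?p a - ?p a * (h \<bullet> ?J a)) * f (s, a) \<partial>JA)"
    unfolding e hJ by (simp add: If IhJ left_diff_distrib)
  have "\<bar>\<integral>a. (?q a - ?p a - ?p a * (h \<bullet> ?J a)) * f (s, a) \<partial>JA\<bar> \<le> (\<integral>a. b * (norm h)\<^sup>2 * (?p a * (2 * (norm (?J a))\<^sup>2 + (2 * c0\<^sup>2 + c0)) + ?q a * (2 * (norm (?J' a))\<^sup>2 + 2 * c0\<^sup>2)) \<partial>JA)"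
  proof (rule abs_integral_le)
    show "integrable JA (\<lambda>a. (?q a - ?p a - ?p a * (h \<bullet> ?J a)) * f (s, a))"
      using If IhJ by (simp add: left_diff_distrib)
    show "integrable JA (\<lambda>a. b * (norm h)\<^sup>2 * (?p a * (2 * (norm (?J a))\<^sup>2 + (2 * c0\<^sup>2 + c0)) + ?q a * (2 * (norm (?J' a))\<^sup>2 + 2 * c0\<^sup>2)))"
      using c0_nonneg by (intro integrable_mult_right Bochner_Integration.integrable_add G2) auto
    fix a assume a: "a \<in> space JA"
    have "\<bar>(?q a - ?p a - ?p a * (h \<bullet> ?J a)) * f (s, a)\<bar>
        \<le> ((norm h)\<^sup>2 * (?p a * (2 * (norm (?J a))\<^sup>2 + 2 * c0\<^sup>2 + c0) + ?q a * (2 * (norm (?J' a))\<^sup>2 + 2 * c0\<^sup>2))) * b"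
      unfolding abs_mult by (intro mult_mono jpol_expansion(2)[OF s a h] b(1)[OF x[OF a]]
          order_trans[OF abs_ge_zero jpol_expansion(2)[OF s a h]] abs_ge_zero)
    then show "\<bar>(?q a - ?p a - ?p a * (h \<bullet> ?J a)) * f (s, a)\<bar>
        \<le> b * (norm h)\<^sup>2 * (?p a * (2 * (norm (?J a))\<^sup>2 + (2 * c0\<^sup>2 + c0)) + ?q a * (2 * (norm (?J' a))\<^sup>2 + 2 * c0\<^sup>2))"
      by (simp only: mult.assoc mult.commute[of _ b] add.assoc)
  qed
  also have "\<dots> = b * (norm h)\<^sup>2 * ((\<integral>a. ?p a * (2 * (norm (?J a))\<^sup>2 + (2 * c0\<^sup>2 + c0)) \<partial>JA) + (\<integral>a. ?q a * (2 * (norm (?J' a))\<^sup>2 + 2 * c0\<^sup>2) \<partial>JA))"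
  proof -
    have nn: "0 \<le> 2 * c0\<^sup>2 + c0" "0 \<le> 2 * c0\<^sup>2" using c0_nonneg by simp_all
    show ?thesis by (simp only: integral_mult_right_zero
          Bochner_Integration.integral_add[OF G2(1)[OF nn(1)] G2(1)[OF nn(2)]])
  qed
  also have "\<dots> \<le> b * (norm h)\<^sup>2 * C1"
  proof (rule mult_left_mono)
    have nn: "0 \<le> 2 * c0\<^sup>2 + c0" "0 \<le> 2 * c0\<^sup>2" using c0_nonneg by simp_all
    show "(\<integral>a. ?p a * (2 * (norm (?J a))\<^sup>2 + (2 * c0\<^sup>2 + c0)) \<partial>JA) + (\<integral>a. ?q a * (2 * (norm (?J' a))\<^sup>2 + 2 * c0\<^sup>2) \<partial>JA) \<le> C1"
      using abs_le_D1[OF G2(2)[OF nn(1), of \<theta>]] abs_le_D1[OF G2(2)[OF nn(2), of "\<theta> + h"]] W_nonneg c0_nonneg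
      unfolding C1_def by linarith
  qed (use b(2) in simp)
  finally show "\<bar>act_mean (\<theta> + h) f s - act_mean \<theta> f s - h \<bullet> (\<chi> m. act_mean \<theta> (\<lambda>x. f x * jscore \<theta> x $ m) s)\<bar>
      \<le> b * C1 * (norm h)\<^sup>2" unfolding eq2 by (simp only: mult.commute mult.left_commute)
qed

end

section \<open>Differentiability of the utilities\<close>

context markov
begin

lemma act_mean_diff:
  assumes "act_bounded \<theta> b f" "act_bounded \<theta> c g" "s \<in> space S"
  shows "act_mean \<theta> (\<lambda>x. f x - g x) s = act_mean \<theta> f s - act_mean \<theta> g s"
  unfolding act_mean_def
  by (rule Bochner_Integration.integral_diff) (use assms act_bounded_integrable in auto)

lemma act_mean_sum:
  assumes "\<And>m. m \<in> A \<Longrightarrow> act_bounded \<theta> b (f m)" "s \<in> space S"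
  shows "act_mean \<theta> (\<lambda>x. \<Sum>m\<in>A. h m * f m x) s = (\<Sum>m\<in>A. h m * act_mean \<theta> (f m) s)"
proof -
  have "integrable (act_step G \<theta> s) (f m)" if "m \<in> A" for m
    by (rule act_bounded_integrable[OF assms(1)[OF that] assms(2)])
  then show ?thesis unfolding act_mean_def by (subst Bochner_Integration.integral_sum) auto
qed

lemma trans_mean_diff:
  assumes "f \<in> borel_measurable S" "\<And>s. s \<in> space S \<Longrightarrow> \<bar>f s\<bar> \<le> b"
    and "g \<in> borel_measurable S" "\<And>s. s \<in> space S \<Longrightarrow> \<bar>g s\<bar> \<le> c" and "x \<in> space SA"
  shows "trans_mean (\<lambda>s. f s - g s) x = trans_mean f x - trans_mean g x"
  unfolding trans_mean_def
  by (rule Bochner_Integration.integral_diff) (use assms trans_mean_bound(2) in blast)+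

lemma trans_mean_sum:
  assumes "\<And>m. m \<in> A \<Longrightarrow> f m \<in> borel_measurable S" "\<And>m s. m \<in> A \<Longrightarrow> s \<in> space S \<Longrightarrow> \<bar>f m s\<bar> \<le> b"
    and "x \<in> space SA"
  shows "trans_mean (\<lambda>s. \<Sum>m\<in>A. h m * f m s) x = (\<Sum>m\<in>A. h m * trans_mean (f m) x)"
proof -
  have "integrable (transition G x) (f m)" if "m \<in> A" for m
    using trans_mean_bound(2)[OF assms(1)[OF that] assms(2)[OF that] assms(3)] .
  then show ?thesis unfolding trans_mean_def by (subst Bochner_Integration.integral_sum) auto
qed

end

context smooth_markov
begin

definition Qf :: "'n \<Rightarrow> real ^ 'm \<Rightarrow> 's \<times> ('n \<Rightarrow> real ^ 'k) \<Rightarrow> real" where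
  "Qf i \<theta> = resolvent \<gamma> (next_pair \<theta>) (reward G i)"

definition Vf :: "'n \<Rightarrow> real ^ 'm \<Rightarrow> 's \<Rightarrow> real" where
  "Vf i \<theta> = act_mean \<theta> (Qf i \<theta>)"

text \<open>The derivative of the value along coordinate \<open>m\<close> when the action values are
  frozen and only the law of the current action moves.\<close>

definition LQ :: "'n \<Rightarrow> real ^ 'm \<Rightarrow> 'm \<Rightarrow> 's \<Rightarrow> real" where
  "LQ i \<theta> m = act_mean \<theta> (\<lambda>x. Qf i \<theta> x * jscore \<theta> x $ m)"

text \<open>The discounted sum of all later source terms seen from a pair. It will equal
  \<open>trans_mean (DV i \<theta> m)\<close>; introducing it first gives \<open>DV\<close> an
  explicit formula.\<close>

definition Zf :: "'n \<Rightarrow> real ^ 'm \<Rightarrow> 'm \<Rightarrow> 's \<times> ('n \<Rightarrow> real ^ 'k) \<Rightarrow> real" where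
  "Zf i \<theta> m = resolvent \<gamma> (next_pair \<theta>) (trans_mean (LQ i \<theta> m))"

text \<open>The solution of the linearised Bellman equation \<open>DV = LQ + \<gamma> * act_mean (trans_mean DV)\<close>.\<close>

definition DV :: "'n \<Rightarrow> real ^ 'm \<Rightarrow> 'm \<Rightarrow> 's \<Rightarrow> real" where
  "DV i \<theta> m s = LQ i \<theta> m s + \<gamma> * act_mean \<theta> (Zf i \<theta> m) s"

text \<open>\<open>b0\<close> bounds action values and values, \<open>b1\<close> the source
  \<open>LQ\<close>, and \<open>b2\<close> both \<open>Zf\<close> and \<open>DV\<close>;
  \<open>C2\<close> and \<open>C3\<close> are the first- and second-order constants of
  \<open>Vf\<close>. Each division by \<open>1 - \<gamma>\<close> is one geometric
  summation.\<close>

definition b0 :: real where "b0 = R / (1 - \<gamma>)"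
definition b1 :: real where "b1 = b0 * (1 + W)"
definition b2 :: real where "b2 = b1 / (1 - \<gamma>)"
definition C2 :: real where "C2 = b0 * C1 / (1 - \<gamma>)"
definition C3 :: real where "C3 = (b0 * C1 + C2 * C1) / (1 - \<gamma>)"

lemma const_nonneg: "0 \<le> b0" "0 \<le> b1" "0 \<le> b2" "0 \<le> C2" "0 \<le> C3"
  using R discount W_nonneg C1_nonneg
  by (simp_all add: b0_def b1_def b2_def C2_def C3_def)

lemma Qf_measurable: "Qf i \<theta> \<in> borel_measurable SA"
  and Qf_bound: "x \<in> space SA \<Longrightarrow> \<bar>Qf i \<theta> x\<bar> \<le> b0"
  unfolding Qf_def b0_def
  by (rule resolvent_measurable[OF next_pair_kernel reward_measurable reward_bound discount]
      resolvent_bound[OF next_pair_kernel reward_measurable reward_bound discount]; assumption)+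

lemma act_bounded_Qf: "act_bounded \<theta>' b0 (Qf i \<theta>)"
  by (rule act_boundedI[OF Qf_measurable Qf_bound const_nonneg(1)])

lemma Vf_measurable: "Vf i \<theta> \<in> borel_measurable S"
  unfolding Vf_def by (rule act_mean_measurable[OF Qf_measurable])

lemma Vf_bound: "s \<in> space S \<Longrightarrow> \<bar>Vf i \<theta> s\<bar> \<le> b0"
  unfolding Vf_def by (rule act_mean_bound[OF act_bounded_Qf])

lemma Qf_eq: "x \<in> space SA \<Longrightarrow> Qf i \<theta> x = reward G i x + \<gamma> * trans_mean (Vf i \<theta>) x"
  using resolvent_fixpoint[OF next_pair_kernel[of \<theta>] reward_measurable[of i] reward_bound discount, of x]
    kop_next_pair[OF act_bounded_Qf, of x \<theta> i \<theta>]
  unfolding Qf_def[symmetric] Vf_def by simp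

lemma act_bounded_QJ: "act_bounded \<theta> b1 (\<lambda>x. Qf i \<theta> x * jscore \<theta> x $ m)"
  unfolding b1_def by (rule act_bounded_score[OF Qf_measurable Qf_bound const_nonneg(1)])

lemma LQ_measurable: "LQ i \<theta> m \<in> borel_measurable S"
  unfolding LQ_def by (rule act_mean_measurable[OF act_bounded_measurable[OF act_bounded_QJ]])

lemma LQ_bound: "s \<in> space S \<Longrightarrow> \<bar>LQ i \<theta> m s\<bar> \<le> b1"
  unfolding LQ_def by (rule act_mean_bound[OF act_bounded_QJ])

lemma Zf_measurable: "Zf i \<theta> m \<in> borel_measurable SA"
  unfolding Zf_def by (rule resolvent_measurable[OF next_pair_kernel trans_mean_measurable[OF LQ_measurable]
        trans_mean_bound(1)[OF LQ_measurable LQ_bound] discount])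

lemma Zf_bound: "x \<in> space SA \<Longrightarrow> \<bar>Zf i \<theta> m x\<bar> \<le> b2"
  unfolding Zf_def b2_def by (rule resolvent_bound[OF next_pair_kernel trans_mean_measurable[OF LQ_measurable]
        trans_mean_bound(1)[OF LQ_measurable LQ_bound] discount])

lemma act_bounded_Zf: "act_bounded \<theta>' b2 (Zf i \<theta> m)"
  by (rule act_boundedI[OF Zf_measurable Zf_bound const_nonneg(3)])

lemma DV_measurable: "DV i \<theta> m \<in> borel_measurable S"
  unfolding DV_def[abs_def] using LQ_measurable[of i \<theta> m] act_mean_measurable[OF Zf_measurable, of \<theta> i \<theta> m]
  by measurable

lemma DV_bound:
  assumes s: "s \<in> space S"
  shows "\<bar>DV i \<theta> m s\<bar> \<le> b2"
proof -
  have "\<bar>DV i \<theta> m s\<bar> \<le> \<bar>LQ i \<theta> m s\<bar> + \<gamma> * \<bar>act_mean \<theta> (Zf i \<theta> m) s\<bar>"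
    unfolding DV_def using discount abs_triangle_ineq[of "LQ i \<theta> m s" "\<gamma> * act_mean \<theta> (Zf i \<theta> m) s"]
    by (simp add: abs_mult)
  also have "\<dots> \<le> b1 + \<gamma> * b2"
    using LQ_bound[OF s] act_mean_bound[OF act_bounded_Zf s] discount
    by (intro add_mono mult_left_mono) auto
  also have "\<dots> = b2" using discount by (simp add: b2_def field_simps)
  finally show ?thesis .
qed

lemma Zf_eq:
  assumes x: "x \<in> space SA"
  shows "Zf i \<theta> m x = trans_mean (DV i \<theta> m) x"
proof -
  note am = act_mean_measurable[OF Zf_measurable, of \<theta> i \<theta> m]
  have ab: "\<bar>act_mean \<theta> (Zf i \<theta> m) s\<bar> \<le> b2" if "s \<in> space S" for s
    by (rule act_mean_bound[OF act_bounded_Zf that])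
  have I1: "integrable (transition G x) (LQ i \<theta> m)" by (rule trans_mean_bound(2)[OF LQ_measurable LQ_bound x])
  have I2: "integrable (transition G x) (act_mean \<theta> (Zf i \<theta> m))" by (rule trans_mean_bound(2)[OF am ab x])
  have "Zf i \<theta> m x = trans_mean (LQ i \<theta> m) x + \<gamma> * kop (next_pair \<theta>) (Zf i \<theta> m) x"
    using resolvent_fixpoint[OF next_pair_kernel[of \<theta>] trans_mean_measurable[OF LQ_measurable[of i \<theta> m]]
        trans_mean_bound(1)[OF LQ_measurable LQ_bound] discount, of x] x unfolding Zf_def by blast
  also have "kop (next_pair \<theta>) (Zf i \<theta> m) x = trans_mean (act_mean \<theta> (Zf i \<theta> m)) x"
    by (rule kop_next_pair[OF act_bounded_Zf x])
  also have "trans_mean (LQ i \<theta> m) x + \<gamma> * trans_mean (act_mean \<theta> (Zf i \<theta> m)) x = trans_mean (DV i \<theta> m) x"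
    unfolding trans_mean_def DV_def using I1 I2 by simp
  finally show ?thesis .
qed

lemma Qf_diff:
  assumes x: "x \<in> space SA"
  shows "Qf i \<theta>' x - Qf i \<theta> x = \<gamma> * trans_mean (\<lambda>s. Vf i \<theta>' s - Vf i \<theta> s) x"
proof -
  have "trans_mean (\<lambda>s. Vf i \<theta>' s - Vf i \<theta> s) x = trans_mean (Vf i \<theta>') x - trans_mean (Vf i \<theta>) x"
    by (rule trans_mean_diff[OF Vf_measurable Vf_bound Vf_measurable Vf_bound x])
  then show ?thesis by (simp add: Qf_eq[OF x] right_diff_distrib)
qed

text \<open>Separates the change of the action law at frozen action values from the change of the
  action values under the new law. The latter is \<open>\<gamma>\<close> times a mean of the same
  difference one step later, which is what makes the recursion contract.\<close>

lemma Vf_diff: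
  assumes s: "s \<in> space S"
  shows "Vf i \<theta>' s - Vf i \<theta> s = (act_mean \<theta>' (Qf i \<theta>) s - act_mean \<theta> (Qf i \<theta>) s)
    + act_mean \<theta>' (\<lambda>x. Qf i \<theta>' x - Qf i \<theta> x) s"
  using act_mean_diff[OF act_bounded_Qf act_bounded_Qf s] by (simp add: Vf_def)

lemma Vf_lipschitz:
  assumes s: "s \<in> space S" and h: "norm h \<le> 1"
  shows "\<bar>Vf i (\<theta> + h) s - Vf i \<theta> s\<bar> \<le> C2 * norm h"
proof -
  let ?e = "\<lambda>s. Vf i (\<theta> + h) s - Vf i \<theta> s"
  have m: "?e \<in> borel_measurable S" by (intro borel_measurable_diff Vf_measurable)
  have "\<bar>?e s\<bar> \<le> (b0 * C1 * norm h) / (1 - \<gamma>)"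
  proof (rule contraction_bound[where A="space S" and B="b0 + b0" and \<gamma>=\<gamma>, OF _ _ discount s])
    show "\<bar>?e s\<bar> \<le> b0 + b0" if "s \<in> space S" for s
      using Vf_bound[OF that, of i "\<theta> + h"] Vf_bound[OF that, of i \<theta>] by linarith
    fix b s assume b: "\<And>s. s \<in> space S \<Longrightarrow> \<bar>?e s\<bar> \<le> b" and s: "s \<in> space S"
    have b0: "0 \<le> b" using b[OF s] by linarith
    have D: "\<bar>Qf i (\<theta> + h) x - Qf i \<theta> x\<bar> \<le> \<gamma> * b" if "x \<in> space SA" for x
      using trans_mean_bound(1)[OF m b that] discount by (simp add: Qf_diff[OF that] abs_mult)
    have "act_bounded (\<theta> + h) (\<gamma> * b) (\<lambda>x. Qf i (\<theta> + h) x - Qf i \<theta> x)"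
      using b0 discount by (intro act_boundedI D borel_measurable_diff Qf_measurable) auto
    from act_mean_bound[OF this s]
    have "\<bar>act_mean (\<theta> + h) (\<lambda>x. Qf i (\<theta> + h) x - Qf i \<theta> x) s\<bar> \<le> \<gamma> * b" .
    moreover have "\<bar>act_mean (\<theta> + h) (Qf i \<theta>) s - act_mean \<theta> (Qf i \<theta>) s\<bar> \<le> b0 * C1 * norm h"
      by (rule act_mean_expansion(1)[OF s Qf_measurable Qf_bound const_nonneg(1) h])
    ultimately show "\<bar>?e s\<bar> \<le> b0 * C1 * norm h + \<gamma> * b"
      unfolding Vf_diff[OF s] by linarith
  qed
  then show ?thesis by (simp add: C2_def)
qed

text \<open>The remainder obeys a discounted recursion with a source of second order. Part of this
  source is the change of the action law applied to the change of the action values, a product of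
  two first-order quantities; hence the Lipschitz bound comes beforehand.\<close>

lemma Vf_expansion:
  assumes s: "s \<in> space S" and h: "norm h \<le> 1"
  shows "\<bar>Vf i (\<theta> + h) s - Vf i \<theta> s - (\<Sum>m\<in>UNIV. h $ m * DV i \<theta> m s)\<bar> \<le> C3 * (norm h)\<^sup>2"
proof -
  let ?\<Delta> = "\<lambda>s. Vf i (\<theta> + h) s - Vf i \<theta> s"
  let ?e = "\<lambda>s. ?\<Delta> s - (\<Sum>m\<in>UNIV. h $ m * DV i \<theta> m s)"
  let ?D = "\<lambda>x. Qf i (\<theta> + h) x - Qf i \<theta> x"
  let ?z = "\<lambda>x. \<Sum>m\<in>UNIV. h $ m * Zf i \<theta> m x"
  have m\<Delta>: "?\<Delta> \<in> borel_measurable S" by (intro borel_measurable_diff Vf_measurable)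
  have mDV: "(\<lambda>s. \<Sum>m\<in>UNIV. h $ m * DV i \<theta> m s) \<in> borel_measurable S"
    by (intro borel_measurable_sum borel_measurable_times borel_measurable_const DV_measurable)
  have m: "?e \<in> borel_measurable S" by (intro borel_measurable_diff m\<Delta> mDV)
  have b\<Delta>: "\<bar>?\<Delta> s\<bar> \<le> C2 * norm h" if "s \<in> space S" for s by (rule Vf_lipschitz[OF that h])
  have bDV: "\<bar>\<Sum>m\<in>UNIV. h $ m * DV i \<theta> m s\<bar> \<le> (\<Sum>m\<in>UNIV. \<bar>h $ m\<bar> * b2)" if "s \<in> space S" for s
    by (rule order_trans[OF sum_abs sum_mono]) (simp add: abs_mult mult_left_mono DV_bound[OF that])
  have mD: "?D \<in> borel_measurable SA" by (intro borel_measurable_diff Qf_measurable)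
  have bD: "\<bar>?D x\<bar> \<le> C2 * norm h" if x: "x \<in> space SA" for x
  proof -
    have "\<bar>?D x\<bar> = \<gamma> * \<bar>trans_mean ?\<Delta> x\<bar>" using discount by (simp add: Qf_diff[OF x] abs_mult)
    also have "\<dots> \<le> 1 * (C2 * norm h)"
      using trans_mean_bound(1)[OF m\<Delta> b\<Delta> x] discount by (intro mult_mono) auto
    finally show ?thesis by simp
  qed
  have C2h: "0 \<le> C2 * norm h" using const_nonneg by simp
  have aD: "act_bounded \<theta>' (C2 * norm h) ?D" for \<theta>' by (rule act_boundedI[OF mD bD C2h])
  have bz: "\<bar>\<gamma> * ?z x\<bar> \<le> \<gamma> * (\<Sum>m\<in>UNIV. \<bar>h $ m\<bar> * b2)" if "x \<in> space SA" for x
    unfolding abs_mult using discount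
    by (intro mult_mono order_trans[OF sum_abs sum_mono]) (auto simp: abs_mult mult_left_mono Zf_bound[OF that])
  have mz: "(\<lambda>x. \<gamma> * ?z x) \<in> borel_measurable SA"
    by (intro borel_measurable_sum borel_measurable_times borel_measurable_const Zf_measurable)
  have az: "act_bounded \<theta>' (\<gamma> * (\<Sum>m\<in>UNIV. \<bar>h $ m\<bar> * b2)) (\<lambda>x. \<gamma> * ?z x)" for \<theta>'
    using discount const_nonneg by (intro act_boundedI[OF mz bz]) (auto intro!: mult_nonneg_nonneg sum_nonneg)
  \<comment> \<open>The linear part of the change of \<open>Qf\<close> is \<open>\<gamma>\<close>
    times \<open>?z\<close>; what is left is a transition mean of the remainder itself, which closes
    the recursion.\<close>
  have rem: "?D x - \<gamma> * ?z x = \<gamma> * trans_mean ?e x" if x: "x \<in> space SA" for x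
  proof -
    have "trans_mean ?e x = trans_mean ?\<Delta> x - trans_mean (\<lambda>s. \<Sum>m\<in>UNIV. h $ m * DV i \<theta> m s) x"
      by (rule trans_mean_diff[OF m\<Delta> b\<Delta> mDV bDV x])
    also have "trans_mean (\<lambda>s. \<Sum>m\<in>UNIV. h $ m * DV i \<theta> m s) x = ?z x"
      using trans_mean_sum[OF DV_measurable DV_bound x] by (simp add: Zf_eq[OF x])
    finally have t: "trans_mean ?e x = trans_mean ?\<Delta> x - ?z x" .
    show ?thesis unfolding Qf_diff[OF x] t by (rule right_diff_distrib[symmetric])
  qed
  have "\<bar>?e s\<bar> \<le> ((b0 * C1 + C2 * C1) * (norm h)\<^sup>2) / (1 - \<gamma>)"
  proof (rule contraction_bound[where A="space S" and B="C2 * norm h + (\<Sum>m\<in>UNIV. \<bar>h $ m\<bar> * b2)" and \<gamma>=\<gamma>, OF _ _ discount s])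
    show "\<bar>?e s\<bar> \<le> C2 * norm h + (\<Sum>m\<in>UNIV. \<bar>h $ m\<bar> * b2)" if "s \<in> space S" for s
      using b\<Delta>[OF that] bDV[OF that] by linarith
    fix b s assume b: "\<And>s. s \<in> space S \<Longrightarrow> \<bar>?e s\<bar> \<le> b" and s: "s \<in> space S"
    have b0: "0 \<le> b" using b[OF s] by linarith
    have D: "\<bar>?D x - \<gamma> * ?z x\<bar> \<le> \<gamma> * b" if "x \<in> space SA" for x
      using trans_mean_bound(1)[OF m b that] discount by (simp only: rem[OF that] abs_mult) simp
    have ar: "act_bounded \<theta> (\<gamma> * b) (\<lambda>x. ?D x - \<gamma> * ?z x)"
      using b0 discount by (intro act_boundedI D borel_measurable_diff[OF mD mz]) auto
    have "(\<Sum>m\<in>UNIV. h $ m * DV i \<theta> m s)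
        = (\<Sum>m\<in>UNIV. h $ m * LQ i \<theta> m s) + \<gamma> * (\<Sum>m\<in>UNIV. h $ m * act_mean \<theta> (Zf i \<theta> m) s)"
      by (simp add: DV_def distrib_left sum.distrib sum_distrib_left mult_ac)
    also have "\<gamma> * (\<Sum>m\<in>UNIV. h $ m * act_mean \<theta> (Zf i \<theta> m) s) = act_mean \<theta> (\<lambda>x. \<gamma> * ?z x) s"
    proof -
      have "act_mean \<theta> ?z s = (\<Sum>m\<in>UNIV. h $ m * act_mean \<theta> (Zf i \<theta> m) s)"
        by (rule act_mean_sum[OF act_bounded_Zf s])
      then show ?thesis by (simp add: act_mean_def)
    qed
    finally have dv: "(\<Sum>m\<in>UNIV. h $ m * DV i \<theta> m s)
        = h \<bullet> (\<chi> m. LQ i \<theta> m s) + act_mean \<theta> (\<lambda>x. \<gamma> * ?z x) s" by (simp add: inner_vec_def)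
    \<comment> \<open>The error at frozen action values, the mixed second difference, and the
      recursive term, in this order.\<close>
    have e: "?e s = (act_mean (\<theta> + h) (Qf i \<theta>) s - act_mean \<theta> (Qf i \<theta>) s - h \<bullet> (\<chi> m. LQ i \<theta> m s))
        + (act_mean (\<theta> + h) ?D s - act_mean \<theta> ?D s) + act_mean \<theta> (\<lambda>x. ?D x - \<gamma> * ?z x) s"
      unfolding dv Vf_diff[OF s] act_mean_diff[OF aD az s] by simp
    have 1: "\<bar>act_mean (\<theta> + h) (Qf i \<theta>) s - act_mean \<theta> (Qf i \<theta>) s - h \<bullet> (\<chi> m. LQ i \<theta> m s)\<bar> \<le> b0 * C1 * (norm h)\<^sup>2"
      unfolding LQ_def by (rule act_mean_expansion(2)[OF s Qf_measurable Qf_bound const_nonneg(1) h])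
    have 2: "\<bar>act_mean (\<theta> + h) ?D s - act_mean \<theta> ?D s\<bar> \<le> C2 * norm h * C1 * norm h"
      by (rule act_mean_expansion(1)[OF s mD bD C2h h])
    have 3: "\<bar>act_mean \<theta> (\<lambda>x. ?D x - \<gamma> * ?z x) s\<bar> \<le> \<gamma> * b" by (rule act_mean_bound[OF ar s])
    have "\<bar>?e s\<bar> \<le> b0 * C1 * (norm h)\<^sup>2 + C2 * norm h * C1 * norm h + \<gamma> * b"
      unfolding e using 1 2 3 by linarith
    then show "\<bar>?e s\<bar> \<le> (b0 * C1 + C2 * C1) * (norm h)\<^sup>2 + \<gamma> * b"
      by (simp add: power2_eq_square algebra_simps)
  qed
  then show ?thesis by (simp add: C3_def)
qed

section \<open>Expansion of the utilities\<close>

definition DU :: "'n \<Rightarrow> real ^ 'm \<Rightarrow> real ^ 'm" where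
  "DU i \<theta> = (\<chi> m. \<integral>s. DV i \<theta> m s \<partial>init G)"

text \<open>The first summand serves increments of norm at most one. Beyond that the squared norm
  exceeds one, and the remainder is bounded crudely: \<open>2 * b0\<close> for the two utilities and
  \<open>real CARD('m) * b2\<close> for the linear term.\<close>

definition C4 :: real where "C4 = C3 + 2 * b0 + real CARD('m) * b2"

lemma C4_nonneg: "0 \<le> C4" using const_nonneg by (simp add: C4_def)

lemma init_prob: "prob_space (init G)" "sets (init G) = sets S" "space (init G) = space S"
  using init_space sets_eq_imp_space_eq by (auto simp: space_prob_algebra)

lemma init_integral:
  fixes g :: "'s \<Rightarrow> real"
  assumes "g \<in> borel_measurable S" "\<And>s. s \<in> space S \<Longrightarrow> \<bar>g s\<bar> \<le> b"
  shows "integrable (init G) g" "\<bar>\<integral>s. g s \<partial>init G\<bar> \<le> b"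
  using kernel_integrable[OF init_prob(1,2) assms] by auto

text \<open>The discounted-sum formula at time 0 with a constant earlier factor. A general initial
  law covers the utility as well as, with a point mass, the value estimates.\<close>

lemma utility_series:
  assumes \<mu>: "\<mu> \<in> space (prob_algebra S)"
  shows "(\<integral>x. (\<Sum>t. \<gamma> ^ t * reward G i (x t)) \<partial>trajectory G \<theta> \<mu>) = (\<integral>s. Vf i \<theta> s \<partial>\<mu>)"
proof -
  interpret T: prob_space "trajectory G \<theta> \<mu>" by (rule trajectory_prob[OF \<mu>])
  note x = coordinate_in[OF \<mu>]
  have gs: "summable (\<lambda>t. \<gamma> ^ t * R)" using discount by (intro summable_mult2 summable_geometric) auto
  define f where "f t x = \<gamma> ^ t * reward G i (x t)" for t and x :: "nat \<Rightarrow> 's \<times> ('n \<Rightarrow> real ^ 'k)"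
  have le: "norm (f t x) \<le> \<gamma> ^ t * R" if "x \<in> space (trajectory G \<theta> \<mu>)" for t x
    using reward_bound[OF x[OF that]] discount by (simp add: f_def abs_mult mult_left_mono)
  have fm: "f t \<in> borel_measurable (trajectory G \<theta> \<mu>)" for t
    unfolding f_def[abs_def]
    by (intro borel_measurable_times borel_measurable_const measurable_compose[OF coordinate_measurable[OF \<mu>] reward_measurable])
  have fI: "integrable (trajectory G \<theta> \<mu>) (f t)" for t
    by (rule T.integrable_const_bound[OF AE_I2[OF le] fm])
  have "AE x in trajectory G \<theta> \<mu>. summable (\<lambda>t. norm (f t x))"
  proof (rule AE_I2)
    fix x assume "x \<in> space (trajectory G \<theta> \<mu>)"
    then show "summable (\<lambda>t. norm (f t x))"
      using le[of x] by (intro summable_comparison_test'[OF gs, of 0]) simp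
  qed
  moreover have "summable (\<lambda>t. \<integral>x. norm (f t x) \<partial>trajectory G \<theta> \<mu>)"
  proof (rule summable_comparison_test'[OF gs, of 0])
    fix t
    have "(\<integral>x. norm (f t x) \<partial>trajectory G \<theta> \<mu>) \<le> (\<integral>x. \<gamma> ^ t * R \<partial>trajectory G \<theta> \<mu>)"
      using le by (intro integral_mono) (auto intro: fI)
    then show "norm (\<integral>x. norm (f t x) \<partial>trajectory G \<theta> \<mu>) \<le> \<gamma> ^ t * R" by (simp add: T.prob_space)
  qed
  ultimately have s: "(\<lambda>t. \<integral>x. f t x \<partial>trajectory G \<theta> \<mu>) sums (\<integral>x. (\<Sum>t. f t x) \<partial>trajectory G \<theta> \<mu>)"
    using sums_integral[of "trajectory G \<theta> \<mu>" f] fI by blast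
  have "(\<lambda>t. \<gamma> ^ t * (\<integral>x. 1 * reward G i (x (0 + t)) \<partial>trajectory G \<theta> \<mu>))
      sums (\<integral>x. 1 * resolvent \<gamma> (next_pair \<theta>) (reward G i) (x 0) \<partial>trajectory G \<theta> \<mu>)"
    by (rule discounted_sum[OF \<mu>, where \<phi>="\<lambda>_. 1" and t=0 and b=R]) (auto simp: reward_measurable reward_bound)
  then have "(\<lambda>t. \<integral>x. f t x \<partial>trajectory G \<theta> \<mu>) sums (\<integral>x. Qf i \<theta> (x 0) \<partial>trajectory G \<theta> \<mu>)"
    by (simp add: f_def Qf_def)
  from sums_unique2[OF s this] show ?thesis
    using start_integral(2)[OF \<mu> act_bounded_Qf] by (simp add: f_def Vf_def)
qed

lemma utility_eq: "utility G i \<theta> = (\<integral>s. Vf i \<theta> s \<partial>init G)"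
  unfolding utility_def by (rule utility_series[OF init_space])

lemma utility_bound: "\<bar>utility G i \<theta>\<bar> \<le> b0"
  unfolding utility_eq by (rule init_integral(2)[OF Vf_measurable Vf_bound])

lemma DU_component_bound: "\<bar>DU i \<theta> $ m\<bar> \<le> b2"
  unfolding DU_def using init_integral(2)[OF DV_measurable DV_bound] by simp

lemma DU_bound: "norm (DU i \<theta>) \<le> real CARD('m) * b2"
proof -
  have "norm (DU i \<theta>) \<le> (\<Sum>m\<in>UNIV. \<bar>DU i \<theta> $ m\<bar>)" by (rule norm_le_l1_cart)
  also have "\<dots> \<le> (\<Sum>m\<in>(UNIV::'m set). b2)" by (intro sum_mono DU_component_bound)
  finally show ?thesis by simp
qed

lemma utility_expansion:
  "\<bar>utility G i y - utility G i x - (y - x) \<bullet> DU i x\<bar> \<le> C4 * (norm (y - x))\<^sup>2"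
proof (cases "norm (y - x) \<le> 1")
  case True
  define h where "h = y - x"
  have y: "y = x + h" and h: "norm h \<le> 1" using True by (simp_all add: h_def)
  have IV: "integrable (init G) (Vf i \<theta>)" for \<theta> by (rule init_integral(1)[OF Vf_measurable Vf_bound])
  have ID: "integrable (init G) (DV i x m)" for m by (rule init_integral(1)[OF DV_measurable DV_bound])
  have "h \<bullet> DU i x = (\<Sum>m\<in>UNIV. h $ m * (\<integral>s. DV i x m s \<partial>init G))"
    by (simp add: DU_def inner_vec_def)
  also have "\<dots> = (\<integral>s. (\<Sum>m\<in>UNIV. h $ m * DV i x m s) \<partial>init G)"
    using ID by (subst Bochner_Integration.integral_sum) auto
  finally have hD: "h \<bullet> DU i x = (\<integral>s. (\<Sum>m\<in>UNIV. h $ m * DV i x m s) \<partial>init G)" .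
  have IS: "integrable (init G) (\<lambda>s. \<Sum>m\<in>UNIV. h $ m * DV i x m s)" using ID by auto
  have "utility G i y - utility G i x - h \<bullet> DU i x
      = (\<integral>s. Vf i (x + h) s - Vf i x s - (\<Sum>m\<in>UNIV. h $ m * DV i x m s) \<partial>init G)"
    unfolding utility_eq hD y using IV IS by simp
  moreover have "\<bar>\<integral>s. Vf i (x + h) s - Vf i x s - (\<Sum>m\<in>UNIV. h $ m * DV i x m s) \<partial>init G\<bar> \<le> C3 * (norm h)\<^sup>2"
    by (rule init_integral(2)[OF _ Vf_expansion[OF _ h]])
      (intro borel_measurable_diff borel_measurable_sum borel_measurable_times borel_measurable_const Vf_measurable DV_measurable)
  moreover have "C3 * (norm h)\<^sup>2 \<le> C4 * (norm h)\<^sup>2"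
    using const_nonneg by (intro mult_right_mono) (auto simp: C4_def)
  ultimately show ?thesis unfolding h_def[symmetric] by linarith
next
  case False
  let ?h = "y - x"
  have sq: "norm ?h \<le> (norm ?h)\<^sup>2" "1 \<le> (norm ?h)\<^sup>2"
    using False by (simp_all add: self_le_power one_le_power)
  have "\<bar>?h \<bullet> DU i x\<bar> \<le> norm ?h * (real CARD('m) * b2)"
    by (rule order_trans[OF Cauchy_Schwarz_ineq2 mult_left_mono[OF DU_bound]]) simp
  also have "\<dots> \<le> (norm ?h)\<^sup>2 * (real CARD('m) * b2)"
    using sq const_nonneg by (intro mult_right_mono) auto
  finally have 1: "\<bar>?h \<bullet> DU i x\<bar> \<le> (norm ?h)\<^sup>2 * (real CARD('m) * b2)" .
  have 2: "2 * b0 \<le> (norm ?h)\<^sup>2 * (2 * b0)"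
    using mult_right_mono[OF sq(2), of "2 * b0"] const_nonneg by simp
  have 3: "0 \<le> (norm ?h)\<^sup>2 * C3" using const_nonneg by simp
  have "\<bar>utility G i y - utility G i x - ?h \<bullet> DU i x\<bar> \<le> (norm ?h)\<^sup>2 * (real CARD('m) * b2) + (norm ?h)\<^sup>2 * (2 * b0) + (norm ?h)\<^sup>2 * C3"
    using 1 2 3 utility_bound[of i y] utility_bound[of i x] by linarith
  then show ?thesis by (simp add: C4_def algebra_simps)
qed

end

section \<open>Bias and second moment of the gradient estimators\<close>

text \<open>The majorant is a summable weight times one integrable function, as arises for
  discounted rewards multiplied by a score.\<close>

lemma series_integral_dominated:
  fixes f :: "nat \<Rightarrow> 'z \<Rightarrow> real"
  assumes f: "\<And>k. f k \<in> borel_measurable M" and le: "\<And>k x. x \<in> space M \<Longrightarrow> \<bar>f k x\<bar> \<le> c k * \<bar>g x\<bar>"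
    and g: "integrable M g" and c: "summable c" "\<And>k. 0 \<le> c k"
  shows "(\<lambda>k. \<integral>x. f k x \<partial>M) sums (\<integral>x. (\<Sum>k. f k x) \<partial>M)"
proof -
  have I: "integrable M (f k)" for k
  proof (rule Bochner_Integration.integrable_bound[OF _ f])
    show "integrable M (\<lambda>x. c k * g x)" using g by simp
    show "AE x in M. norm (f k x) \<le> norm (c k * g x)"
      using le c by (intro AE_I2) (simp add: abs_mult)
  qed
  have "AE x in M. summable (\<lambda>k. norm (f k x))"
  proof (rule AE_I2)
    fix x assume "x \<in> space M"
    then show "summable (\<lambda>k. norm (f k x))"
      using le[of x] by (intro summable_comparison_test'[OF summable_mult2[OF c(1)], of 0]) simp
  qed
  moreover have "summable (\<lambda>k. \<integral>x. norm (f k x) \<partial>M)"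
  proof (rule summable_comparison_test'[OF summable_mult2[OF c(1), of "\<integral>x. \<bar>g x\<bar> \<partial>M"], of 0])
    fix k
    have "(\<integral>x. norm (f k x) \<partial>M) \<le> (\<integral>x. c k * \<bar>g x\<bar> \<partial>M)"
      using le g by (intro integral_mono) (auto intro: I)
    then show "norm (\<integral>x. norm (f k x) \<partial>M) \<le> c k * (\<integral>x. \<bar>g x\<bar> \<partial>M)" by simp
  qed
  ultimately show ?thesis using sums_integral[of M f] I by blast
qed

lemma geometric_tail:
  assumes q: "0 < q" "q < 1"
  shows "(\<integral>n. indicator {k..} n \<partial>measure_pmf (geometric_pmf (1 - q))) = (q ^ k :: real)"
proof -
  let ?p = "geometric_pmf (1 - q)"
  have "measure_pmf.prob ?p {..<k} = (\<Sum>n<k. q ^ n * (1 - q))"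
    using q by (subst measure_measure_pmf_finite) auto
  also have "\<dots> = 1 - q ^ k" by (simp add: one_diff_power_eq sum_distrib_right mult.commute sum_distrib_left)
  finally have "measure_pmf.prob ?p {..<k} = 1 - q ^ k" .
  moreover have "{k..} = UNIV - {..<k}" by auto
  ultimately have "measure_pmf.prob ?p {k..} = q ^ k"
    using measure_pmf.prob_compl[of "{..<k}" ?p] by simp
  then show ?thesis by simp
qed

text \<open>The geometric horizon supplies one factor \<open>q ^ k\<close>, the weights the other one.\<close>

lemma geometric_horizon_sum:
  fixes r :: "nat \<Rightarrow> real"
  assumes q: "0 < q" "q < 1" and r: "\<And>k. \<bar>r k\<bar> \<le> b"
  shows "(\<integral>n. (\<Sum>k\<le>n. q ^ k * r k) \<partial>measure_pmf (geometric_pmf (1 - q))) = (\<Sum>k. (q * q) ^ k * r k)"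
proof -
  let ?p = "measure_pmf (geometric_pmf (1 - q))"
  define f where "f k n = q ^ k * r k * indicator {k..} n" for k n
  have "(\<Sum>k. f k n) = (\<Sum>k\<le>n. q ^ k * r k)" for n
  proof -
    have "(\<Sum>k. f k n) = (\<Sum>k\<le>n. f k n)" by (rule suminf_finite) (auto simp: f_def)
    then show ?thesis by (simp add: f_def)
  qed
  moreover have "(\<lambda>k. \<integral>n. f k n \<partial>?p) sums (\<integral>n. (\<Sum>k. f k n) \<partial>?p)"
  proof (rule series_integral_dominated)
    show "\<bar>f k n\<bar> \<le> (q ^ k * \<bar>b\<bar>) * \<bar>1\<bar>" for k n
      using q r[of k] by (auto simp: f_def abs_mult indicator_def intro!: mult_left_mono)
    show "summable (\<lambda>k. q ^ k * \<bar>b\<bar>)" using q by (intro summable_mult2 summable_geometric) auto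
  qed (use q in auto)
  moreover have "(\<integral>n. f k n \<partial>?p) = (q * q) ^ k * r k" for k
    unfolding f_def integral_mult_right_zero geometric_tail[OF q] by (simp add: power_mult_distrib mult_ac)
  ultimately show ?thesis by (simp add: sums_iff)
qed

context smooth_markov
begin

abbreviation "g2 \<equiv> \<gamma> powr (1 / 2)"

lemma g2: "0 < g2" "g2 < 1" "g2 * g2 = \<gamma>"
proof -
  show "0 < g2" using discount by simp
  show "g2 < 1" using powr_less_one[of \<gamma> "1/2"] discount
    by (simp add: powr_less_one) (metis discount(1,2) powr_half_sqrt real_sqrt_lt_1_iff less_imp_le)
  show "g2 * g2 = \<gamma>" using discount by (simp flip: powr_add)
qed

lemma reward_sum_eq: "reward_sum G i T T' x = (\<Sum>k\<le>T'. g2 ^ k * reward G i (x (T + k)))"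
proof -
  have "\<gamma> powr (real k / 2) = g2 ^ k" for k
    using discount by (simp add: powr_powr flip: powr_realpow)
  then show ?thesis unfolding reward_sum_def
    by (intro sum.reindex_bij_witness[of _ "\<lambda>k. T + k" "\<lambda>t. t - T"]) (auto simp del: of_nat_diff)
qed

text \<open>A pathwise bound for the estimated return, independent of the random horizon because the
  weights are summable. Among the factors of a sampled gradient only the score remains
  unbounded.\<close>

definition rb :: real where "rb = R / (1 - g2)"

lemma rb_nonneg: "0 \<le> rb" using R g2 by (simp add: rb_def)

lemma reward_sum_bound:
  assumes "\<And>t. x t \<in> space SA"
  shows "\<bar>reward_sum G i T T' x\<bar> \<le> rb"
proof -
  have "\<bar>reward_sum G i T T' x\<bar> \<le> (\<Sum>k\<le>T'. g2 ^ k * R)"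
    unfolding reward_sum_eq
    by (rule order_trans[OF sum_abs sum_mono]) (use assms reward_bound in \<open>simp add: abs_mult mult_left_mono\<close>)
  also have "\<dots> \<le> (\<Sum>k. g2 ^ k * R)"
    using g2 R by (intro sum_le_suminf summable_mult2 summable_geometric) auto
  also have "\<dots> = rb" using g2 by (simp add: rb_def suminf_geometric suminf_mult2[symmetric] summable_geometric)
  finally show ?thesis .
qed

lemma horizon_mean:
  assumes "\<And>t. x t \<in> space SA"
  shows "(\<integral>n. reward_sum G i T n x \<partial>measure_pmf (geometric_pmf (1 - g2))) = (\<Sum>k. \<gamma> ^ k * reward G i (x (T + k)))"
  unfolding reward_sum_eq
  using geometric_horizon_sum[OF g2(1,2), of "\<lambda>k. reward G i (x (T + k))" R] reward_bound assms g2(3) by simp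

section \<open>The policy gradient formula\<close>

text \<open>The joint policy has mass one for every parameter. Expanding the constant function 1
  leaves only the linear term, bounded by \<open>C1 * (norm h)\<^sup>2\<close>, and a linear
  functional of quadratic size vanishes.\<close>

lemma jscore_mean:
  assumes s: "s \<in> space S"
  shows "act_mean \<theta> (\<lambda>x. jscore \<theta> x $ m) s = 0"
proof -
  define v :: "real ^ 'm" where "v = (\<chi> m. act_mean \<theta> (\<lambda>x. 1 * jscore \<theta> x $ m) s)"
  have c: "act_mean \<theta>' (\<lambda>_. 1) s = 1" for \<theta>'
    using prob_space.prob_space[OF prob_kernelD(1)[OF act_step_kernel s]] by (simp add: act_mean_def)
  have bound: "\<bar>h \<bullet> v\<bar> \<le> C1 * (norm h)\<^sup>2" if "norm h \<le> 1" for h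
    using act_mean_expansion(2)[OF s, of "\<lambda>_. 1" 1 h \<theta>] that unfolding v_def[symmetric] c by simp
  have "v = 0"
  proof (rule ccontr)
    assume nz: "v \<noteq> 0"
    \<comment> \<open>Small enough that the expansion applies to \<open>t *\<^sub>R v\<close> and
      that \<open>t * C1 < 1\<close>, which contradicts the quadratic bound on a nonzero
      \<open>v\<close>.\<close>
    define t where "t = min (1 / norm v) (1 / (2 * (C1 + 1)))"
    have t: "0 < t" "t * norm v \<le> 1" "t * C1 < 1"
    proof -
      show "0 < t" using nz C1_nonneg by (simp add: t_def)
      have "t \<le> 1 / norm v" by (simp add: t_def)
      then show "t * norm v \<le> 1" using nz by (simp add: field_simps)
      have "t \<le> 1 / (2 * (C1 + 1))" by (simp add: t_def)
      then have "t * C1 \<le> 1 / (2 * (C1 + 1)) * C1" using C1_nonneg by (rule mult_right_mono)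
      also have "\<dots> < 1" using C1_nonneg by (simp add: field_simps)
      finally show "t * C1 < 1" .
    qed
    have "t * (norm v)\<^sup>2 \<le> C1 * (t * norm v)\<^sup>2"
      using bound[of "t *\<^sub>R v"] t by (simp add: power2_norm_eq_inner)
    also have "\<dots> = (t * C1) * (t * (norm v)\<^sup>2)" by (simp add: power2_eq_square)
    also have "\<dots> < 1 * (t * (norm v)\<^sup>2)" using t nz by (intro mult_strict_right_mono) auto
    finally show False by simp
  qed
  then have "v $ m = 0" by simp
  then show ?thesis by (simp add: v_def)
qed

lemma coordinate_mean_zero:
  assumes \<mu>: "\<mu> \<in> space (prob_algebra S)" and f: "act_bounded \<theta> c f"
    and z: "\<And>s. s \<in> space S \<Longrightarrow> act_mean \<theta> f s = 0"
  shows "(\<integral>x. f (x t) \<partial>trajectory G \<theta> \<mu>) = 0"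
proof (cases t)
  case 0
  have "space \<mu> = space S" using \<mu> sets_eq_imp_space_eq by (auto simp: space_prob_algebra)
  then have "(\<integral>s. act_mean \<theta> f s \<partial>\<mu>) = (\<integral>s. 0 \<partial>\<mu>)" by (intro Bochner_Integration.integral_cong) (auto simp: z)
  then show ?thesis using 0 start_integral(2)[OF \<mu> f] by simp
next
  case (Suc n)
  have tm: "trans_mean (act_mean \<theta> f) x = 0" if "x \<in> space SA" for x
  proof -
    have "trans_mean (act_mean \<theta> f) x = (\<integral>s. 0 \<partial>transition G x)" unfolding trans_mean_def
      by (rule Bochner_Integration.integral_cong) (use prob_kernelD(3)[OF transition_kernel that] z in auto)
    then show ?thesis by simp
  qed
  have "(\<integral>x. trans_mean (act_mean \<theta> f) (x n) \<partial>trajectory G \<theta> \<mu>) = (\<integral>x. 0 \<partial>trajectory G \<theta> \<mu>)"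
    by (rule Bochner_Integration.integral_cong) (auto simp: tm coordinate_in[OF \<mu>])
  then show ?thesis using Suc step_integral(2)[OF \<mu> f] by simp
qed

lemma state_measurable: "g \<in> borel_measurable S \<Longrightarrow> (\<lambda>x. g (fst x)) \<in> borel_measurable SA"
  unfolding state_actions_def by (rule measurable_compose[OF measurable_fst])

lemma act_mean_state_factor:
  assumes s: "s \<in> space S" and g: "g \<in> borel_measurable S" and f: "f \<in> borel_measurable SA"
  shows "act_mean \<theta> (\<lambda>x. g (fst x) * f x) s = g s * act_mean \<theta> f s"
proof -
  have "(\<lambda>x. g (fst x) * f x) \<in> borel_measurable SA"
    by (intro borel_measurable_times state_measurable g f)
  from act_step_integral(2)[OF s this, of \<theta>] act_step_integral(2)[OF s f, of \<theta>]
  show ?thesis by (simp add: mult.left_commute)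
qed

text \<open>The term at time 0 is split off because \<open>f\<close> may be unbounded: one step
  earlier it is seen through its conditional mean, a bounded function, to which the resolvent
  applies.\<close>

lemma discounted_mean:
  assumes f: "act_bounded \<theta> c f"
  shows "(\<lambda>t. \<gamma> ^ t * (\<integral>x. f (x t) \<partial>trajectory G \<theta> (init G))) sums
    (\<integral>s. act_mean \<theta> f s + \<gamma> * act_mean \<theta> (resolvent \<gamma> (next_pair \<theta>) (trans_mean (act_mean \<theta> f))) s \<partial>init G)"
proof -
  let ?Tr = "trajectory G \<theta> (init G)" and ?g = "trans_mean (act_mean \<theta> f)"
  let ?Z = "resolvent \<gamma> (next_pair \<theta>) ?g"
  interpret T: prob_space ?Tr by (rule trajectory_prob[OF init_space])
  have c: "0 \<le> c" using f by (simp add: act_bounded_def)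
  note am = act_mean_measurable[OF act_bounded_measurable[OF f], of \<theta>]
  have ab: "\<bar>act_mean \<theta> f s\<bar> \<le> c" if "s \<in> space S" for s by (rule act_mean_bound[OF f that])
  have gm: "?g \<in> borel_measurable SA" by (rule trans_mean_measurable[OF am])
  have gb: "\<bar>?g x\<bar> \<le> c" if "x \<in> space SA" for x by (rule trans_mean_bound(1)[OF am ab that])
  have Zm: "?Z \<in> borel_measurable SA" by (rule resolvent_measurable[OF next_pair_kernel gm gb discount])
  have Zb: "\<bar>?Z x\<bar> \<le> c / (1 - \<gamma>)" if "x \<in> space SA" for x
    by (rule resolvent_bound[OF next_pair_kernel gm gb discount that])
  have aZ: "act_bounded \<theta> (c / (1 - \<gamma>)) ?Z"
    using c discount by (intro act_boundedI[OF Zm Zb]) auto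
  have "(\<lambda>k. \<gamma> ^ k * (\<integral>x. 1 * ?g (x (0 + k)) \<partial>?Tr)) sums (\<integral>x. 1 * ?Z (x 0) \<partial>?Tr)"
    by (rule discounted_sum[OF init_space, where \<phi>="\<lambda>_. 1" and t=0 and b=c]) (auto simp: gm gb)
  then have "(\<lambda>k. \<gamma> ^ k * (\<integral>x. f (x (Suc k)) \<partial>?Tr)) sums (\<integral>s. act_mean \<theta> ?Z s \<partial>init G)"
    using step_integral(2)[OF init_space f] start_integral(2)[OF init_space aZ] by simp
  from sums_mult[OF this, of \<gamma>]
  have "(\<lambda>k. \<gamma> ^ Suc k * (\<integral>x. f (x (Suc k)) \<partial>?Tr)) sums (\<gamma> * (\<integral>s. act_mean \<theta> ?Z s \<partial>init G))"
    by (simp add: mult_ac)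
  then have "(\<lambda>k. \<gamma> ^ k * (\<integral>x. f (x k) \<partial>?Tr)) sums
      (\<gamma> * (\<integral>s. act_mean \<theta> ?Z s \<partial>init G) + \<gamma> ^ 0 * (\<integral>x. f (x 0) \<partial>?Tr))"
    by (subst (asm) sums_Suc_iff) (simp add: algebra_simps)
  moreover have "\<gamma> * (\<integral>s. act_mean \<theta> ?Z s \<partial>init G) + \<gamma> ^ 0 * (\<integral>x. f (x 0) \<partial>?Tr)
      = (\<integral>s. act_mean \<theta> f s + \<gamma> * act_mean \<theta> ?Z s \<partial>init G)"
  proof -
    have "integrable (init G) (act_mean \<theta> f)" by (rule init_integral(1)[OF am ab])
    moreover have "integrable (init G) (act_mean \<theta> ?Z)"
      by (rule init_integral(1)[OF act_mean_measurable[OF Zm] act_mean_bound[OF aZ]])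
    ultimately show ?thesis using start_integral(2)[OF init_space f] by simp
  qed
  ultimately show ?thesis by simp
qed

text \<open>The policy gradient theorem: weighted by the discounted occupation measure, action value
  times score gives exactly the linear term of the utility expansion.\<close>

lemma QJ_discounted_mean:
  "(\<lambda>t. \<gamma> ^ t * (\<integral>x. Qf i \<theta> (x t) * jscore \<theta> (x t) $ m \<partial>trajectory G \<theta> (init G))) sums (DU i \<theta> $ m)"
  using discounted_mean[OF act_bounded_QJ, of \<theta> i m]
  unfolding DU_def DV_def[abs_def] Zf_def LQ_def by simp

section \<open>Sampling rounds\<close>

definition p1 :: "nat measure" where "p1 = measure_pmf (geometric_pmf (1 - \<gamma>))"
definition p2 :: "nat measure" where "p2 = measure_pmf (geometric_pmf (1 - g2))"

lemma p_prob: "prob_space p1" "prob_space p2"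
  by (simp_all add: p1_def p2_def measure_pmf.prob_space_axioms)

lemma sets_p: "sets p1 = sets (count_space UNIV)" "sets p2 = sets (count_space UNIV)"
  by (simp_all add: p1_def p2_def)

text \<open>Times are countable, so it is enough to treat each fixed time.\<close>

lemma coordinate_random_time:
  fixes g :: "'z \<Rightarrow> nat"
  assumes "f \<in> M \<rightarrow>\<^sub>M PiM UNIV (\<lambda>_. SA)" "g \<in> M \<rightarrow>\<^sub>M count_space UNIV"
  shows "(\<lambda>z. f z (g z)) \<in> M \<rightarrow>\<^sub>M SA"
proof (rule measurable_compose_countable[OF _ assms(2)])
  show "(\<lambda>z. f z i) \<in> M \<rightarrow>\<^sub>M SA" for i
    by (rule measurable_compose[OF assms(1) measurable_component_singleton]) simp
qed

lemma reward_sum_measurable: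
  assumes f: "f \<in> M \<rightarrow>\<^sub>M PiM UNIV (\<lambda>_. SA)"
    and g: "g \<in> M \<rightarrow>\<^sub>M count_space UNIV" "h \<in> M \<rightarrow>\<^sub>M count_space UNIV"
  shows "(\<lambda>z. reward_sum G i (g z) (h z) (f z)) \<in> borel_measurable M"
proof (rule measurable_compose_countable[OF _ g(2)])
  fix n
  have "(\<lambda>z. reward G i (f z (g z + k))) \<in> borel_measurable M" for k
    by (rule measurable_compose[OF coordinate_random_time[OF f] reward_measurable])
      (use g in measurable)
  then show "(\<lambda>z. reward_sum G i (g z) n (f z)) \<in> borel_measurable M"
    unfolding reward_sum_eq by (intro borel_measurable_sum borel_measurable_times borel_measurable_const)
qed

end

context smooth_markov
begin

section \<open>Value estimates from fresh rounds\<close>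

lemma value_law_eq: "value_law G i \<theta> s =
    distr (p2 \<Otimes>\<^sub>M trajectory G \<theta> (return S s)) borel (\<lambda>w. reward_sum G i 0 (fst w) (snd w))"
  by (simp add: value_law_def p2_def case_prod_beta')

lemma value_law_kernel: "value_law G i \<theta> \<in> S \<rightarrow>\<^sub>M prob_algebra borel"
  unfolding value_law_eq[abs_def]
proof (rule measurable_distr_prob_space2)
  show "(\<lambda>s. p2 \<Otimes>\<^sub>M trajectory G \<theta> (return S s)) \<in> S \<rightarrow>\<^sub>M prob_algebra (p2 \<Otimes>\<^sub>M PiM UNIV (\<lambda>_. SA))"
    by (intro measurable_pair_prob measurable_const trajectory_kernel)
      (simp add: space_prob_algebra p_prob)
  have "(\<lambda>z. reward_sum G i 0 (fst (snd z)) (snd (snd z))) \<in> borel_measurable (S \<Otimes>\<^sub>M (p2 \<Otimes>\<^sub>M PiM UNIV (\<lambda>_. SA)))"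
    by (intro reward_sum_measurable measurable_const) (auto simp: p2_def)
  then show "(\<lambda>(s, w). reward_sum G i 0 (fst w) (snd w)) \<in> borel_measurable (S \<Otimes>\<^sub>M (p2 \<Otimes>\<^sub>M PiM UNIV (\<lambda>_. SA)))"
    by (simp add: case_prod_beta')
qed

text \<open>Averaging over the horizon first leaves the discounted reward series of one trajectory,
  whose mean from a point mass is the value at that state.\<close>

lemma value_law:
  assumes s: "s \<in> space S"
  shows value_law_bound: "AE v in value_law G i \<theta> s. \<bar>v\<bar> \<le> rb"
    and value_law_integrable: "integrable (value_law G i \<theta> s) (\<lambda>v. v)"
    and value_law_mean: "(\<integral>v. v \<partial>value_law G i \<theta> s) = Vf i \<theta> s"
proof -
  note \<mu> = return_in_prob[OF s]
  let ?T = "trajectory G \<theta> (return S s)"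
  interpret T: prob_space ?T by (rule trajectory_prob[OF \<mu>])
  interpret p2: prob_space p2 by (rule p_prob)
  interpret pp: pair_prob_space p2 ?T ..
  have m: "(\<lambda>w. reward_sum G i 0 (fst w) (snd w)) \<in> borel_measurable (p2 \<Otimes>\<^sub>M ?T)"
  proof (intro reward_sum_measurable measurable_const)
    have "snd \<in> p2 \<Otimes>\<^sub>M ?T \<rightarrow>\<^sub>M ?T" by (rule measurable_snd)
    then show "snd \<in> p2 \<Otimes>\<^sub>M ?T \<rightarrow>\<^sub>M PiM UNIV (\<lambda>_. SA)"
      by (simp only: measurable_cong_sets[OF refl sets_trajectory[OF \<mu>]])
    have "fst \<in> p2 \<Otimes>\<^sub>M ?T \<rightarrow>\<^sub>M p2" by (rule measurable_fst)
    then show "fst \<in> p2 \<Otimes>\<^sub>M ?T \<rightarrow>\<^sub>M count_space UNIV"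
      by (simp only: measurable_cong_sets[OF refl sets_p(2)])
  qed simp
  have b: "\<bar>reward_sum G i 0 (fst w) (snd w)\<bar> \<le> rb" if "w \<in> space (p2 \<Otimes>\<^sub>M ?T)" for w
    using that coordinate_in[OF \<mu>] by (intro reward_sum_bound) (auto simp: space_pair_measure)
  show "AE v in value_law G i \<theta> s. \<bar>v\<bar> \<le> rb"
    unfolding value_law_eq by (subst AE_distr_iff[OF m]) (auto intro: b)
  have I: "integrable (p2 \<Otimes>\<^sub>M ?T) (\<lambda>w. reward_sum G i 0 (fst w) (snd w))"
    by (rule pp.integrable_const_bound[where B=rb]) (use b m in auto)
  then show "integrable (value_law G i \<theta> s) (\<lambda>v. v)"
    unfolding value_law_eq by (subst integrable_distr_eq[OF m]) auto
  have "(\<integral>v. v \<partial>value_law G i \<theta> s) = (\<integral>w. reward_sum G i 0 (fst w) (snd w) \<partial>(p2 \<Otimes>\<^sub>M ?T))"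
    unfolding value_law_eq by (subst integral_distr[OF m]) auto
  also have "\<dots> = (\<integral>x. \<integral>n. reward_sum G i 0 n x \<partial>p2 \<partial>?T)"
    using pp.integral_snd[of "\<lambda>n x. reward_sum G i 0 n x"] I by (simp add: case_prod_beta')
  also have "\<dots> = (\<integral>x. (\<Sum>k. \<gamma> ^ k * reward G i (x k)) \<partial>?T)"
    using horizon_mean[OF coordinate_in[OF \<mu>], of _ _ i 0]
    by (intro Bochner_Integration.integral_cong refl) (simp add: p2_def)
  also have "\<dots> = (\<integral>s. Vf i \<theta> s \<partial>return S s)" by (rule utility_series[OF \<mu>])
  also have "\<dots> = Vf i \<theta> s" by (rule integral_return[OF s Vf_measurable])
  finally show "(\<integral>v. v \<partial>value_law G i \<theta> s) = Vf i \<theta> s" .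
qed

section \<open>The main sampling round\<close>

lemma play_eq: "play G \<theta> = p1 \<Otimes>\<^sub>M (p2 \<Otimes>\<^sub>M trajectory G \<theta> (init G))"
  by (simp add: play_def p1_def p2_def)

lemma play_prob: "prob_space (play G \<theta>)"
  unfolding play_eq by (intro prob_space_pair p_prob trajectory_prob init_space)

lemma play_projections:
  "fst \<in> play G \<theta> \<rightarrow>\<^sub>M count_space UNIV"
  "(\<lambda>z. fst (snd z)) \<in> play G \<theta> \<rightarrow>\<^sub>M count_space UNIV"
  "(\<lambda>z. snd (snd z)) \<in> play G \<theta> \<rightarrow>\<^sub>M PiM UNIV (\<lambda>_. SA)"
proof -
  have 1: "fst \<in> play G \<theta> \<rightarrow>\<^sub>M p1" unfolding play_eq by (rule measurable_fst)
  then show "fst \<in> play G \<theta> \<rightarrow>\<^sub>M count_space UNIV" by (simp add: p1_def)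
  have 2: "(\<lambda>z. fst (snd z)) \<in> play G \<theta> \<rightarrow>\<^sub>M p2" unfolding play_eq by measurable
  then show "(\<lambda>z. fst (snd z)) \<in> play G \<theta> \<rightarrow>\<^sub>M count_space UNIV" by (simp add: p2_def)
  have 3: "(\<lambda>z. snd (snd z)) \<in> play G \<theta> \<rightarrow>\<^sub>M trajectory G \<theta> (init G)" unfolding play_eq by measurable
  then show "(\<lambda>z. snd (snd z)) \<in> play G \<theta> \<rightarrow>\<^sub>M PiM UNIV (\<lambda>_. SA)"
    by (simp add: sets_trajectory[OF init_space] cong: measurable_cong_sets)
qed

abbreviation (input) x1 :: "nat \<times> nat \<times> (nat \<Rightarrow> 's \<times> ('n \<Rightarrow> real ^ 'k)) \<Rightarrow> 's \<times> ('n \<Rightarrow> real ^ 'k)" where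
  "x1 z \<equiv> snd (snd z) (fst z)"

lemma play_coordinate: "(\<lambda>z. snd (snd z) (fst z)) \<in> play G \<theta> \<rightarrow>\<^sub>M SA"
  "(\<lambda>z. snd (snd z) (fst z + 1)) \<in> play G \<theta> \<rightarrow>\<^sub>M SA"
proof -
  show "(\<lambda>z. snd (snd z) (fst z)) \<in> play G \<theta> \<rightarrow>\<^sub>M SA"
    by (rule coordinate_random_time[OF play_projections(3,1)])
  have "(\<lambda>z. fst z + 1) \<in> play G \<theta> \<rightarrow>\<^sub>M count_space UNIV"
    by (rule measurable_compose[OF play_projections(1)]) simp
  from coordinate_random_time[OF play_projections(3) this]
  show "(\<lambda>z. snd (snd z) (fst z + 1)) \<in> play G \<theta> \<rightarrow>\<^sub>M SA" .
qed

lemma play_reward_sum: "(\<lambda>z. reward_sum G i (fst z) (fst (snd z)) (snd (snd z))) \<in> borel_measurable (play G \<theta>)"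
  by (rule reward_sum_measurable[OF play_projections(3,1,2)])

lemma play_in: "z \<in> space (play G \<theta>) \<Longrightarrow> snd (snd z) t \<in> space SA"
  using coordinate_in[OF init_space, of "snd (snd z)" \<theta> t] by (auto simp: play_eq space_pair_measure)

lemma play_nn_integral:
  assumes f: "act_bounded \<theta> c f"
  shows "(\<integral>\<^sup>+z. ennreal \<bar>f (x1 z)\<bar> \<partial>play G \<theta>) \<le> ennreal c" "integrable (play G \<theta>) (\<lambda>z. f (x1 z))"
proof -
  let ?T = "trajectory G \<theta> (init G)"
  interpret T: prob_space ?T by (rule trajectory_prob[OF init_space])
  interpret p1: prob_space p1 by (rule p_prob)
  interpret p2: prob_space p2 by (rule p_prob)
  interpret pp: pair_prob_space p2 ?T ..
  have m: "(\<lambda>z. f (x1 z)) \<in> borel_measurable (play G \<theta>)"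
    by (rule measurable_compose[OF play_coordinate(1) act_bounded_measurable[OF f]])
  then have m': "(\<lambda>z. ennreal \<bar>f (x1 z)\<bar>) \<in> borel_measurable (p1 \<Otimes>\<^sub>M (p2 \<Otimes>\<^sub>M ?T))"
    unfolding play_eq[symmetric] by measurable
  have "(\<integral>\<^sup>+z. ennreal \<bar>f (x1 z)\<bar> \<partial>play G \<theta>)
      = (\<integral>\<^sup>+t. \<integral>\<^sup>+w. ennreal \<bar>f (snd w t)\<bar> \<partial>(p2 \<Otimes>\<^sub>M ?T) \<partial>p1)"
    unfolding play_eq using pp.nn_integral_fst[OF m'] by simp
  also have "\<dots> \<le> (\<integral>\<^sup>+t. ennreal c \<partial>p1)"
  proof (rule nn_integral_mono)
    fix t
    have "(\<lambda>x. ennreal \<bar>f (x t)\<bar>) \<in> borel_measurable ?T"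
      using measurable_compose[OF coordinate_measurable[OF init_space] act_bounded_measurable[OF f]] by measurable
    then have mw: "(\<lambda>w. ennreal \<bar>f (snd w t)\<bar>) \<in> borel_measurable (p2 \<Otimes>\<^sub>M ?T)"
      by (rule measurable_compose[OF measurable_snd])
    have "(\<integral>\<^sup>+w. ennreal \<bar>f (snd w t)\<bar> \<partial>(p2 \<Otimes>\<^sub>M ?T)) = (\<integral>\<^sup>+n. \<integral>\<^sup>+x. ennreal \<bar>f (x t)\<bar> \<partial>?T \<partial>p2)"
      using T.nn_integral_fst[OF mw] by simp
    also have "\<dots> \<le> ennreal c"
      using coordinate_nn_integral(1)[OF init_space f] by (simp add: p2.emeasure_space_1)
    finally show "(\<integral>\<^sup>+w. ennreal \<bar>f (snd w t)\<bar> \<partial>(p2 \<Otimes>\<^sub>M ?T)) \<le> ennreal c" .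
  qed
  finally show le: "(\<integral>\<^sup>+z. ennreal \<bar>f (x1 z)\<bar> \<partial>play G \<theta>) \<le> ennreal c" by (simp add: p1.emeasure_space_1)
  then show "integrable (play G \<theta>) (\<lambda>z. f (x1 z))"
    by (intro integrableI_bounded m) (auto intro: le_less_trans)
qed

lemma play_integral:
  fixes F :: "nat \<times> nat \<times> (nat \<Rightarrow> 's \<times> ('n \<Rightarrow> real ^ 'k)) \<Rightarrow> real"
  assumes F: "integrable (play G \<theta>) F"
  shows "(\<integral>z. F z \<partial>play G \<theta>) = (\<integral>t. \<integral>x. \<integral>n. F (t, n, x) \<partial>p2 \<partial>trajectory G \<theta> (init G) \<partial>p1)"
proof -
  let ?T = "trajectory G \<theta> (init G)"
  interpret T: prob_space ?T by (rule trajectory_prob[OF init_space])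
  interpret p1: prob_space p1 by (rule p_prob)
  interpret p2: prob_space p2 by (rule p_prob)
  interpret pp: pair_prob_space p2 ?T ..
  interpret ppp: pair_prob_space p1 "p2 \<Otimes>\<^sub>M ?T" ..
  have F': "integrable (p1 \<Otimes>\<^sub>M (p2 \<Otimes>\<^sub>M ?T)) F" using F by (simp add: play_eq)
  have "AE t in p1. integrable (p2 \<Otimes>\<^sub>M ?T) (\<lambda>w. F (t, w))" by (rule ppp.AE_integrable_fst'[OF F'])
  then have "\<forall>t\<in>set_pmf (geometric_pmf (1 - \<gamma>)). integrable (p2 \<Otimes>\<^sub>M ?T) (\<lambda>w. F (t, w))"
    unfolding p1_def by (simp only: AE_measure_pmf_iff)
  \<comment> \<open>Every natural number has positive mass under the geometric law, so an almost
    sure property of the horizon holds for each of its values.\<close>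
  then have It: "integrable (p2 \<Otimes>\<^sub>M ?T) (\<lambda>w. F (t, w))" for t
    using discount set_pmf_geometric[of "1 - \<gamma>"] by simp
  have "(\<integral>z. F z \<partial>play G \<theta>) = (\<integral>t. \<integral>w. F (t, w) \<partial>(p2 \<Otimes>\<^sub>M ?T) \<partial>p1)"
    unfolding play_eq by (rule ppp.integral_fst'[OF F', symmetric])
  also have "\<dots> = (\<integral>t. \<integral>x. \<integral>n. F (t, n, x) \<partial>p2 \<partial>?T \<partial>p1)"
  proof (rule Bochner_Integration.integral_cong[OF refl])
    fix t
    show "(\<integral>w. F (t, w) \<partial>(p2 \<Otimes>\<^sub>M ?T)) = (\<integral>x. \<integral>n. F (t, n, x) \<partial>p2 \<partial>?T)"
      using pp.integral_snd[of "\<lambda>n x. F (t, n, x)"] It[of t] by (simp add: case_prod_beta')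
  qed
  finally show ?thesis .
qed

lemma play_integral_first:
  assumes f: "act_bounded \<theta> c f"
  shows "(\<integral>z. f (x1 z) \<partial>play G \<theta>) = (\<integral>t. \<integral>x. f (x t) \<partial>trajectory G \<theta> (init G) \<partial>p1)"
proof -
  interpret p2: prob_space p2 by (rule p_prob)
  show ?thesis unfolding play_integral[OF play_nn_integral(2)[OF f]] by (simp add: p2.prob_space)
qed

lemma geometric_integral:
  fixes e :: "nat \<Rightarrow> real"
  assumes q: "0 < q" "q < 1" and e: "\<And>n. \<bar>e n\<bar> \<le> b"
  shows "(\<lambda>n. q ^ n * (1 - q) * e n) sums (\<integral>n. e n \<partial>measure_pmf (geometric_pmf (1 - q)))"
proof -
  let ?p = "measure_pmf (geometric_pmf (1 - q))"
  have I: "integrable ?p e" by (rule measure_pmf.integrable_const_bound[where B=b]) (use e in auto)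
  have "integrable (count_space UNIV) (\<lambda>n. pmf (geometric_pmf (1 - q)) n * e n)"
    using I unfolding measure_pmf_eq_density by (subst (asm) integrable_density) auto
  then have "(\<lambda>n. pmf (geometric_pmf (1 - q)) n * e n) sums (\<integral>n. pmf (geometric_pmf (1 - q)) n * e n \<partial>count_space UNIV)"
    by (rule sums_integral_count_space_nat)
  also have "(\<integral>n. pmf (geometric_pmf (1 - q)) n * e n \<partial>count_space UNIV) = (\<integral>n. e n \<partial>?p)"
    unfolding measure_pmf_eq_density by (subst integral_density) auto
  finally show ?thesis using q by simp
qed

lemma play_QJ: "(\<integral>z. Qf i \<theta> (x1 z) * jscore \<theta> (x1 z) $ m \<partial>play G \<theta>) = (1 - \<gamma>) * DU i \<theta> $ m"
proof -
  let ?T = "trajectory G \<theta> (init G)"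
  let ?e = "\<lambda>t. \<integral>x. Qf i \<theta> (x t) * jscore \<theta> (x t) $ m \<partial>?T"
  have "\<bar>?e t\<bar> \<le> b1" for t
  proof -
    have "ennreal \<bar>?e t\<bar> \<le> (\<integral>\<^sup>+x. ennreal \<bar>Qf i \<theta> (x t) * jscore \<theta> (x t) $ m\<bar> \<partial>?T)"
      using integral_norm_bound_ennreal[OF coordinate_nn_integral(2)[OF init_space act_bounded_QJ]] by simp
    also have "\<dots> \<le> ennreal b1" by (rule coordinate_nn_integral(1)[OF init_space act_bounded_QJ])
    finally show ?thesis using const_nonneg by simp
  qed
  from geometric_integral[OF discount this]
  have "(\<lambda>t. \<gamma> ^ t * (1 - \<gamma>) * ?e t) sums (\<integral>z. Qf i \<theta> (x1 z) * jscore \<theta> (x1 z) $ m \<partial>play G \<theta>)"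
    unfolding play_integral_first[OF act_bounded_QJ] p1_def .
  moreover have "(\<lambda>t. \<gamma> ^ t * (1 - \<gamma>) * ?e t) sums ((1 - \<gamma>) * DU i \<theta> $ m)"
    using sums_mult[OF QJ_discounted_mean[of \<theta> i m], of "1 - \<gamma>"] by (simp add: mult_ac)
  ultimately show ?thesis by (rule sums_unique2)
qed

lemma act_bounded_J: "act_bounded \<theta> (1 + W) (\<lambda>x. jscore \<theta> x $ m)"
  using act_bounded_score[of "\<lambda>_. 1" 1 \<theta> m] by simp

text \<open>Given the trajectory, the second horizon averages to the discounted reward series from
  time \<open>T1\<close> on. The score at \<open>T1\<close> is then the earlier factor of the
  discounted-sum formula, which replaces the series by \<open>Qf\<close>.\<close>

lemma play_Q_estimator:
  "integrable (play G \<theta>) (\<lambda>z. reward_sum G i (fst z) (fst (snd z)) (snd (snd z)) * jscore \<theta> (x1 z) $ m)"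
  "(\<integral>z. reward_sum G i (fst z) (fst (snd z)) (snd (snd z)) * jscore \<theta> (x1 z) $ m \<partial>play G \<theta>) = (1 - \<gamma>) * DU i \<theta> $ m"
proof -
  let ?T = "trajectory G \<theta> (init G)"
  let ?J = "\<lambda>x. jscore \<theta> x $ m"
  interpret T: prob_space ?T by (rule trajectory_prob[OF init_space])
  note J = act_bounded_J[of \<theta> m]
  note xin = coordinate_in[OF init_space]
  show I: "integrable (play G \<theta>) (\<lambda>z. reward_sum G i (fst z) (fst (snd z)) (snd (snd z)) * ?J (x1 z))"
  proof (rule Bochner_Integration.integrable_bound)
    show "integrable (play G \<theta>) (\<lambda>z. rb * ?J (x1 z))" by (intro integrable_mult_right play_nn_integral(2)[OF J])
    show "(\<lambda>z. reward_sum G i (fst z) (fst (snd z)) (snd (snd z)) * ?J (x1 z)) \<in> borel_measurable (play G \<theta>)"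
      by (intro borel_measurable_times play_reward_sum measurable_compose[OF play_coordinate(1) jscore_component_measurable])
    show "AE z in play G \<theta>. norm (reward_sum G i (fst z) (fst (snd z)) (snd (snd z)) * ?J (x1 z)) \<le> norm (rb * ?J (x1 z))"
      using reward_sum_bound[OF play_in] rb_nonneg by (intro AE_I2) (simp add: abs_mult mult_right_mono)
  qed
  have "(\<integral>x. \<integral>n. reward_sum G i t n x * ?J (x t) \<partial>p2 \<partial>?T) = (\<integral>x. Qf i \<theta> (x t) * ?J (x t) \<partial>?T)" for t
  proof -
    have "(\<integral>x. \<integral>n. reward_sum G i t n x * ?J (x t) \<partial>p2 \<partial>?T)
        = (\<integral>x. (\<Sum>k. \<gamma> ^ k * (?J (x t) * reward G i (x (t + k)))) \<partial>?T)"
    proof (rule Bochner_Integration.integral_cong[OF refl])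
      fix x assume x: "x \<in> space ?T"
      have "summable (\<lambda>k. \<gamma> ^ k * reward G i (x (t + k)))"
      proof (rule summable_comparison_test'[of "\<lambda>k. \<gamma> ^ k * R" 0])
        show "summable (\<lambda>k. \<gamma> ^ k * R)" using discount by (intro summable_mult2 summable_geometric) auto
      qed (use reward_bound[OF xin[OF x]] discount in \<open>simp add: abs_mult mult_left_mono\<close>)
      from suminf_mult[OF this, of "?J (x t)"]
      show "(\<integral>n. reward_sum G i t n x * ?J (x t) \<partial>p2) = (\<Sum>k. \<gamma> ^ k * (?J (x t) * reward G i (x (t + k))))"
        using horizon_mean[OF xin[OF x], of i t] by (simp add: p2_def mult_ac)
    qed
    also have "\<dots> = (\<integral>x. ?J (x t) * Qf i \<theta> (x t) \<partial>?T)"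
    proof -
      have a: "(\<lambda>k. \<integral>x. \<gamma> ^ k * (?J (x t) * reward G i (x (t + k))) \<partial>?T)
          sums (\<integral>x. (\<Sum>k. \<gamma> ^ k * (?J (x t) * reward G i (x (t + k)))) \<partial>?T)"
      proof (rule series_integral_dominated)
        show "(\<lambda>x. \<gamma> ^ k * (?J (x t) * reward G i (x (t + k)))) \<in> borel_measurable ?T" for k
          by (intro borel_measurable_times borel_measurable_const
              measurable_compose[OF coordinate_measurable[OF init_space] jscore_component_measurable]
              measurable_compose[OF coordinate_measurable[OF init_space] reward_measurable])
        show "integrable ?T (\<lambda>x. ?J (x t))" by (rule coordinate_nn_integral(2)[OF init_space J])
        show "\<bar>\<gamma> ^ k * (?J (x t) * reward G i (x (t + k)))\<bar> \<le> (\<gamma> ^ k * R) * \<bar>?J (x t)\<bar>" if "x \<in> space ?T" for k x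
          using mult_left_mono[OF reward_bound[OF xin[OF that, of "t + k"], of i], of "\<gamma> ^ k * \<bar>?J (x t)\<bar>"] discount
          by (simp add: abs_mult mult_ac)
        show "summable (\<lambda>k. \<gamma> ^ k * R)" using discount by (intro summable_mult2 summable_geometric) auto
      qed (use discount R in simp)
      have b: "(\<lambda>k. \<gamma> ^ k * (\<integral>x. ?J (x t) * reward G i (x (t + k)) \<partial>?T)) sums (\<integral>x. ?J (x t) * Qf i \<theta> (x t) \<partial>?T)"
        unfolding Qf_def
        by (rule discounted_sum[OF init_space jscore_component_measurable coordinate_nn_integral(2)[OF init_space J]
              reward_measurable reward_bound])
      show ?thesis using sums_unique2[OF a] b by simp
    qed
    finally show ?thesis by (simp add: mult.commute)
  qed
  then have "(\<integral>z. reward_sum G i (fst z) (fst (snd z)) (snd (snd z)) * ?J (x1 z) \<partial>play G \<theta>)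
      = (\<integral>z. Qf i \<theta> (x1 z) * ?J (x1 z) \<partial>play G \<theta>)"
    unfolding play_integral[OF I] play_integral_first[OF act_bounded_QJ] by simp
  then show "(\<integral>z. reward_sum G i (fst z) (fst (snd z)) (snd (snd z)) * ?J (x1 z) \<partial>play G \<theta>) = (1 - \<gamma>) * DU i \<theta> $ m"
    by (simp add: play_QJ)
qed

lemma act_bounded_VJ: "act_bounded \<theta> b1 (\<lambda>x. Vf i \<theta> (fst x) * jscore \<theta> x $ m)"
  unfolding b1_def
proof (rule act_bounded_score[OF state_measurable[OF Vf_measurable] Vf_bound const_nonneg(1)])
  show "x \<in> space SA \<Longrightarrow> fst x \<in> space S" for x by (auto simp: space_SA)
qed

text \<open>The value estimate is a baseline: given the state, the score has mean zero.\<close>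

lemma play_VJ: "(\<integral>z. Vf i \<theta> (fst (x1 z)) * jscore \<theta> (x1 z) $ m \<partial>play G \<theta>) = 0"
proof -
  have "(\<integral>x. Vf i \<theta> (fst (x t)) * jscore \<theta> (x t) $ m \<partial>trajectory G \<theta> (init G)) = 0" for t
    by (rule coordinate_mean_zero[OF init_space act_bounded_VJ])
      (simp add: act_mean_state_factor[OF _ Vf_measurable jscore_component_measurable] jscore_mean)
  then show ?thesis unfolding play_integral_first[OF act_bounded_VJ] by simp
qed

text \<open>Given the pair at time \<open>T1\<close>, the reward plus the discounted value of the
  next state has mean \<open>Qf\<close>: this is the Bellman equation combined with one use of the
  Markov property.\<close>

lemma play_TD:
  "integrable (play G \<theta>) (\<lambda>z. (reward G i (x1 z) + \<gamma> * Vf i \<theta> (fst (snd (snd z) (fst z + 1)))) * jscore \<theta> (x1 z) $ m)"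
  "(\<integral>z. (reward G i (x1 z) + \<gamma> * Vf i \<theta> (fst (snd (snd z) (fst z + 1)))) * jscore \<theta> (x1 z) $ m \<partial>play G \<theta>)
    = (1 - \<gamma>) * DU i \<theta> $ m"
proof -
  let ?T = "trajectory G \<theta> (init G)"
  let ?J = "\<lambda>x. jscore \<theta> x $ m" and ?V = "\<lambda>x. Vf i \<theta> (fst x)"
  interpret p2: prob_space p2 by (rule p_prob)
  note J = act_bounded_J[of \<theta> m]
  note Jm = jscore_component_measurable
  have Vm: "?V \<in> borel_measurable SA" by (rule state_measurable[OF Vf_measurable])
  have Vb: "\<bar>?V x\<bar> \<le> b0" if "x \<in> space SA" for x using that by (intro Vf_bound) (auto simp: space_SA)
  have b0: "\<bar>r + \<gamma> * v\<bar> \<le> R + b0" if "\<bar>r\<bar> \<le> R" "\<bar>v\<bar> \<le> b0" for r v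
  proof -
    have "\<bar>r + \<gamma> * v\<bar> \<le> \<bar>r\<bar> + \<gamma> * \<bar>v\<bar>" using discount abs_triangle_ineq[of r "\<gamma> * v"] by (simp add: abs_mult)
    also have "\<gamma> * \<bar>v\<bar> \<le> 1 * b0" using that discount by (intro mult_mono) auto
    finally show ?thesis using that by simp
  qed
  show I: "integrable (play G \<theta>) (\<lambda>z. (reward G i (x1 z) + \<gamma> * ?V (snd (snd z) (fst z + 1))) * ?J (x1 z))"
  proof (rule Bochner_Integration.integrable_bound)
    show "integrable (play G \<theta>) (\<lambda>z. (R + b0) * ?J (x1 z))" by (intro integrable_mult_right play_nn_integral(2)[OF J])
    show "(\<lambda>z. (reward G i (x1 z) + \<gamma> * ?V (snd (snd z) (fst z + 1))) * ?J (x1 z)) \<in> borel_measurable (play G \<theta>)"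
      by (intro borel_measurable_times borel_measurable_add borel_measurable_const
          measurable_compose[OF play_coordinate(1) Jm] measurable_compose[OF play_coordinate(1) reward_measurable]
          measurable_compose[OF play_coordinate(2) Vm])
    show "AE z in play G \<theta>. norm ((reward G i (x1 z) + \<gamma> * ?V (snd (snd z) (fst z + 1))) * ?J (x1 z)) \<le> norm ((R + b0) * ?J (x1 z))"
      using b0[OF reward_bound[OF play_in] Vb[OF play_in]] const_nonneg R
      by (intro AE_I2) (simp add: abs_mult mult_right_mono)
  qed
  have "(\<integral>x. (reward G i (x t) + \<gamma> * ?V (x (t + 1))) * ?J (x t) \<partial>?T) = (\<integral>x. Qf i \<theta> (x t) * ?J (x t) \<partial>?T)" for t
  proof -
    note JI = coordinate_nn_integral(2)[OF init_space J, of t]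
    have aV: "act_bounded \<theta> b0 ?V" by (rule act_boundedI[OF Vm Vb const_nonneg(1)])
    have kV: "kop (next_pair \<theta>) ?V x = trans_mean (Vf i \<theta>) x" if x: "x \<in> space SA" for x
    proof -
      have "act_mean \<theta> ?V s = Vf i \<theta> s" if s: "s \<in> space S" for s
        using act_mean_state_factor[OF s Vf_measurable[of i \<theta>], of "\<lambda>_. 1" \<theta>]
          prob_space.prob_space[OF prob_kernelD(1)[OF act_step_kernel[of \<theta>] s]] by (simp add: act_mean_def)
      then have "trans_mean (act_mean \<theta> ?V) x = trans_mean (Vf i \<theta>) x" unfolding trans_mean_def
        by (intro Bochner_Integration.integral_cong) (use prob_kernelD(3)[OF transition_kernel x] in auto)
      then show ?thesis by (simp add: kop_next_pair[OF aV x])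
    qed
    have IV: "integrable ?T (\<lambda>x. ?J (x t) * ?V (x (Suc t)))"
    proof (rule Bochner_Integration.integrable_bound)
      show "integrable ?T (\<lambda>x. b0 * ?J (x t))" using JI by simp
      show "(\<lambda>x. ?J (x t) * ?V (x (Suc t))) \<in> borel_measurable ?T"
        by (intro borel_measurable_times measurable_compose[OF coordinate_measurable[OF init_space] Jm]
            measurable_compose[OF coordinate_measurable[OF init_space] Vm])
      show "AE x in ?T. norm (?J (x t) * ?V (x (Suc t))) \<le> norm (b0 * ?J (x t))"
        using Vb[OF coordinate_in[OF init_space]] const_nonneg
        by (intro AE_I2) (simp add: abs_mult mult.commute[of b0] mult_left_mono)
    qed
    have Ir: "integrable ?T (\<lambda>x. reward G i (x t) * ?J (x t))"
      by (rule coordinate_nn_integral(2)[OF init_space act_bounded_score[OF reward_measurable reward_bound less_imp_le[OF R]]])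
    have IQ: "integrable ?T (\<lambda>x. Qf i \<theta> (x t) * ?J (x t))"
      by (rule coordinate_nn_integral(2)[OF init_space act_bounded_QJ])
    have "(\<integral>x. (reward G i (x t) + \<gamma> * ?V (x (t + 1))) * ?J (x t) \<partial>?T)
        = (\<integral>x. reward G i (x t) * ?J (x t) + \<gamma> * (?J (x t) * ?V (x (Suc t))) \<partial>?T)"
      by (simp add: algebra_simps)
    also have "\<dots> = (\<integral>x. reward G i (x t) * ?J (x t) \<partial>?T) + \<gamma> * (\<integral>x. ?J (x t) * ?V (x (Suc t)) \<partial>?T)"
      using Ir IV by simp
    also have "(\<integral>x. ?J (x t) * ?V (x (Suc t)) \<partial>?T) = (\<integral>x. ?J (x t) * kop (next_pair \<theta>) ?V (x t) \<partial>?T)"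
      by (rule markov_property[OF init_space Jm JI Vm Vb order_refl])
    also have "\<gamma> * (\<integral>x. ?J (x t) * kop (next_pair \<theta>) ?V (x t) \<partial>?T)
        = (\<integral>x. Qf i \<theta> (x t) * ?J (x t) - reward G i (x t) * ?J (x t) \<partial>?T)"
      unfolding integral_mult_right_zero[symmetric]
      by (rule Bochner_Integration.integral_cong[OF refl])
        (simp add: kV Qf_eq coordinate_in[OF init_space] algebra_simps)
    finally show ?thesis using Ir IQ by simp
  qed
  then have "(\<integral>z. (reward G i (x1 z) + \<gamma> * ?V (snd (snd z) (fst z + 1))) * ?J (x1 z) \<partial>play G \<theta>)
      = (\<integral>z. Qf i \<theta> (x1 z) * ?J (x1 z) \<partial>play G \<theta>)"
    unfolding play_integral[OF I] play_integral_first[OF act_bounded_QJ] by (simp add: p2.prob_space)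
  then show "(\<integral>z. (reward G i (x1 z) + \<gamma> * ?V (snd (snd z) (fst z + 1))) * ?J (x1 z) \<partial>play G \<theta>) = (1 - \<gamma>) * DU i \<theta> $ m"
    by (simp add: play_QJ)
qed

end

lemma distr_pair_snd:
  assumes "prob_space M" "prob_space N"
  shows "distr (M \<Otimes>\<^sub>M N) N snd = N"
proof (rule measure_eqI)
  interpret M: prob_space M by fact
  interpret N: prob_space N by fact
  fix X assume "X \<in> sets (distr (M \<Otimes>\<^sub>M N) N snd)"
  then have X: "X \<in> sets N" by simp
  have "snd -` X \<inter> space (M \<Otimes>\<^sub>M N) = space M \<times> X"
    using sets.sets_into_space[OF X] by (auto simp: space_pair_measure)
  then show "emeasure (distr (M \<Otimes>\<^sub>M N) N snd) X = emeasure N X"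
    using X by (simp add: emeasure_distr N.emeasure_pair_measure_Times M.emeasure_space_1)
qed simp

lemma affine_integral:
  fixes f g :: "'z \<Rightarrow> real"
  assumes "prob_space N" "integrable N f" "integrable N g"
  shows "(\<integral>v. a + b * g v - f v \<partial>N) = a + b * (\<integral>v. g v \<partial>N) - (\<integral>v. f v \<partial>N)"
proof -
  interpret prob_space N by fact
  show ?thesis using assms(2,3) by (simp add: prob_space)
qed

context smooth_markov
begin

section \<open>Bias and moments of the three gradient laws\<close>

lemma play_jscore_moment:
  "(\<integral>\<^sup>+z. ennreal ((norm (jscore \<theta> (x1 z)))\<^sup>2) \<partial>play G \<theta>) \<le> ennreal W"
proof -
  have "act_bounded \<theta> W (\<lambda>x. (norm (jscore \<theta> x))\<^sup>2)"
    unfolding act_bounded_def using jscore_second_moment W_nonneg by (auto intro!: borel_measurable_power)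
  from play_nn_integral(1)[OF this] show ?thesis by simp
qed

lemma norm_score_sum_le: "x \<in> space SA \<Longrightarrow> norm (score_sum G i \<theta> x) \<le> norm (jscore \<theta> x)"
  by (simp add: score_sum_eq_block norm_block_le)

lemma vec_nth_borel: "(\<lambda>y::real ^ 'm. y $ m) \<in> borel_measurable borel"
  by (rule borel_measurable_continuous_onI[OF linear_continuous_on[OF bounded_linear_vec_nth]])

lemma scaled_score_moment:
  assumes "z \<in> space (play G \<theta>)" "\<bar>c\<bar> \<le> C"
  shows "ennreal ((norm (c *\<^sub>R score_sum G i \<theta> (x1 z)))\<^sup>2) \<le> ennreal (C\<^sup>2) * ennreal ((norm (jscore \<theta> (x1 z)))\<^sup>2)"
proof -
  have "norm (c *\<^sub>R score_sum G i \<theta> (x1 z)) \<le> C * norm (jscore \<theta> (x1 z))"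
    using assms norm_score_sum_le[OF play_in[OF assms(1)]] by (auto intro!: mult_mono)
  then have "(norm (c *\<^sub>R score_sum G i \<theta> (x1 z)))\<^sup>2 \<le> (C * norm (jscore \<theta> (x1 z)))\<^sup>2" by (intro power_mono) auto
  then show ?thesis by (simp add: power_mult_distrib ennreal_mult[symmetric] ennreal_leI)
qed

text \<open>The common shape of the estimators: after the main round \<open>z\<close>, an auxiliary
  draw \<open>v\<close> with law \<open>N z\<close> supplies the scalar \<open>c z v\<close> in
  front of the score. Boundedness of the scalar reduces the second moment to that of the score; for
  the mean, the auxiliary draw is integrated out first.\<close>

lemma estimator_mixture:
  assumes N: "N \<in> play G \<theta> \<rightarrow>\<^sub>M prob_algebra N0"
    and c: "(\<lambda>(z, v). c z v) \<in> borel_measurable (play G \<theta> \<Otimes>\<^sub>M N0)"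
    and cb: "\<And>z. z \<in> space (play G \<theta>) \<Longrightarrow> AE v in N z. \<bar>c z v\<bar> \<le> C"
    and \<kappa>: "\<kappa> = play G \<theta> \<bind> (\<lambda>z. distr (N z) borel (\<lambda>v. c z v *\<^sub>R score_sum G i \<theta> (x1 z)))"
  shows "prob_space \<kappa>" "sets \<kappa> = sets borel"
    "(\<integral>\<^sup>+y. ennreal ((norm y)\<^sup>2) \<partial>\<kappa>) \<le> ennreal (C\<^sup>2 * W)"
    "owner G m = i \<Longrightarrow> (\<integral>y. y $ m \<partial>\<kappa>) = (\<integral>z. (\<integral>v. c z v \<partial>N z) * jscore \<theta> (x1 z) $ m \<partial>play G \<theta>)"
proof -
  let ?P = "play G \<theta>"
  let ?k = "\<lambda>z. distr (N z) borel (\<lambda>v. c z v *\<^sub>R score_sum G i \<theta> (x1 z))"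
  interpret P: prob_space ?P by (rule play_prob)
  have sm: "(\<lambda>z. score_sum G i \<theta> (x1 z)) \<in> borel_measurable ?P"
    by (rule measurable_compose[OF play_coordinate(1) score_sum_measurable])
  have km: "(\<lambda>w. c (fst w) (snd w) *\<^sub>R score_sum G i \<theta> (x1 (fst w))) \<in> borel_measurable (?P \<Otimes>\<^sub>M N0)"
  proof (rule borel_measurable_scaleR)
    show "(\<lambda>w. c (fst w) (snd w)) \<in> borel_measurable (?P \<Otimes>\<^sub>M N0)" using c by (simp add: case_prod_beta')
    show "(\<lambda>w. score_sum G i \<theta> (x1 (fst w))) \<in> borel_measurable (?P \<Otimes>\<^sub>M N0)"
      by (rule measurable_compose[OF measurable_fst sm])
  qed
  have k: "?k \<in> ?P \<rightarrow>\<^sub>M prob_algebra borel"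
    by (rule measurable_distr_prob_space2[OF N]) (use km in \<open>simp add: case_prod_beta'\<close>)
  note k' = measurable_prob_algebraD[OF k]
  have Pin: "?P \<in> space (prob_algebra ?P)" by (simp add: space_prob_algebra P.prob_space_axioms)
  show "prob_space \<kappa>" unfolding \<kappa> by (rule prob_space_bind'[OF Pin k])
  show "sets \<kappa> = sets borel" unfolding \<kappa> by (rule sets_bind'[OF Pin k])
  have cz: "c z \<in> borel_measurable (N z)" if "z \<in> space ?P" for z
    using measurable_compose[OF measurable_Pair1'[OF that] c] prob_kernelD(2)[OF N that]
    by (simp cong: measurable_cong_sets)
  have gz: "(\<lambda>v. c z v *\<^sub>R score_sum G i \<theta> (x1 z)) \<in> borel_measurable (N z)" if "z \<in> space ?P" for z
    using cz[OF that] by (intro borel_measurable_scaleR) auto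
  have "(\<integral>\<^sup>+y. ennreal ((norm y)\<^sup>2) \<partial>\<kappa>) = (\<integral>\<^sup>+z. \<integral>\<^sup>+y. ennreal ((norm y)\<^sup>2) \<partial>?k z \<partial>?P)"
    unfolding \<kappa> by (rule nn_integral_bind[OF _ k']) measurable
  also have "\<dots> \<le> (\<integral>\<^sup>+z. ennreal (C\<^sup>2) * ennreal ((norm (jscore \<theta> (x1 z)))\<^sup>2) \<partial>?P)"
  proof (rule nn_integral_mono)
    fix z assume z: "z \<in> space ?P"
    have "(\<integral>\<^sup>+y. ennreal ((norm y)\<^sup>2) \<partial>?k z) = (\<integral>\<^sup>+v. ennreal ((norm (c z v *\<^sub>R score_sum G i \<theta> (x1 z)))\<^sup>2) \<partial>N z)"
      by (subst nn_integral_distr[OF gz[OF z]]) auto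
    also have "\<dots> \<le> (\<integral>\<^sup>+v. ennreal (C\<^sup>2) * ennreal ((norm (jscore \<theta> (x1 z)))\<^sup>2) \<partial>N z)"
      using cb[OF z] by (intro nn_integral_mono_AE, eventually_elim) (rule scaled_score_moment[OF z])
    finally show "(\<integral>\<^sup>+y. ennreal ((norm y)\<^sup>2) \<partial>?k z) \<le> ennreal (C\<^sup>2) * ennreal ((norm (jscore \<theta> (x1 z)))\<^sup>2)"
      by (simp add: prob_space.emeasure_space_1[OF prob_kernelD(1)[OF N z]])
  qed
  also have "\<dots> = ennreal (C\<^sup>2) * (\<integral>\<^sup>+z. ennreal ((norm (jscore \<theta> (x1 z)))\<^sup>2) \<partial>?P)"
  proof (rule nn_integral_cmult)
    have [measurable]: "(\<lambda>z. jscore \<theta> (x1 z)) \<in> borel_measurable ?P"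
      by (rule measurable_compose[OF play_coordinate(1) jscore_measurable])
    show "(\<lambda>z. ennreal ((norm (jscore \<theta> (x1 z)))\<^sup>2)) \<in> borel_measurable ?P" by measurable
  qed
  also have "\<dots> \<le> ennreal (C\<^sup>2) * ennreal W" by (intro mult_left_mono play_jscore_moment) simp
  finally show mom: "(\<integral>\<^sup>+y. ennreal ((norm y)\<^sup>2) \<partial>\<kappa>) \<le> ennreal (C\<^sup>2 * W)" by (simp add: ennreal_mult W_nonneg)
  assume m: "owner G m = i"
  have comp: "(\<lambda>y. \<bar>y $ m\<bar>) \<in> borel_measurable (borel :: (real ^ 'm) measure)"
    using vec_nth_borel[of m] by measurable
  have fin: "(\<integral>\<^sup>+z. \<integral>\<^sup>+y. ennreal \<bar>y $ m\<bar> \<partial>?k z \<partial>?P) < \<infinity>"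
  proof -
    have "(\<integral>\<^sup>+z. \<integral>\<^sup>+y. ennreal \<bar>y $ m\<bar> \<partial>?k z \<partial>?P) = (\<integral>\<^sup>+y. ennreal \<bar>y $ m\<bar> \<partial>\<kappa>)"
      unfolding \<kappa> using comp by (intro nn_integral_bind[OF _ k', symmetric]) measurable
    also have "\<dots> \<le> (\<integral>\<^sup>+y. 1 + ennreal ((norm y)\<^sup>2) \<partial>\<kappa>)"
    proof (rule nn_integral_mono)
      fix y :: "real ^ 'm"
      have "\<bar>y $ m\<bar> \<le> 1 + (norm y)\<^sup>2"
        using component_le_norm_cart[of y m] norm_le_one_plus_square[of y] by linarith
      then show "ennreal \<bar>y $ m\<bar> \<le> 1 + ennreal ((norm y)\<^sup>2)"
        using ennreal_leI[of "\<bar>y $ m\<bar>" "1 + (norm y)\<^sup>2"] by simp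
    qed
    also have "\<dots> = 1 + (\<integral>\<^sup>+y. ennreal ((norm y)\<^sup>2) \<partial>\<kappa>)"
      using prob_space.emeasure_space_1[OF \<open>prob_space \<kappa>\<close>] \<open>sets \<kappa> = sets borel\<close>
      by (subst nn_integral_add) (auto cong: measurable_cong_sets)
    also have "\<dots> \<le> 1 + ennreal (C\<^sup>2 * W)" using mom by (rule add_left_mono)
    also have "\<dots> < \<infinity>" by simp
    finally show ?thesis .
  qed
  have "(\<integral>y. y $ m \<partial>\<kappa>) = (\<integral>z. \<integral>y. y $ m \<partial>?k z \<partial>?P)"
    unfolding \<kappa> by (rule integral_bind_fin[OF vec_nth_borel k' P.not_empty fin])
  also have "\<dots> = (\<integral>z. (\<integral>v. c z v \<partial>N z) * jscore \<theta> (x1 z) $ m \<partial>?P)"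
  proof (rule Bochner_Integration.integral_cong[OF refl])
    fix z assume z: "z \<in> space ?P"
    have "(\<integral>y. y $ m \<partial>?k z) = (\<integral>v. c z v * jscore \<theta> (x1 z) $ m \<partial>N z)"
      using m by (subst integral_distr[OF gz[OF z] vec_nth_borel]) (simp add: score_sum_eq_block[OF play_in[OF z]])
    then show "(\<integral>y. y $ m \<partial>?k z) = (\<integral>v. c z v \<partial>N z) * jscore \<theta> (x1 z) $ m" by simp
  qed
  finally show "(\<integral>y. y $ m \<partial>\<kappa>) = (\<integral>z. (\<integral>v. c z v \<partial>N z) * jscore \<theta> (x1 z) $ m \<partial>?P)" .
qed

text \<open>Covers the scalars of all three estimators: at most \<open>rb\<close> for the action
  value, \<open>2 * rb\<close> for the advantage, and \<open>R + 2 * rb\<close> for the temporal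
  difference.\<close>

definition Cg :: real where "Cg = R + 2 * rb"

lemma fst_coordinate: "(\<lambda>z. fst (x1 z)) \<in> play G \<theta> \<rightarrow>\<^sub>M S" "(\<lambda>z. fst (snd (snd z) (fst z + 1))) \<in> play G \<theta> \<rightarrow>\<^sub>M S"
proof -
  have f: "fst \<in> SA \<rightarrow>\<^sub>M S" unfolding state_actions_def by (rule measurable_fst)
  show "(\<lambda>z. fst (x1 z)) \<in> play G \<theta> \<rightarrow>\<^sub>M S" by (rule measurable_compose[OF play_coordinate(1) f])
  show "(\<lambda>z. fst (snd (snd z) (fst z + 1))) \<in> play G \<theta> \<rightarrow>\<^sub>M S" by (rule measurable_compose[OF play_coordinate(2) f])
qed

lemma play_fst_in: "z \<in> space (play G \<theta>) \<Longrightarrow> fst (snd (snd z) t) \<in> space S"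
  using play_in[of z \<theta> t] by (auto simp: space_SA)

lemma play_reward_bound: "z \<in> space (play G \<theta>) \<Longrightarrow> \<bar>reward_sum G i t n (snd (snd z))\<bar> \<le> rb"
  by (rule reward_sum_bound[OF play_in])

text \<open>Fits the mixture scheme with a trivial auxiliary draw, the point mass on the unit
  type.\<close>

lemma gradient_law_Q:
  "prob_space (gradient_law G Q_Function i \<theta>)" "sets (gradient_law G Q_Function i \<theta>) = sets borel"
  "(\<integral>\<^sup>+y. ennreal ((norm y)\<^sup>2) \<partial>gradient_law G Q_Function i \<theta>) \<le> ennreal (Cg\<^sup>2 * W)"
  "owner G m = i \<Longrightarrow> (\<integral>y. y $ m \<partial>gradient_law G Q_Function i \<theta>) = (1 - \<gamma>) * DU i \<theta> $ m"
proof -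
  let ?P = "play G \<theta>"
  let ?r = "\<lambda>z. reward_sum G i (fst z) (fst (snd z)) (snd (snd z))"
  let ?N = "\<lambda>_. return (count_space UNIV) () :: unit measure"
  interpret P: prob_space ?P by (rule play_prob)
  have rm: "(\<lambda>w. ?r (fst w)) \<in> borel_measurable (?P \<Otimes>\<^sub>M (count_space UNIV :: unit measure))"
    by (rule measurable_compose[OF measurable_fst play_reward_sum])
  have gm: "(\<lambda>z. ?r z *\<^sub>R score_sum G i \<theta> (x1 z)) \<in> borel_measurable ?P"
    by (intro borel_measurable_scaleR play_reward_sum measurable_compose[OF play_coordinate(1) score_sum_measurable])
  have N: "?N \<in> ?P \<rightarrow>\<^sub>M prob_algebra (count_space UNIV)"
    by (intro measurable_const) (simp add: space_prob_algebra prob_space_return)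
  have d: "distr (return (count_space UNIV) ()) borel (\<lambda>v. ?r z *\<^sub>R score_sum G i \<theta> (x1 z))
      = return borel (?r z *\<^sub>R score_sum G i \<theta> (x1 z))" for z
    by (subst distr_return) auto
  have e: "gradient_law G Q_Function i \<theta>
      = ?P \<bind> (\<lambda>z. distr (?N z) borel (\<lambda>v. ?r z *\<^sub>R score_sum G i \<theta> (x1 z)))"
    unfolding d using bind_return_distr'[OF P.not_empty gm] by (simp add: case_prod_beta')
  have rC: "rb \<le> Cg" using R rb_nonneg by (simp add: Cg_def)
  have cb: "AE v in ?N z. \<bar>?r z\<bar> \<le> Cg" if "z \<in> space ?P" for z
    using play_reward_bound[OF that, of i "fst z" "fst (snd z)"] rC by (intro AE_I2) linarith
  have rm': "(\<lambda>(z, v). ?r z) \<in> borel_measurable (?P \<Otimes>\<^sub>M (count_space UNIV :: unit measure))"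
    using rm by (simp add: case_prod_beta')
  note mix = estimator_mixture[OF N rm' cb e]
  show "prob_space (gradient_law G Q_Function i \<theta>)" by (rule mix(1))
  show "sets (gradient_law G Q_Function i \<theta>) = sets borel" by (rule mix(2))
  show "(\<integral>\<^sup>+y. ennreal ((norm y)\<^sup>2) \<partial>gradient_law G Q_Function i \<theta>) \<le> ennreal (Cg\<^sup>2 * W)" by (rule mix(3))
  assume m: "owner G m = i"
  have "(\<integral>y. y $ m \<partial>gradient_law G Q_Function i \<theta>) = (\<integral>z. (\<integral>v. ?r z \<partial>?N z) * jscore \<theta> (x1 z) $ m \<partial>?P)"
    by (rule mix(4)[OF _ m])
  also have "\<dots> = (\<integral>z. ?r z * jscore \<theta> (x1 z) $ m \<partial>?P)"
    by (simp add: measure_return)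
  finally show "(\<integral>y. y $ m \<partial>gradient_law G Q_Function i \<theta>) = (1 - \<gamma>) * DU i \<theta> $ m"
    by (simp only: play_Q_estimator(2))
qed

lemma value_law_measure: "s \<in> space S \<Longrightarrow> prob_space (value_law G i \<theta> s)"
  by (rule prob_kernelD(1)[OF value_law_kernel])

lemma gradient_law_A:
  "prob_space (gradient_law G Advantage i \<theta>)" "sets (gradient_law G Advantage i \<theta>) = sets borel"
  "(\<integral>\<^sup>+y. ennreal ((norm y)\<^sup>2) \<partial>gradient_law G Advantage i \<theta>) \<le> ennreal (Cg\<^sup>2 * W)"
  "owner G m = i \<Longrightarrow> (\<integral>y. y $ m \<partial>gradient_law G Advantage i \<theta>) = (1 - \<gamma>) * DU i \<theta> $ m"
proof -
  let ?P = "play G \<theta>"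
  let ?r = "\<lambda>z. reward_sum G i (fst z) (fst (snd z)) (snd (snd z))"
  let ?N = "\<lambda>z. value_law G i \<theta> (fst (x1 z))"
  have e: "gradient_law G Advantage i \<theta>
      = ?P \<bind> (\<lambda>z. distr (?N z) borel (\<lambda>v. (?r z - v) *\<^sub>R score_sum G i \<theta> (x1 z)))"
    by (simp add: case_prod_beta')
  have N: "?N \<in> ?P \<rightarrow>\<^sub>M prob_algebra borel"
    by (rule measurable_compose[OF fst_coordinate(1) value_law_kernel])
  have rm: "(\<lambda>(z, v). ?r z - v) \<in> borel_measurable (?P \<Otimes>\<^sub>M borel)"
  proof -
    have "(\<lambda>w. ?r (fst w)) \<in> borel_measurable (?P \<Otimes>\<^sub>M (borel :: real measure))"
      by (rule measurable_compose[OF measurable_fst play_reward_sum])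
    moreover have "snd \<in> borel_measurable (?P \<Otimes>\<^sub>M (borel :: real measure))" by (rule measurable_snd)
    ultimately show ?thesis unfolding case_prod_beta' by (rule borel_measurable_diff)
  qed
  have cb: "AE v in ?N z. \<bar>?r z - v\<bar> \<le> Cg" if z: "z \<in> space ?P" for z
    using value_law_bound[OF play_fst_in[OF z]]
  proof eventually_elim
    case (elim v)
    then show ?case using play_reward_bound[OF z, of i "fst z" "fst (snd z)"] R
      by (simp add: Cg_def)
  qed
  note mix = estimator_mixture[OF N rm cb e]
  show "prob_space (gradient_law G Advantage i \<theta>)" by (rule mix(1))
  show "sets (gradient_law G Advantage i \<theta>) = sets borel" by (rule mix(2))
  show "(\<integral>\<^sup>+y. ennreal ((norm y)\<^sup>2) \<partial>gradient_law G Advantage i \<theta>) \<le> ennreal (Cg\<^sup>2 * W)" by (rule mix(3))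
  assume m: "owner G m = i"
  have "(\<integral>y. y $ m \<partial>gradient_law G Advantage i \<theta>) = (\<integral>z. (\<integral>v. ?r z - v \<partial>?N z) * jscore \<theta> (x1 z) $ m \<partial>?P)"
    by (rule mix(4)[OF _ m])
  also have "\<dots> = (\<integral>z. ?r z * jscore \<theta> (x1 z) $ m - Vf i \<theta> (fst (x1 z)) * jscore \<theta> (x1 z) $ m \<partial>?P)"
  proof (rule Bochner_Integration.integral_cong[OF refl])
    fix z assume z: "z \<in> space ?P"
    interpret v: prob_space "?N z" by (rule value_law_measure[OF play_fst_in[OF z]])
    have "(\<integral>v. ?r z - v \<partial>?N z) = ?r z - Vf i \<theta> (fst (x1 z))"
      using value_law_integrable[OF play_fst_in[OF z], of i \<theta>] value_law_mean[OF play_fst_in[OF z], of i \<theta>]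
      by (simp add: v.prob_space)
    then show "(\<integral>v. ?r z - v \<partial>?N z) * jscore \<theta> (x1 z) $ m
        = ?r z * jscore \<theta> (x1 z) $ m - Vf i \<theta> (fst (x1 z)) * jscore \<theta> (x1 z) $ m"
      by (simp add: left_diff_distrib)
  qed
  also have "\<dots> = (\<integral>z. ?r z * jscore \<theta> (x1 z) $ m \<partial>?P) - (\<integral>z. Vf i \<theta> (fst (x1 z)) * jscore \<theta> (x1 z) $ m \<partial>?P)"
    by (rule Bochner_Integration.integral_diff[OF play_Q_estimator(1) play_nn_integral(2)[OF act_bounded_VJ]])
  finally show "(\<integral>y. y $ m \<partial>gradient_law G Advantage i \<theta>) = (1 - \<gamma>) * DU i \<theta> $ m"
    by (simp only: play_Q_estimator(2) play_VJ)
qed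

lemma gradient_law_TD:
  "prob_space (gradient_law G Temporal_Difference i \<theta>)" "sets (gradient_law G Temporal_Difference i \<theta>) = sets borel"
  "(\<integral>\<^sup>+y. ennreal ((norm y)\<^sup>2) \<partial>gradient_law G Temporal_Difference i \<theta>) \<le> ennreal (Cg\<^sup>2 * W)"
  "owner G m = i \<Longrightarrow> (\<integral>y. y $ m \<partial>gradient_law G Temporal_Difference i \<theta>) = (1 - \<gamma>) * DU i \<theta> $ m"
proof -
  let ?P = "play G \<theta>"
  let ?y = "\<lambda>z. snd (snd z) (fst z + 1)"
  let ?r = "\<lambda>z. reward G i (x1 z)"
  let ?A = "\<lambda>z. value_law G i \<theta> (fst (x1 z))" and ?B = "\<lambda>z. value_law G i \<theta> (fst (?y z))"
  let ?c = "\<lambda>z v. ?r z + \<gamma> * snd v - fst v"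
  have e: "gradient_law G Temporal_Difference i \<theta>
      = ?P \<bind> (\<lambda>z. distr (?A z \<Otimes>\<^sub>M ?B z) borel (\<lambda>v. ?c z v *\<^sub>R score_sum G i \<theta> (x1 z)))"
    by (simp add: case_prod_beta')
  have N: "(\<lambda>z. ?A z \<Otimes>\<^sub>M ?B z) \<in> ?P \<rightarrow>\<^sub>M prob_algebra (borel \<Otimes>\<^sub>M borel)"
    by (intro measurable_pair_prob measurable_compose[OF fst_coordinate(1) value_law_kernel]
        measurable_compose[OF fst_coordinate(2) value_law_kernel])
  have "(\<lambda>w. ?r (fst w)) \<in> borel_measurable (?P \<Otimes>\<^sub>M (borel \<Otimes>\<^sub>M borel))"
    by (rule measurable_compose[OF measurable_fst measurable_compose[OF play_coordinate(1) reward_measurable]])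
  moreover have "(\<lambda>w. snd (snd w)) \<in> borel_measurable (?P \<Otimes>\<^sub>M (borel \<Otimes>\<^sub>M borel :: (real \<times> real) measure))"
    "(\<lambda>w. fst (snd w)) \<in> borel_measurable (?P \<Otimes>\<^sub>M (borel \<Otimes>\<^sub>M borel :: (real \<times> real) measure))" by measurable
  ultimately have rm: "(\<lambda>(z, v). ?c z v) \<in> borel_measurable (?P \<Otimes>\<^sub>M (borel \<Otimes>\<^sub>M borel))"
    unfolding case_prod_beta' by (intro borel_measurable_diff borel_measurable_add borel_measurable_times borel_measurable_const)
  \<comment> \<open>The scalar is affine in the two value estimates, so its mean and its bound
    follow from the two marginals of the product.\<close>
  have pair: "integrable (?A z \<Otimes>\<^sub>M ?B z) fst" "integrable (?A z \<Otimes>\<^sub>M ?B z) snd"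
    "(\<integral>v. fst v \<partial>(?A z \<Otimes>\<^sub>M ?B z)) = Vf i \<theta> (fst (x1 z))"
    "(\<integral>v. snd v \<partial>(?A z \<Otimes>\<^sub>M ?B z)) = Vf i \<theta> (fst (?y z))"
    "AE v in ?A z \<Otimes>\<^sub>M ?B z. \<bar>fst v\<bar> \<le> rb \<and> \<bar>snd v\<bar> \<le> rb"
    "prob_space (?A z \<Otimes>\<^sub>M ?B z)"
    if z: "z \<in> space ?P" for z
  proof -
    note s = play_fst_in[OF z]
    interpret A: prob_space "?A z" by (rule value_law_measure[OF s])
    interpret B: prob_space "?B z" by (rule value_law_measure[OF s])
    interpret AB: pair_prob_space "?A z" "?B z" ..
    have sA: "sets (?A z) = sets borel" and sB: "sets (?B z) = sets borel"
      using prob_kernelD(2)[OF value_law_kernel s] by blast+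
    have dA: "distr (?A z \<Otimes>\<^sub>M ?B z) (?A z) fst = ?A z" by (rule B.distr_pair_fst)
    have swap: "distr (?A z \<Otimes>\<^sub>M ?B z) (?B z) snd = ?B z"
      by (rule distr_pair_snd[OF A.prob_space_axioms B.prob_space_axioms])
    have idA: "(\<lambda>v::real. v) \<in> borel_measurable (?A z)" "(\<lambda>v::real. v) \<in> borel_measurable (?B z)"
      using sA sB by (simp_all cong: measurable_cong_sets)
    show "integrable (?A z \<Otimes>\<^sub>M ?B z) fst"
      using value_law_integrable[OF s, of i \<theta>] integrable_distr_eq[OF measurable_fst[of "?A z" "?B z"] idA(1)] unfolding dA by simp
    show "integrable (?A z \<Otimes>\<^sub>M ?B z) snd"
      using value_law_integrable[OF s, of i \<theta>] integrable_distr_eq[OF measurable_snd[of "?A z" "?B z"] idA(2)] unfolding swap by simp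
    show "(\<integral>v. fst v \<partial>(?A z \<Otimes>\<^sub>M ?B z)) = Vf i \<theta> (fst (x1 z))"
      using value_law_mean[OF s, of i \<theta>] integral_distr[OF measurable_fst[of "?A z" "?B z"] idA(1)] unfolding dA by simp
    show "(\<integral>v. snd v \<partial>(?A z \<Otimes>\<^sub>M ?B z)) = Vf i \<theta> (fst (?y z))"
      using value_law_mean[OF s, of i \<theta>] integral_distr[OF measurable_snd[of "?A z" "?B z"] idA(2)] unfolding swap by simp
    have p: "{v \<in> space (?A z). \<bar>v\<bar> \<le> rb} \<in> sets (?A z)" "{v \<in> space (?B z). \<bar>v\<bar> \<le> rb} \<in> sets (?B z)"
      using idA by measurable
    have "AE v in ?A z \<Otimes>\<^sub>M ?B z. \<bar>fst v\<bar> \<le> rb"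
      using value_law_bound[OF s, of i \<theta>] AE_distr_iff[OF measurable_fst[of "?A z" "?B z"] p(1)] unfolding dA by blast
    moreover have "AE v in ?A z \<Otimes>\<^sub>M ?B z. \<bar>snd v\<bar> \<le> rb"
      using value_law_bound[OF s, of i \<theta>] AE_distr_iff[OF measurable_snd[of "?A z" "?B z"] p(2)] unfolding swap by blast
    ultimately show "AE v in ?A z \<Otimes>\<^sub>M ?B z. \<bar>fst v\<bar> \<le> rb \<and> \<bar>snd v\<bar> \<le> rb" by eventually_elim simp
    show "prob_space (?A z \<Otimes>\<^sub>M ?B z)" by unfold_locales
  qed
  have cb: "AE v in ?A z \<Otimes>\<^sub>M ?B z. \<bar>?c z v\<bar> \<le> Cg" if z: "z \<in> space ?P" for z
    using pair(5)[OF z]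
  proof eventually_elim
    case (elim v)
    have "\<gamma> * \<bar>snd v\<bar> \<le> 1 * rb" using elim discount by (intro mult_mono) auto
    then have "\<bar>\<gamma> * snd v\<bar> \<le> rb" using discount by (simp add: abs_mult)
    then show ?case using elim reward_bound[OF play_in[OF z], of i "fst z"] by (simp add: Cg_def) linarith
  qed
  note mix = estimator_mixture[OF N rm cb e]
  show "prob_space (gradient_law G Temporal_Difference i \<theta>)" by (rule mix(1))
  show "sets (gradient_law G Temporal_Difference i \<theta>) = sets borel" by (rule mix(2))
  show "(\<integral>\<^sup>+y. ennreal ((norm y)\<^sup>2) \<partial>gradient_law G Temporal_Difference i \<theta>) \<le> ennreal (Cg\<^sup>2 * W)" by (rule mix(3))
  assume m: "owner G m = i"
  have "(\<integral>y. y $ m \<partial>gradient_law G Temporal_Difference i \<theta>)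
      = (\<integral>z. (\<integral>v. ?c z v \<partial>(?A z \<Otimes>\<^sub>M ?B z)) * jscore \<theta> (x1 z) $ m \<partial>?P)"
    by (rule mix(4)[OF _ m])
  also have "\<dots> = (\<integral>z. (?r z + \<gamma> * Vf i \<theta> (fst (?y z))) * jscore \<theta> (x1 z) $ m - Vf i \<theta> (fst (x1 z)) * jscore \<theta> (x1 z) $ m \<partial>?P)"
  proof (rule Bochner_Integration.integral_cong[OF refl])
    fix z assume z: "z \<in> space ?P"
    interpret v: prob_space "?A z \<Otimes>\<^sub>M ?B z" by (rule pair(6)[OF z])
    have "(\<integral>v. ?c z v \<partial>(?A z \<Otimes>\<^sub>M ?B z)) = ?r z + \<gamma> * Vf i \<theta> (fst (?y z)) - Vf i \<theta> (fst (x1 z))"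
      using affine_integral[OF pair(6,1,2)[OF z], of "?r z" \<gamma>] by (simp only: pair(3,4)[OF z])
    then show "(\<integral>v. ?c z v \<partial>(?A z \<Otimes>\<^sub>M ?B z)) * jscore \<theta> (x1 z) $ m
        = (?r z + \<gamma> * Vf i \<theta> (fst (?y z))) * jscore \<theta> (x1 z) $ m - Vf i \<theta> (fst (x1 z)) * jscore \<theta> (x1 z) $ m"
      by (simp only: left_diff_distrib)
  qed
  also have "\<dots> = (\<integral>z. (?r z + \<gamma> * Vf i \<theta> (fst (?y z))) * jscore \<theta> (x1 z) $ m \<partial>?P) - (\<integral>z. Vf i \<theta> (fst (x1 z)) * jscore \<theta> (x1 z) $ m \<partial>?P)"
    by (rule Bochner_Integration.integral_diff[OF play_TD(1) play_nn_integral(2)[OF act_bounded_VJ]])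
  finally show "(\<integral>y. y $ m \<partial>gradient_law G Temporal_Difference i \<theta>) = (1 - \<gamma>) * DU i \<theta> $ m"
    by (simp only: play_TD(2) play_VJ)
qed

lemma gradient_law:
  shows gradient_law_prob: "prob_space (gradient_law G e i \<theta>)"
    and gradient_law_sets: "sets (gradient_law G e i \<theta>) = sets borel"
    and gradient_law_moment: "(\<integral>\<^sup>+y. ennreal ((norm y)\<^sup>2) \<partial>gradient_law G e i \<theta>) \<le> ennreal (Cg\<^sup>2 * W)"
    and gradient_law_mean: "owner G m = i \<Longrightarrow> (\<integral>y. y $ m \<partial>gradient_law G e i \<theta>) = (1 - \<gamma>) * DU i \<theta> $ m"
proof -
  show "prob_space (gradient_law G e i \<theta>)"
    by (cases e; simp only: gradient_law_Q(1) gradient_law_A(1) gradient_law_TD(1))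
  show "sets (gradient_law G e i \<theta>) = sets borel"
    by (cases e; simp only: gradient_law_Q(2) gradient_law_A(2) gradient_law_TD(2))
  show "(\<integral>\<^sup>+y. ennreal ((norm y)\<^sup>2) \<partial>gradient_law G e i \<theta>) \<le> ennreal (Cg\<^sup>2 * W)"
    by (cases e; simp only: gradient_law_Q(3) gradient_law_A(3) gradient_law_TD(3))
  show "(\<integral>y. y $ m \<partial>gradient_law G e i \<theta>) = (1 - \<gamma>) * DU i \<theta> $ m" if "owner G m = i"
    using that by (cases e; simp only: gradient_law_Q(4) gradient_law_A(4) gradient_law_TD(4))
qed

end

section \<open>The potential\<close>

text \<open>Along a direction inside block \<open>i\<close> the other blocks stay constant, so a
  partial gradient acts as an ordinary directional derivative.\<close>

lemma has_pgrad_segment: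
  fixes f :: "real ^ 'm::finite \<Rightarrow> real"
  assumes D: "has_pgrad own i f (x + t *\<^sub>R v) D" and v: "block own i v = v"
  shows "((\<lambda>s. f (x + s *\<^sub>R v)) has_real_derivative v \<bullet> D) (at t)"
proof -
  have "combine own i (x + s *\<^sub>R v) (x + t *\<^sub>R v) = x + s *\<^sub>R v" for s
  proof -
    have "v $ m = 0" if "own m \<noteq> i" for m using v that by (metis block_nth)
    then show ?thesis by (auto simp: combine_def vec_eq_iff)
  qed
  then show ?thesis using segment_deriv[OF D[unfolded has_pgrad_def]] by simp
qed

context smooth_markov
begin

abbreviation "own \<equiv> owner G"

lemma utility_pgrad: "has_pgrad own i (utility G i) \<theta> (block own i (DU i \<theta>))"
  by (rule has_pgrad_block[OF GDERIV_quadratic[OF utility_expansion]])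

lemma DU_lipschitz: "norm (DU i y - DU i x) \<le> 6 * C4 * norm (y - x)"
  by (rule quadratic_expansion_lipschitz[OF utility_expansion])

context
  fixes u :: "real ^ 'm \<Rightarrow> real"
  assumes potential: "is_potential G u"
begin

lemma potential_pgrad: "has_pgrad own i u \<theta> (block own i (DU i \<theta>))"
  using potential utility_pgrad has_pgrad_unique unfolding is_potential_def by metis

text \<open>On a segment inside block \<open>i\<close> the potential and the utility of
  \<open>i\<close> have equal derivatives, so their difference is constant there.\<close>

lemma potential_diff:
  assumes v: "block own i v = v"
  shows "u (x + v) - u x = utility G i (x + v) - utility G i x"
proof -
  define \<psi> where "\<psi> s = u (x + s *\<^sub>R v) - utility G i (x + s *\<^sub>R v)" for s
  have "(\<psi> has_real_derivative 0) (at t)" for t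
  proof -
    have "((\<lambda>s. u (x + s *\<^sub>R v)) has_real_derivative v \<bullet> block own i (DU i (x + t *\<^sub>R v))) (at t)"
      by (rule has_pgrad_segment[OF potential_pgrad v])
    moreover have "((\<lambda>s. utility G i (x + s *\<^sub>R v)) has_real_derivative v \<bullet> block own i (DU i (x + t *\<^sub>R v))) (at t)"
      by (rule has_pgrad_segment[OF utility_pgrad v])
    ultimately show ?thesis unfolding \<psi>_def by (auto dest: DERIV_diff)
  qed
  then have "\<psi> 1 = \<psi> 0" using DERIV_isconst_all[of \<psi> 1 0] by blast
  then show ?thesis by (simp add: \<psi>_def)
qed

definition mixed :: "'n set \<Rightarrow> real ^ 'm \<Rightarrow> real ^ 'm \<Rightarrow> real ^ 'm" where
  "mixed A x v = x + (\<Sum>i\<in>A. block own i v)"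

lemma mixed_insert: "i \<notin> A \<Longrightarrow> mixed (insert i A) x v = mixed A x v + block own i v" if "finite A"
  using that by (simp add: mixed_def algebra_simps)

lemma block_block: "block own i (block own i v) = block own i v"
  by (simp add: vec_eq_iff)

lemma mixed_UNIV: "mixed UNIV x v = x + v"
  by (simp add: mixed_def sum_block)

lemma norm_mixed: "norm (mixed A x v - x) \<le> norm v"
proof -
  have "(mixed A x v - x) $ m = (if own m \<in> A then v $ m else 0)" for m
  proof -
    have "(\<Sum>i\<in>A. block own i v) $ m = (\<Sum>i\<in>A. if own m = i then v $ m else 0)" by simp
    also have "\<dots> = (if own m \<in> A then v $ m else 0)" by (rule sum.delta'[OF finite])
    finally show ?thesis by (simp add: mixed_def)
  qed
  then show ?thesis by (intro norm_le_componentwise_cart) simp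
qed

lemma potential_oscillation: "\<bar>u y - u x\<bar> \<le> real CARD('n) * (2 * b0)"
proof -
  define v where "v = y - x"
  have "\<bar>u (mixed A x v) - u x\<bar> \<le> real (card A) * (2 * b0)" for A :: "'n set"
    using finite[of A]
  proof (induction A rule: finite_induct)
    case (insert i A)
    let ?z = "mixed A x v"
    have "\<bar>u (?z + block own i v) - u ?z\<bar> \<le> 2 * b0"
      unfolding potential_diff[OF block_block]
      using utility_bound[of i "?z + block own i v"] utility_bound[of i ?z] by linarith
    with insert show ?case by (simp add: mixed_insert distrib_right)
  qed (simp add: mixed_def)
  from this[of UNIV] show ?thesis by (simp add: mixed_UNIV v_def)
qed

text \<open>The candidate for the total gradient: each coordinate is taken from the utility of the
  agent owning it.\<close>

definition Dpot :: "real ^ 'm \<Rightarrow> real ^ 'm" where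
  "Dpot x = (\<chi> m. DU (own m) x $ m)"

text \<open>Per agent, \<open>C4\<close> is the remainder of its own utility, and
  \<open>6 * C4\<close> pays for evaluating its gradient at a partly updated point instead of
  \<open>x\<close>.\<close>

definition C6 :: real where "C6 = real CARD('n) * (7 * C4)"

lemma C6_nonneg: "0 \<le> C6" using C4_nonneg by (simp add: C6_def)

text \<open>Partial derivatives alone would not give a total expansion. Here the blocks are changed
  one agent at a time, each change is expanded through that agent's utility, and the Lipschitz
  gradients bring all linear terms back to the base point \<open>x\<close>.\<close>

lemma potential_expansion: "\<bar>u y - u x - (y - x) \<bullet> Dpot x\<bar> \<le> C6 * (norm (y - x))\<^sup>2"
proof -
  define v where "v = y - x"
  have "\<bar>u (mixed A x v) - u x - (\<Sum>i\<in>A. block own i v \<bullet> DU i x)\<bar> \<le> real (card A) * (7 * C4) * (norm v)\<^sup>2" for A :: "'n set"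
    using finite[of A]
  proof (induction A rule: finite_induct)
    case (insert i A)
    let ?z = "mixed A x v" and ?w = "block own i v"
    have nw: "norm ?w \<le> norm v" by (rule norm_block_le)
    have "\<bar>utility G i (?z + ?w) - utility G i ?z - ?w \<bullet> DU i ?z\<bar> \<le> C4 * (norm ?w)\<^sup>2"
      using utility_expansion[of i "?z + ?w" ?z] by simp
    also have "\<dots> \<le> C4 * (norm v)\<^sup>2" using nw C4_nonneg by (intro mult_left_mono power_mono) auto
    finally have 1: "\<bar>u (?z + ?w) - u ?z - ?w \<bullet> DU i ?z\<bar> \<le> C4 * (norm v)\<^sup>2"
      unfolding potential_diff[OF block_block] .
    have "\<bar>?w \<bullet> (DU i ?z - DU i x)\<bar> \<le> norm ?w * norm (DU i ?z - DU i x)" by (rule Cauchy_Schwarz_ineq2)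
    also have "\<dots> \<le> norm v * (6 * C4 * norm v)"
    proof (intro mult_mono nw)
      have "norm (DU i ?z - DU i x) \<le> 6 * C4 * norm (?z - x)" by (rule DU_lipschitz)
      also have "\<dots> \<le> 6 * C4 * norm v" using C4_nonneg by (intro mult_left_mono norm_mixed) auto
      finally show "norm (DU i ?z - DU i x) \<le> 6 * C4 * norm v" .
    qed auto
    also have "\<dots> = 6 * C4 * (norm v)\<^sup>2" by (simp add: power2_eq_square)
    finally have 2: "\<bar>?w \<bullet> DU i ?z - ?w \<bullet> DU i x\<bar> \<le> 6 * C4 * (norm v)\<^sup>2" by (simp add: inner_diff_right)
    have 3: "real (card (insert i A)) * (7 * C4) * (norm v)\<^sup>2
        = real (card A) * (7 * C4) * (norm v)\<^sup>2 + C4 * (norm v)\<^sup>2 + 6 * C4 * (norm v)\<^sup>2"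
      using insert by (simp add: algebra_simps)
    have 4: "(\<Sum>j\<in>insert i A. block own j v \<bullet> DU j x) = ?w \<bullet> DU i x + (\<Sum>j\<in>A. block own j v \<bullet> DU j x)"
      using insert by simp
    have 5: "mixed (insert i A) x v = ?z + ?w" by (rule mixed_insert) (use insert in auto)
    show ?case unfolding 3 4 5 using insert.IH 1 2 by linarith
  qed (simp add: mixed_def)
  from this[of UNIV] have "\<bar>u (x + v) - u x - (\<Sum>i\<in>UNIV. block own i v \<bullet> DU i x)\<bar> \<le> C6 * (norm v)\<^sup>2"
    by (simp add: mixed_UNIV C6_def)
  moreover have "(\<Sum>i\<in>UNIV. block own i v \<bullet> DU i x) = v \<bullet> Dpot x"
  proof -
    have "(\<Sum>i\<in>UNIV. block own i v \<bullet> DU i x) = (\<Sum>i\<in>UNIV. \<Sum>m\<in>UNIV. if own m = i then v $ m * DU i x $ m else 0)"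
      unfolding inner_vec_def by (intro sum.cong refl) auto
    also have "\<dots> = (\<Sum>m\<in>UNIV. \<Sum>i\<in>UNIV. if own m = i then v $ m * DU i x $ m else 0)" by (rule sum.swap)
    also have "\<dots> = (\<Sum>m\<in>UNIV. v $ m * DU (own m) x $ m)" by simp
    finally show ?thesis by (simp add: inner_vec_def Dpot_def)
  qed
  ultimately show ?thesis by (simp add: v_def)
qed

lemma grad_potential: "grad u x = Dpot x"
  by (rule grad_eq[OF GDERIV_quadratic[OF potential_expansion]])

lemma potential_continuous: "continuous_on UNIV u"
proof (rule differentiable_imp_continuous_on)
  show "u differentiable_on UNIV"
    using GDERIV_quadratic[OF potential_expansion] unfolding gderiv_def differentiable_on_def
    by (blast intro: differentiableI differentiable_at_withinI)
qed

lemma DU_measurable: "DU i \<in> borel_measurable borel"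
proof (rule borel_measurable_continuous_onI)
  have "(6 * C4)-lipschitz_on UNIV (DU i)"
    using DU_lipschitz C4_nonneg by (intro lipschitz_onI) (auto simp: dist_norm)
  then show "continuous_on UNIV (DU i)" by (rule lipschitz_on_continuous_on)
qed

lemma Dpot_measurable: "Dpot \<in> borel_measurable borel"
proof (rule borel_measurable_vecI)
  fix m
  have "(\<lambda>x. DU (own m) x $ m) \<in> borel_measurable borel"
    by (rule measurable_compose[OF DU_measurable vec_nth_borel])
  then show "(\<lambda>x. Dpot x $ m) \<in> borel_measurable borel" by (simp add: Dpot_def)
qed

lemma Dpot_component_bound: "\<bar>Dpot x $ m\<bar> \<le> b2"
  by (simp add: Dpot_def DU_component_bound)

end

end

section \<open>Networked play\<close>

locale networked = smooth_markov G R V L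
  for G :: "('s, 'k::finite, 'n::finite, 'm::finite) game" and R V L :: real +
  fixes u :: "real ^ 'm \<Rightarrow> real"
    and est :: "'n \<Rightarrow> estimator"
    and E :: "nat \<Rightarrow> ('n \<times> 'n) set"
    and w :: "nat \<Rightarrow> 'n \<Rightarrow> 'n \<Rightarrow> 'n \<Rightarrow> real"
    and \<alpha> :: "nat \<Rightarrow> real"
    and M :: "'w measure" and F :: "nat \<Rightarrow> 'w measure"
    and theta :: "nat \<Rightarrow> 'w \<Rightarrow> real ^ 'm"
    and bel g :: "nat \<Rightarrow> 'n \<Rightarrow> 'w \<Rightarrow> real ^ 'm"
    and TG :: nat
    and h \<beta> :: real
  assumes potential: "is_potential G u"
    and play: "networked_play G est E w \<alpha> M F theta bel g"
    and connected: "\<And>i j. (i, j) \<in> (limit_edges E)\<^sup>*"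
    and period: "TG > 0" "\<And>e t. e \<in> limit_edges E \<Longrightarrow> t \<ge> 1 \<Longrightarrow> e \<in> (\<Union>\<tau>\<in>{0..TG - 1}. E (t + \<tau>))"
    and h: "0 < h" "h < 1"
    and weight: "\<And>t i j l. t \<ge> 1 \<Longrightarrow> i \<noteq> j \<Longrightarrow> l \<in> nbrs E i t \<union> {i} \<Longrightarrow> w t i j l \<ge> h"
    and weight_sum: "\<And>t i j. t \<ge> 1 \<Longrightarrow> (\<Sum>l\<in>nbrs E i t \<union> {i}. w t i j l) = 1"
    and initial: "\<And>i m. i \<noteq> owner G m \<Longrightarrow> integrable M (\<lambda>\<omega>. \<bar>bel 0 i \<omega> $ m - theta 0 \<omega> $ m\<bar>)"
    and \<beta>: "1 / 2 \<le> \<beta>" "\<beta> < 1"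
    and step_pos: "\<And>t. t \<ge> 1 \<Longrightarrow> \<alpha> t > 0"
    and step_rate: "\<alpha> \<in> \<Theta>(\<lambda>t. 1 / real t powr \<beta>)"
begin

lemma play_facts:
  shows prob_M: "prob_space M"
    and subalg: "subalgebra M (F t)"
    and theta_F: "theta t \<in> borel_measurable (F t)"
    and bel_F: "bel t i \<in> borel_measurable (F t)"
    and theta0_integrable: "integrable M (theta 0)"
    and bel_own: "\<omega> \<in> space M \<Longrightarrow> own m = i \<Longrightarrow> bel t i \<omega> $ m = theta t \<omega> $ m"
    and g_law: "has_cond_law M (F t) (g (Suc t) i) (\<lambda>\<omega>. gradient_law G (est i) i (bel t i \<omega>))"
    and theta_Suc: "\<omega> \<in> space M \<Longrightarrow> own m = i \<Longrightarrow> theta (Suc t) \<omega> $ m = theta t \<omega> $ m + \<alpha> (Suc t) * g (Suc t) i \<omega> $ m"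
    and bel_Suc: "\<omega> \<in> space M \<Longrightarrow> own m = j \<Longrightarrow> i \<noteq> j \<Longrightarrow>
        bel (Suc t) i \<omega> $ m = (\<Sum>l\<in>nbrs E i t \<union> {i}. w t i j l * bel t l \<omega> $ m)"
proof -
  note q1 = play[unfolded networked_play_def]
  note q2 = conjunct2[OF q1] note q3 = conjunct2[OF q2] note q4 = conjunct2[OF q3] note q5 = conjunct2[OF q4]
  note q6 = conjunct2[OF q5] note q7 = conjunct2[OF q6] note q8 = conjunct2[OF q7] note q9 = conjunct2[OF q8]
  note q10 = conjunct2[OF q9] note q11 = conjunct2[OF q10]
  show "prob_space M" by (rule conjunct1[OF q1])
  show "subalgebra M (F t)" by (rule conjunct1[OF q3, rule_format])
  show "theta t \<in> borel_measurable (F t)" by (rule conjunct1[OF q4, rule_format])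
  show "bel t i \<in> borel_measurable (F t)" by (rule conjunct1[OF q5, rule_format])
  show "integrable M (theta 0)" by (rule conjunct1[OF q6])
  show "bel t i \<omega> $ m = theta t \<omega> $ m" if "\<omega> \<in> space M" "own m = i"
    by (rule conjunct1[OF q8, rule_format, OF that])
  show "has_cond_law M (F t) (g (Suc t) i) (\<lambda>\<omega>. gradient_law G (est i) i (bel t i \<omega>))"
    using conjunct1[OF q9, rule_format, of "Suc t" i] by simp
  show "theta (Suc t) \<omega> $ m = theta t \<omega> $ m + \<alpha> (Suc t) * g (Suc t) i \<omega> $ m" if "\<omega> \<in> space M" "own m = i"
    using conjunct1[OF q10, rule_format, of "Suc t", OF _ that] by simp
  show "bel (Suc t) i \<omega> $ m = (\<Sum>l\<in>nbrs E i t \<union> {i}. w t i j l * bel t l \<omega> $ m)"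
    if "\<omega> \<in> space M" "own m = j" "i \<noteq> j"
    using q11[rule_format, OF that(1) conjI[OF that(2,3)], of t] by simp
qed

sublocale M: prob_space M by (rule prob_M)

lemma theta_M: "theta t \<in> borel_measurable M"
  by (rule measurable_from_subalg[OF subalg theta_F])

lemma bel_M: "bel t i \<in> borel_measurable M"
  by (rule measurable_from_subalg[OF subalg bel_F])

lemma g_M: "g (Suc t) i \<in> borel_measurable M"
  using g_law[of t i] by (simp add: has_cond_law_def)

lemma nth_M: "f \<in> borel_measurable N \<Longrightarrow> (\<lambda>\<omega>. (f \<omega> :: real ^ 'm) $ m) \<in> borel_measurable N"
  by (rule measurable_compose[OF _ vec_nth_borel])

lemma integrable_space_cong:
  fixes f f' :: "'w \<Rightarrow> real"
  shows "integrable M f \<Longrightarrow> (\<And>\<omega>. \<omega> \<in> space M \<Longrightarrow> f' \<omega> = f \<omega>) \<Longrightarrow> integrable M f'"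
  using Bochner_Integration.integrable_cong[OF refl, of M f' f] by blast

section \<open>Moments and conditional means of the sampled gradients\<close>

definition M2 :: real where "M2 = Cg\<^sup>2 * W"

lemma M2_nonneg: "0 \<le> M2" by (simp add: M2_def W_nonneg)

lemma g_moment: "integrable M (\<lambda>\<omega>. (norm (g (Suc t) i \<omega>))\<^sup>2)" "(\<integral>\<omega>. (norm (g (Suc t) i \<omega>))\<^sup>2 \<partial>M) \<le> M2"
proof -
  have m: "(\<lambda>\<omega>. (norm (g (Suc t) i \<omega>))\<^sup>2) \<in> borel_measurable M" using g_M by measurable
  have le: "(\<integral>\<^sup>+\<omega>. ennreal ((norm (g (Suc t) i \<omega>))\<^sup>2) \<partial>M) \<le> ennreal M2"
    unfolding M2_def
    by (rule cond_law_nn_integral_le[OF prob_M subalg g_law gradient_law_prob gradient_law_sets])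
      (auto simp: gradient_law_moment)
  then show I: "integrable M (\<lambda>\<omega>. (norm (g (Suc t) i \<omega>))\<^sup>2)"
    by (intro integrableI_bounded m) (auto intro: le_less_trans)
  show "(\<integral>\<omega>. (norm (g (Suc t) i \<omega>))\<^sup>2 \<partial>M) \<le> M2"
    using le M2_nonneg by (subst (asm) nn_integral_eq_integral[OF I]) auto
qed

lemma norm_square_sum: "(norm (y :: real ^ 'm))\<^sup>2 = (\<Sum>m\<in>UNIV. (y $ m)\<^sup>2)"
  by (simp add: norm_vec_def L2_set_def sum_nonneg)

lemma nth_le_square: "\<bar>(y :: real ^ 'm) $ m\<bar> \<le> 1 + (norm y)\<^sup>2"
  using component_le_norm_cart[of y m] norm_le_one_plus_square[of y] by linarith

lemma g_component: "integrable M (\<lambda>\<omega>. g (Suc t) i \<omega> $ m)" "(\<integral>\<omega>. \<bar>g (Suc t) i \<omega> $ m\<bar> \<partial>M) \<le> 1 + M2"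
proof -
  have I1: "integrable M (\<lambda>\<omega>. 1 + (norm (g (Suc t) i \<omega>))\<^sup>2)" using g_moment(1) by simp
  show I: "integrable M (\<lambda>\<omega>. g (Suc t) i \<omega> $ m)"
  proof (rule Bochner_Integration.integrable_bound[OF I1 nth_M[OF g_M]])
    have "norm (g (Suc t) i \<omega> $ m) \<le> norm (1 + (norm (g (Suc t) i \<omega>))\<^sup>2)" for \<omega>
      using order_trans[OF nth_le_square abs_ge_self] unfolding real_norm_def .
    then show "AE \<omega> in M. norm (g (Suc t) i \<omega> $ m) \<le> norm (1 + (norm (g (Suc t) i \<omega>))\<^sup>2)" by (rule AE_I2)
  qed
  have "(\<integral>\<omega>. \<bar>g (Suc t) i \<omega> $ m\<bar> \<partial>M) \<le> (\<integral>\<omega>. 1 + (norm (g (Suc t) i \<omega>))\<^sup>2 \<partial>M)"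
    by (rule integral_mono[OF integrable_abs[OF I] I1 nth_le_square])
  also have "\<dots> = 1 + (\<integral>\<omega>. (norm (g (Suc t) i \<omega>))\<^sup>2 \<partial>M)" using g_moment(1) by (simp add: M.prob_space)
  finally show "(\<integral>\<omega>. \<bar>g (Suc t) i \<omega> $ m\<bar> \<partial>M) \<le> 1 + M2" using g_moment(2)[of t i] by linarith
qed

text \<open>The conditional mean is a gradient at the agent's own beliefs, not at the joint
  parameter. Testing against a factor \<open>Y\<close> known after iteration \<open>t\<close> is
  what the drift estimate needs.\<close>

lemma g_unbiased:
  assumes m: "own m = i" and Y: "Y \<in> borel_measurable (F t)" "\<And>\<omega>. \<bar>Y \<omega>\<bar> \<le> b"
  shows "(\<integral>\<omega>. Y \<omega> * g (Suc t) i \<omega> $ m \<partial>M) = (\<integral>\<omega>. Y \<omega> * ((1 - \<gamma>) * DU i (bel t i \<omega>) $ m) \<partial>M)"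
proof (rule cond_law_integral(3)[OF prob_M subalg g_law gradient_law_prob gradient_law_sets vec_nth_borel])
  show "(\<integral>\<^sup>+y. ennreal \<bar>y $ m\<bar> \<partial>gradient_law G (est i) i (bel t i \<omega>)) \<le> ennreal (1 + M2)" for \<omega>
  proof -
    let ?\<kappa> = "gradient_law G (est i) i (bel t i \<omega>)"
    have "(\<integral>\<^sup>+y. ennreal \<bar>y $ m\<bar> \<partial>?\<kappa>) \<le> (\<integral>\<^sup>+y. 1 + ennreal ((norm y)\<^sup>2) \<partial>?\<kappa>)"
      using ennreal_leI[OF nth_le_square] by (intro nn_integral_mono) simp
    also have "\<dots> = 1 + (\<integral>\<^sup>+y. ennreal ((norm y)\<^sup>2) \<partial>?\<kappa>)"
      using prob_space.emeasure_space_1[OF gradient_law_prob] gradient_law_sets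
      by (subst nn_integral_add) (auto cong: measurable_cong_sets)
    also have "\<dots> \<le> 1 + ennreal M2" unfolding M2_def by (intro add_left_mono gradient_law_moment)
    also have "\<dots> = ennreal (1 + M2)" using M2_nonneg by simp
    finally show ?thesis .
  qed
  show "(\<lambda>\<omega>. (1 - \<gamma>) * DU i (bel t i \<omega>) $ m) \<in> borel_measurable (F t)"
    by (intro borel_measurable_times borel_measurable_const nth_M measurable_compose[OF bel_F DU_measurable[OF potential]])
qed (use m Y gradient_law_mean in auto)

section \<open>Belief errors\<close>

text \<open>Parameters and beliefs are treated in one induction: a belief about the own block is the
  parameter itself, and any other belief is a finite sum of earlier beliefs.\<close>

lemma theta_bel_integrable: "integrable M (\<lambda>\<omega>. theta t \<omega> $ m) \<and> (\<forall>i. integrable M (\<lambda>\<omega>. bel t i \<omega> $ m))"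
proof (induction t)
  case 0
  have t: "integrable M (\<lambda>\<omega>. theta 0 \<omega> $ m)"
    by (rule integrable_bounded_linear[OF bounded_linear_vec_nth theta0_integrable])
  moreover have "integrable M (\<lambda>\<omega>. bel 0 i \<omega> $ m)" for i
  proof (cases "own m = i")
    case True
    show ?thesis by (rule integrable_space_cong[OF t]) (simp add: bel_own[OF _ True])
  next
    case False
    then have "i \<noteq> own m" by simp
    then have "integrable M (\<lambda>\<omega>. \<bar>bel 0 i \<omega> $ m - theta 0 \<omega> $ m\<bar>)" by (rule initial)
    then have "integrable M (\<lambda>\<omega>. bel 0 i \<omega> $ m - theta 0 \<omega> $ m)"
      using integrable_abs_iff[OF borel_measurable_diff[OF nth_M[OF bel_M] nth_M[OF theta_M]]] by blast
    from Bochner_Integration.integrable_add[OF this t] show ?thesis by simp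
  qed
  ultimately show ?case by blast
next
  case (Suc t)
  have t: "integrable M (\<lambda>\<omega>. theta (Suc t) \<omega> $ m)"
  proof -
    have "integrable M (\<lambda>\<omega>. theta t \<omega> $ m + \<alpha> (Suc t) * g (Suc t) (own m) \<omega> $ m)"
      by (intro Bochner_Integration.integrable_add integrable_mult_right g_component(1) conjunct1[OF Suc])
    then show ?thesis by (rule integrable_space_cong) (simp add: theta_Suc[OF _ refl])
  qed
  moreover have "integrable M (\<lambda>\<omega>. bel (Suc t) i \<omega> $ m)" for i
  proof (cases "own m = i")
    case True
    show ?thesis by (rule integrable_space_cong[OF t]) (simp add: bel_own[OF _ True])
  next
    case False
    have "integrable M (\<lambda>\<omega>. \<Sum>l\<in>nbrs E i t \<union> {i}. w t i (own m) l * bel t l \<omega> $ m)"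
      using conjunct2[OF Suc] by (intro Bochner_Integration.integrable_sum integrable_mult_right) (rule spec)
    then show ?thesis by (rule integrable_space_cong) (use False in \<open>simp add: bel_Suc[OF _ refl]\<close>)
  qed
  ultimately show ?case by blast
qed

text \<open>Kept per agent and coordinate because the consensus weights depend on the owner of the
  coordinate and the averaging acts on each coordinate separately.\<close>

definition err :: "nat \<Rightarrow> 'n \<Rightarrow> 'm \<Rightarrow> real" where
  "err t i m = (\<integral>\<omega>. \<bar>bel t i \<omega> $ m - theta t \<omega> $ m\<bar> \<partial>M)"

lemma err_integrable: "integrable M (\<lambda>\<omega>. bel t i \<omega> $ m - theta t \<omega> $ m)"
  using theta_bel_integrable by (intro Bochner_Integration.integrable_diff) blast+

lemma err_nonneg: "0 \<le> err t i m"
  by (simp add: err_def)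

lemma err_own: "err t (own m) m = 0"
proof -
  have "err t (own m) m = (\<integral>\<omega>. 0 \<partial>M)" unfolding err_def
    by (rule Bochner_Integration.integral_cong) (auto simp: bel_own)
  then show ?thesis by simp
qed

text \<open>Consensus averages beliefs about the parameter of time \<open>t\<close>, whereas the new
  error is measured against the parameter that has moved meanwhile. This move is the noise, of mean
  size at most \<open>\<alpha> (Suc t) * (1 + M2)\<close>.\<close>

lemma err_step:
  assumes t: "t \<ge> 1" and i: "i \<noteq> own m"
  shows "err (t + 1) i m \<le> (\<Sum>l\<in>nbrs E i t \<union> {i}. w t i (own m) l * err t l m) + \<alpha> (Suc t) * (1 + M2)"
proof -
  let ?N = "nbrs E i t \<union> {i}" and ?j = "own m"
  let ?e = "\<lambda>l \<omega>. bel t l \<omega> $ m - theta t \<omega> $ m"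
  have w0: "0 \<le> w t i ?j l" if "l \<in> ?N" for l using weight[OF t i that] h by simp
  have a0: "0 \<le> \<alpha> (Suc t)" using step_pos[of "Suc t"] by simp
  have Ie: "integrable M (\<lambda>\<omega>. \<bar>?e l \<omega>\<bar>)" for l using err_integrable by simp
  have Ig: "integrable M (\<lambda>\<omega>. \<bar>g (Suc t) ?j \<omega> $ m\<bar>)" using g_component(1) by simp
  have I2: "integrable M (\<lambda>\<omega>. (\<Sum>l\<in>?N. w t i ?j l * \<bar>?e l \<omega>\<bar>) + \<alpha> (Suc t) * \<bar>g (Suc t) ?j \<omega> $ m\<bar>)"
    using Ie Ig by (intro Bochner_Integration.integrable_add Bochner_Integration.integrable_sum integrable_mult_right)
  have "err (t + 1) i m \<le> (\<integral>\<omega>. (\<Sum>l\<in>?N. w t i ?j l * \<bar>?e l \<omega>\<bar>) + \<alpha> (Suc t) * \<bar>g (Suc t) ?j \<omega> $ m\<bar> \<partial>M)"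
    unfolding err_def
  proof (rule integral_mono[OF _ I2])
    show "integrable M (\<lambda>\<omega>. \<bar>bel (t + 1) i \<omega> $ m - theta (t + 1) \<omega> $ m\<bar>)" using err_integrable by simp
    fix \<omega> assume \<omega>: "\<omega> \<in> space M"
    \<comment> \<open>As the weights sum to one, the true parameter passes through the average, and
      the errors are averaged in its place.\<close>
    have "(\<Sum>l\<in>?N. w t i ?j l * theta t \<omega> $ m) = theta t \<omega> $ m"
      using weight_sum[OF t, of i ?j] by (simp only: sum_distrib_right[symmetric] mult_1)
    then have "bel (t + 1) i \<omega> $ m - theta (t + 1) \<omega> $ m = (\<Sum>l\<in>?N. w t i ?j l * ?e l \<omega>) - \<alpha> (Suc t) * g (Suc t) ?j \<omega> $ m"
      using bel_Suc[OF \<omega> refl i, of t] theta_Suc[OF \<omega> refl, of t m] by (simp add: right_diff_distrib sum_subtractf)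
    moreover have "\<bar>\<Sum>l\<in>?N. w t i ?j l * ?e l \<omega>\<bar> \<le> (\<Sum>l\<in>?N. w t i ?j l * \<bar>?e l \<omega>\<bar>)"
      by (rule order_trans[OF sum_abs sum_mono]) (simp only: abs_mult abs_of_nonneg[OF w0] order_refl)
    moreover have "\<bar>\<alpha> (Suc t) * g (Suc t) ?j \<omega> $ m\<bar> = \<alpha> (Suc t) * \<bar>g (Suc t) ?j \<omega> $ m\<bar>"
      using a0 by (simp add: abs_mult)
    ultimately show "\<bar>bel (t + 1) i \<omega> $ m - theta (t + 1) \<omega> $ m\<bar>
        \<le> (\<Sum>l\<in>?N. w t i ?j l * \<bar>?e l \<omega>\<bar>) + \<alpha> (Suc t) * \<bar>g (Suc t) ?j \<omega> $ m\<bar>" by linarith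
  qed
  also have "\<dots> = (\<Sum>l\<in>?N. w t i ?j l * err t l m) + \<alpha> (Suc t) * (\<integral>\<omega>. \<bar>g (Suc t) ?j \<omega> $ m\<bar> \<partial>M)"
  proof -
    have "(\<integral>\<omega>. (\<Sum>l\<in>?N. w t i ?j l * \<bar>?e l \<omega>\<bar>) \<partial>M) = (\<Sum>l\<in>?N. w t i ?j l * err t l m)"
      unfolding err_def using Ie by (subst Bochner_Integration.integral_sum) auto
    moreover have "integrable M (\<lambda>\<omega>. \<Sum>l\<in>?N. w t i ?j l * \<bar>?e l \<omega>\<bar>)"
      using Ie by (intro Bochner_Integration.integrable_sum integrable_mult_right)
    ultimately show ?thesis using Ig by (subst Bochner_Integration.integral_add) auto
  qed
  also have "\<dots> \<le> (\<Sum>l\<in>?N. w t i ?j l * err t l m) + \<alpha> (Suc t) * (1 + M2)"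
    using g_component(2)[of t ?j m] a0 by (intro add_left_mono mult_left_mono) auto
  finally show ?thesis .
qed

section \<open>Step sizes and decay of the belief errors\<close>

lemma step_upper: "\<exists>c\<ge>0. \<forall>t\<ge>1. \<alpha> t \<le> c / real t powr \<beta>"
proof -
  from step_rate have "\<alpha> \<in> O(\<lambda>t. 1 / real t powr \<beta>)" by blast
  then obtain c where c: "c > 0" "\<forall>\<^sub>F t in sequentially. norm (\<alpha> t) \<le> c * norm (1 / real t powr \<beta>)"
    by (elim landau_o.bigE)
  then obtain t0 where t0: "\<And>t. t \<ge> t0 \<Longrightarrow> \<bar>\<alpha> t\<bar> \<le> c / real t powr \<beta>"
    unfolding eventually_sequentially by auto
  \<comment> \<open>Adding the finitely many early values to the constant extends an eventual bound
    to all \<open>t\<close>.\<close>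
  define c' where "c' = c + (\<Sum>t<t0. \<bar>\<alpha> t\<bar> * real t powr \<beta>)"
  have s0: "0 \<le> (\<Sum>t<t0. \<bar>\<alpha> t\<bar> * real t powr \<beta>)" by (intro sum_nonneg) auto
  have "\<alpha> t \<le> c' / real t powr \<beta>" if t: "t \<ge> 1" for t
  proof (cases "t < t0")
    case True
    have "\<bar>\<alpha> t\<bar> * real t powr \<beta> \<le> (\<Sum>t<t0. \<bar>\<alpha> t\<bar> * real t powr \<beta>)"
      using True by (intro member_le_sum) auto
    then have "\<alpha> t * real t powr \<beta> \<le> c'"
      using c mult_right_mono[OF abs_ge_self, of "real t powr \<beta>" "\<alpha> t"] by (simp add: c'_def)
    then show ?thesis using t by (simp add: pos_le_divide_eq)
  next
    case False
    then have "\<alpha> t \<le> c / real t powr \<beta>" using t0[of t] by auto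
    also have "\<dots> \<le> c' / real t powr \<beta>" using s0 by (intro divide_right_mono) (auto simp: c'_def)
    finally show ?thesis .
  qed
  moreover have "0 \<le> c'" using c s0 by (simp add: c'_def)
  ultimately show ?thesis by blast
qed

text \<open>Supplies the lower bound on the weights in a window; positivity of the steps removes the
  absolute value that the asymptotic relation leaves.\<close>

lemma step_lower: "\<exists>c>0. \<exists>T0. \<forall>t\<ge>T0. c / real t powr \<beta> \<le> \<alpha> t"
proof -
  from step_rate have "\<alpha> \<in> \<Omega>(\<lambda>t. 1 / real t powr \<beta>)" by blast
  then obtain c where c: "c > 0" "\<forall>\<^sub>F t in sequentially. norm (\<alpha> t) \<ge> c * norm (1 / real t powr \<beta>)"
    by (elim landau_omega.bigE)
  then obtain t0 where t0: "\<And>t. t \<ge> t0 \<Longrightarrow> c / real t powr \<beta> \<le> \<bar>\<alpha> t\<bar>"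
    unfolding eventually_sequentially by auto
  have "c / real t powr \<beta> \<le> \<alpha> t" if "t \<ge> max 1 t0" for t
    using t0[of t] step_pos[of t] that by auto
  with c(1) show ?thesis by blast
qed

text \<open>For each coordinate the owner is the pinned agent of the consensus contraction. The
  maximum over the agents then contracts every \<open>K\<close> steps, up to \<open>K\<close> noise
  terms, each at most a multiple of \<open>1 / real t powr \<beta>\<close>.\<close>

lemma err_decay: "\<exists>D\<ge>0. \<forall>t\<ge>1. \<forall>i m. err t i m \<le> D / real t powr \<beta>"
proof -
  obtain c where c: "c \<ge> 0" "\<And>t. t \<ge> 1 \<Longrightarrow> \<alpha> t \<le> c / real t powr \<beta>" using step_upper by blast
  have "\<exists>D. \<forall>t\<ge>1. \<forall>i. err t i m \<le> D / real t powr \<beta>" for m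
  proof -
    define b where "b s = \<alpha> (Suc s) * (1 + M2)" for s
    have b0: "0 \<le> b s" for s using step_pos[of "Suc s"] M2_nonneg by (simp add: b_def)
    have "\<exists>K>0. \<exists>\<rho>. 0 \<le> \<rho> \<and> \<rho> < 1 \<and> (\<forall>t\<ge>1. \<forall>A. (\<forall>i. err t i m \<le> A) \<longrightarrow>
      (\<forall>i. err (t + K) i m \<le> \<rho> * A + (\<Sum>s=t..<t + K. b s)))"
    proof (rule consensus_contraction[where j="own m" and T=TG and h=h and E=E and w="\<lambda>t i l. w t i (own m) l"])
      show "err (t + 1) i m \<le> (\<Sum>l\<in>nbrs E i t \<union> {i}. w t i (own m) l * err t l m) + b t"
        if "t \<ge> 1" "i \<noteq> own m" for t i unfolding b_def by (rule err_step[OF that])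
    qed (use connected period h weight weight_sum err_own b0 in auto)
    then obtain K \<rho> where K: "K > 0" and \<rho>: "0 \<le> \<rho>" "\<rho> < 1" and contr:
      "\<And>t A. t \<ge> 1 \<Longrightarrow> (\<And>i. err t i m \<le> A) \<Longrightarrow> (\<forall>i. err (t + K) i m \<le> \<rho> * A + (\<Sum>s=t..<t + K. b s))" by blast
    define A where "A t = Max (range (\<lambda>i. err t i m))" for t
    have A: "err t i m \<le> A t" for t i unfolding A_def by (rule Max_ge) auto
    have "\<exists>D. \<forall>t\<ge>1. A t \<le> D / real t powr \<beta>"
    proof (rule contraction_decay[where K=K and \<rho>=\<rho> and c="real K * (c * (1 + M2))"])
      fix t :: nat assume t: "t \<ge> 1"
      have "b s \<le> c * (1 + M2) / real t powr \<beta>" if "s \<in> {t..<t + K}" for s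
      proof -
        have "\<alpha> (Suc s) \<le> c / real (Suc s) powr \<beta>" by (rule c(2)) simp
        also have "\<dots> \<le> c / real t powr \<beta>"
          using that t c(1) \<beta> by (intro divide_left_mono powr_mono2) auto
        finally have "\<alpha> (Suc s) * (1 + M2) \<le> c / real t powr \<beta> * (1 + M2)"
          using M2_nonneg by (intro mult_right_mono) auto
        then show ?thesis by (simp add: b_def)
      qed
      then have "(\<Sum>s=t..<t + K. b s) \<le> (\<Sum>s=t..<t + K. c * (1 + M2) / real t powr \<beta>)" by (rule sum_mono)
      then have "(\<Sum>s=t..<t + K. b s) \<le> real K * (c * (1 + M2)) / real t powr \<beta>" by simp
      then show "A (t + K) \<le> \<rho> * A t + real K * (c * (1 + M2)) / real t powr \<beta>"
        using contr[OF t A] unfolding A_def[of "t + K"] by (subst Max_le_iff) (auto intro: order_trans)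
    next
      show "0 \<le> A t" for t using A[of t undefined] err_nonneg[of t undefined m] by linarith
    qed (use K \<rho> \<beta> c M2_nonneg in auto)
    then show ?thesis using A by (meson order_trans)
  qed
  then obtain D where D: "\<And>m t i. t \<ge> 1 \<Longrightarrow> err t i m \<le> D m / real t powr \<beta>" by metis
  have "err t i m \<le> (\<Sum>m\<in>UNIV. \<bar>D m\<bar>) / real t powr \<beta>" if "t \<ge> 1" for t i m
  proof -
    have "D m \<le> (\<Sum>m\<in>UNIV. \<bar>D m\<bar>)" using member_le_sum[of m UNIV "\<lambda>m. \<bar>D m\<bar>"] by simp
    then show ?thesis using D[OF that, of i m] divide_right_mono[of "D m" "\<Sum>m\<in>UNIV. \<bar>D m\<bar>" "real t powr \<beta>"] by simp
  qed
  then show ?thesis by (intro exI[of _ "\<Sum>m\<in>UNIV. \<bar>D m\<bar>"]) (auto simp: sum_nonneg)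
qed

section \<open>Ascent of the potential\<close>

definition d :: "nat \<Rightarrow> real" where
  "d t = (\<integral>\<omega>. (norm (Dpot (theta t \<omega>)))\<^sup>2 \<partial>M)"

definition EU :: "nat \<Rightarrow> real" where "EU t = (\<integral>\<omega>. u (theta t \<omega>) \<partial>M)"

lemma u_integrable: "integrable M (\<lambda>\<omega>. u (theta t \<omega>))"
proof (rule M.integrable_const_bound)
  show "(\<lambda>\<omega>. u (theta t \<omega>)) \<in> borel_measurable M"
    by (rule measurable_compose[OF theta_M borel_measurable_continuous_onI[OF potential_continuous[OF potential]]])
  show "AE \<omega> in M. norm (u (theta t \<omega>)) \<le> \<bar>u 0\<bar> + real CARD('n) * (2 * b0)"
  proof (rule AE_I2)
    fix \<omega>
    show "norm (u (theta t \<omega>)) \<le> \<bar>u 0\<bar> + real CARD('n) * (2 * b0)"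
      using potential_oscillation[OF potential, of "theta t \<omega>" 0] unfolding real_norm_def by linarith
  qed
qed

lemma EU_oscillation: "EU s - EU t \<le> real CARD('n) * (2 * b0)"
proof -
  have "EU s - EU t = (\<integral>\<omega>. u (theta s \<omega>) - u (theta t \<omega>) \<partial>M)" by (simp add: EU_def u_integrable)
  also have "\<dots> \<le> (\<integral>\<omega>. real CARD('n) * (2 * b0) \<partial>M)"
    using potential_oscillation[OF potential]
    by (intro integral_mono Bochner_Integration.integrable_diff u_integrable) (auto intro: order_trans[OF abs_ge_self])
  finally show ?thesis by (simp add: M.prob_space)
qed

lemma Dpot_M: "(\<lambda>\<omega>. Dpot (theta t \<omega>)) \<in> borel_measurable (F t)"
  by (rule measurable_compose[OF theta_F Dpot_measurable[OF potential]])

lemma Dpot_square_integrable: "integrable M (\<lambda>\<omega>. (Dpot (theta t \<omega>) $ m)\<^sup>2)"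
proof (rule M.integrable_const_bound)
  show "(\<lambda>\<omega>. (Dpot (theta t \<omega>) $ m)\<^sup>2) \<in> borel_measurable M"
    by (intro borel_measurable_power nth_M measurable_from_subalg[OF subalg Dpot_M])
  show "AE \<omega> in M. norm ((Dpot (theta t \<omega>) $ m)\<^sup>2) \<le> b2\<^sup>2"
    using Dpot_component_bound[OF potential] const_nonneg by (auto simp: abs_le_square_iff[symmetric])
qed

lemma d_eq: "d t = (\<Sum>m\<in>UNIV. \<integral>\<omega>. (Dpot (theta t \<omega>) $ m)\<^sup>2 \<partial>M)"
proof -
  show ?thesis unfolding d_def norm_square_sum using Dpot_square_integrable by (simp add: Bochner_Integration.integral_sum)
qed

lemma d_nonneg: "0 \<le> d t" by (simp add: d_def)

text \<open>The bound on a coordinate of the gradient times the Lipschitz constant of the utility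
  gradients.\<close>

definition C7 :: real where "C7 = b2 * (6 * C4)"

lemma C7_nonneg: "0 \<le> C7" using const_nonneg C4_nonneg by (simp add: C7_def)

text \<open>With \<open>?D\<close> the gradient coordinate at the true parameter and
  \<open>?B\<close> the one at the beliefs, \<open>?D * ?B\<close> equals the square of
  \<open>?D\<close> minus \<open>?D * (?D - ?B)\<close>; the last product is at most
  \<open>C7\<close> times the belief error.\<close>

lemma drift:
  "(1 - \<gamma>) * (\<integral>\<omega>. (Dpot (theta t \<omega>) $ m)\<^sup>2 \<partial>M) - C7 * (\<Sum>l\<in>UNIV. err t (own m) l)
    \<le> (\<integral>\<omega>. Dpot (theta t \<omega>) $ m * g (Suc t) (own m) \<omega> $ m \<partial>M)"
proof -
  let ?D = "\<lambda>\<omega>. Dpot (theta t \<omega>) $ m" and ?B = "\<lambda>\<omega>. DU (own m) (bel t (own m) \<omega>) $ m"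
  have DF: "?D \<in> borel_measurable (F t)" by (rule nth_M[OF Dpot_M])
  have BF: "?B \<in> borel_measurable (F t)"
    by (rule nth_M[OF measurable_compose[OF bel_F DU_measurable[OF potential]]])
  note [measurable] = measurable_from_subalg[OF subalg DF] measurable_from_subalg[OF subalg BF]
  have Db: "\<bar>?D \<omega>\<bar> \<le> b2" for \<omega> by (rule Dpot_component_bound[OF potential])
  have I: "integrable M (\<lambda>\<omega>. ?D \<omega> * ?B \<omega>)"
  proof (rule M.integrable_const_bound)
    show "AE \<omega> in M. norm (?D \<omega> * ?B \<omega>) \<le> b2 * b2"
      using Db DU_component_bound const_nonneg by (intro AE_I2) (simp add: abs_mult mult_mono)
  qed measurable
  have Ie: "integrable M (\<lambda>\<omega>. \<Sum>l\<in>UNIV. \<bar>bel t (own m) \<omega> $ l - theta t \<omega> $ l\<bar>)"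
    using err_integrable by (intro Bochner_Integration.integrable_sum integrable_abs)
  have I2: "integrable M (\<lambda>\<omega>. (?D \<omega>)\<^sup>2 - C7 * (\<Sum>l\<in>UNIV. \<bar>bel t (own m) \<omega> $ l - theta t \<omega> $ l\<bar>))"
    by (intro Bochner_Integration.integrable_diff Dpot_square_integrable integrable_mult_right Ie)
  have "(\<integral>\<omega>. (?D \<omega>)\<^sup>2 - C7 * (\<Sum>l\<in>UNIV. \<bar>bel t (own m) \<omega> $ l - theta t \<omega> $ l\<bar>) \<partial>M) \<le> (\<integral>\<omega>. ?D \<omega> * ?B \<omega> \<partial>M)"
  proof (rule integral_mono[OF I2 I])
    fix \<omega>
    let ?e = "bel t (own m) \<omega> - theta t \<omega>"
    have "\<bar>?D \<omega> - ?B \<omega>\<bar> = \<bar>(DU (own m) (bel t (own m) \<omega>) - DU (own m) (theta t \<omega>)) $ m\<bar>"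
      by (simp add: Dpot_def[OF potential] abs_minus_commute)
    also have "\<dots> \<le> norm (DU (own m) (bel t (own m) \<omega>) - DU (own m) (theta t \<omega>))" by (rule component_le_norm_cart)
    also have "\<dots> \<le> 6 * C4 * norm ?e" by (rule DU_lipschitz)
    also have "\<dots> \<le> 6 * C4 * (\<Sum>l\<in>UNIV. \<bar>?e $ l\<bar>)" using C4_nonneg by (intro mult_left_mono norm_le_l1_cart) auto
    finally have "\<bar>?D \<omega>\<bar> * \<bar>?D \<omega> - ?B \<omega>\<bar> \<le> b2 * (6 * C4 * (\<Sum>l\<in>UNIV. \<bar>?e $ l\<bar>))"
      using Db[of \<omega>] const_nonneg by (intro mult_mono) auto
    then have "?D \<omega> * (?D \<omega> - ?B \<omega>) \<le> C7 * (\<Sum>l\<in>UNIV. \<bar>?e $ l\<bar>)"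
      using abs_ge_self[of "?D \<omega> * (?D \<omega> - ?B \<omega>)"] by (simp add: abs_mult C7_def mult.assoc)
    then show "(?D \<omega>)\<^sup>2 - C7 * (\<Sum>l\<in>UNIV. \<bar>bel t (own m) \<omega> $ l - theta t \<omega> $ l\<bar>) \<le> ?D \<omega> * ?B \<omega>"
      by (simp add: power2_eq_square right_diff_distrib)
  qed
  moreover have "(\<integral>\<omega>. (?D \<omega>)\<^sup>2 - C7 * (\<Sum>l\<in>UNIV. \<bar>bel t (own m) \<omega> $ l - theta t \<omega> $ l\<bar>) \<partial>M)
      = (\<integral>\<omega>. (?D \<omega>)\<^sup>2 \<partial>M) - C7 * (\<Sum>l\<in>UNIV. err t (own m) l)"
  proof -
    have "(\<integral>\<omega>. (\<Sum>l\<in>UNIV. \<bar>bel t (own m) \<omega> $ l - theta t \<omega> $ l\<bar>) \<partial>M) = (\<Sum>l\<in>UNIV. err t (own m) l)"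
      unfolding err_def using err_integrable by (subst Bochner_Integration.integral_sum) auto
    then show ?thesis using Ie Dpot_square_integrable by simp
  qed
  ultimately have 1: "(\<integral>\<omega>. (?D \<omega>)\<^sup>2 \<partial>M) - C7 * (\<Sum>l\<in>UNIV. err t (own m) l) \<le> (\<integral>\<omega>. ?D \<omega> * ?B \<omega> \<partial>M)" by simp
  have e: "(\<integral>\<omega>. ?D \<omega> * g (Suc t) (own m) \<omega> $ m \<partial>M) = (1 - \<gamma>) * (\<integral>\<omega>. ?D \<omega> * ?B \<omega> \<partial>M)"
    unfolding g_unbiased[OF refl DF Db] by (simp add: mult.left_commute)
  have s: "0 \<le> C7 * (\<Sum>l\<in>UNIV. err t (own m) l)"
    using C7_nonneg by (intro mult_nonneg_nonneg sum_nonneg err_nonneg)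
  have "(1 - \<gamma>) * ((\<integral>\<omega>. (?D \<omega>)\<^sup>2 \<partial>M) - C7 * (\<Sum>l\<in>UNIV. err t (own m) l)) \<le> (1 - \<gamma>) * (\<integral>\<omega>. ?D \<omega> * ?B \<omega> \<partial>M)"
    using 1 discount by (intro mult_left_mono) auto
  moreover have "(1 - \<gamma>) * (C7 * (\<Sum>l\<in>UNIV. err t (own m) l)) \<le> C7 * (\<Sum>l\<in>UNIV. err t (own m) l)"
    using s discount by (intro mult_left_le_one_le) auto
  ultimately show ?thesis unfolding e by (simp only: right_diff_distrib)
qed

text \<open>The quadratic expansion of the potential gives a pathwise inequality along the realised
  update. In expectation its linear part is bounded below by the drift and its quadratic part by the
  second moments.\<close>

lemma ascent:
  "(1 - \<gamma>) * \<alpha> (Suc t) * d t \<le> EU (Suc t) - EU t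
    + \<alpha> (Suc t) * (C7 * (\<Sum>m\<in>UNIV. \<Sum>l\<in>UNIV. err t (own m) l)) + C6 * (\<alpha> (Suc t))\<^sup>2 * (real CARD('n) * M2)"
proof -
  let ?a = "\<alpha> (Suc t)"
  \<comment> \<open>The realised update direction: every agent moves only its own block, so each
    coordinate comes from the gradient sampled by its owner.\<close>
  let ?v = "\<lambda>\<omega>. \<chi> m. g (Suc t) (own m) \<omega> $ m"
  let ?s = "\<lambda>\<omega>. \<Sum>m\<in>UNIV. Dpot (theta t \<omega>) $ m * g (Suc t) (own m) \<omega> $ m"
  let ?q = "\<lambda>\<omega>. \<Sum>i\<in>UNIV. (norm (g (Suc t) i \<omega>))\<^sup>2"
  have a0: "0 \<le> ?a" using step_pos[of "Suc t"] by simp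
  have Ig: "integrable M (\<lambda>\<omega>. Dpot (theta t \<omega>) $ m * g (Suc t) (own m) \<omega> $ m)" for m
  proof (rule Bochner_Integration.integrable_bound)
    show "integrable M (\<lambda>\<omega>. b2 * g (Suc t) (own m) \<omega> $ m)" using g_component(1) by simp
    show "(\<lambda>\<omega>. Dpot (theta t \<omega>) $ m * g (Suc t) (own m) \<omega> $ m) \<in> borel_measurable M"
      by (intro borel_measurable_times nth_M g_M measurable_from_subalg[OF subalg Dpot_M])
    show "AE \<omega> in M. norm (Dpot (theta t \<omega>) $ m * g (Suc t) (own m) \<omega> $ m) \<le> norm (b2 * g (Suc t) (own m) \<omega> $ m)"
      using Dpot_component_bound[OF potential] const_nonneg by (intro AE_I2) (simp add: abs_mult mult_right_mono)
  qed
  have Is: "integrable M ?s" using Ig by (intro Bochner_Integration.integrable_sum)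
  have Iq: "integrable M ?q" using g_moment(1) by (intro Bochner_Integration.integrable_sum)
  have vq: "(norm (?v \<omega>))\<^sup>2 \<le> ?q \<omega>" for \<omega>
  proof -
    have "(norm (?v \<omega>))\<^sup>2 = (\<Sum>m\<in>UNIV. (g (Suc t) (own m) \<omega> $ m)\<^sup>2)"
      by (simp add: norm_square_sum)
    also have "\<dots> = (\<Sum>m\<in>UNIV. \<Sum>i\<in>UNIV. if own m = i then (g (Suc t) i \<omega> $ m)\<^sup>2 else 0)" by simp
    also have "\<dots> = (\<Sum>i\<in>UNIV. \<Sum>m\<in>UNIV. if own m = i then (g (Suc t) i \<omega> $ m)\<^sup>2 else 0)" by (rule sum.swap)
    also have "\<dots> \<le> (\<Sum>i\<in>UNIV. \<Sum>m\<in>UNIV. (g (Suc t) i \<omega> $ m)\<^sup>2)" by (intro sum_mono) auto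
    also have "\<dots> = ?q \<omega>" by (simp only: norm_square_sum)
    finally show ?thesis .
  qed
  have pw: "?a * ?s \<omega> - C6 * ?a\<^sup>2 * ?q \<omega> \<le> u (theta (Suc t) \<omega>) - u (theta t \<omega>)" if \<omega>: "\<omega> \<in> space M" for \<omega>
  proof -
    have th: "theta (Suc t) \<omega> - theta t \<omega> = ?a *\<^sub>R ?v \<omega>"
      by (simp add: vec_eq_iff theta_Suc[OF \<omega> refl])
    have "(?a *\<^sub>R ?v \<omega>) \<bullet> Dpot (theta t \<omega>) = ?a * ?s \<omega>"
      by (simp add: inner_vec_def sum_distrib_left mult_ac)
    moreover have "C6 * (norm (?a *\<^sub>R ?v \<omega>))\<^sup>2 \<le> C6 * ?a\<^sup>2 * ?q \<omega>"
    proof -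
      have "(norm (?a *\<^sub>R ?v \<omega>))\<^sup>2 = ?a\<^sup>2 * (norm (?v \<omega>))\<^sup>2" by (simp add: power_mult_distrib)
      also have "\<dots> \<le> ?a\<^sup>2 * ?q \<omega>" by (intro mult_left_mono vq) simp
      finally have "(norm (?a *\<^sub>R ?v \<omega>))\<^sup>2 \<le> ?a\<^sup>2 * ?q \<omega>" .
      from mult_left_mono[OF this C6_nonneg[OF potential]] show ?thesis by (simp only: mult.assoc)
    qed
    ultimately show ?thesis
      using potential_expansion[OF potential, of "theta (Suc t) \<omega>" "theta t \<omega>"] unfolding th by linarith
  qed
  have "(\<integral>\<omega>. ?a * ?s \<omega> - C6 * ?a\<^sup>2 * ?q \<omega> \<partial>M) \<le> (\<integral>\<omega>. u (theta (Suc t) \<omega>) - u (theta t \<omega>) \<partial>M)"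
    by (intro integral_mono pw Bochner_Integration.integrable_diff integrable_mult_right Is Iq u_integrable)
  then have A: "?a * (\<integral>\<omega>. ?s \<omega> \<partial>M) - C6 * ?a\<^sup>2 * (\<integral>\<omega>. ?q \<omega> \<partial>M) \<le> EU (Suc t) - EU t"
    using Is Iq u_integrable by (simp add: EU_def)
  have "(\<integral>\<omega>. ?q \<omega> \<partial>M) = (\<Sum>i\<in>UNIV. \<integral>\<omega>. (norm (g (Suc t) i \<omega>))\<^sup>2 \<partial>M)"
    using g_moment(1) by (intro Bochner_Integration.integral_sum)
  then have "(\<integral>\<omega>. ?q \<omega> \<partial>M) \<le> (\<Sum>i\<in>(UNIV::'n set). M2)" using g_moment(2) by (simp only:) (intro sum_mono)
  then have B: "C6 * ?a\<^sup>2 * (\<integral>\<omega>. ?q \<omega> \<partial>M) \<le> C6 * ?a\<^sup>2 * (real CARD('n) * M2)"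
    using C6_nonneg[OF potential] by (intro mult_left_mono) auto
  have "(\<integral>\<omega>. ?s \<omega> \<partial>M) = (\<Sum>m\<in>UNIV. \<integral>\<omega>. Dpot (theta t \<omega>) $ m * g (Suc t) (own m) \<omega> $ m \<partial>M)"
    using Ig by (intro Bochner_Integration.integral_sum)
  then have "(\<Sum>m\<in>UNIV. (1 - \<gamma>) * (\<integral>\<omega>. (Dpot (theta t \<omega>) $ m)\<^sup>2 \<partial>M) - C7 * (\<Sum>l\<in>UNIV. err t (own m) l)) \<le> (\<integral>\<omega>. ?s \<omega> \<partial>M)"
    by (simp only:) (intro sum_mono drift)
  then have "(1 - \<gamma>) * d t - C7 * (\<Sum>m\<in>UNIV. \<Sum>l\<in>UNIV. err t (own m) l) \<le> (\<integral>\<omega>. ?s \<omega> \<partial>M)"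
    by (simp only: sum_subtractf d_eq sum_distrib_left)
  from mult_left_mono[OF this a0]
  have "?a * ((1 - \<gamma>) * d t) - ?a * (C7 * (\<Sum>m\<in>UNIV. \<Sum>l\<in>UNIV. err t (own m) l)) \<le> ?a * (\<integral>\<omega>. ?s \<omega> \<partial>M)"
    by (simp only: right_diff_distrib)
  moreover have "(1 - \<gamma>) * ?a * d t = ?a * ((1 - \<gamma>) * d t)" by simp
  ultimately show ?thesis using A B by linarith
qed

text \<open>The increments of the expected potential telescope to its bounded oscillation. Each step
  adds an error of at most \<open>B / real T\<close>, and the window has exactly \<open>T\<close>
  steps.\<close>

lemma window_sum: "\<exists>C. \<forall>T\<ge>1. (\<Sum>t=T..<2*T. \<alpha> (t + 1) * d t) \<le> C"
proof -
  obtain c where c: "c \<ge> 0" "\<And>t. t \<ge> 1 \<Longrightarrow> \<alpha> t \<le> c / real t powr \<beta>" using step_upper by blast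
  obtain D where D: "D \<ge> 0" "\<And>t i m. t \<ge> 1 \<Longrightarrow> err t i m \<le> D / real t powr \<beta>" using err_decay by blast
  define e1 where "e1 = C7 * (real CARD('m) * (real CARD('m) * D))"
  define e2 where "e2 = C6 * (real CARD('n) * M2)"
  have e0: "0 \<le> e1" "0 \<le> e2" using C7_nonneg C6_nonneg[OF potential] D M2_nonneg by (simp_all add: e1_def e2_def)
  define B where "B = c * e1 + c\<^sup>2 * e2"
  have B0: "0 \<le> B" using e0 c by (simp add: B_def)
  have "(\<Sum>t=T..<2*T. \<alpha> (t + 1) * d t) \<le> (real CARD('n) * (2 * b0) + B) / (1 - \<gamma>)" if T: "T \<ge> 1" for T
  proof -
    define x where "x = real T powr \<beta>"
    have x: "x > 0" using T by (simp add: x_def)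
    \<comment> \<open>The place where \<open>\<beta> \<ge> 1 / 2\<close> keeps the errors summable
      over a window: \<open>T\<close> is at most \<open>T powr (2 * \<beta>)\<close>.\<close>
    have xx: "real T \<le> x * x"
    proof -
      have "real T powr 1 \<le> real T powr (\<beta> + \<beta>)" using T \<beta> by (intro powr_mono) auto
      then show ?thesis using T by (simp add: x_def flip: powr_add)
    qed
    have step_bound: "(1 - \<gamma>) * (\<alpha> (t + 1) * d t) \<le> (EU (Suc t) - EU t) + B / real T" if t: "t \<in> {T..<2*T}" for t
    proof -
      have t1: "t \<ge> 1" using t T by simp
      have a: "\<alpha> (Suc t) \<le> c / x"
      proof -
        have "\<alpha> (Suc t) \<le> c / real (Suc t) powr \<beta>" by (rule c(2)) simp
        also have "\<dots> \<le> c / x" unfolding x_def using t T c(1) \<beta> by (intro divide_left_mono powr_mono2) auto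
        finally show ?thesis .
      qed
      have a0: "0 \<le> \<alpha> (Suc t)" using step_pos[of "Suc t"] by simp
      have "err t i m \<le> D / x" for i m
      proof -
        have "D / real t powr \<beta> \<le> D / x" unfolding x_def using t T D(1) \<beta> by (intro divide_left_mono powr_mono2) auto
        with D(2)[OF t1, of i m] show ?thesis by simp
      qed
      then have "(\<Sum>m\<in>UNIV. \<Sum>l\<in>UNIV. err t (own m) l) \<le> (\<Sum>m\<in>(UNIV::'m set). \<Sum>l\<in>(UNIV::'m set). D / x)"
        by (intro sum_mono)
      then have "C7 * (\<Sum>m\<in>UNIV. \<Sum>l\<in>UNIV. err t (own m) l) \<le> C7 * (real CARD('m) * (real CARD('m) * (D / x)))"
        using C7_nonneg by (intro mult_left_mono) auto
      then have e: "C7 * (\<Sum>m\<in>UNIV. \<Sum>l\<in>UNIV. err t (own m) l) \<le> e1 / x" by (simp add: e1_def)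
      have "\<alpha> (Suc t) * (C7 * (\<Sum>m\<in>UNIV. \<Sum>l\<in>UNIV. err t (own m) l)) \<le> (c / x) * (e1 / x)"
        using a a0 e C7_nonneg err_nonneg c x by (intro mult_mono) (auto intro!: mult_nonneg_nonneg sum_nonneg)
      moreover have "C6 * (\<alpha> (Suc t))\<^sup>2 * (real CARD('n) * M2) \<le> (c / x)\<^sup>2 * e2"
      proof -
        have "(\<alpha> (Suc t))\<^sup>2 * e2 \<le> (c / x)\<^sup>2 * e2" using a a0 e0 by (intro mult_right_mono power_mono) auto
        then show ?thesis by (simp add: e2_def mult_ac)
      qed
      moreover have "(c / x) * (e1 / x) + (c / x)\<^sup>2 * e2 = B / (x * x)"
        using x by (simp add: B_def power2_eq_square add_divide_distrib)
      moreover have "B / (x * x) \<le> B / real T" using xx T B0 x by (intro divide_left_mono) auto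
      ultimately show ?thesis using ascent[of t] by (simp add: mult.assoc)
    qed
    have "(1 - \<gamma>) * (\<Sum>t=T..<2*T. \<alpha> (t + 1) * d t) \<le> (\<Sum>t=T..<2*T. (EU (Suc t) - EU t) + B / real T)"
      unfolding sum_distrib_left by (rule sum_mono[OF step_bound])
    also have "\<dots> = (EU (2*T) - EU T) + B"
      using T by (simp add: sum.distrib sum_Suc_diff')
    also have "\<dots> \<le> real CARD('n) * (2 * b0) + B" using EU_oscillation[of "2*T" T] by simp
    finally show ?thesis using discount by (simp add: pos_le_divide_eq mult.commute)
  qed
  then show ?thesis by blast
qed

theorem convergence_rate:
  "(\<forall>\<epsilon>>0. \<exists>t. (INF \<tau>\<in>{0..t}. d \<tau>) \<le> \<epsilon>) \<and>
    (\<lambda>\<epsilon>. real (hitting_time d \<epsilon>)) \<in> O[at_right 0](\<lambda>\<epsilon>. \<epsilon> powr (- 1 / min (1 - \<beta>) \<beta>)) \<and>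
    (\<beta> = 1 / 2 \<longrightarrow> (\<lambda>\<epsilon>. real (hitting_time d \<epsilon>)) \<in> O[at_right 0](\<lambda>\<epsilon>. \<epsilon> powr (- 2)))"
proof -
  obtain c T0 where c: "c > 0" and lower: "\<forall>t\<ge>T0. c / real t powr \<beta> \<le> \<alpha> t" using step_lower by (elim exE conjE)
  obtain C where C: "\<forall>T\<ge>1. (\<Sum>t=T..<2*T. \<alpha> (t + 1) * d t) \<le> C" using window_sum by (elim exE)
  have "\<exists>C'>0. \<exists>T1\<ge>1. \<forall>T\<ge>T1. \<exists>t\<le>2*T. d t \<le> C' * real T powr (\<beta> - 1)"
  proof (rule rate_of_window_sums[where d=d and \<alpha>=\<alpha> and \<beta>=\<beta> and c=c and C=C and ?T0.0="max 1 T0"])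
    show "0 < \<beta>" using \<beta>(1) by simp
    show "c / real t powr \<beta> \<le> \<alpha> t" if "t \<ge> max 1 T0" for t
      by (rule lower[rule_format]) (use that in simp)
    show "(\<Sum>t=T..<2*T. \<alpha> (t + 1) * d t) \<le> C" if "T \<ge> max 1 T0" for T
      by (rule C[rule_format]) (use that in simp)
  qed (rule d_nonneg \<beta>(2) c)+
  then obtain C' T1 where C': "C' > 0" and T1: "T1 \<ge> 1"
    and rate: "\<forall>T\<ge>T1. \<exists>t\<le>2*T. d t \<le> C' * real T powr (\<beta> - 1)" by (elim exE conjE)
  show ?thesis
    by (rule hitting_time_rate[where d=d and \<beta>=\<beta> and C=C' and ?T1.0=T1])
      (rule d_nonneg \<beta> C' T1 rate[rule_format], assumption?)+
qed

end

text \<open>Moment bounds are accompanied by integrability because the Bochner integral of a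
  nonintegrable function is 0. The two-sided order of the step sizes gives late windows a total step
  size of exact order \<open>T powr (1 - \<beta>)\<close>.\<close>

theorem theorem2:
  fixes G :: "('s, 'k::finite, 'n::finite, 'm::finite) game"
    and u :: "real ^ 'm \<Rightarrow> real"
    and est :: "'n \<Rightarrow> estimator"
    and E :: "nat \<Rightarrow> ('n \<times> 'n) set"
    and w :: "nat \<Rightarrow> 'n \<Rightarrow> 'n \<Rightarrow> 'n \<Rightarrow> real"
    and \<alpha> :: "nat \<Rightarrow> real"
    and M :: "'w measure" and F :: "nat \<Rightarrow> 'w measure"
    and theta :: "nat \<Rightarrow> 'w \<Rightarrow> real ^ 'm"
    and bel g :: "nat \<Rightarrow> 'n \<Rightarrow> 'w \<Rightarrow> real ^ 'm"
    and T\<^sub>G :: nat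
    and h \<kappa> \<beta> R B V L :: real
  assumes game: "markov_game G"
    and potential: "is_potential G u"
    and play: "networked_play G est E w \<alpha> M F theta bel g"
    and A1_connected: "\<forall>i j. (i, j) \<in> (limit_edges E)\<^sup>*"
    and A1_period: "T\<^sub>G > 0"
      "\<forall>e\<in>limit_edges E. \<forall>t\<ge>1. e \<in> (\<Union>\<tau>\<in>{0..T\<^sub>G - 1}. E (t + \<tau>))"
    and A2_h: "0 < h" "h < 1"
    and A2_i: "\<forall>t\<ge>1. \<forall>i j l. i \<noteq> j \<longrightarrow>
      (if l \<in> nbrs E i t \<union> {i} then w t i j l \<ge> h else w t i j l = 0)"
    and A2_ii: "\<forall>t\<ge>1. \<forall>j. w t j j j = 1"
    and A2_iii: "\<forall>t\<ge>1. \<forall>i j. (\<Sum>l\<in>nbrs E i t \<union> {i}. w t i j l) = 1"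
    and A3: "\<kappa> \<ge> 0"
      "\<forall>i m. i \<noteq> owner G m \<longrightarrow>
         integrable M (\<lambda>\<omega>. \<bar>bel 0 i \<omega> $ m - theta 0 \<omega> $ m\<bar>) \<and>
         (\<integral>\<omega>. \<bar>bel 0 i \<omega> $ m - theta 0 \<omega> $ m\<bar> \<partial>M) \<le> \<kappa>"
    and A4_beta: "1 / 2 \<le> \<beta>" "\<beta> < 1"
    and A4_steps: "\<forall>t\<ge>1. \<alpha> t > 0" "\<not> summable \<alpha>" "\<alpha> \<in> \<Theta>(\<lambda>t. 1 / real t powr \<beta>)"
    and A5: "R > 0" "\<forall>i. \<forall>x\<in>space (state_actions G). \<bar>reward G i x\<bar> \<le> R"
    and A6_moments: "B \<ge> 0" "V \<ge> 0"
      "\<forall>i n \<theta>. \<forall>s\<in>space (states G).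
         integrable (policy G n \<theta> s) (\<lambda>a. norm (score G i n \<theta> s a)) \<and>
         (\<integral>a. norm (score G i n \<theta> s a) \<partial>policy G n \<theta> s) \<le> B"
      "\<forall>i n \<theta>. \<forall>s\<in>space (states G).
         integrable (policy G n \<theta> s) (\<lambda>a. (norm (score G i n \<theta> s a))\<^sup>2) \<and>
         (\<integral>a. (norm (score G i n \<theta> s a))\<^sup>2 \<partial>policy G n \<theta> s) \<le> V\<^sup>2"
    and A6_lipschitz: "L \<ge> 0"
      "\<forall>i n \<theta>1 \<theta>2. \<forall>s\<in>space (states G). \<forall>a\<in>space (act_ref G).
         norm (score G i n \<theta>1 s a - score G i n \<theta>2 s a) \<le> L * norm (\<theta>1 - \<theta>2)"
  defines "d \<equiv> \<lambda>\<tau>. \<integral>\<omega>. (norm (grad u (theta \<tau> \<omega>)))\<^sup>2 \<partial>M"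
  shows "(\<forall>\<epsilon>>0. \<exists>t. (INF \<tau>\<in>{0..t}. d \<tau>) \<le> \<epsilon>) \<and>
    (\<lambda>\<epsilon>. real (hitting_time d \<epsilon>)) \<in> O[at_right 0](\<lambda>\<epsilon>. \<epsilon> powr (- 1 / min (1 - \<beta>) \<beta>)) \<and>
    (\<beta> = 1 / 2 \<longrightarrow> (\<lambda>\<epsilon>. real (hitting_time d \<epsilon>)) \<in> O[at_right 0](\<lambda>\<epsilon>. \<epsilon> powr (- 2)))"
proof -
  interpret smooth_markov G R V L
  proof
    show "markov_game G" by (rule game)
    show "0 < R" "0 \<le> L" by (rule A5(1) A6_lipschitz(1))+
    show "\<bar>reward G i x\<bar> \<le> R" if "x \<in> space (state_actions G)" for i x
      by (rule A5(2)[rule_format, OF that])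
    show "integrable (policy G n \<theta> s) (\<lambda>a. (norm (score G i n \<theta> s a))\<^sup>2) \<and>
        (\<integral>a. (norm (score G i n \<theta> s a))\<^sup>2 \<partial>policy G n \<theta> s) \<le> V\<^sup>2" if "s \<in> space (states G)" for i n \<theta> s
      using A6_moments(4) that by blast
    show "norm (score G i n \<theta>1 s a - score G i n \<theta>2 s a) \<le> L * norm (\<theta>1 - \<theta>2)"
      if "s \<in> space (states G)" "a \<in> space (act_ref G)" for i n \<theta>1 \<theta>2 s a
      using A6_lipschitz(2) that by blast
  qed
  interpret P: networked G R V L u est E w \<alpha> M F theta bel g T\<^sub>G h \<beta>
  proof
    show "is_potential G u" by (rule potential)
    show "networked_play G est E w \<alpha> M F theta bel g" by (rule play)
    show "(i, j) \<in> (limit_edges E)\<^sup>*" for i j using A1_connected by blast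
    show "0 < T\<^sub>G" by (rule A1_period)
    show "e \<in> (\<Union>\<tau>\<in>{0..T\<^sub>G - 1}. E (t + \<tau>))" if "e \<in> limit_edges E" "1 \<le> t" for e t
      by (rule A1_period(2)[rule_format, OF that])
    show "0 < h" "h < 1" by (rule A2_h)+
    show "h \<le> w t i j l" if "1 \<le> t" "i \<noteq> j" "l \<in> nbrs E i t \<union> {i}" for t i j l
      using A2_i[rule_format, OF that(1,2), of l] that(3) by (simp only: if_True)
    show "(\<Sum>l\<in>nbrs E i t \<union> {i}. w t i j l) = 1" if "1 \<le> t" for t i j
      by (rule A2_iii[rule_format, OF that])
    show "integrable M (\<lambda>\<omega>. \<bar>bel 0 i \<omega> $ m - theta 0 \<omega> $ m\<bar>)" if "i \<noteq> owner G m" for i m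
      using A3(2)[rule_format, OF that] by (rule conjunct1)
    show "1 / 2 \<le> \<beta>" "\<beta> < 1" by (rule A4_beta)+
    show "0 < \<alpha> t" if "1 \<le> t" for t by (rule A4_steps(1)[rule_format, OF that])
    show "\<alpha> \<in> \<Theta>(\<lambda>t. 1 / real t powr \<beta>)" by (rule A4_steps(3))
  qed
  \<comment> \<open>The gradient obtained by \<open>THE\<close> is identified with
    \<open>Dpot\<close> through the quadratic expansion of the potential.\<close>
  have "P.d = d" by (rule ext) (simp only: d_def P.d_def grad_potential[OF potential])
  from P.convergence_rate[unfolded this] show ?thesis .
qed

end
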